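(* Let $f(z)=\sum_{n\ge0} a_n z^n/n! \in \mathbb{Q}[[z]]$ be an $E$-function (in the sense defined in the context) and let $r\in\mathbb{Q}$. Then either $f(r)\in\mathbb{Q}$, or for every $\varepsilon>0$ there exists a constant $c>0$, depending on $f$, $r$ and $\varepsilon$, such that for all $p\in\mathbb{Z}$ and all $q\in\mathbb{N}^*=\{1,2,3,\dots\}$, $$\left|f(r)-\frac{p}{q}\right|\ \ge\ \frac{c}{q^{2+\varepsilon}}.$$
   Context: $\overline{\mathbb{Q}}$ is viewed as a subset of $\mathbb{C}$. A power series $F(z)=\sum_{n=0}^\infty a_n z^n/n!\in\overline{\mathbb{Q}}[[z]]$ is called an $E$-function if (i) $F$ satisfies a non-zero linear differential equation with coefficients in $\overline{\mathbb{Q}}(z)$, and there exists $C>0$ such that (ii) for every $\sigma\in\mathrm{Gal}(\overline{\mathbb{Q}}/\mathbb{Q})$ and every $n\ge0$, $|\sigma(a_n)|\le C^{n+1}$, and (iii) there is a sequence of integers $(d_n)_{n\ge0}$ with $1\le d_n\le C^{n+1}$ such that $d_n a_m$ is an algebraic integer for all $0\le m\le n$. *)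

theory Defs
  imports Complex_Main "HOL-Computational_Algebra.Computational_Algebra"
begin

text \<open>Field automorphisms of the complex numbers. Every element of
  Gal(Qbar/Q) extends to such an automorphism, and every such automorphism
  restricts to an element of Gal(Qbar/Q); hence quantifying over them is the
  same as quantifying over Gal(Qbar/Q) when applied to algebraic numbers.\<close>
definition complex_field_aut :: "(complex \<Rightarrow> complex) \<Rightarrow> bool" where
  "complex_field_aut \<sigma> \<longleftrightarrow> bij \<sigma> \<and> (\<forall>x y. \<sigma> (x + y) = \<sigma> x + \<sigma> y)
     \<and> (\<forall>x y. \<sigma> (x * y) = \<sigma> x * \<sigma> y) \<and> \<sigma> 1 = 1"

definition algebraic_integer :: "complex \<Rightarrow> bool" where
  "algebraic_integer x \<longleftrightarrow>
     (\<exists>p :: int poly. lead_coeff p = 1 \<and> poly (map_poly of_int p) x = 0)"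

text \<open>E-functions, with the series given by its coefficient sequence
  a, i.e. F(z) = sum a n z^n / n!. Condition (i): a nonzero linear
  differential equation with coefficients in Qbar(z); after clearing
  denominators the coefficients are polynomials with algebraic coefficients,
  not all zero.\<close>
definition E_function :: "(nat \<Rightarrow> complex) \<Rightarrow> bool" where
  "E_function a \<longleftrightarrow>
     (\<forall>n. algebraic (a n)) \<and>
     (\<exists>m (P :: nat \<Rightarrow> complex poly).
        (\<forall>k\<le>m. \<forall>i. algebraic (coeff (P k) i)) \<and> (\<exists>k\<le>m. P k \<noteq> 0) \<and>
        (\<Sum>k\<le>m. fps_of_poly (P k) * (fps_deriv ^^ k) (Abs_fps (\<lambda>n. a n / fact n))) = 0) \<and>
     (\<exists>C::real. C > 0 \<and>
        (\<forall>\<sigma>. complex_field_aut \<sigma> \<longrightarrow> (\<forall>n. norm (\<sigma> (a n)) \<le> C ^ (n + 1))) \<and>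
        (\<exists>d :: nat \<Rightarrow> int. \<forall>n. 1 \<le> d n \<and> real_of_int (d n) \<le> C ^ (n + 1) \<and>
            (\<forall>m\<le>n. algebraic_integer (of_int (d n) * a m))))"

end

theory Submission
  imports Defs
begin

text \<open>
  The argument is the method of graded Pade approximants. After rescaling, the value is \<open>\<xi> = f(1)\<close>, where the
  derivatives \<open>f\<^sub>0, \<dots>, f\<^sub>m\<^sub>-\<^sub>1\<close> of \<open>f\<close> satisfy a linear system over the rational functions. Put
  \<open>\<gamma> = \<Sum>f\<^sub>k w\<^sub>k\<close> for variables \<open>w\<^sub>k\<close>. Siegel's lemma yields forms \<open>x\<^sub>0, x\<^sub>1\<close> of degrees \<open>F\<close> and
  \<open>F + 1\<close> in \<open>w\<close>, with polynomial coefficients of small height, such that all coefficients of \<open>\<gamma> x\<^sub>0 - x\<^sub>1\<close> vanish to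
  high order at \<open>0\<close>; the ratio of the number of conditions to the number of unknowns tends to \<open>1/2\<close> as \<open>F\<close> grows, which is the
  source of the exponent \<open>2\<close>. The system lets one differentiate such a form, and a zero estimate shows that some
  derivative has a small order of vanishing when evaluated along a curve near \<open>z = 1\<close>.

  The evaluation uses a rational linear basis of the reals containing \<open>1\<close> and \<open>\<xi>\<close>. The components of the Taylor
  series of \<open>f\<close> at \<open>1\<close> solve the same differential equation, and the one belonging to \<open>\<xi>\<close> is not a combination of the
  others; so there are power series \<open>w\<^sub>k\<close> with rational coefficients for which \<open>\<Sum>w\<^sub>k(t) f\<^sub>k(1 + t)\<close> has the shape
  \<open>\<alpha>(t) \<xi> + \<beta>(t)\<close> with rational \<open>\<alpha> \<noteq> 0\<close> and \<open>\<beta>\<close>. Substituting them in the forms gives pairs of integers whose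
  linear forms in \<open>1\<close> and \<open>\<xi>\<close> are small enough.
\<close>

section \<open>Linear algebra over integral domains\<close>

text \<open>The point 1 may be a singularity of the equation, and \<open>f(1)\<close> may be tied to
  the other values by linear relations. Hence the weights \<open>w\<close> are power series along a
  curve, and their coefficients are only known to have factorial growth. This does no harm because a
  zero estimate lets one use only about \<open>x * s\<close> of them, with \<open>x\<close> as small
  as desired, where \<open>s\<close> is the order of vanishing at 0. A second obstacle is that the
  derivatives of an auxiliary form may span a differential module of too small a rank. The forms are
  therefore taken from a module that minimises the quotient (rank of remainders) / (rank of module),
  and a loss of rank contradicts minimality. For this, the constants of the zero estimate must be
  the same for all modules; their uniformity is what the sections on orders, kernels and
  differential modules provide. Sizes: degrees are about \<open>\<theta> s\<close> with \<theta>
  slightly above 1/2, the integers obtained about \<open>s^(\<theta> s)\<close>, the linear forms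
  about \<open>s^((\<theta> - 1) s)\<close>. The quotient of the exponents tends to 1, which gives
  the irrationality exponent 2.\<close>

lemma homogeneous_system_solvable:
  fixes A :: "'e \<Rightarrow> 'i \<Rightarrow> 'r::idom"
  assumes "finite E" "finite I" "card E < card I"
  shows "\<exists>x. (\<exists>i\<in>I. x i \<noteq> 0) \<and> (\<forall>e\<in>E. (\<Sum>i\<in>I. A e i * x i) = 0)"
  using assms
proof (induction E arbitrary: I A rule: finite_induct)
  case empty
  then have "I \<noteq> {}" by auto
  then show ?case by (intro exI[of _ "\<lambda>_. 1"]) auto
next
  case (insert e E)
  show ?case
  proof (cases "\<forall>i\<in>I. A e i = 0")
    case True
    have "card E < card I" using insert by simp
    then obtain x where "\<exists>i\<in>I. x i \<noteq> 0" "\<forall>e\<in>E. (\<Sum>i\<in>I. A e i * x i) = 0"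
      using insert.IH[of I A] insert.prems by auto
    then show ?thesis using True by (intro exI[of _ x]) auto
  next
    case False
    then obtain i0 where i0: "i0 \<in> I" "A e i0 \<noteq> 0" by auto
    define J where "J = I - {i0}"
    \<comment> \<open>Cross-multiplied elimination of the unknown \<open>i0\<close> by means of
      equation \<open>e\<close>: no division, so polynomial and power series entries are
      allowed.\<close>
    define A' where "A' = (\<lambda>f i. A e i0 * A f i - A f i0 * A e i)"
    have J: "finite J" "I = insert i0 J" "i0 \<notin> J" using insert.prems i0 by (auto simp: J_def)
    have "card E < card J" using insert J by simp
    then obtain x where x: "\<exists>i\<in>J. x i \<noteq> 0" "\<forall>f\<in>E. (\<Sum>i\<in>J. A' f i * x i) = 0"
      using insert.IH[of J A'] J by auto
    define y where "y = (\<lambda>i. if i = i0 then - (\<Sum>i\<in>J. A e i * x i) else A e i0 * x i)"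
    have s: "(\<Sum>i\<in>I. A f i * y i) = A e i0 * (\<Sum>i\<in>J. A f i * x i) - A f i0 * (\<Sum>i\<in>J. A e i * x i)" for f
    proof -
      have "(\<Sum>i\<in>J. A f i * y i) = (\<Sum>i\<in>J. A e i0 * (A f i * x i))"
        using J by (intro sum.cong) (auto simp: y_def)
      then show ?thesis using J by (simp add: y_def sum_distrib_left)
    qed
    have "(\<Sum>i\<in>I. A f i * y i) = 0" if "f \<in> insert e E" for f
    proof (cases "f = e")
      case True then show ?thesis unfolding s by simp
    next
      case False
      then have "(\<Sum>i\<in>J. A' f i * x i) = 0" using that x by auto
      then show ?thesis unfolding s A'_def
        by (simp add: sum_distrib_left sum_subtractf algebra_simps)
    qed
    moreover have "\<exists>i\<in>I. y i \<noteq> 0" using x J i0 by (force simp: y_def)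
    ultimately show ?thesis by blast
  qed
qed

text \<open>Independence of the restrictions to \<open>A\<close>, with coefficients in the ring
  itself; over a domain this agrees with independence over the fraction field.\<close>

definition indep_on :: "'k set \<Rightarrow> 'a set \<Rightarrow> ('k \<Rightarrow> 'a \<Rightarrow> 'r::idom) \<Rightarrow> bool" where
  "indep_on K A x \<longleftrightarrow> (\<forall>c. (\<forall>a\<in>A. (\<Sum>k\<in>K. c k * x k a) = 0) \<longrightarrow> (\<forall>k\<in>K. c k = 0))"

lemma indep_onD:
  "indep_on K A x \<Longrightarrow> (\<And>a. a \<in> A \<Longrightarrow> (\<Sum>k\<in>K. c k * x k a) = 0) \<Longrightarrow> k \<in> K \<Longrightarrow> c k = 0"
  by (auto simp: indep_on_def)

lemma indep_on_card_le:
  fixes x :: "'k \<Rightarrow> 'a \<Rightarrow> 'r::idom"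
  assumes "finite K" "finite J" "indep_on K A x"
    and det: "\<And>c. \<forall>a\<in>J. (\<Sum>k\<in>K. c k * x k a) = 0 \<Longrightarrow> \<forall>a\<in>A. (\<Sum>k\<in>K. c k * x k a) = 0"
  shows "card K \<le> card J"
proof (rule ccontr)
  assume "\<not> card K \<le> card J"
  then obtain c where c: "\<exists>k\<in>K. c k \<noteq> 0" "\<forall>a\<in>J. (\<Sum>k\<in>K. x k a * c k) = 0"
    using homogeneous_system_solvable[of J K "\<lambda>a k. x k a"] assms by auto
  then have "\<forall>a\<in>A. (\<Sum>k\<in>K. c k * x k a) = 0" by (intro det) (simp add: mult.commute)
  then show False using c assms(3) by (auto simp: indep_on_def)
qed

text \<open>A row basis \<open>x\<close>, pivot coordinates \<open>\<Lambda>\<close> and a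
  denominator \<open>M\<close> valid for all of \<open>S\<close> at once. The single
  \<open>M\<close> matters: the loss of order in \<open>order_on_coordinates\<close> is governed by
  it, uniformly over an infinite set.\<close>

lemma rank_exists:
  fixes S :: "('a \<Rightarrow> 'r::idom) set"
  assumes "finite A"
  shows "\<exists>(n::nat) x \<Lambda> M m. (\<forall>k<n. x k \<in> S) \<and> indep_on {..<n} A x \<and> \<Lambda> \<subseteq> A \<and> card \<Lambda> = n \<and> M \<noteq> 0 \<and>
           (\<forall>y\<in>S. \<forall>a\<in>A. M * y a = (\<Sum>\<kappa>\<in>\<Lambda>. m a \<kappa> * y \<kappa>))"
  using assms
proof (induction "card A" arbitrary: A S rule: less_induct)
  case less
  show ?case
  proof (cases "\<forall>y\<in>S. \<forall>a\<in>A. y a = 0")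
    case True
    then show ?thesis
      by (intro exI[of _ 0] exI[of _ undefined] exI[of _ "{}"] exI[of _ 1] exI[of _ undefined])
         (auto simp: indep_on_def)
  next
    case False
    then obtain x1 l1 where x1: "x1 \<in> S" "l1 \<in> A" "x1 l1 \<noteq> 0" by auto
    define A' where "A' = A - {l1}"
    \<comment> \<open>Projection along \<open>x1\<close>: the pivot coordinate \<open>l1\<close>
      becomes zero, and the induction runs on the remaining coordinates.\<close>
    define g where "g = (\<lambda>x a. x1 l1 * x a - x l1 * x1 a)"
    have A': "finite A'" "l1 \<notin> A'" "A = insert l1 A'" "card A' < card A"
      using less.prems x1 card_Diff1_less[of A l1] by (auto simp: A'_def)
    from less.hyps[OF A'(4) A'(1), of "g ` S"]
    obtain n x' \<Lambda> M m where IH: "\<forall>k<(n::nat). x' k \<in> g ` S" "indep_on {..<n} A' x'" "\<Lambda> \<subseteq> A'" "card \<Lambda> = n"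
      "M \<noteq> 0" "\<forall>y\<in>g ` S. \<forall>a\<in>A'. M * y a = (\<Sum>\<kappa>\<in>\<Lambda>. m a \<kappa> * y \<kappa>)" by blast
    obtain x where x: "\<forall>k<n. x k \<in> S \<and> x' k = g (x k)" using IH(1) unfolding image_iff by metis
    have fin: "finite \<Lambda>" using IH(3) A'(1) finite_subset by blast
    define X where "X = (\<lambda>k. if k < n then x k else x1)"
    define \<Lambda>' where "\<Lambda>' = insert l1 \<Lambda>"
    define M' where "M' = M * x1 l1"
    \<comment> \<open>Undoing \<open>g\<close> in the relation for \<open>g y\<close> produces these
      coefficients; the row of the new pivot has only the diagonal entry \<open>M'\<close>.\<close>
    define m' where "m' = (\<lambda>a l. if a = l1 then (if l = l1 then M' else 0)
        else if l = l1 then M * x1 a - (\<Sum>\<kappa>\<in>\<Lambda>. m a \<kappa> * x1 \<kappa>) else m a l * x1 l1)"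
    have l1n: "l1 \<notin> \<Lambda>" using IH(3) A' by auto
    have "\<forall>k<Suc n. X k \<in> S" using x x1 by (auto simp: X_def)
    moreover have "indep_on {..<Suc n} A X"
      unfolding indep_on_def
    proof (intro allI impI)
      fix c assume c: "\<forall>a\<in>A. (\<Sum>k<Suc n. c k * X k a) = 0"
      have c2: "(\<Sum>k<n. c k * x k a) = - (c n * x1 a)" if "a \<in> A" for a
      proof -
        have "(\<Sum>k<n. c k * X k a) = (\<Sum>k<n. c k * x k a)" by (intro sum.cong) (auto simp: X_def)
        then show ?thesis using c that by (simp add: X_def eq_neg_iff_add_eq_0)
      qed
      have "(\<Sum>k<n. c k * x' k a) = 0" if "a \<in> A'" for a
      proof -
        have "(\<Sum>k<n. c k * x' k a) = (\<Sum>k<n. x1 l1 * (c k * x k a) - (c k * x k l1) * x1 a)"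
          using x by (intro sum.cong) (auto simp: g_def algebra_simps)
        also have "\<dots> = x1 l1 * (\<Sum>k<n. c k * x k a) - (\<Sum>k<n. c k * x k l1) * x1 a"
          by (simp add: sum_subtractf sum_distrib_left sum_distrib_right)
        also have "\<dots> = 0" using c2[of a] c2[of l1] that A' by (simp add: algebra_simps)
        finally show ?thesis .
      qed
      then have z: "c k = 0" if "k < n" for k using IH(2) that by (auto simp: indep_on_def)
      moreover have "c n = 0" using c2[of l1] z x1 by simp
      ultimately show "\<forall>k\<in>{..<Suc n}. c k = 0" by (auto simp: less_Suc_eq)
    qed
    moreover have "\<Lambda>' \<subseteq> A" "card \<Lambda>' = Suc n" using IH(3,4) x1 A' fin l1n by (auto simp: \<Lambda>'_def)
    moreover have "M' \<noteq> 0" using IH x1 by (simp add: M'_def)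
    moreover have "M' * y a = (\<Sum>\<kappa>\<in>\<Lambda>'. m' a \<kappa> * y \<kappa>)" if y: "y \<in> S" and a: "a \<in> A" for y a
    proof (cases "a = l1")
      case True
      have "(\<Sum>\<kappa>\<in>\<Lambda>. m' a \<kappa> * y \<kappa>) = 0" using l1n True by (intro sum.neutral) (auto simp: m'_def)
      then show ?thesis using True fin l1n by (simp add: \<Lambda>'_def m'_def)
    next
      case False
      then have "M * g y a = (\<Sum>\<kappa>\<in>\<Lambda>. m a \<kappa> * g y \<kappa>)" using IH(6) a y A' by auto
      also have "\<dots> = (\<Sum>\<kappa>\<in>\<Lambda>. (m a \<kappa> * x1 l1) * y \<kappa>) - y l1 * (\<Sum>\<kappa>\<in>\<Lambda>. m a \<kappa> * x1 \<kappa>)"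
        by (simp add: g_def sum_subtractf sum_distrib_left algebra_simps)
      finally have e: "M' * y a = (\<Sum>\<kappa>\<in>\<Lambda>. (m a \<kappa> * x1 l1) * y \<kappa>) + (M * x1 a - (\<Sum>\<kappa>\<in>\<Lambda>. m a \<kappa> * x1 \<kappa>)) * y l1"
        by (simp add: g_def M'_def algebra_simps)
      have "(\<Sum>\<kappa>\<in>\<Lambda>. m' a \<kappa> * y \<kappa>) = (\<Sum>\<kappa>\<in>\<Lambda>. (m a \<kappa> * x1 l1) * y \<kappa>)"
        using l1n False by (intro sum.cong) (auto simp: m'_def)
      then show ?thesis unfolding e using fin l1n False by (simp add: \<Lambda>'_def m'_def)
    qed
    ultimately show ?thesis by blast
  qed
qed

lemma rank_obtains:
  fixes S :: "('a \<Rightarrow> 'r::idom) set"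
  assumes "finite A"
  obtains n :: nat and x \<Lambda> M m where "\<And>k. k < n \<Longrightarrow> x k \<in> S" "indep_on {..<n} A x" "\<Lambda> \<subseteq> A" "finite \<Lambda>" "card \<Lambda> = n"
    "M \<noteq> 0" "\<And>y a. y \<in> S \<Longrightarrow> a \<in> A \<Longrightarrow> M * y a = (\<Sum>\<kappa>\<in>\<Lambda>. m a \<kappa> * y \<kappa>)"
  using rank_exists[OF assms, of S]
proof (elim exE conjE)
  fix n x \<Lambda> M m
  assume "\<forall>k<(n::nat). x k \<in> S" "indep_on {..<n} A x" "\<Lambda> \<subseteq> A" "card \<Lambda> = n" "M \<noteq> 0"
    "\<forall>y\<in>S. \<forall>a\<in>A. M * y a = (\<Sum>\<kappa>\<in>\<Lambda>. m a \<kappa> * y \<kappa>)"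
  then show thesis using assms by (intro that[of n x \<Lambda> M m]) (auto intro: finite_subset)
qed

text \<open>The relations reduce everything to the \<open>n\<close> coordinates in
  \<open>\<Lambda>\<close>, where \<open>n + 1\<close> vectors are dependent; independence of the
  \<open>x k\<close> makes the coefficient of \<open>y\<close> nonzero.\<close>

lemma dependence_exists:
  fixes x :: "nat \<Rightarrow> 'a \<Rightarrow> 'r::idom"
  assumes "indep_on {..<n} A x" "finite \<Lambda>" "card \<Lambda> = n" "M \<noteq> 0"
    and rel: "\<And>z a. z = y \<or> (\<exists>k<n. z = x k) \<Longrightarrow> a \<in> A \<Longrightarrow> M * z a = (\<Sum>\<kappa>\<in>\<Lambda>. m a \<kappa> * z \<kappa>)"
  obtains p c where "p \<noteq> 0" "\<And>a. a \<in> A \<Longrightarrow> p * y a = (\<Sum>k<n. c k * x k a)"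
proof -
  define X where "X = (\<lambda>k. if k < n then x k else y)"
  obtain c where c: "\<exists>k\<in>{..<Suc n}. c k \<noteq> 0" "\<forall>l\<in>\<Lambda>. (\<Sum>k\<in>{..<Suc n}. X k l * c k) = 0"
    using homogeneous_system_solvable[of \<Lambda> "{..<Suc n}" "\<lambda>l k. X k l"] assms by auto
  have all: "(\<Sum>k<Suc n. c k * X k a) = 0" if "a \<in> A" for a
  proof -
    have "M * (\<Sum>k<Suc n. c k * X k a) = (\<Sum>k<Suc n. c k * (M * X k a))"
      by (simp add: sum_distrib_left algebra_simps)
    also have "\<dots> = (\<Sum>k<Suc n. c k * (\<Sum>\<kappa>\<in>\<Lambda>. m a \<kappa> * X k \<kappa>))"
      using that by (intro sum.cong refl arg_cong2[where f="(*)"] rel) (auto simp: X_def)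
    also have "\<dots> = (\<Sum>\<kappa>\<in>\<Lambda>. m a \<kappa> * (\<Sum>k<Suc n. X k \<kappa> * c k))"
      unfolding sum_distrib_left by (subst sum.swap) (simp add: mult_ac)
    also have "\<dots> = 0" using c by simp
    finally show ?thesis using assms by simp
  qed
  have e: "(\<Sum>k<n. c k * x k a) + c n * y a = 0" if "a \<in> A" for a
  proof -
    have "(\<Sum>k<n. c k * X k a) = (\<Sum>k<n. c k * x k a)" by (intro sum.cong) (auto simp: X_def)
    then show ?thesis using all[OF that] by (simp add: X_def)
  qed
  have "c n \<noteq> 0"
  proof
    assume "c n = 0"
    then have "\<forall>k<n. c k = 0" using e assms(1) by (auto simp: indep_on_def)
    with \<open>c n = 0\<close> c(1) show False by (auto simp: less_Suc_eq)
  qed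
  moreover have "c n * y a = (\<Sum>k<n. (- c k) * x k a)" if "a \<in> A" for a
    using e[OF that] by (simp add: sum_negf add_eq_0_iff)
  ultimately show ?thesis by (intro that[of "c n" "\<lambda>k. - c k"]) auto
qed

section \<open>Rank of a set of vectors over a domain\<close>

definition rank_on :: "'a set \<Rightarrow> ('a \<Rightarrow> 'r::idom) set \<Rightarrow> nat" where
  "rank_on A S = Max {n. \<exists>x. (\<forall>k<n. x k \<in> S) \<and> indep_on {..<n} A x}"

lemma rank_on_obtains:
  fixes S :: "('a \<Rightarrow> 'r::idom) set"
  assumes "finite A"
  obtains x \<Lambda> M m where "\<And>k. k < rank_on A S \<Longrightarrow> x k \<in> S" "indep_on {..<rank_on A S} A x" "\<Lambda> \<subseteq> A" "finite \<Lambda>"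
    "card \<Lambda> = rank_on A S" "M \<noteq> 0" "\<And>y a. y \<in> S \<Longrightarrow> a \<in> A \<Longrightarrow> M * y a = (\<Sum>\<kappa>\<in>\<Lambda>. m a \<kappa> * y \<kappa>)"
proof -
  obtain n x \<Lambda> M m where r: "\<And>k. k < (n::nat) \<Longrightarrow> x k \<in> S" "indep_on {..<n} A x" "\<Lambda> \<subseteq> A" "finite \<Lambda>" "card \<Lambda> = n"
    "M \<noteq> 0" "\<And>y a. y \<in> S \<Longrightarrow> a \<in> A \<Longrightarrow> M * y a = (\<Sum>\<kappa>\<in>\<Lambda>. m a \<kappa> * y \<kappa>)"
    using that by (rule rank_obtains[OF assms, of S])
  have le: "k \<le> n" if y: "\<forall>j<k. y j \<in> S" "indep_on {..<k} A y" for k :: nat and y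
  proof -
    have "card {..<k} \<le> card \<Lambda>"
    proof (rule indep_on_card_le[OF _ r(4) y(2)])
      fix c assume c: "\<forall>a\<in>\<Lambda>. (\<Sum>k<k. c k * y k a) = 0"
      show "\<forall>a\<in>A. (\<Sum>k<k. c k * y k a) = 0"
      proof
        fix a assume a: "a \<in> A"
        have "M * (\<Sum>k<k. c k * y k a) = (\<Sum>k<k. c k * (M * y k a))" by (simp add: sum_distrib_left mult_ac)
        also have "\<dots> = (\<Sum>k<k. c k * (\<Sum>\<kappa>\<in>\<Lambda>. m a \<kappa> * y k \<kappa>))" using a r(7) y(1) by (intro sum.cong) auto
        also have "\<dots> = (\<Sum>\<kappa>\<in>\<Lambda>. m a \<kappa> * (\<Sum>k<k. c k * y k \<kappa>))"
          unfolding sum_distrib_left by (subst sum.swap) (simp add: mult_ac)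
        also have "\<dots> = 0" using c by simp
        finally show "(\<Sum>k<k. c k * y k a) = 0" using r(6) by simp
      qed
    qed auto
    then show ?thesis using r(5) by simp
  qed
  let ?N = "{n. \<exists>x. (\<forall>k<(n::nat). x k \<in> S) \<and> indep_on {..<n} A x}"
  \<comment> \<open>The bound \<open>le\<close> by the pivots is what makes \<open>Max\<close>
    meaningful.\<close>
  have "finite ?N" by (rule finite_subset[of _ "{..n}"]) (use le in auto)
  then have "rank_on A S = n"
    unfolding rank_on_def using le r(1,2) by (intro Max_eqI) auto
  with r show thesis by (intro that[of x \<Lambda> M m]) auto
qed

lemma indep_on_le_rank:
  fixes y :: "nat \<Rightarrow> 'a \<Rightarrow> 'r::idom"
  assumes "finite A" "\<forall>k<n. y k \<in> S" "indep_on {..<n} A y"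
  shows "n \<le> rank_on A S"
proof -
  have "k \<le> card A" if "indep_on {..<k} A y" for k :: nat and y :: "nat \<Rightarrow> 'a \<Rightarrow> 'r"
    using indep_on_card_le[OF _ assms(1) that] by auto
  then have "finite {n. \<exists>x. (\<forall>k<(n::nat). x k \<in> S) \<and> indep_on {..<n} A x}"
    by - (rule finite_subset[of _ "{..card A}"], auto)
  then show ?thesis unfolding rank_on_def using assms by (intro Max_ge) auto
qed

lemma rank_on_mono:
  fixes S :: "('a \<Rightarrow> 'r::idom) set"
  assumes "finite A" "S \<subseteq> T"
  shows "rank_on A S \<le> rank_on A T"
proof -
  obtain x \<Lambda> M m where r: "\<And>k. k < rank_on A S \<Longrightarrow> x k \<in> S" "indep_on {..<rank_on A S} A x" "\<Lambda> \<subseteq> A" "finite \<Lambda>"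
    "card \<Lambda> = rank_on A S" "M \<noteq> 0" "\<And>y a. y \<in> S \<Longrightarrow> a \<in> A \<Longrightarrow> M * y a = (\<Sum>\<kappa>\<in>\<Lambda>. m a \<kappa> * y \<kappa>)"
    using that by (rule rank_on_obtains[OF assms(1), of S])
  then show ?thesis using assms by (intro indep_on_le_rank[of A _ x]) auto
qed

lemma rank_on_le_card:
  fixes S :: "('a \<Rightarrow> 'r::idom) set"
  assumes "finite A"
  shows "rank_on A S \<le> card A"
proof -
  obtain x \<Lambda> M m where r: "\<And>k. k < rank_on A S \<Longrightarrow> x k \<in> S" "indep_on {..<rank_on A S} A x" "\<Lambda> \<subseteq> A" "finite \<Lambda>"
    "card \<Lambda> = rank_on A S" "M \<noteq> 0" "\<And>y a. y \<in> S \<Longrightarrow> a \<in> A \<Longrightarrow> M * y a = (\<Sum>\<kappa>\<in>\<Lambda>. m a \<kappa> * y \<kappa>)"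
    using that by (rule rank_on_obtains[OF assms, of S])
  then show ?thesis using card_mono[OF assms r(3)] by simp
qed

lemma rank_on_dependence:
  fixes x :: "nat \<Rightarrow> 'a \<Rightarrow> 'r::idom"
  assumes "finite A" "\<forall>k<n. x k \<in> S" "indep_on {..<n} A x" "n = rank_on A S" "y \<in> S"
  obtains p c where "p \<noteq> 0" "\<And>a. a \<in> A \<Longrightarrow> p * y a = (\<Sum>k<n. c k * x k a)"
proof -
  obtain x' \<Lambda> M m where r: "\<And>k. k < rank_on A S \<Longrightarrow> x' k \<in> S" "indep_on {..<rank_on A S} A x'" "\<Lambda> \<subseteq> A" "finite \<Lambda>"
    "card \<Lambda> = rank_on A S" "M \<noteq> 0" "\<And>y a. y \<in> S \<Longrightarrow> a \<in> A \<Longrightarrow> M * y a = (\<Sum>\<kappa>\<in>\<Lambda>. m a \<kappa> * y \<kappa>)"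
    using that by (rule rank_on_obtains[OF assms(1), of S])
  have "M * z a = (\<Sum>\<kappa>\<in>\<Lambda>. m a \<kappa> * z \<kappa>)" if "z = y \<or> (\<exists>k<n. z = x k)" "a \<in> A" for z a
    using r(7)[OF _ that(2)] that(1) assms(2,5) by auto
  from dependence_exists[OF assms(3) r(4) _ r(6) this] r(5) assms(4) that show thesis by auto
qed

text \<open>The predicate \<open>P\<close> stands for a subring. The dual vector is built without
  division and so stays in the subring of the entries; this is applied to series with rational
  coefficients and factorial growth.\<close>

lemma dual_vector_exists:
  fixes x :: "nat \<Rightarrow> 'a \<Rightarrow> 'r::idom"
  assumes "finite A" "indep_on {..<n} A x" "\<And>k a. k < n \<Longrightarrow> a \<in> A \<Longrightarrow> P (x k a)"
    and P: "P 0" "P 1" "\<And>u v. P u \<Longrightarrow> P v \<Longrightarrow> P (u + v)" "\<And>u v. P u \<Longrightarrow> P v \<Longrightarrow> P (u * v)" "\<And>u. P u \<Longrightarrow> P (- u)"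
    and k0: "k0 < n"
  obtains w where "\<And>a. a \<in> A \<Longrightarrow> P (w a)" "(\<Sum>a\<in>A. w a * x k0 a) \<noteq> 0"
    "\<And>k. k < n \<Longrightarrow> k \<noteq> k0 \<Longrightarrow> (\<Sum>a\<in>A. w a * x k a) = 0"
proof -
  have Psum: "P (sum f B)" if "finite B" "\<And>b. b \<in> B \<Longrightarrow> P (f b)" for f :: "'a \<Rightarrow> 'r" and B
    using that by (induction B rule: finite_induct) (auto intro: P)
  \<comment> \<open>The vectors to be annihilated are removed one at a time, and each removal
    changes all the others; hence the generalisation over \<open>x\<close> and
    \<open>x0\<close>.\<close>
  have *: "\<exists>w. (\<forall>a\<in>A. P (w a)) \<and> (\<Sum>a\<in>A. w a * x0 a) \<noteq> 0 \<and> (\<forall>k\<in>K. (\<Sum>a\<in>A. w a * x k a) = 0)"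
    if "finite K" "\<And>k a. k \<in> K \<Longrightarrow> a \<in> A \<Longrightarrow> P (x k a)" "\<And>a. a \<in> A \<Longrightarrow> P (x0 a)"
      "\<And>c p. \<forall>a\<in>A. p * x0 a + (\<Sum>k\<in>K. c k * x k a) = 0 \<Longrightarrow> p = 0 \<and> (\<forall>k\<in>K. c k = 0)"
    for K :: "nat set" and x :: "nat \<Rightarrow> 'a \<Rightarrow> 'r" and x0
    using that
  proof (induction K arbitrary: x x0 rule: finite_induct)
    case empty
    have "\<exists>a\<in>A. x0 a \<noteq> 0" using empty.prems(3)[of 1 "\<lambda>_. 0"] by auto
    then obtain a0 where a0: "a0 \<in> A" "x0 a0 \<noteq> 0" by auto
    then have "(\<Sum>a\<in>A. (if a = a0 then 1 else 0) * x0 a) = x0 a0"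
      using assms(1) by (simp add: if_distrib[of "\<lambda>z. z * _"] cong: if_cong)
    then show ?case using a0 P by (intro exI[of _ "\<lambda>a. if a = a0 then 1 else 0"]) auto
  next
    case (insert k1 K)
    have "\<exists>a\<in>A. x k1 a \<noteq> 0"
    proof (rule ccontr)
      assume "\<not> ?thesis"
      then have "\<forall>a\<in>A. 0 * x0 a + (\<Sum>k\<in>insert k1 K. (if k = k1 then 1 else 0) * x k a) = 0"
        using insert.hyps by (auto intro!: sum.neutral)
      from insert.prems(3)[OF this] show False by auto
    qed
    then obtain i where i: "i \<in> A" "x k1 i \<noteq> 0" by auto
    define g where "g = (\<lambda>v a. x k1 i * v a - v i * x k1 a)"
    have "\<exists>w. (\<forall>a\<in>A. P (w a)) \<and> (\<Sum>a\<in>A. w a * g x0 a) \<noteq> 0 \<and> (\<forall>k\<in>K. (\<Sum>a\<in>A. w a * g (x k) a) = 0)"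
    proof (rule insert.IH)
      have Pg: "P (g v a)" if "\<And>b. b \<in> A \<Longrightarrow> P (v b)" "a \<in> A" for v a
        unfolding g_def diff_conv_add_uminus using that i insert.prems(1)[of k1] by (intro P) auto
      show "P (g (x k) a)" if "k \<in> K" "a \<in> A" for k a using Pg that insert.prems(1)[of k] by auto
      show "P (g x0 a)" if "a \<in> A" for a using Pg that insert.prems(2) by auto
    next
      fix c p assume h: "\<forall>a\<in>A. p * g x0 a + (\<Sum>k\<in>K. c k * g (x k) a) = 0"
      define c' where "c' = (\<lambda>k. if k = k1 then - (p * x0 i + (\<Sum>k\<in>K. c k * x k i)) else c k * x k1 i)"
      have "(p * x k1 i) * x0 a + (\<Sum>k\<in>insert k1 K. c' k * x k a) = 0" if "a \<in> A" for a
      proof -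
        have "(\<Sum>k\<in>K. c' k * x k a) = (\<Sum>k\<in>K. c k * x k1 i * x k a)"
          using insert.hyps by (intro sum.cong) (auto simp: c'_def)
        then have "(p * x k1 i) * x0 a + (\<Sum>k\<in>insert k1 K. c' k * x k a) = p * g x0 a + (\<Sum>k\<in>K. c k * g (x k) a)"
          using insert.hyps by (simp add: c'_def g_def algebra_simps sum_subtractf sum_distrib_left sum_distrib_right)
        then show ?thesis using h that by simp
      qed
      then have "p * x k1 i = 0 \<and> (\<forall>k\<in>insert k1 K. c' k = 0)" by (intro insert.prems(3)) auto
      then show "p = 0 \<and> (\<forall>k\<in>K. c k = 0)" using i insert.hyps by (auto simp: c'_def split: if_splits)
    qed
    then obtain w where w: "\<forall>a\<in>A. P (w a)" "(\<Sum>a\<in>A. w a * g x0 a) \<noteq> 0" "\<forall>k\<in>K. (\<Sum>a\<in>A. w a * g (x k) a) = 0" by blast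
    define s where "s = (\<Sum>a\<in>A. w a * x k1 a)"
    \<comment> \<open>Transpose of the projection \<open>g\<close>: pairing \<open>w'\<close> with
      \<open>v\<close> is pairing \<open>w\<close> with \<open>g v\<close>, and \<open>g\<close>
      kills \<open>x k1\<close>.\<close>
    define w' where "w' = (\<lambda>a. x k1 i * w a + (if a = i then - s else 0))"
    have e: "(\<Sum>a\<in>A. w' a * v a) = (\<Sum>a\<in>A. w a * g v a)" for v
    proof -
      have "(\<Sum>a\<in>A. w' a * v a) = (\<Sum>a\<in>A. x k1 i * (w a * v a)) + (\<Sum>a\<in>A. if a = i then - s * v a else 0)"
        unfolding sum.distrib[symmetric] by (intro sum.cong) (auto simp: w'_def algebra_simps)
      also have "\<dots> = (\<Sum>a\<in>A. w a * g v a)"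
        using assms(1) i by (simp add: g_def s_def algebra_simps sum_subtractf sum_distrib_left)
      finally show ?thesis .
    qed
    have "g (x k1) a = 0" for a by (simp add: g_def)
    then have "\<forall>k\<in>insert k1 K. (\<Sum>a\<in>A. w' a * x k a) = 0" using w e by auto
    moreover have "(\<Sum>a\<in>A. w' a * x0 a) \<noteq> 0" using w e by simp
    moreover have "\<forall>a\<in>A. P (w' a)"
    proof
      fix a assume a: "a \<in> A"
      have "P s" unfolding s_def using w insert.prems(1) assms(1) by (intro Psum P) auto
      moreover have "P (x k1 i * w a)" using w i a insert.prems(1) by (intro P(4)) auto
      ultimately show "P (w' a)" unfolding w'_def using P(1,3,5) by simp
    qed
    ultimately show ?case by blast
  qed
  have "\<exists>w. (\<forall>a\<in>A. P (w a)) \<and> (\<Sum>a\<in>A. w a * x k0 a) \<noteq> 0 \<and> (\<forall>k\<in>{..<n} - {k0}. (\<Sum>a\<in>A. w a * x k a) = 0)"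
  proof (rule *)
    fix c p assume h: "\<forall>a\<in>A. p * x k0 a + (\<Sum>k\<in>{..<n} - {k0}. c k * x k a) = 0"
    define c' where "c' = c(k0 := p)"
    have "(\<Sum>k<n. c' k * x k a) = 0" if "a \<in> A" for a
    proof -
      have "(\<Sum>k<n. c' k * x k a) = c' k0 * x k0 a + (\<Sum>k\<in>{..<n} - {k0}. c' k * x k a)"
        using k0 by (simp add: sum.remove)
      also have "(\<Sum>k\<in>{..<n} - {k0}. c' k * x k a) = (\<Sum>k\<in>{..<n} - {k0}. c k * x k a)"
        by (intro sum.cong) (auto simp: c'_def)
      finally show ?thesis using h that by (simp add: c'_def)
    qed
    then have "\<forall>k<n. c' k = 0" using assms(2) by (auto simp: indep_on_def)
    then show "p = 0 \<and> (\<forall>k\<in>{..<n} - {k0}. c k = 0)" using k0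
      by (metis Diff_iff c'_def fun_upd_apply insertI1 lessThan_iff)
  qed (use assms in auto)
  then show ?thesis using that by auto
qed

section \<open>Orders of vanishing in finite-dimensional families of power series\<close>

lemma fps_X_power_dvd_iff: "fps_X ^ s dvd (f :: 'a::comm_ring_1 fps) \<longleftrightarrow> (\<forall>u<s. f $ u = 0)"
proof
  assume "fps_X ^ s dvd f"
  then show "\<forall>u<s. f $ u = 0" by (auto simp: dvd_def fps_X_power_mult_nth)
next
  assume "\<forall>u<s. f $ u = 0"
  then have "f = fps_X ^ s * Abs_fps (\<lambda>k. f $ (k + s))"
    by (intro fps_ext) (auto simp: fps_X_power_mult_nth)
  then show "fps_X ^ s dvd f" by (metis dvd_triv_left)
qed

text \<open>Orders add in a domain, so a factor of order below \<open>e\<close> can absorb fewer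
  than \<open>e\<close> powers of X.\<close>

lemma fps_X_power_dvd_mult_cancel:
  fixes f g :: "'a::idom fps"
  assumes "fps_X ^ s dvd f * g" "f \<noteq> 0" "\<not> fps_X ^ e dvd f"
  shows "fps_X ^ (s - e) dvd g"
proof (cases "g = 0")
  case False
  have "subdegree f < e"
    using assms(3) unfolding fps_X_power_dvd_iff
    by (meson linorder_not_less nth_less_subdegree_zero order_less_le_trans)
  moreover have "\<not> subdegree (f * g) < s"
  proof
    assume "subdegree (f * g) < s"
    then have "(f * g) $ subdegree (f * g) = 0" using assms(1) unfolding fps_X_power_dvd_iff by blast
    then show False using assms(2) False by simp
  qed
  ultimately have "s - e \<le> subdegree g" using assms(2) False by (simp add: subdegree_mult)
  then show ?thesis unfolding fps_X_power_dvd_iff by (auto intro: nth_less_subdegree_zero)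
qed simp

text \<open>The rows \<open>g s $ u\<close>, for all \<open>u\<close>, have finite rank; once the
  finitely many rows of a basis annihilate \<open>c\<close>, all rows do.\<close>

lemma finite_span_order:
  fixes g :: "'s \<Rightarrow> 'k::idom fps"
  assumes "finite S"
  shows "\<exists>e. \<forall>c. (\<forall>u<e. (\<Sum>s\<in>S. c s * g s $ u) = 0) \<longrightarrow> (\<forall>u. (\<Sum>s\<in>S. c s * g s $ u) = 0)"
proof -
  define R where "R = range (\<lambda>u s. g s $ u)"
  obtain n x \<Lambda> M m where r: "\<And>k. k < (n::nat) \<Longrightarrow> x k \<in> R" "indep_on {..<n} S x" "\<Lambda> \<subseteq> S" "finite \<Lambda>" "card \<Lambda> = n" "M \<noteq> 0"
    "\<And>y a. y \<in> R \<Longrightarrow> a \<in> S \<Longrightarrow> M * y a = (\<Sum>k\<in>\<Lambda>. m a k * y k)"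
    using that by (rule rank_obtains[OF assms, of R])
  have "\<exists>u. x k = (\<lambda>s. g s $ u)" if "k < n" for k using r(1)[OF that] by (auto simp: R_def)
  then have "\<forall>k. \<exists>u. k < n \<longrightarrow> x k = (\<lambda>s. g s $ u)" by auto
  from choice[OF this] obtain v where v: "\<And>k. k < n \<Longrightarrow> x k = (\<lambda>s. g s $ v k)" by auto
  define e where "e = Suc (Max (insert 0 (v ` {..<n})))"
  have e: "v k < e" if "k < n" for k using that by (auto simp: e_def less_Suc_eq_le)
  have "(\<Sum>s\<in>S. c s * g s $ u) = 0" if c: "\<forall>u<e. (\<Sum>s\<in>S. c s * g s $ u) = 0" for c u
  proof -
    have "M * z a = (\<Sum>k\<in>\<Lambda>. m a k * z k)" if "z = (\<lambda>a. g a $ u) \<or> (\<exists>k<n. z = x k)" "a \<in> S" for z a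
    proof -
      have "z \<in> R" using that(1) r(1) by (auto simp: R_def)
      then show ?thesis using r(7) that(2) by blast
    qed
    from dependence_exists[OF r(2,4,5,6) this]
    obtain p d where pd: "p \<noteq> 0" "\<And>a. a \<in> S \<Longrightarrow> p * g a $ u = (\<Sum>k<n. d k * x k a)" by (auto simp: mult.commute)
    have "p * (\<Sum>s\<in>S. c s * g s $ u) = (\<Sum>s\<in>S. c s * (p * g s $ u))" by (simp add: sum_distrib_left mult_ac)
    also have "\<dots> = (\<Sum>s\<in>S. c s * (\<Sum>k<n. d k * x k s))" using pd by (intro sum.cong) auto
    also have "\<dots> = (\<Sum>k<n. d k * (\<Sum>s\<in>S. c s * x k s))"
      unfolding sum_distrib_left by (subst sum.swap) (simp add: mult_ac)
    also have "\<dots> = 0" using v e c by (intro sum.neutral) auto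
    finally show ?thesis using pd by simp
  qed
  then show ?thesis by (intro exI[of _ e] allI impI) auto
qed

text \<open>The generators are combined with constant coefficients, not with series: this is a
  finite-dimensional condition, under which nonzero entries have bounded order.\<close>

definition fin_gen :: "'l set \<Rightarrow> ('l \<Rightarrow> 'k::idom fps) set \<Rightarrow> bool" where
  "fin_gen L Y \<longleftrightarrow> (\<exists>(n::nat) g. \<forall>y\<in>Y. \<exists>c. \<forall>l\<in>L. y l = (\<Sum>s<n. fps_const (c s) * g s l))"

lemma fin_genI:
  assumes "finite I" "\<And>y. y \<in> Y \<Longrightarrow> \<exists>c. \<forall>l\<in>L. y l = (\<Sum>i\<in>I. fps_const (c i) * g i l)"
  shows "fin_gen L Y"
proof -
  obtain h where h: "bij_betw h {..<card I} I"
    using ex_bij_betw_nat_finite[OF assms(1)] by (auto simp: atLeast0LessThan)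
  have "\<exists>c. \<forall>l\<in>L. y l = (\<Sum>s<card I. fps_const (c s) * g (h s) l)" if y: "y \<in> Y" for y
  proof -
    obtain c where "\<forall>l\<in>L. y l = (\<Sum>i\<in>I. fps_const (c i) * g i l)" using assms(2)[OF y] by blast
    then show ?thesis
      by (intro exI[of _ "c \<circ> h"]) (auto simp: sum.reindex_bij_betw[OF h, symmetric])
  qed
  then show ?thesis unfolding fin_gen_def by (intro exI[of _ "card I"] exI[of _ "\<lambda>s. g (h s)"]) auto
qed

lemma fin_gen_order:
  fixes Y :: "('l \<Rightarrow> 'k::idom fps) set"
  assumes "finite L" "fin_gen L Y"
  shows "\<exists>e. \<forall>y\<in>Y. \<forall>l\<in>L. y l \<noteq> 0 \<longrightarrow> \<not> fps_X ^ e dvd y l"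
proof -
  obtain n g where g: "\<forall>y\<in>Y. \<exists>c. \<forall>l\<in>L. y l = (\<Sum>s<(n::nat). fps_const (c s) * g s l)"
    using assms(2) by (auto simp: fin_gen_def)
  have "\<exists>e. \<forall>c. (\<forall>u<e. (\<Sum>s<n. c s * g s l $ u) = 0) \<longrightarrow> (\<forall>u. (\<Sum>s<n. c s * g s l $ u) = 0)" for l
    by (rule finite_span_order) auto
  then obtain e where e: "\<And>l c. (\<forall>u<e l. (\<Sum>s<n. c s * g s l $ u) = 0) \<longrightarrow> (\<forall>u. (\<Sum>s<n. c s * g s l $ u) = 0)" by metis
  obtain E where E: "\<forall>l\<in>L. e l \<le> E"
    using assms(1) by (intro that[of "Max (e ` L)"]) auto
  have "y l = 0" if *: "y \<in> Y" "l \<in> L" "fps_X ^ E dvd y l" for y l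
  proof -
    obtain c where c: "y l = (\<Sum>s<n. fps_const (c s) * g s l)" using bspec[OF g *(1)] *(2) by auto
    have n: "y l $ u = (\<Sum>s<n. c s * g s l $ u)" for u by (simp add: c fps_sum_nth)
    have "\<forall>u<e l. y l $ u = 0" using * E unfolding fps_X_power_dvd_iff by force
    then show ?thesis using e[of l c] n by (intro fps_ext) simp
  qed
  then show ?thesis by (intro exI[of _ E]) auto
qed

text \<open>A Cramer argument with a constant \<open>e\<close> common to all families in
  \<open>Y\<close>. Eliminating one vector replaces the entries by 2 by 2 minors, and these minors
  again come from a finitely generated set, so the induction applies to them.\<close>

lemma uniform_order:
  fixes Y :: "('l \<Rightarrow> 'k::idom fps) set" and r :: nat
  assumes "finite L" "fin_gen L Y"
  shows "\<exists>e. \<forall>y. (\<forall>k<r. y k \<in> Y) \<and> indep_on {..<r} L y \<longrightarrow>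
     (\<forall>\<beta> s. (\<forall>l\<in>L. fps_X ^ s dvd (\<Sum>k<r. \<beta> k * y k l)) \<longrightarrow> (\<forall>k<r. fps_X ^ (s - e) dvd \<beta> k))"
  using assms(2)
proof (induction r arbitrary: Y)
  case 0
  then show ?case by auto
next
  case (Suc r)
  define h :: "('l \<Rightarrow> 'k fps) \<Rightarrow> ('l \<Rightarrow> 'k fps) \<Rightarrow> 'l \<Rightarrow> 'l \<Rightarrow> 'k fps"
    where "h = (\<lambda>y1 y2 l1 l. y1 l1 * y2 l - y2 l1 * y1 l)"
  define Y' where "Y' = {h y1 y2 l1 |y1 y2 l1. y1 \<in> Y \<and> y2 \<in> Y \<and> l1 \<in> L}"
  obtain n g where g: "\<forall>y\<in>Y. \<exists>c. \<forall>l\<in>L. y l = (\<Sum>s<(n::nat). fps_const (c s) * g s l)"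
    using Suc.prems by (auto simp: fin_gen_def)
  have "fin_gen L Y'"
  proof (rule fin_genI)
    show "finite ({..<n} \<times> {..<n} \<times> L)" using assms(1) by auto
    fix y assume "y \<in> Y'"
    then obtain y1 y2 l1 where y: "y = h y1 y2 l1" "y1 \<in> Y" "y2 \<in> Y" "l1 \<in> L" by (auto simp: Y'_def)
    obtain c1 c2 where c: "\<forall>l\<in>L. y1 l = (\<Sum>s<n. fps_const (c1 s) * g s l)"
      "\<forall>l\<in>L. y2 l = (\<Sum>s<n. fps_const (c2 s) * g s l)" using bspec[OF g y(2)] bspec[OF g y(3)] by auto
    \<comment> \<open>Minors are bilinear, hence constant combinations of the minors of the
      generators. The column \<open>l1\<close> varies with the minor, so it becomes part of the
      generator, as \<open>l'\<close>.\<close>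
    define C where "C = (\<lambda>(s, s', l'). if l' = l1 then c1 s * c2 s' else 0)"
    define G where "G = (\<lambda>(s, s', l') l. g s l' * g s' l - g s' l' * g s l)"
    have "y l = (\<Sum>i\<in>{..<n} \<times> {..<n} \<times> L. fps_const (C i) * G i l)" if l: "l \<in> L" for l
    proof -
      have "(\<Sum>i\<in>{..<n} \<times> {..<n} \<times> L. fps_const (C i) * G i l) =
        (\<Sum>s<n. \<Sum>s'<n. \<Sum>l'\<in>L. fps_const (C (s, s', l')) * G (s, s', l') l)"
        by (simp add: sum.cartesian_product)
      also have "\<dots> = (\<Sum>s<n. \<Sum>s'<n. \<Sum>l'\<in>L. if l' = l1 then fps_const (c1 s * c2 s') * G (s, s', l1) l else 0)"
        by (intro sum.cong) (auto simp: C_def)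
      also have "\<dots> = (\<Sum>s<n. \<Sum>s'<n. fps_const (c1 s * c2 s') * G (s, s', l1) l)"
        using assms(1) y by simp
      also have "\<dots> = (\<Sum>s<n. \<Sum>s'<n. (fps_const (c1 s) * g s l1) * (fps_const (c2 s') * g s' l))
          - (\<Sum>s<n. \<Sum>s'<n. (fps_const (c1 s) * g s l) * (fps_const (c2 s') * g s' l1))"
        unfolding sum_subtractf[symmetric]
        by (intro sum.cong) (auto simp: G_def algebra_simps fps_const_mult[symmetric] simp del: fps_const_mult)
      also have "\<dots> = y1 l1 * y2 l - y1 l * y2 l1" using c l y by (simp add: sum_product)
      finally show ?thesis by (simp add: y(1) h_def mult_ac)
    qed
    then show "\<exists>c. \<forall>l\<in>L. y l = (\<Sum>i\<in>{..<n} \<times> {..<n} \<times> L. fps_const (c i) * G i l)" by blast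
  qed
  from Suc.IH[OF this] obtain e' where "\<forall>y. (\<forall>k<r. y k \<in> Y') \<and> indep_on {..<r} L y \<longrightarrow>
     (\<forall>\<beta> s. (\<forall>l\<in>L. fps_X ^ s dvd (\<Sum>k<r. \<beta> k * y k l)) \<longrightarrow> (\<forall>k<r. fps_X ^ (s - e') dvd \<beta> k))" ..
  then have e': "\<And>y \<beta> s k. (\<forall>k<r. y k \<in> Y') \<Longrightarrow> indep_on {..<r} L y \<Longrightarrow>
     (\<forall>l\<in>L. fps_X ^ s dvd (\<Sum>k<r. \<beta> k * y k l)) \<Longrightarrow> k < r \<Longrightarrow> fps_X ^ (s - e') dvd \<beta> k"
    by simp
  obtain e1 where e1: "\<forall>y\<in>Y. \<forall>l\<in>L. y l \<noteq> 0 \<longrightarrow> \<not> fps_X ^ e1 dvd y l"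
    using fin_gen_order[OF assms(1) Suc.prems] by blast
  have "fps_X ^ (s - (e' + e1)) dvd \<beta> k"
    if y: "\<forall>k<Suc r. y k \<in> Y" "indep_on {..<Suc r} L y" and b: "\<forall>l\<in>L. fps_X ^ s dvd (\<Sum>k<Suc r. \<beta> k * y k l)"
      and k: "k < Suc r" for y \<beta> s k
  proof -
    have "\<exists>l\<in>L. y r l \<noteq> 0"
    proof (rule ccontr)
      assume "\<not> ?thesis"
      then have "(\<Sum>k<Suc r. (if k = r then 1 else 0) * y k l) = 0" if "l \<in> L" for l using that by simp
      then have "(if r = r then 1 else (0::'k fps)) = 0" using indep_onD[OF y(2), of "\<lambda>k. if k = r then 1 else 0" r] by auto
      then show False by simp
    qed
    then obtain l1 where l1: "l1 \<in> L" "y r l1 \<noteq> 0" by auto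
    define y' where "y' = (\<lambda>k. h (y r) (y k) l1)"
    have hs: "(\<Sum>k<r. c k * y' k l) = y r l1 * (\<Sum>k<r. c k * y k l) - (\<Sum>k<r. c k * y k l1) * y r l" for c l
      by (simp add: y'_def h_def sum_subtractf sum_distrib_left sum_distrib_right algebra_simps)
    have i': "indep_on {..<r} L y'"
      unfolding indep_on_def
    proof (intro allI impI)
      fix c assume c: "\<forall>l\<in>L. (\<Sum>k<r. c k * y' k l) = 0"
      define c' where "c' = (\<lambda>k. if k = r then - (\<Sum>k<r. c k * y k l1) else y r l1 * c k)"
      have "(\<Sum>k<Suc r. c' k * y k l) = 0" if "l \<in> L" for l
      proof -
        have "(\<Sum>k<r. c' k * y k l) = (\<Sum>k<r. y r l1 * (c k * y k l))" by (intro sum.cong) (auto simp: c'_def)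
        then show ?thesis using c that hs[of c l] by (simp add: c'_def sum_distrib_left)
      qed
      then have "c' k = 0" if "k < r" for k using y(2) that by (auto simp: indep_on_def)
      then show "\<forall>k\<in>{..<r}. c k = 0" using l1 by (auto simp: c'_def)
    qed
    have d: "fps_X ^ s dvd (\<Sum>k<r. \<beta> k * y' k l)" if "l \<in> L" for l
    proof -
      have "(\<Sum>k<r. \<beta> k * y' k l) = y r l1 * (\<Sum>k<Suc r. \<beta> k * y k l) - (\<Sum>k<Suc r. \<beta> k * y k l1) * y r l"
        unfolding hs by (simp add: algebra_simps)
      then show ?thesis using b l1(1) that by (auto intro!: dvd_diff dvd_mult dvd_mult2 simp del: sum.lessThan_Suc)
    qed
    have lt: "fps_X ^ (s - e') dvd \<beta> k" if "k < r" for k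
    proof (rule e'[OF _ i' _ that])
      have "y' k \<in> Y'" if "k < r" for k
        unfolding Y'_def y'_def using y(1) l1(1) that by (intro CollectI exI[of _ "y r"] exI[of _ "y k"] exI[of _ l1]) auto
      then show "\<forall>k<r. y' k \<in> Y'" by simp
    qed (use d in auto)
    show ?thesis
    proof (cases "k = r")
      case True
      \<comment> \<open>The last coefficient is read off in column \<open>l1\<close>, where
        \<open>y r l1\<close> is nonzero and of order below \<open>e1\<close>.\<close>
      have "fps_X ^ (s - e') dvd (\<Sum>k<Suc r. \<beta> k * y k l1)"
        by (rule dvd_trans[OF le_imp_power_dvd bspec[OF b l1(1)]]) simp
      moreover have "fps_X ^ (s - e') dvd (\<Sum>k<r. \<beta> k * y k l1)" using lt by (intro dvd_sum) auto
      ultimately have "fps_X ^ (s - e') dvd y r l1 * \<beta> r"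
        by (simp add: dvd_add_right_iff mult.commute)
      then have "fps_X ^ (s - e' - e1) dvd \<beta> r"
        using fps_X_power_dvd_mult_cancel[of "s - e'" "y r l1" "\<beta> r" e1] l1 e1 y(1) by auto
      then show ?thesis using True by simp
    next
      case False
      then have "fps_X ^ (s - e') dvd \<beta> k" using lt k by simp
      then show ?thesis by (rule dvd_trans[OF le_imp_power_dvd, rotated]) simp
    qed
  qed
  note key = this
  show ?case
  proof (intro exI[of _ "e' + e1"] allI impI)
    fix y \<beta> s k
    assume "(\<forall>k<Suc r. y k \<in> Y) \<and> indep_on {..<Suc r} L y"
      and b: "\<forall>l\<in>L. fps_X ^ s dvd (\<Sum>k<Suc r. \<beta> k * y k l)" and k: "k < Suc r"
    then show "fps_X ^ (s - (e' + e1)) dvd \<beta> k" by (intro key[OF _ _ b k]) auto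
  qed
qed

section \<open>Bounded generation of kernels over a polynomial ring\<close>

text \<open>A combination of \<open>Om\<close> that vanishes off the pivot set \<open>J\<close> of
  \<open>Z\<close> is orthogonal to \<open>Z\<close>, and \<open>Z\<close> has full rank on
  \<open>J\<close>, so the combination vanishes. Thus the \<open>card A - card J\<close> remaining
  coordinates determine the span of \<open>Om\<close>.\<close>

lemma rank_orthogonal:
  fixes Om Z :: "('a \<Rightarrow> 'r::idom) set"
  assumes "finite A" and orth: "\<And>w x. w \<in> Om \<Longrightarrow> x \<in> Z \<Longrightarrow> (\<Sum>a\<in>A. x a * w a) = 0"
  shows "rank_on A Om + rank_on A Z \<le> card A"
proof -
  obtain d J M m where d: "\<And>k. k < rank_on A Z \<Longrightarrow> d k \<in> Z" "indep_on {..<rank_on A Z} A d" "J \<subseteq> A" "finite J"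
    "card J = rank_on A Z" "M \<noteq> 0" "\<And>y a. y \<in> Z \<Longrightarrow> a \<in> A \<Longrightarrow> M * y a = (\<Sum>\<kappa>\<in>J. m a \<kappa> * y \<kappa>)"
    using that by (rule rank_on_obtains[OF assms(1), of Z])
  obtain w \<Lambda> M' m' where w: "\<And>k. k < rank_on A Om \<Longrightarrow> w k \<in> Om" "indep_on {..<rank_on A Om} A w" "\<Lambda> \<subseteq> A" "finite \<Lambda>"
    "card \<Lambda> = rank_on A Om" "M' \<noteq> 0" "\<And>y a. y \<in> Om \<Longrightarrow> a \<in> A \<Longrightarrow> M' * y a = (\<Sum>\<kappa>\<in>\<Lambda>. m' a \<kappa> * y \<kappa>)"
    using that by (rule rank_on_obtains[OF assms(1), of Om])
  define n where "n = rank_on A Z"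
  have dJ: "indep_on {..<n} J d"
    unfolding indep_on_def
  proof (intro allI impI)
    fix c assume c: "\<forall>a\<in>J. (\<Sum>k<n. c k * d k a) = 0"
    have "(\<Sum>k<n. c k * d k a) = 0" if a: "a \<in> A" for a
    proof -
      have "M * (\<Sum>k<n. c k * d k a) = (\<Sum>k<n. c k * (M * d k a))" by (simp add: sum_distrib_left mult_ac)
      also have "\<dots> = (\<Sum>k<n. c k * (\<Sum>\<kappa>\<in>J. m a \<kappa> * d k \<kappa>))"
        using a d(1) by (intro sum.cong refl arg_cong2[where f="(*)"] d(7)) (auto simp: n_def)
      also have "\<dots> = (\<Sum>\<kappa>\<in>J. m a \<kappa> * (\<Sum>k<n. c k * d k \<kappa>))"
        unfolding sum_distrib_left by (subst sum.swap) (simp add: mult_ac)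
      also have "\<dots> = 0" using c by simp
      finally show ?thesis using d(6) by simp
    qed
    then show "\<forall>k\<in>{..<n}. c k = 0" using d(2) by (simp add: indep_on_def n_def)
  qed
  have "card {..<rank_on A Om} \<le> card (A - J)"
  proof (rule indep_on_card_le[OF _ _ w(2)])
    fix c assume c: "\<forall>a\<in>A - J. (\<Sum>k<rank_on A Om. c k * w k a) = 0"
    define y where "y = (\<lambda>a. \<Sum>k<rank_on A Om. c k * w k a)"
    have y0: "y a = 0" if "a \<in> A" "a \<notin> J" for a using c that by (auto simp: y_def)
    have yd: "(\<Sum>a\<in>J. y a * d k a) = 0" if k: "k < n" for k
    proof -
      have "(\<Sum>a\<in>J. y a * d k a) = (\<Sum>a\<in>A. y a * d k a)"
        using d(3) y0 assms(1) by (intro sum.mono_neutral_left) auto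
      also have "\<dots> = (\<Sum>j<rank_on A Om. c j * (\<Sum>a\<in>A. d k a * w j a))"
        unfolding y_def sum_distrib_left sum_distrib_right by (subst sum.swap) (simp add: mult_ac)
      also have "\<dots> = 0" using orth w(1) d(1) k by (intro sum.neutral) (auto simp: n_def)
      finally show ?thesis .
    qed
    \<comment> \<open>A multiple of each unit vector on \<open>J\<close> is a combination of the
      \<open>d k\<close>, all of which are orthogonal to \<open>y\<close>.\<close>
    have "y a0 = 0" if a0: "a0 \<in> J" for a0
    proof -
      define e where "e = (\<lambda>a. if a = a0 then 1 else (0::'r))"
      have "1 * z a = (\<Sum>\<kappa>\<in>J. (if \<kappa> = a then 1 else 0) * z \<kappa>)"
        if "z = e \<or> (\<exists>k<n. z = d k)" "a \<in> J" for z :: "'a \<Rightarrow> 'r" and a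
        using that(2) d(4) by (simp add: if_distrib[of "\<lambda>u. u * _"] cong: if_cong)
      from dependence_exists[OF dJ d(4) _ _ this]
      obtain p c where pc: "p \<noteq> 0" "\<And>a. a \<in> J \<Longrightarrow> p * e a = (\<Sum>k<n. c k * d k a)"
        using d(5) by (auto simp: n_def mult.commute)
      have "p * y a0 = (\<Sum>a\<in>J. if a = a0 then y a * p else 0)" using a0 d(4) by simp
      also have "\<dots> = (\<Sum>a\<in>J. y a * (p * e a))" by (intro sum.cong) (auto simp: e_def)
      also have "\<dots> = (\<Sum>a\<in>J. y a * (\<Sum>k<n. c k * d k a))" using pc by (intro sum.cong) auto
      also have "\<dots> = (\<Sum>k<n. c k * (\<Sum>a\<in>J. y a * d k a))"
        unfolding sum_distrib_left by (subst sum.swap) (simp add: mult_ac)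
      also have "\<dots> = 0" using yd by simp
      finally show ?thesis using pc by simp
    qed
    then show "\<forall>a\<in>A. (\<Sum>k<rank_on A Om. c k * w k a) = 0" using y0 unfolding y_def by blast
  qed (use assms in auto)
  also have "card (A - J) = card A - card J" using d(3,4) by (simp add: card_Diff_subset)
  finally show ?thesis using d(5) card_mono[OF assms(1) d(3)] by simp
qed

text \<open>If the kernel vectors of low degree had too small a rank \<open>k\<close>, one could
  impose vanishing on their \<open>k\<close> pivot coordinates besides the kernel equations and
  still find a nonzero solution of low degree. It would be a low-degree kernel vector with zero
  pivots, hence zero. The bound depends on \<open>Om\<close> through \<open>c\<close> alone.\<close>

lemma kernel_bounded_generation:
  fixes Om :: "('a \<Rightarrow> 'k::field poly) set"
  assumes "finite A" and deg: "\<And>w b. w \<in> Om \<Longrightarrow> b \<in> A \<Longrightarrow> degree (w b) \<le> c"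
  defines "Z \<equiv> {x. (\<forall>a. a \<notin> A \<longrightarrow> x a = 0) \<and> (\<forall>w\<in>Om. (\<Sum>b\<in>A. x b * w b) = 0)}"
  shows "rank_on A {x\<in>Z. \<forall>a. degree (x a) \<le> card A * c} = rank_on A Z"
proof (rule antisym)
  define c' where "c' = card A * c"
  define Z' where "Z' = {x\<in>Z. \<forall>a. degree (x a) \<le> c'}"
  define N where "N = card A"
  show "rank_on A {x\<in>Z. \<forall>a. degree (x a) \<le> card A * c} \<le> rank_on A Z"
    by (intro rank_on_mono assms) auto
  have "rank_on A Z \<le> rank_on A Z'"
  proof (rule ccontr)
    assume "\<not> rank_on A Z \<le> rank_on A Z'"
    then have lt: "rank_on A Z' < rank_on A Z" by simp
    obtain w \<Lambda> M m where w: "\<And>k. k < rank_on A Om \<Longrightarrow> w k \<in> Om" "indep_on {..<rank_on A Om} A w" "\<Lambda> \<subseteq> A" "finite \<Lambda>"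
      "card \<Lambda> = rank_on A Om" "M \<noteq> 0" "\<And>y a. y \<in> Om \<Longrightarrow> a \<in> A \<Longrightarrow> M * y a = (\<Sum>\<kappa>\<in>\<Lambda>. m a \<kappa> * y \<kappa>)"
      using that by (rule rank_on_obtains[OF assms(1), of Om])
    obtain d J M' m' where d: "\<And>k. k < rank_on A Z' \<Longrightarrow> d k \<in> Z'" "indep_on {..<rank_on A Z'} A d" "J \<subseteq> A" "finite J"
      "card J = rank_on A Z'" "M' \<noteq> 0" "\<And>y a. y \<in> Z' \<Longrightarrow> a \<in> A \<Longrightarrow> M' * y a = (\<Sum>\<kappa>\<in>J. m' a \<kappa> * y \<kappa>)"
      using that by (rule rank_on_obtains[OF assms(1), of Z'])
    define n where "n = rank_on A Om"
    define k where "k = rank_on A Z'"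
    have "n + rank_on A Z \<le> N"
      unfolding n_def N_def by (rule rank_orthogonal[OF assms(1)]) (auto simp: Z_def)
    then have nk: "n + k + 1 \<le> N" using lt by (simp add: k_def)
    \<comment> \<open>\<open>Inl (j, v)\<close> is coefficient \<open>v\<close> of the kernel
      equation for \<open>w j\<close>; \<open>Inr (a, u)\<close> is the vanishing of coefficient
      \<open>u\<close> at the pivot \<open>a\<close>.\<close>
    define E where "E = Inl ` ({..<n} \<times> {..c'+c}) \<union> Inr ` (J \<times> {..c'})"
    define I where "I = A \<times> {..c'}"
    define f where "f = (\<lambda>e (b, u). case e of Inl (j, v) \<Rightarrow> coeff (monom 1 u * w j b) v
        | Inr (a, u') \<Rightarrow> (if b = a \<and> u = u' then 1 else (0::'k)))"
    have "card E = n * (c' + c + 1) + k * (c' + 1)"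
      unfolding E_def using d(4,5)
      by (subst card_Un_disjoint) (auto simp: card_image inj_on_def card_cartesian_product k_def)
    also have "\<dots> < N * (c' + 1)"
    proof -
      have "n * (c' + c + 1) + k * (c' + 1) = (n + k) * (c' + 1) + n * c" by (simp add: algebra_simps)
      \<comment> \<open>Origin of the bound \<open>card A * c\<close>: multiplying by the
        \<open>w j\<close> costs \<open>n * c\<close> additional equations, and one spare coordinate
        supplies \<open>c' + 1\<close> unknowns.\<close>
      also have "n * c \<le> c'" using nk by (auto simp: c'_def N_def)
      also have "(n + k) * (c' + 1) + c' < (n + k + 1) * (c' + 1)" by (simp add: algebra_simps)
      also have "\<dots> \<le> N * (c' + 1)" using nk by (intro mult_right_mono) auto
      finally show ?thesis by simp
    qed
    also have "\<dots> = card I" by (simp add: I_def N_def card_cartesian_product)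
    finally have "card E < card I" .
    then obtain y where y: "\<exists>i\<in>I. y i \<noteq> 0" "\<forall>e\<in>E. (\<Sum>i\<in>I. f e i * y i) = 0"
      using homogeneous_system_solvable[of E I f] assms(1) d(4) by (auto simp: E_def I_def)
    define x where "x = (\<lambda>b. if b \<in> A then \<Sum>u\<le>c'. monom (y (b, u)) u else 0)"
    have cx: "coeff (x b) u = (if b \<in> A \<and> u \<le> c' then y (b, u) else 0)" for b u
      by (simp add: x_def coeff_sum)
    have degx: "degree (x b) \<le> c'" for b by (rule degree_le) (auto simp: cx)
    have wx: "(\<Sum>b\<in>A. x b * w j b) = 0" if j: "j < n" for j
    proof (rule poly_eqI)
      fix v
      show "coeff (\<Sum>b\<in>A. x b * w j b) v = coeff 0 v"
      proof (cases "v \<le> c' + c")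
        case True
        have "coeff (\<Sum>b\<in>A. x b * w j b) v = (\<Sum>b\<in>A. \<Sum>u\<le>c'. coeff (monom (y (b, u)) u * w j b) v)"
          by (simp add: coeff_sum x_def sum_distrib_right)
        also have "\<dots> = (\<Sum>b\<in>A. \<Sum>u\<le>c'. f (Inl (j, v)) (b, u) * y (b, u))"
          by (intro sum.cong) (auto simp: f_def coeff_monom_mult)
        also have "\<dots> = (\<Sum>i\<in>I. f (Inl (j, v)) i * y i)"
          by (simp add: I_def sum.cartesian_product)
        also have "\<dots> = 0" using y(2) j True by (auto simp: E_def)
        finally show ?thesis by simp
      next
        case False
        have "degree (x b * w j b) \<le> c' + c" if "b \<in> A" for b
          using degree_mult_le[of "x b" "w j b"] degx[of b] deg[OF w(1)[of j] that] j by (simp add: n_def)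
        then have "degree (\<Sum>b\<in>A. x b * w j b) \<le> c' + c" using assms(1) by (intro degree_sum_le) auto
        then show ?thesis using False by (simp add: coeff_eq_0)
      qed
    qed
    have "(\<Sum>b\<in>A. x b * v b) = 0" if v: "v \<in> Om" for v
    proof -
      have "\<forall>k<n. w k \<in> Om" using w(1) by (simp add: n_def)
      note rank_on_dependence[OF assms(1) this w(2)[folded n_def] n_def v]
      then obtain p c where pc: "p \<noteq> 0" "\<And>a. a \<in> A \<Longrightarrow> p * v a = (\<Sum>k<n. c k * w k a)"
        using that by blast
      have "p * (\<Sum>b\<in>A. x b * v b) = (\<Sum>b\<in>A. x b * (p * v b))" by (simp add: sum_distrib_left mult_ac)
      also have "\<dots> = (\<Sum>b\<in>A. x b * (\<Sum>k<n. c k * w k b))" using pc by (intro sum.cong) auto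
      also have "\<dots> = (\<Sum>k<n. c k * (\<Sum>b\<in>A. x b * w k b))"
        unfolding sum_distrib_left by (subst sum.swap) (simp add: mult_ac)
      also have "\<dots> = 0" using wx by simp
      finally show ?thesis using pc by simp
    qed
    then have xZ: "x \<in> Z'" using degx by (auto simp: Z'_def Z_def x_def)
    have xJ: "x a = 0" if a: "a \<in> J" for a
    proof (rule poly_eqI)
      fix u
      show "coeff (x a) u = coeff 0 u"
      proof (cases "u \<le> c'")
        case True
        have aA: "a \<in> A" using a d(3) by auto
        have "(\<Sum>i\<in>I. f (Inr (a, u)) i * y i) = (\<Sum>i\<in>I. if i = (a, u) then y i else 0)"
          by (intro sum.cong) (auto simp: f_def split: if_splits)
        also have "\<dots> = y (a, u)" using assms(1) aA True by (simp add: I_def)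
        finally show ?thesis using y(2) a True by (simp add: cx E_def)
      qed (simp add: cx)
    qed
    have "x a = 0" if a: "a \<in> A" for a
    proof -
      have "M' * x a = (\<Sum>\<kappa>\<in>J. m' a \<kappa> * x \<kappa>)" by (rule d(7)[OF xZ a])
      also have "\<dots> = 0" using xJ by simp
      finally show ?thesis using d(6) by simp
    qed
    then have "y i = 0" if "i \<in> I" for i
      using cx[of "fst i" "snd i"] that by (auto simp: I_def)
    then show False using y(1) by auto
  qed
  then show "rank_on A Z \<le> rank_on A {x\<in>Z. \<forall>a. degree (x a) \<le> card A * c}"
    by (simp add: Z'_def c'_def)
qed

section \<open>Differential modules over the rational polynomials\<close>

text \<open>A connection along the vector field \<open>q d/dz\<close> on the free module with basis
  \<open>A\<close>; the factor \<open>q\<close> keeps it polynomial in the presence of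
  singularities.\<close>

locale diff_module =
  fixes A :: "'a set" and q :: "rat poly" and D :: "('a \<Rightarrow> rat poly) \<Rightarrow> 'a \<Rightarrow> rat poly"
  assumes finA: "finite A"
    and D_add: "D (\<lambda>a. x a + y a) = (\<lambda>a. D x a + D y a)"
    and D_mult: "D (\<lambda>a. p * x a) = (\<lambda>a. q * pderiv p * x a + p * D x a)"
    and D_supp: "\<forall>a. a \<notin> A \<longrightarrow> x a = 0 \<Longrightarrow> \<forall>a. a \<notin> A \<longrightarrow> D x a = 0"
begin

definition vecs :: "('a \<Rightarrow> rat poly) set" where "vecs = {x. \<forall>a. a \<notin> A \<longrightarrow> x a = 0}"

definition dmod :: "('a \<Rightarrow> rat poly) set \<Rightarrow> bool" where
  "dmod V \<longleftrightarrow> V \<subseteq> vecs \<and> (\<lambda>_. 0) \<in> V \<and> (\<forall>x\<in>V. \<forall>y\<in>V. (\<lambda>a. x a + y a) \<in> V) \<and>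
     (\<forall>p. \<forall>x\<in>V. (\<lambda>a. p * x a) \<in> V) \<and> (\<forall>x\<in>V. D x \<in> V)"

lemma dmodD:
  assumes "dmod V"
  shows "V \<subseteq> vecs" "(\<lambda>_. 0) \<in> V" "x \<in> V \<Longrightarrow> y \<in> V \<Longrightarrow> (\<lambda>a. x a + y a) \<in> V"
    "x \<in> V \<Longrightarrow> (\<lambda>a. p * x a) \<in> V" "x \<in> V \<Longrightarrow> D x \<in> V"
  using assms by (auto simp: dmod_def)

lemma dmod_funpow: "dmod V \<Longrightarrow> x \<in> V \<Longrightarrow> (D ^^ j) x \<in> V"
  by (induction j) (auto intro: dmodD)

lemma dmod_sum:
  assumes "dmod V" "finite K" "\<And>k. k \<in> K \<Longrightarrow> x k \<in> V"
  shows "(\<lambda>a. \<Sum>k\<in>K. p k * x k a) \<in> V"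
  using assms(2,3) by (induction K rule: finite_induct) (auto intro!: dmodD[OF assms(1)])

lemma D_zero: "D (\<lambda>_. 0) = (\<lambda>_. 0)" using D_mult[of 0 "\<lambda>_. 0"] by simp

lemma D_sum: "finite K \<Longrightarrow> D (\<lambda>a. \<Sum>k\<in>K. f k a) = (\<lambda>a. \<Sum>k\<in>K. D (f k) a)"
  by (induction K rule: finite_induct) (simp_all add: D_zero D_add)

lemma dmod_vecs: "dmod vecs"
  using D_supp by (auto simp: dmod_def vecs_def)

lemma funpow_in_vecs: "x \<in> vecs \<Longrightarrow> (D ^^ j) x \<in> vecs" by (rule dmod_funpow[OF dmod_vecs])

definition unit_vec :: "'a \<Rightarrow> 'a \<Rightarrow> rat poly" where "unit_vec b = (\<lambda>a. if a = b then 1 else 0)"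

lemma unit_vec_in_vecs: "b \<in> A \<Longrightarrow> unit_vec b \<in> vecs" by (auto simp: unit_vec_def vecs_def)

lemma vec_expand: "x \<in> vecs \<Longrightarrow> x = (\<lambda>a. \<Sum>b\<in>A. x b * unit_vec b a)"
  using finA by (auto simp: vecs_def unit_vec_def if_distrib[of "\<lambda>u. _ * u"] cong: if_cong)

lemma D_expand:
  assumes "x \<in> vecs" "a \<in> A"
  shows "D x a = q * pderiv (x a) + (\<Sum>b\<in>A. x b * D (unit_vec b) a)"
proof -
  have "D x = D (\<lambda>a. \<Sum>b\<in>A. x b * unit_vec b a)" using vec_expand[OF assms(1)] by simp
  also have "\<dots> = (\<lambda>a. \<Sum>b\<in>A. D (\<lambda>a. x b * unit_vec b a) a)" by (rule D_sum[OF finA])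
  finally have "D x a = (\<Sum>b\<in>A. D (\<lambda>a. x b * unit_vec b a) a)" by simp
  also have "\<dots> = (\<Sum>b\<in>A. q * pderiv (x b) * unit_vec b a) + (\<Sum>b\<in>A. x b * D (unit_vec b) a)"
    by (simp add: D_mult sum.distrib)
  also have "(\<Sum>b\<in>A. q * pderiv (x b) * unit_vec b a) = (\<Sum>b\<in>A. if b = a then q * pderiv (x b) else 0)"
    by (intro sum.cong) (auto simp: unit_vec_def)
  also have "\<dots> = q * pderiv (x a)" using finA assms(2) by simp
  finally show ?thesis .
qed

text \<open>Saturation of the span of \<open>P, D P, D\<^sup>2 P, \<dots>\<close>: it is spanned by the derivatives preceding the first dependent one.\<close>

lemma cyclic_module:
  assumes P: "P \<in> vecs" "P \<noteq> (\<lambda>_. 0)"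
  obtains V n where "dmod V" "n \<noteq> 0" "rank_on A V = n" "indep_on {..<n} A (\<lambda>j. (D ^^ j) P)" "\<And>j. (D ^^ j) P \<in> V"
proof -
  define x where "x = (\<lambda>j. (D ^^ j) P)"
  have xv: "x j \<in> vecs" for j using funpow_in_vecs[OF P(1)] by (simp add: x_def)
  have le: "n \<le> card A" if "indep_on {..<n} A x" for n :: nat
    using indep_on_card_le[OF _ finA that] by auto
  define N where "N = {n :: nat. indep_on {..<n} A x}"
  have N: "finite N" "0 \<in> N" unfolding N_def using le by (auto intro: finite_subset[of _ "{..card A}"] simp: indep_on_def)
  define n where "n = Max N"
  have n: "indep_on {..<n} A x" "\<not> indep_on {..<Suc n} A x"
  proof -
    have "n \<in> N" unfolding n_def using N by (intro Max_in) auto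
    then show "indep_on {..<n} A x" by (simp add: N_def)
    show "\<not> indep_on {..<Suc n} A x" using Max_ge[OF N(1), of "Suc n"] unfolding n_def N_def by auto
  qed
  obtain c k where c: "\<forall>a\<in>A. (\<Sum>k<Suc n. c k * x k a) = 0" "k < Suc n" "c k \<noteq> 0"
    using n(2) by (auto simp: indep_on_def)
  have cn: "c n \<noteq> 0"
  proof
    assume 0: "c n = 0"
    then have "\<forall>a\<in>A. (\<Sum>k<n. c k * x k a) = 0" using c(1) by simp
    then have "\<forall>k<n. c k = 0" using n(1) by (auto simp: indep_on_def)
    then show False using 0 c by (auto simp: less_Suc_eq)
  qed
  \<comment> \<open>A denominator \<open>p\<close> is allowed here, because the first relation
    expresses only the multiple \<open>c n * x n\<close> by the earlier derivatives.\<close>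
  define V where "V = {y \<in> vecs. \<exists>p d. p \<noteq> 0 \<and> (\<forall>a. p * y a = (\<Sum>k<n. d k * x k a))}"
  have VI: "y \<in> V" if "y \<in> vecs" "p \<noteq> 0" "\<And>a. a \<in> A \<Longrightarrow> p * y a = (\<Sum>k<n. d k * x k a)" for y p d
  proof -
    have "p * y a = (\<Sum>k<n. d k * x k a)" for a
      using that xv by (cases "a \<in> A") (auto simp: vecs_def)
    then show ?thesis using that by (auto simp: V_def)
  qed
  have xn: "x n \<in> V"
  proof (rule VI[OF xv cn])
    fix a assume "a \<in> A"
    then show "c n * x n a = (\<Sum>k<n. (- c k) * x k a)" using c(1) by (simp add: sum_negf add_eq_0_iff2 add.commute)
  qed
  have V_add: "(\<lambda>a. y a + z a) \<in> V" if *: "y \<in> V" "z \<in> V" for y z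
  proof -
    obtain p d where y: "y \<in> vecs" "p \<noteq> 0" "\<forall>a. p * y a = (\<Sum>k<n. d k * x k a)" using *(1) by (auto simp: V_def)
    obtain p' d' where z: "z \<in> vecs" "p' \<noteq> 0" "\<forall>a. p' * z a = (\<Sum>k<n. d' k * x k a)" using *(2) by (auto simp: V_def)
    show ?thesis
    proof (rule VI)
      show "(p * p') * (y a + z a) = (\<Sum>k<n. (p' * d k + p * d' k) * x k a)" for a
      proof -
        have "(p * p') * (y a + z a) = p' * (p * y a) + p * (p' * z a)" by (simp add: algebra_simps)
        also have "\<dots> = (\<Sum>k<n. (p' * d k + p * d' k) * x k a)"
          using y z by (simp add: sum_distrib_left sum.distrib algebra_simps)
        finally show ?thesis .
      qed
    qed (use y z in \<open>auto simp: vecs_def\<close>)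
  qed
  have V_mult: "(\<lambda>a. r * y a) \<in> V" if *: "y \<in> V" for y r
  proof -
    obtain p d where y: "y \<in> vecs" "p \<noteq> 0" "\<forall>a. p * y a = (\<Sum>k<n. d k * x k a)" using *(1) by (auto simp: V_def)
    show ?thesis
    proof (rule VI)
      show "p * (r * y a) = (\<Sum>k<n. (r * d k) * x k a)" for a
      proof -
        have "p * (r * y a) = r * (p * y a)" by (simp add: algebra_simps)
        also have "\<dots> = (\<Sum>k<n. (r * d k) * x k a)" using y by (simp add: sum_distrib_left algebra_simps)
        finally show ?thesis .
      qed
    qed (use y in \<open>auto simp: vecs_def\<close>)
  qed
  have V_cancel: "y \<in> V" if y: "y \<in> vecs" "r \<noteq> 0" "(\<lambda>a. r * y a) \<in> V" for y r
  proof -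
    obtain p d where z: "p \<noteq> 0" "\<forall>a. p * (r * y a) = (\<Sum>k<n. d k * x k a)" using y(3) by (auto simp: V_def)
    show ?thesis by (rule VI[of _ "p * r" d]) (use y z in \<open>auto simp: mult.assoc\<close>)
  qed
  have V0: "(\<lambda>_. 0) \<in> V" by (rule VI[of _ 1 "\<lambda>_. 0"]) (auto simp: vecs_def)
  have V_sum: "(\<lambda>a. \<Sum>k\<in>K. f k a) \<in> V" if "finite K" "\<And>k. k \<in> K \<Longrightarrow> f k \<in> V" for K :: "nat set" and f
    using that by (induction K rule: finite_induct) (auto intro!: V0 V_add)
  have xk: "x k \<in> V" if k: "k < n" for k
  proof (rule VI[of _ 1 "\<lambda>j. if j = k then 1 else 0"])
    show "1 * x k a = (\<Sum>j<n. (if j = k then 1 else 0) * x j a)" for a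
      using k by (simp add: if_distrib[of "\<lambda>u. u * _"] cong: if_cong)
  qed (use xv in auto)
  have xSuc: "x (Suc k) \<in> V" if k: "k < n" for k using xk[of "Suc k"] xn k by (cases "Suc k = n") auto
  have Dx: "D (x k) = x (Suc k)" for k by (simp add: x_def)
  have V_D: "D y \<in> V" if yV: "y \<in> V" for y
  proof -
    obtain p d where y: "y \<in> vecs" "p \<noteq> 0" "\<forall>a. p * y a = (\<Sum>k<n. d k * x k a)" using yV by (auto simp: V_def)
    have "(\<lambda>a. p * y a) = (\<lambda>a. \<Sum>k<n. d k * x k a)" using y(3) by auto
    then have "D (\<lambda>a. p * y a) = (\<lambda>a. \<Sum>k<n. D (\<lambda>a. d k * x k a) a)" by (simp add: D_sum)
    \<comment> \<open>Differentiating \<open>p * y\<close> also produces a multiple of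
      \<open>y\<close>; moved to the other side, it lies in \<open>V\<close> already.\<close>
    then have e: "(\<lambda>a. p * D y a) = (\<lambda>a. (\<Sum>k<n. q * pderiv (d k) * x k a + d k * x (Suc k) a) + (- (q * pderiv p)) * y a)"
      by (auto simp: D_mult fun_eq_iff Dx algebra_simps)
    have "(\<lambda>a. q * pderiv (d k) * x k a + d k * x (Suc k) a) \<in> V" if "k \<in> {..<n}" for k
      using that by (intro V_add[OF V_mult[OF xk] V_mult[OF xSuc]]) auto
    from V_add[OF V_sum[OF finite_lessThan this] V_mult[OF yV]]
    have "(\<lambda>a. p * D y a) \<in> V" unfolding e .
    then show ?thesis by (rule V_cancel[OF dmodD(5)[OF dmod_vecs y(1)] y(2)])
  qed
  have "V \<subseteq> vecs" by (auto simp: V_def)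
  then have dm: "dmod V" unfolding dmod_def by (intro conjI ballI allI V0 V_add V_mult V_D)
  have n0: "n \<noteq> 0"
  proof
    assume "n = 0"
    then have "\<forall>a\<in>A. c 0 * P a = 0" "c 0 \<noteq> 0" using c cn by (auto simp: x_def)
    then have "P a = 0" for a using P(1) by (cases "a \<in> A") (auto simp: vecs_def)
    then show False using P(2) by auto
  qed
  have "rank_on A V = n"
  proof (rule antisym)
    obtain y \<Lambda> M m where y: "\<And>k. k < rank_on A V \<Longrightarrow> y k \<in> V" "indep_on {..<rank_on A V} A y" "\<Lambda> \<subseteq> A" "finite \<Lambda>"
      "card \<Lambda> = rank_on A V" "M \<noteq> 0" "\<And>y a. y \<in> V \<Longrightarrow> a \<in> A \<Longrightarrow> M * y a = (\<Sum>\<kappa>\<in>\<Lambda>. m a \<kappa> * y \<kappa>)"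
      using that by (rule rank_on_obtains[OF finA, of V])
    have "\<forall>k. \<exists>p d. k < rank_on A V \<longrightarrow> p \<noteq> 0 \<and> (\<forall>a. p * y k a = (\<Sum>j<n. d j * x j a))"
      using y(1) by (auto simp: V_def)
    then obtain p d where pd: "\<And>k. k < rank_on A V \<Longrightarrow> p k \<noteq> 0 \<and> (\<forall>a. p k * y k a = (\<Sum>j<n. d k j * x j a))"
      by metis
    show "rank_on A V \<le> n"
    proof (rule ccontr)
      assume "\<not> rank_on A V \<le> n"
      then obtain b where b: "\<exists>k\<in>{..<rank_on A V}. b k \<noteq> 0" "\<forall>j\<in>{..<n}. (\<Sum>k<rank_on A V. d k j * b k) = 0"
        using homogeneous_system_solvable[of "{..<n}" "{..<rank_on A V}" "\<lambda>j k. d k j"] by auto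
      have "(\<Sum>k<rank_on A V. (b k * p k) * y k a) = 0" for a
      proof -
        have "(\<Sum>k<rank_on A V. (b k * p k) * y k a) = (\<Sum>k<rank_on A V. b k * (\<Sum>j<n. d k j * x j a))"
          using pd by (intro sum.cong) (auto simp: mult.assoc)
        also have "\<dots> = (\<Sum>j<n. (\<Sum>k<rank_on A V. d k j * b k) * x j a)"
          unfolding sum_distrib_left sum_distrib_right by (subst sum.swap) (simp add: mult_ac)
        also have "\<dots> = 0" using b by simp
        finally show ?thesis .
      qed
      then have "b k * p k = 0" if "k < rank_on A V" for k using indep_onD[OF y(2), of "\<lambda>k. b k * p k"] that by auto
      then show False using b pd by auto
    qed
    show "n \<le> rank_on A V" by (rule indep_on_le_rank[OF finA _ n(1)]) (use xk in auto)
  qed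
  moreover have "(D ^^ j) P \<in> V" for j
    using dmod_funpow[OF dm xk[of 0]] n0 by (simp add: x_def)
  ultimately show thesis using that[of V n] dm n0 n(1) by (simp add: x_def)
qed

end

section \<open>Series solutions at a nonsingular point, and bounded generation of differential
  submodules\<close>

locale diff_module_at = diff_module A q D for A :: "'a set" and q D +
  fixes z0 :: rat
  assumes q_z0: "poly q z0 \<noteq> 0"
begin

text \<open>Flowing along the vector field \<open>q d/dz\<close> from \<open>z0\<close> turns \<open>D\<close> into the plain derivation of power series.\<close>

definition flow :: "rat poly \<Rightarrow> rat fps" where
  "flow p = Abs_fps (\<lambda>j. poly (((\<lambda>p. q * pderiv p) ^^ j) p) z0 / fact j)"

definition vflow :: "('a \<Rightarrow> rat poly) \<Rightarrow> 'a \<Rightarrow> rat fps" where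
  "vflow x a = Abs_fps (\<lambda>j. poly ((D ^^ j) x a) z0 / fact j)"

lemma flow_0: "flow p $ 0 = poly p z0" by (simp add: flow_def)
lemma vflow_0: "vflow x a $ 0 = poly (x a) z0" by (simp add: vflow_def)

lemma flow_deriv: "fps_deriv (flow p) = flow (q * pderiv p)"
  by (rule fps_ext) (simp add: flow_def funpow_Suc_right del: funpow.simps of_nat_Suc)

lemma vflow_deriv: "fps_deriv (vflow x a) = vflow (D x) a"
  by (rule fps_ext) (simp add: vflow_def funpow_Suc_right del: funpow.simps of_nat_Suc)

lemma flow_add: "flow (p + r) = flow p + flow r"
proof -
  have "((\<lambda>p. q * pderiv p) ^^ j) (p + r) = ((\<lambda>p. q * pderiv p) ^^ j) p + ((\<lambda>p. q * pderiv p) ^^ j) r" for j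
    by (induction j) (auto simp: pderiv_add algebra_simps)
  then show ?thesis by (intro fps_ext) (simp add: flow_def add_divide_distrib)
qed

lemma vflow_add: "vflow (\<lambda>a. x a + y a) b = vflow x b + vflow y b"
proof -
  have "(D ^^ j) (\<lambda>a. x a + y a) = (\<lambda>a. (D ^^ j) x a + (D ^^ j) y a)" for j
    by (induction j) (auto simp: D_add)
  then show ?thesis by (intro fps_ext) (simp add: vflow_def add_divide_distrib)
qed

lemma fps_eq_iff_deriv:
  fixes f g :: "rat fps"
  shows "f $ Suc n = g $ Suc n \<longleftrightarrow> fps_deriv f $ n = fps_deriv g $ n"
  by (simp add: of_nat_neq_0 del: of_nat_Suc)

text \<open>The constant terms agree, and the Leibniz rule expresses both derivatives by products of
  the same kind; so the coefficients agree by induction, for all factors simultaneously.\<close>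

lemma flow_mult: "flow (p * r) = flow p * flow r"
proof -
  have "flow (p * r) $ n = (flow p * flow r) $ n" for n
  proof (induction n arbitrary: p r)
    case 0
    then show ?case by (simp add: flow_0)
  next
    case (Suc n)
    have "q * pderiv (p * r) = (q * pderiv p) * r + p * (q * pderiv r)" by (simp add: pderiv_mult algebra_simps)
    then show ?case unfolding fps_eq_iff_deriv
      by (simp add: flow_deriv flow_add Suc.IH del: fps_deriv_nth)
  qed
  then show ?thesis by (intro fps_ext)
qed

lemma vflow_mult: "vflow (\<lambda>a. p * x a) b = flow p * vflow x b"
proof -
  have "vflow (\<lambda>a. p * x a) b $ n = (flow p * vflow x b) $ n" for n
  proof (induction n arbitrary: p x)
    case 0
    then show ?case by (simp add: flow_0 vflow_0)
  next
    case (Suc n)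
    then show ?case unfolding fps_eq_iff_deriv
      by (simp add: flow_deriv vflow_deriv D_mult vflow_add Suc.IH del: fps_deriv_nth)
  qed
  then show ?thesis by (intro fps_ext)
qed

lemma flow_zero [simp]: "flow 0 = 0" using flow_add[of 0 0] by simp

lemma flow_sum: "finite K \<Longrightarrow> flow (\<Sum>k\<in>K. f k) = (\<Sum>k\<in>K. flow (f k))"
  by (induction K rule: finite_induct) (simp_all add: flow_add)

lemma vflow_sum: "finite K \<Longrightarrow> vflow (\<lambda>a. \<Sum>k\<in>K. f k a) b = (\<Sum>k\<in>K. vflow (f k) b)"
proof (induction K rule: finite_induct)
  case empty
  show ?case using vflow_mult[of 0 "\<lambda>_. 0" b] by simp
qed (simp add: vflow_add)

lemma flow_const: "flow [:c:] = fps_const c"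
proof (rule fps_ext)
  fix n
  have "((\<lambda>p. q * pderiv p) ^^ n) [:c:] = (if n = 0 then [:c:] else 0)" by (induction n) (auto simp: pderiv_pCons)
  then show "flow [:c:] $ n = fps_const c $ n" by (simp add: flow_def)
qed

text \<open>Since \<open>q\<close> is nonzero at \<open>z0\<close>, the polynomial
  \<open>z - z0\<close> goes to a series with nonzero linear coefficient, and a polynomial not
  divisible by it goes to a series with nonzero constant term.\<close>

lemma flow_eq_0_iff [simp]: "flow p = 0 \<longleftrightarrow> p = 0"
proof
  assume f: "flow p = 0"
  show "p = 0"
  proof (rule ccontr)
    assume "p \<noteq> 0"
    then obtain r where r: "p = [:- z0, 1:] ^ order z0 p * r" "\<not> [:- z0, 1:] dvd r"
      using order_decomp by blast
    have "flow r $ 0 \<noteq> 0" using r(2) by (simp add: flow_0 poly_eq_0_iff_dvd)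
    then have "flow r \<noteq> 0" by auto
    moreover have "flow [:- z0, 1:] $ 1 \<noteq> 0" using q_z0 by (simp add: flow_def pderiv_pCons)
    then have "flow [:- z0, 1:] \<noteq> 0" by auto
    moreover have "flow (s ^ n) = flow s ^ n" for s n
      by (induction n) (simp_all add: flow_mult flow_const one_pCons)
    ultimately have "flow p \<noteq> 0" by (subst r(1)) (simp add: flow_mult)
    then show False using f by simp
  qed
qed simp

lemma vflow_expand: "x \<in> vecs \<Longrightarrow> vflow x a = (\<Sum>b\<in>A. flow (x b) * vflow (unit_vec b) a)"
proof -
  assume x: "x \<in> vecs"
  have "vflow x a = vflow (\<lambda>a. \<Sum>b\<in>A. x b * unit_vec b a) a" using vec_expand[OF x] by simp
  also have "\<dots> = (\<Sum>b\<in>A. flow (x b) * vflow (unit_vec b) a)" by (simp add: vflow_sum[OF finA] vflow_mult)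
  finally show ?thesis .
qed

text \<open>The matrix of the \<open>vflow (unit_vec b) a\<close> is the identity in degree 0, so
  the coefficients of the \<open>g b\<close> vanish one degree after the other.\<close>

lemma vflow_units_independent:
  assumes "\<And>a. a \<in> A \<Longrightarrow> (\<Sum>b\<in>A. g b * vflow (unit_vec b) a) = 0" "b \<in> A"
  shows "g b = 0"
proof -
  have "\<forall>b\<in>A. g b $ n = 0" for n
  proof (induction n rule: less_induct)
    case (less n)
    show ?case
    proof
      fix a assume a: "a \<in> A"
      have "0 = (\<Sum>b\<in>A. g b * vflow (unit_vec b) a) $ n" using assms(1)[OF a] by simp
      also have "\<dots> = (\<Sum>b\<in>A. \<Sum>i=0..n. g b $ i * vflow (unit_vec b) a $ (n - i))"
        by (simp add: fps_sum_nth fps_mult_nth)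
      also have "\<dots> = (\<Sum>b\<in>A. \<Sum>i=0..n. if i = n then g b $ n * vflow (unit_vec b) a $ 0 else 0)"
        using less by (intro sum.cong) auto
      also have "\<dots> = (\<Sum>b\<in>A. if b = a then g b $ n else 0)"
        by (intro sum.cong) (auto simp: vflow_0 unit_vec_def)
      also have "\<dots> = g a $ n" using a finA by simp
      finally show "g a $ n = 0" by simp
    qed
  qed
  then show ?thesis using assms(2) by (intro fps_ext) simp
qed

text \<open>A basis over the polynomials, embedded by \<open>flow\<close>, of the span of finitely
  many series, with one denominator. It serves to turn linear conditions on series into linear
  conditions on polynomials with fixed coefficients.\<close>

lemma flow_basis_exists:
  fixes u :: "'i \<Rightarrow> rat fps"
  assumes "finite I"
  shows "\<exists>T\<subseteq>I. \<exists>p r. p \<noteq> 0 \<and> (\<forall>i\<in>I. flow p * u i = (\<Sum>t\<in>T. flow (r i t) * u t)) \<and>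
     (\<forall>s. (\<Sum>t\<in>T. flow (s t) * u t) = 0 \<longrightarrow> (\<forall>t\<in>T. s t = 0))"
  using assms
proof (induction I rule: finite_induct)
  case empty
  then show ?case by (intro exI[of _ "{}"] conjI exI[of _ 1]) auto
next
  case (insert i I)
  then obtain T p r where T: "T \<subseteq> I" "p \<noteq> 0" "\<forall>i\<in>I. flow p * u i = (\<Sum>t\<in>T. flow (r i t) * u t)"
     "\<forall>s. (\<Sum>t\<in>T. flow (s t) * u t) = 0 \<longrightarrow> (\<forall>t\<in>T. s t = 0)" by auto
  have fT: "finite T" and iT: "i \<notin> T" using T(1) insert.hyps finite_subset by auto
  show ?case
  proof (cases "\<forall>s. (\<Sum>t\<in>insert i T. flow (s t) * u t) = 0 \<longrightarrow> (\<forall>t\<in>insert i T. s t = 0)")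
    case True
    define r' where "r' = (\<lambda>j t. if j = i then (if t = i then p else 0) else if t = i then 0 else r j t)"
    have "flow p * u j = (\<Sum>t\<in>insert i T. flow (r' j t) * u t)" if "j \<in> insert i I" for j
    proof (cases "j = i")
      case True
      have "(\<Sum>t\<in>T. flow (r' j t) * u t) = 0" using iT True by (intro sum.neutral) (auto simp: r'_def)
      then show ?thesis using fT iT True by (simp add: r'_def)
    next
      case False
      have "(\<Sum>t\<in>T. flow (r' j t) * u t) = (\<Sum>t\<in>T. flow (r j t) * u t)"
        using iT False by (intro sum.cong) (auto simp: r'_def)
      then show ?thesis using fT iT False T(3) that by (simp add: r'_def)
    qed
    with True T(1,2) show ?thesis by (intro exI[of _ "insert i T"] conjI exI[of _ p] exI[of _ r']) auto
  next
    case False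
    then obtain s where s: "(\<Sum>t\<in>insert i T. flow (s t) * u t) = 0" "\<exists>t\<in>insert i T. s t \<noteq> 0" by auto
    have si: "s i \<noteq> 0"
    proof
      assume "s i = 0"
      then show False using s T(4) fT iT by auto
    qed
    define r' where "r' = (\<lambda>j t. if j = i then - (p * s t) else s i * r j t)"
    have "flow (p * s i) * u j = (\<Sum>t\<in>T. flow (r' j t) * u t)" if "j \<in> insert i I" for j
    proof (cases "j = i")
      case True
      have fm: "flow (- x) = - flow x" for x using flow_add[of x "- x"] by (simp add: eq_neg_iff_add_eq_0 add.commute)
      have "flow (s i) * u i = - (\<Sum>t\<in>T. flow (s t) * u t)" using s(1) fT iT by (simp add: eq_neg_iff_add_eq_0)
      then show ?thesis using True by (simp add: r'_def flow_mult fm sum_negf sum_distrib_left mult.assoc)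
    next
      case False
      then have "flow p * u j = (\<Sum>t\<in>T. flow (r j t) * u t)" using T(3) that by auto
      then have "flow (s i) * (flow p * u j) = flow (s i) * (\<Sum>t\<in>T. flow (r j t) * u t)" by simp
      then show ?thesis using False by (simp add: r'_def flow_mult sum_distrib_left mult_ac)
    qed
    with T si show ?thesis by (intro exI[of _ T] conjI exI[of _ "p * s i"] exI[of _ r']) auto
  qed
qed

text \<open>Lifts of independent values are independent: in a relation every coefficient vanishes at
  \<open>z0\<close>, the factor \<open>z - z0\<close> cancels, and the argument repeats without end,
  which no nonzero polynomial allows.\<close>

lemma rank_of_values_le:
  assumes "dmod V"
  shows "rank_on A ((\<lambda>x a. poly (x a) z0) ` V) \<le> rank_on A V"
proof -
  define S where "S = (\<lambda>x a. poly (x a) z0) ` V"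
  obtain v \<Lambda> M m where v: "\<And>k. k < rank_on A S \<Longrightarrow> v k \<in> S" "indep_on {..<rank_on A S} A v" "\<Lambda> \<subseteq> A" "finite \<Lambda>"
    "card \<Lambda> = rank_on A S" "M \<noteq> 0" "\<And>y a. y \<in> S \<Longrightarrow> a \<in> A \<Longrightarrow> M * y a = (\<Sum>\<kappa>\<in>\<Lambda>. m a \<kappa> * y \<kappa>)"
    using that by (rule rank_on_obtains[OF finA, of S])
  define n where "n = rank_on A S"
  have "\<forall>k. \<exists>x. k < n \<longrightarrow> x \<in> V \<and> v k = (\<lambda>a. poly (x a) z0)" using v(1) by (auto simp: S_def n_def)
  from choice[OF this] obtain x where x: "\<And>k. k < n \<Longrightarrow> x k \<in> V" "\<And>k. k < n \<Longrightarrow> v k = (\<lambda>a. poly (x k a) z0)" by auto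
  have div: "\<forall>k<n. [:- z0, 1:] ^ N dvd c k" if "\<forall>a\<in>A. (\<Sum>k<n. c k * x k a) = 0" for N c
    using that
  proof (induction N arbitrary: c)
    case (Suc N)
    have "(\<Sum>k<n. poly (c k) z0 * v k a) = 0" if "a \<in> A" for a
    proof -
      have "(\<Sum>k<n. poly (c k) z0 * v k a) = poly (\<Sum>k<n. c k * x k a) z0" using x(2) by (simp add: poly_sum)
      then show ?thesis using Suc.prems that by simp
    qed
    then have "poly (c k) z0 = 0" if "k < n" for k
      using v(2) that indep_onD[of "{..<n}" A v "\<lambda>k. poly (c k) z0" k] by (auto simp: n_def)
    then have "\<forall>k. \<exists>d. k < n \<longrightarrow> c k = [:- z0, 1:] * d" by (auto simp: poly_eq_0_iff_dvd dvd_def)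
    from choice[OF this] obtain d where d: "\<And>k. k < n \<Longrightarrow> c k = [:- z0, 1:] * d k" by blast
    have "(\<Sum>k<n. d k * x k a) = 0" if "a \<in> A" for a
    proof -
      have "[:- z0, 1:] * (\<Sum>k<n. d k * x k a) = (\<Sum>k<n. c k * x k a)"
        unfolding sum_distrib_left by (intro sum.cong refl) (simp only: d lessThan_iff mult.assoc)
      also have "\<dots> = 0" using Suc.prems that by simp
      finally show ?thesis by (metis mult_eq_0_iff pCons_eq_0_iff zero_neq_one)
    qed
    then have "\<forall>k<n. [:- z0, 1:] ^ N dvd d k" using Suc.IH by auto
    then show ?case using d by (auto intro: mult_dvd_mono simp del: mult_pCons_left)
  qed simp
  have "indep_on {..<n} A x"
    unfolding indep_on_def
  proof (intro allI impI ballI)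
    fix c k assume c: "\<forall>a\<in>A. (\<Sum>k<n. c k * x k a) = 0" and k: "k \<in> {..<n}"
    show "c k = 0"
    proof (rule ccontr)
      assume nz: "c k \<noteq> 0"
      have "[:- z0, 1:] ^ Suc (degree (c k)) dvd c k" by (rule div[OF c, rule_format]) (use k in auto)
      then have "degree ([:- z0, 1:] ^ Suc (degree (c k))) \<le> degree (c k)" using nz by (rule dvd_imp_degree_le)
      then show False unfolding degree_linear_power by simp
    qed
  qed
  then show ?thesis using indep_on_le_rank[OF finA, of n x V] x(1) by (simp add: n_def S_def)
qed

text \<open>Near \<open>z0\<close> a differential submodule is described by constant-coefficient
  conditions on the solution vectors \<open>vflow x\<close>. In terms of a polynomial basis of the
  finitely many series \<open>vflow (unit_vec b) a\<close>, the conditions become polynomial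
  equations. The submodule enters them only through rational constants, so their degrees do not
  depend on it.\<close>

theorem bounded_generation:
  "\<exists>c. \<forall>V. dmod V \<longrightarrow> (\<exists>Z. dmod Z \<and> V \<subseteq> Z \<and> rank_on A Z = rank_on A V \<and>
     rank_on A {x\<in>Z. \<forall>a. degree (x a) \<le> c} = rank_on A Z)"
proof -
  define u where "u = (\<lambda>(b, a). vflow (unit_vec b) a)"
  obtain T p r where T: "T \<subseteq> A \<times> A" "p \<noteq> 0" "\<forall>i\<in>A \<times> A. flow p * u i = (\<Sum>t\<in>T. flow (r i t) * u t)"
     "\<forall>s. (\<Sum>t\<in>T. flow (s t) * u t) = 0 \<longrightarrow> (\<forall>t\<in>T. s t = 0)"
    using flow_basis_exists[of "A \<times> A" u] finA by auto
  have fT: "finite T" using T(1) finA finite_subset by auto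
  define c where "c = Max (insert 0 ((\<lambda>(i, t). degree (r i t)) ` ((A \<times> A) \<times> T)))"
  have c: "degree (r i t) \<le> c" if "i \<in> A \<times> A" "t \<in> T" for i t
    unfolding c_def using that finA fT by (intro Max_ge) auto
  have "\<exists>Z. dmod Z \<and> V \<subseteq> Z \<and> rank_on A Z = rank_on A V \<and> rank_on A {x\<in>Z. \<forall>a. degree (x a) \<le> card A * c} = rank_on A Z"
    if V: "dmod V" for V
  proof -
    define S where "S = (\<lambda>x a. poly (x a) z0) ` V"
    obtain v \<Lambda> M m where v: "\<And>k. k < rank_on A S \<Longrightarrow> v k \<in> S" "indep_on {..<rank_on A S} A v" "\<Lambda> \<subseteq> A" "finite \<Lambda>"
      "card \<Lambda> = rank_on A S" "M \<noteq> 0" "\<And>y a. y \<in> S \<Longrightarrow> a \<in> A \<Longrightarrow> M * y a = (\<Sum>\<kappa>\<in>\<Lambda>. m a \<kappa> * y \<kappa>)"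
      using that by (rule rank_on_obtains[OF finA, of S])
    \<comment> \<open>The relations between coordinates that hold for all values at
      \<open>z0\<close> of elements of \<open>V\<close>, now imposed on the whole series.\<close>
    define rel where "rel = (\<lambda>x a. fps_const M * vflow x a - (\<Sum>\<kappa>\<in>\<Lambda>. fps_const (m a \<kappa>) * vflow x \<kappa>))"
    define Z where "Z = {x\<in>vecs. \<forall>a\<in>A. rel x a = 0}"
    have rel_add: "rel (\<lambda>a. x a + y a) a = rel x a + rel y a" for x y a
      by (simp add: rel_def vflow_add algebra_simps sum.distrib)
    have rel_mult: "rel (\<lambda>a. s * x a) a = flow s * rel x a" for s x a
      by (simp add: rel_def vflow_mult algebra_simps sum_distrib_left)
    have rel_D: "rel (D x) a = fps_deriv (rel x a)" for x a
      by (simp add: rel_def vflow_deriv fps_deriv_sum)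
    have "rel (\<lambda>_. 0) a = 0" for a using rel_mult[of 0 "\<lambda>_. 0" a] by simp
    then have dZ: "dmod Z"
      unfolding dmod_def Z_def using dmodD[OF dmod_vecs] by (auto simp: rel_add rel_mult rel_D)
    \<comment> \<open>The coefficients of \<open>vflow x\<close> are values at \<open>z0\<close> of
      iterated derivatives of \<open>x\<close>, which remain in \<open>V\<close>.\<close>
    have VZ: "V \<subseteq> Z"
    proof
      fix x assume x: "x \<in> V"
      have "rel x a = 0" if a: "a \<in> A" for a
      proof (rule fps_ext)
        fix j
        have "(\<lambda>a. poly ((D ^^ j) x a) z0) \<in> S" using dmod_funpow[OF V x] by (auto simp: S_def)
        from v(7)[OF this a] show "rel x a $ j = 0 $ j"
          by (simp add: rel_def vflow_def fps_sum_nth sum_divide_distrib[symmetric] diff_divide_distrib[symmetric])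
      qed
      then show "x \<in> Z" using x dmodD(1)[OF V] by (auto simp: Z_def)
    qed
    have "rank_on A Z \<le> card \<Lambda>"
    proof -
      obtain d J M' m' where d: "\<And>k. k < rank_on A Z \<Longrightarrow> d k \<in> Z" "indep_on {..<rank_on A Z} A d" "J \<subseteq> A" "finite J"
        "card J = rank_on A Z" "M' \<noteq> 0" "\<And>y a. y \<in> Z \<Longrightarrow> a \<in> A \<Longrightarrow> M' * y a = (\<Sum>\<kappa>\<in>J. m' a \<kappa> * y \<kappa>)"
        using that by (rule rank_on_obtains[OF finA, of Z])
      define n where "n = rank_on A Z"
      show ?thesis
      proof (rule ccontr)
        assume "\<not> ?thesis"
        \<comment> \<open>More than \<open>card \<Lambda>\<close> elements of \<open>Z\<close> are
          dependent over the power series on \<open>\<Lambda>\<close>, hence on \<open>A\<close>.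
          Invertibility of the solution matrix carries this back to the polynomial vectors, where a
          dual vector isolates one nonzero coefficient.\<close>
        then obtain b where b: "\<exists>k\<in>{..<n}. b k \<noteq> 0" "\<forall>a\<in>\<Lambda>. (\<Sum>k<n. vflow (d k) a * b k) = 0"
          using homogeneous_system_solvable[of \<Lambda> "{..<n}" "\<lambda>a k. vflow (d k) a"] v(4) by (auto simp: n_def)
        have all: "(\<Sum>k<n. b k * vflow (d k) a) = 0" if a: "a \<in> A" for a
        proof -
          have "fps_const M * (\<Sum>k<n. b k * vflow (d k) a) = (\<Sum>k<n. b k * (fps_const M * vflow (d k) a))"
            by (simp add: sum_distrib_left mult_ac)
          also have "\<dots> = (\<Sum>k<n. b k * (\<Sum>\<kappa>\<in>\<Lambda>. fps_const (m a \<kappa>) * vflow (d k) \<kappa>))"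
            using d(1) a by (intro sum.cong) (auto simp: Z_def rel_def n_def)
          also have "\<dots> = (\<Sum>\<kappa>\<in>\<Lambda>. fps_const (m a \<kappa>) * (\<Sum>k<n. vflow (d k) \<kappa> * b k))"
            unfolding sum_distrib_left by (subst sum.swap) (simp add: mult_ac)
          also have "\<dots> = 0" using b(2) by simp
          finally show ?thesis using v(6) by simp
        qed
        define g where "g = (\<lambda>b'. \<Sum>k<n. b k * flow (d k b'))"
        have g0: "g b' = 0" if "b' \<in> A" for b'
        proof (rule vflow_units_independent[OF _ that])
          fix a assume a: "a \<in> A"
          have "(\<Sum>b'\<in>A. g b' * vflow (unit_vec b') a) = (\<Sum>k<n. b k * (\<Sum>b'\<in>A. flow (d k b') * vflow (unit_vec b') a))"
            unfolding g_def sum_distrib_left sum_distrib_right by (subst sum.swap) (simp add: mult_ac)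
          also have "\<dots> = (\<Sum>k<n. b k * vflow (d k) a)"
            using d(1) by (intro sum.cong refl arg_cong2[where f="(*)"] vflow_expand[symmetric]) (auto simp: Z_def n_def)
          finally show "(\<Sum>b'\<in>A. g b' * vflow (unit_vec b') a) = 0" using all[OF a] by simp
        qed
        obtain k0 where k0: "k0 < n" "b k0 \<noteq> 0" using b(1) by auto
        obtain w where w: "\<And>a. a \<in> A \<Longrightarrow> True" "(\<Sum>a\<in>A. w a * d k0 a) \<noteq> 0"
           "\<And>k. k < n \<Longrightarrow> k \<noteq> k0 \<Longrightarrow> (\<Sum>a\<in>A. w a * d k a) = 0"
          using dual_vector_exists[OF finA d(2)[folded n_def], of "\<lambda>_. True" k0] k0(1) by auto
        have "0 = (\<Sum>a\<in>A. flow (w a) * g a)" using g0 by simp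
        also have "\<dots> = (\<Sum>k<n. b k * flow (\<Sum>a\<in>A. w a * d k a))"
          unfolding g_def flow_sum[OF finA] flow_mult sum_distrib_left by (subst sum.swap) (simp add: mult_ac)
        also have "\<dots> = (\<Sum>k<n. if k = k0 then b k0 * flow (\<Sum>a\<in>A. w a * d k0 a) else 0)"
          using w(3) by (intro sum.cong) auto
        also have "\<dots> = b k0 * flow (\<Sum>a\<in>A. w a * d k0 a)" using k0 by simp
        finally show False using w(2) k0(2) by simp
      qed
    qed
    also have "card \<Lambda> \<le> rank_on A V" using v(5) rank_of_values_le[OF V] by (simp add: S_def)
    finally have rZ: "rank_on A Z = rank_on A V" using rank_on_mono[OF finA VZ] by simp
    \<comment> \<open>Only the constants \<open>M\<close> and \<open>m\<close> depend on
      \<open>V\<close>; the degrees are those of the fixed coefficients \<open>r\<close>.\<close>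
    define w where "w = (\<lambda>a t b. smult M (r (b, a) t) - (\<Sum>\<kappa>\<in>\<Lambda>. smult (m a \<kappa>) (r (b, \<kappa>) t)))"
    define Om where "Om = {w a t |a t. a \<in> A \<and> t \<in> T}"
    have degw: "degree (w' b) \<le> c" if w': "w' \<in> Om" and b: "b \<in> A" for w' b
    proof -
      obtain a t where at: "w' = w a t" "a \<in> A" "t \<in> T" using w' by (auto simp: Om_def)
      have "degree (\<Sum>\<kappa>\<in>\<Lambda>. smult (m a \<kappa>) (r (b, \<kappa>) t)) \<le> c"
        using v(3,4) b at by (intro degree_sum_le order.trans[OF degree_smult_le] c) auto
      moreover have "degree (smult M (r (b, a) t)) \<le> c"
        using b at by (intro order.trans[OF degree_smult_le] c) auto
      ultimately show ?thesis unfolding at(1) w_def by (intro degree_diff_le)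
    qed
    have rel_w: "flow p * rel x a = (\<Sum>t\<in>T. flow (\<Sum>b\<in>A. x b * w a t b) * u t)" if x: "x \<in> vecs" and a: "a \<in> A" for x a
    proof -
      have e: "flow p * vflow x a = (\<Sum>t\<in>T. \<Sum>b\<in>A. flow (x b * r (b, a) t) * u t)" if "a \<in> A" for a
      proof -
        have "flow p * vflow x a = (\<Sum>b\<in>A. flow (x b) * (flow p * u (b, a)))"
          by (subst vflow_expand[OF x]) (simp add: sum_distrib_left mult_ac u_def)
        also have "\<dots> = (\<Sum>b\<in>A. flow (x b) * (\<Sum>t\<in>T. flow (r (b, a) t) * u t))"
          using T(3) that by (intro sum.cong) auto
        also have "\<dots> = (\<Sum>t\<in>T. \<Sum>b\<in>A. flow (x b * r (b, a) t) * u t)"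
          unfolding sum_distrib_left flow_mult by (subst sum.swap) (simp add: mult_ac)
        finally show ?thesis .
      qed
      have fs: "flow (smult k s) = fps_const k * flow s" for k s
        using flow_mult[of "[:k:]" s] by (simp add: flow_const)
      have fd: "flow (s - s') = flow s - flow s'" for s s' using flow_add[of "s - s'" s'] by (simp add: algebra_simps)
      have fin: "finite \<Lambda>" by (rule v(4))
      have "flow (\<Sum>b\<in>A. x b * w a t b) = fps_const M * (\<Sum>b\<in>A. flow (x b * r (b, a) t))
          - (\<Sum>\<kappa>\<in>\<Lambda>. fps_const (m a \<kappa>) * (\<Sum>b\<in>A. flow (x b * r (b, \<kappa>) t)))" for t
      proof -
        have "flow (\<Sum>b\<in>A. x b * w a t b) = (\<Sum>b\<in>A. fps_const M * flow (x b * r (b, a) t)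
            - (\<Sum>\<kappa>\<in>\<Lambda>. fps_const (m a \<kappa>) * flow (x b * r (b, \<kappa>) t)))"
          by (simp add: flow_sum[OF finA] w_def flow_mult fd fs flow_sum[OF fin] right_diff_distrib sum_distrib_left mult_ac)
        also have "\<dots> = (\<Sum>b\<in>A. fps_const M * flow (x b * r (b, a) t))
            - (\<Sum>\<kappa>\<in>\<Lambda>. \<Sum>b\<in>A. fps_const (m a \<kappa>) * flow (x b * r (b, \<kappa>) t))"
          unfolding sum_subtractf by (subst (2) sum.swap) simp
        finally show ?thesis by (simp add: sum_distrib_left)
      qed
      note e1 = this
      have "flow p * rel x a = fps_const M * (flow p * vflow x a) - (\<Sum>\<kappa>\<in>\<Lambda>. fps_const (m a \<kappa>) * (flow p * vflow x \<kappa>))"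
        by (simp add: rel_def right_diff_distrib sum_distrib_left mult_ac)
      also have "(\<Sum>\<kappa>\<in>\<Lambda>. fps_const (m a \<kappa>) * (flow p * vflow x \<kappa>)) =
          (\<Sum>\<kappa>\<in>\<Lambda>. fps_const (m a \<kappa>) * (\<Sum>t\<in>T. \<Sum>b\<in>A. flow (x b * r (b, \<kappa>) t) * u t))"
        using v(3) by (intro sum.cong refl arg_cong2[where f="(*)"] e) auto
      also have "\<dots> = (\<Sum>t\<in>T. (\<Sum>\<kappa>\<in>\<Lambda>. fps_const (m a \<kappa>) * (\<Sum>b\<in>A. flow (x b * r (b, \<kappa>) t))) * u t)"
        unfolding sum_distrib_left sum_distrib_right by (subst sum.swap) (simp add: mult_ac)
      also have "flow p * vflow x a = (\<Sum>t\<in>T. (\<Sum>b\<in>A. flow (x b * r (b, a) t)) * u t)"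
        by (simp add: e[OF a] sum_distrib_right)
      also have "fps_const M * \<dots> - (\<Sum>t\<in>T. (\<Sum>\<kappa>\<in>\<Lambda>. fps_const (m a \<kappa>) * (\<Sum>b\<in>A. flow (x b * r (b, \<kappa>) t))) * u t)
         = (\<Sum>t\<in>T. flow (\<Sum>b\<in>A. x b * w a t b) * u t)"
        unfolding e1 left_diff_distrib sum_subtractf by (subst sum_distrib_left) (simp only: mult.assoc)
      finally show ?thesis .
    qed
    have "rel x a = 0 \<longleftrightarrow> (\<forall>t\<in>T. (\<Sum>b\<in>A. x b * w a t b) = 0)" if x: "x \<in> vecs" and a: "a \<in> A" for x a
    proof
      assume "rel x a = 0"
      then have "(\<Sum>t\<in>T. flow (\<Sum>b\<in>A. x b * w a t b) * u t) = 0" using rel_w[OF x a] by simp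
      then show "\<forall>t\<in>T. (\<Sum>b\<in>A. x b * w a t b) = 0" using T(4)[rule_format, of "\<lambda>t. \<Sum>b\<in>A. x b * w a t b"] by auto
    next
      assume "\<forall>t\<in>T. (\<Sum>b\<in>A. x b * w a t b) = 0"
      then have "flow p * rel x a = 0" unfolding rel_w[OF x a] by simp
      then show "rel x a = 0" using T(2) by simp
    qed
    note rel_iff = this
    have Om_all: "(\<forall>w'\<in>Om. Q w') \<longleftrightarrow> (\<forall>a\<in>A. \<forall>t\<in>T. Q (w a t))" for Q unfolding Om_def by blast
    have "Z = {x. (\<forall>a. a \<notin> A \<longrightarrow> x a = 0) \<and> (\<forall>w\<in>Om. (\<Sum>b\<in>A. x b * w b) = 0)}"
    proof (rule set_eqI)
      fix x
      have "x \<in> Z \<longleftrightarrow> x \<in> vecs \<and> (\<forall>a\<in>A. \<forall>t\<in>T. (\<Sum>b\<in>A. x b * w a t b) = 0)"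
        using rel_iff by (auto simp: Z_def)
      then show "x \<in> Z \<longleftrightarrow> x \<in> {x. (\<forall>a. a \<notin> A \<longrightarrow> x a = 0) \<and> (\<forall>w\<in>Om. (\<Sum>b\<in>A. x b * w b) = 0)}"
        unfolding Om_all vecs_def by simp
    qed
    then have "rank_on A {x\<in>Z. \<forall>a. degree (x a) \<le> card A * c} = rank_on A Z"
      using kernel_bounded_generation[OF finA, of Om c] degw by simp
    then show ?thesis using dZ VZ rZ by auto
  qed
  then show ?thesis by blast
qed

end

section \<open>Zero estimates\<close>

text \<open>Rank is insensitive to denominators: the coordinate relations of \<open>T\<close> hold
  on \<open>S\<close> as well, so the pivots of \<open>T\<close> determine the span of
  \<open>S\<close>.\<close>

lemma rank_on_le_of_multiples:
  fixes S T :: "('a \<Rightarrow> 'r::idom) set"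
  assumes "finite A"
    and mult: "\<And>y. y \<in> S \<Longrightarrow> \<exists>p (n::nat) c x. p \<noteq> 0 \<and> (\<forall>k<n. x k \<in> T) \<and> (\<forall>a\<in>A. p * y a = (\<Sum>k<n. c k * x k a))"
  shows "rank_on A S \<le> rank_on A T"
proof -
  obtain y \<Lambda>' M' m' where y: "\<And>k. k < rank_on A S \<Longrightarrow> y k \<in> S" "indep_on {..<rank_on A S} A y" "\<Lambda>' \<subseteq> A" "finite \<Lambda>'"
    "card \<Lambda>' = rank_on A S" "M' \<noteq> 0" "\<And>y a. y \<in> S \<Longrightarrow> a \<in> A \<Longrightarrow> M' * y a = (\<Sum>\<kappa>\<in>\<Lambda>'. m' a \<kappa> * y \<kappa>)"
    using that by (rule rank_on_obtains[OF assms(1), of S])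
  obtain x \<Lambda> M m where x: "\<And>k. k < rank_on A T \<Longrightarrow> x k \<in> T" "indep_on {..<rank_on A T} A x" "\<Lambda> \<subseteq> A" "finite \<Lambda>"
    "card \<Lambda> = rank_on A T" "M \<noteq> 0" "\<And>y a. y \<in> T \<Longrightarrow> a \<in> A \<Longrightarrow> M * y a = (\<Sum>\<kappa>\<in>\<Lambda>. m a \<kappa> * y \<kappa>)"
    using that by (rule rank_on_obtains[OF assms(1), of T])
  have rel: "M * z a = (\<Sum>\<kappa>\<in>\<Lambda>. m a \<kappa> * z \<kappa>)" if z: "z \<in> S" and a: "a \<in> A" for z a
  proof -
    obtain p n c t where p: "p \<noteq> 0" "\<forall>k<(n::nat). t k \<in> T" "\<forall>a\<in>A. p * z a = (\<Sum>k<n. c k * t k a)"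
      using mult[OF z] by auto
    have "p * (M * z a) = (\<Sum>k<n. c k * (M * t k a))" using p(3) a by (simp add: mult.left_commute sum_distrib_left)
    also have "\<dots> = (\<Sum>k<n. c k * (\<Sum>\<kappa>\<in>\<Lambda>. m a \<kappa> * t k \<kappa>))" using x(7) p(2) a by (intro sum.cong) auto
    also have "\<dots> = (\<Sum>\<kappa>\<in>\<Lambda>. m a \<kappa> * (\<Sum>k<n. c k * t k \<kappa>))"
      unfolding sum_distrib_left by (subst sum.swap) (simp add: mult_ac)
    also have "\<dots> = (\<Sum>\<kappa>\<in>\<Lambda>. m a \<kappa> * (p * z \<kappa>))" using p(3) x(3) by (intro sum.cong) auto
    also have "\<dots> = p * (\<Sum>\<kappa>\<in>\<Lambda>. m a \<kappa> * z \<kappa>)" by (simp add: sum_distrib_left mult_ac)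
    finally show ?thesis using p(1) by simp
  qed
  have "card {..<rank_on A S} \<le> card \<Lambda>"
  proof (rule indep_on_card_le[OF _ x(4) y(2)])
    fix c assume c: "\<forall>a\<in>\<Lambda>. (\<Sum>k<rank_on A S. c k * y k a) = 0"
    show "\<forall>a\<in>A. (\<Sum>k<rank_on A S. c k * y k a) = 0"
    proof
      fix a assume a: "a \<in> A"
      have "M * (\<Sum>k<rank_on A S. c k * y k a) = (\<Sum>k<rank_on A S. c k * (M * y k a))"
        by (simp add: sum_distrib_left mult_ac)
      also have "\<dots> = (\<Sum>k<rank_on A S. c k * (\<Sum>\<kappa>\<in>\<Lambda>. m a \<kappa> * y k \<kappa>))"
        using rel y(1) a by (intro sum.cong) auto
      also have "\<dots> = (\<Sum>\<kappa>\<in>\<Lambda>. m a \<kappa> * (\<Sum>k<rank_on A S. c k * y k \<kappa>))"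
        unfolding sum_distrib_left by (subst sum.swap) (simp add: mult_ac)
      also have "\<dots> = 0" using c by simp
      finally show "(\<Sum>k<rank_on A S. c k * y k a) = 0" using x(6) by simp
    qed
  qed auto
  then show ?thesis using x(5) by simp
qed

lemma fps_of_poly_eq_0_if_dvd:
  fixes p :: "'a::comm_ring_1 poly"
  assumes "fps_X ^ k dvd fps_of_poly p" "\<And>i. k \<le> i \<Longrightarrow> coeff p i = 0"
  shows "p = 0"
proof (rule poly_eqI)
  fix i
  have "fps_of_poly p $ i = 0" if "i < k" using assms(1) that unfolding fps_X_power_dvd_iff by blast
  then show "coeff p i = coeff 0 i" using assms(2) by (cases "i < k") auto
qed

text \<open>Taylor expansion \<open>p(1 + X)\<close>, with real coefficients because it is combined
  with real Taylor series.\<close>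

definition shift_poly :: "rat poly \<Rightarrow> real fps" where
  "shift_poly p = fps_of_poly (pcompose (map_poly of_rat p) [:1, 1:])"

lemma map_poly_of_rat_add: "map_poly (of_rat :: rat \<Rightarrow> real) (p + r) = map_poly of_rat p + map_poly of_rat r"
  by (intro poly_eqI) (simp add: coeff_map_poly of_rat_add)

lemma map_poly_of_rat_mult: "map_poly (of_rat :: rat \<Rightarrow> real) (p * r) = map_poly of_rat p * map_poly of_rat r"
  by (intro poly_eqI) (simp add: coeff_map_poly coeff_mult of_rat_sum of_rat_mult)

lemma shift_poly_add: "shift_poly (p + r) = shift_poly p + shift_poly r"
  by (simp add: shift_poly_def map_poly_of_rat_add pcompose_add fps_of_poly_add)

lemma shift_poly_mult: "shift_poly (p * r) = shift_poly p * shift_poly r"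
  by (simp add: shift_poly_def map_poly_of_rat_mult pcompose_mult fps_of_poly_mult)

lemma shift_poly_0 [simp]: "shift_poly 0 = 0" by (simp add: shift_poly_def)

lemma shift_poly_sum: "shift_poly (sum f K) = (\<Sum>k\<in>K. shift_poly (f k))"
  by (induction K rule: infinite_finite_induct) (simp_all add: shift_poly_add)

lemma shift_poly_nth_0: "shift_poly p $ 0 = of_rat (poly p 1)"
proof -
  have "shift_poly p $ 0 = poly (map_poly of_rat p) (1::real)"
    by (simp add: shift_poly_def poly_0_coeff_0[symmetric] poly_pcompose)
  also have "\<dots> = of_rat (poly p 1)" by (simp add: poly_altdef of_rat_sum coeff_map_poly degree_map_poly)
  finally show ?thesis .
qed

lemma shift_poly_eq_0_if_dvd:
  assumes "fps_X ^ k dvd shift_poly p" "\<And>i. k \<le> i \<Longrightarrow> coeff p i = 0"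
  shows "p = 0"
proof (cases "k = 0")
  case True then show ?thesis using assms by (intro poly_eqI) auto
next
  case False
  define P where "P = pcompose (map_poly (of_rat :: rat \<Rightarrow> real) p) [:1, 1:]"
  have "degree p < k" using assms(2) False
    by (metis le_degree leading_coeff_0_iff linorder_not_less degree_0 neq0_conv)
  then have "degree P < k" by (simp add: P_def degree_map_poly degree_pcompose)
  then have "P = 0" using assms(1) by (intro fps_of_poly_eq_0_if_dvd[of k]) (auto simp: P_def shift_poly_def coeff_eq_0)
  then have "map_poly (of_rat :: rat \<Rightarrow> real) p = 0" unfolding P_def by (subst (asm) pcompose_eq_0_iff) auto
  then show ?thesis by (intro poly_eqI) (metis coeff_0 coeff_map_poly of_rat_0 of_rat_eq_0_iff)
qed

text \<open>\<open>G\<close> is the matrix sending a vector of polynomials to its remainders at 0,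
  indexed by \<open>L\<close>. That \<open>D\<close> does not lower the order of the remainders will
  come from a vector field vanishing at 0.\<close>

locale pade = diff_module_at A q D z0 for A :: "'a set" and q D z0 +
  fixes L :: "'l set" and G :: "'l \<Rightarrow> 'a \<Rightarrow> rat fps"
  assumes finL: "finite L"
    and ord_D: "\<And>s x. x \<in> vecs \<Longrightarrow> \<forall>l\<in>L. fps_X ^ s dvd (\<Sum>a\<in>A. G l a * fps_of_poly (x a)) \<Longrightarrow>
          \<forall>l\<in>L. fps_X ^ s dvd (\<Sum>a\<in>A. G l a * fps_of_poly (D x a))"
begin

definition remd :: "('a \<Rightarrow> rat poly) \<Rightarrow> 'l \<Rightarrow> rat fps" where
  "remd x l = (\<Sum>a\<in>A. G l a * fps_of_poly (x a))"

definition remrank :: "('a \<Rightarrow> rat poly) set \<Rightarrow> nat" where "remrank V = rank_on L (remd ` V)"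

lemma remd_add: "remd (\<lambda>a. x a + y a) l = remd x l + remd y l"
  by (simp add: remd_def fps_of_poly_add algebra_simps sum.distrib)

lemma remd_mult: "remd (\<lambda>a. p * x a) l = fps_of_poly p * remd x l"
  by (simp add: remd_def fps_of_poly_mult sum_distrib_left mult_ac)

lemma remd_sum: "finite K \<Longrightarrow> remd (\<lambda>a. \<Sum>k\<in>K. f k a) l = (\<Sum>k\<in>K. remd (f k) l)"
  by (induction K rule: finite_induct) (simp_all add: remd_add, simp add: remd_def)

lemma ord_funpow:
  assumes "x \<in> vecs" "\<forall>l\<in>L. fps_X ^ s dvd remd x l"
  shows "\<forall>l\<in>L. fps_X ^ s dvd remd ((D ^^ j) x) l"
proof (induction j)
  case (Suc j)
  then show ?case using ord_D[OF funpow_in_vecs[OF assms(1), of j], of s] by (simp add: remd_def)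
qed (use assms in simp)

lemma degree_D_bound: "\<exists>d. \<forall>x n. x \<in> vecs \<longrightarrow> (\<forall>a. degree (x a) \<le> n) \<longrightarrow> (\<forall>a. degree (D x a) \<le> n + d)"
proof -
  define d where "d = Max (insert (degree q) ((\<lambda>(b, a). degree (D (unit_vec b) a)) ` (A \<times> A)))"
  have d1: "degree q \<le> d" unfolding d_def using finA by (intro Max_ge) auto
  have d2: "degree (D (unit_vec b) a) \<le> d" if "b \<in> A" "a \<in> A" for a b
    unfolding d_def using finA that by (intro Max_ge) auto
  have "degree (D x a) \<le> n + d" if x: "x \<in> vecs" "\<forall>a. degree (x a) \<le> n" for x n a
  proof (cases "a \<in> A")
    case True
    have "degree (q * pderiv (x a)) \<le> n + d"
      using degree_mult_le[of q "pderiv (x a)"] d1 x(2)[rule_format, of a] degree_pderiv[of "x a"] by linarith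
    moreover have "degree (x b * D (unit_vec b) a) \<le> n + d" if "b \<in> A" for b
      using degree_mult_le[of "x b" "D (unit_vec b) a"] d2[OF that True] x(2)[rule_format, of b] by linarith
    then have "degree (\<Sum>b\<in>A. x b * D (unit_vec b) a) \<le> n + d" using finA by (intro degree_sum_le) auto
    ultimately show ?thesis unfolding D_expand[OF x(1) True] by (intro degree_add_le)
  next
    case False
    then have "D x a = 0" using dmodD(5)[OF dmod_vecs x(1)] by (auto simp: vecs_def)
    then show ?thesis by simp
  qed
  then show ?thesis by blast
qed

lemma degree_funpow_bound:
  assumes "\<forall>x n. x \<in> vecs \<longrightarrow> (\<forall>a. degree (x a) \<le> n) \<longrightarrow> (\<forall>a. degree (D x a) \<le> n + d)"
    "x \<in> vecs" "\<forall>a. degree (x a) \<le> n"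
  shows "\<forall>a. degree ((D ^^ j) x a) \<le> n + j * d"
proof (induction j)
  case (Suc j)
  have "\<forall>a. degree (D ((D ^^ j) x) a) \<le> (n + j * d) + d"
    using assms(1) Suc funpow_in_vecs[OF assms(2)] by blast
  then show ?case by (simp add: algebra_simps)
qed (use assms in simp)

text \<open>An element of \<open>V\<close> is determined by its entries at
  \<open>rank_on A V\<close> pivots, each of which has \<open>N + 1\<close> coefficients.\<close>

lemma rational_dimension_le:
  fixes y :: "'u \<Rightarrow> 'a \<Rightarrow> rat poly"
  assumes "finite U" "\<And>u. u \<in> U \<Longrightarrow> y u \<in> V" "\<And>u a. u \<in> U \<Longrightarrow> degree (y u a) \<le> N" "dmod V"
    and ind: "\<And>c. \<forall>a\<in>A. (\<Sum>u\<in>U. smult (c u) (y u a)) = 0 \<Longrightarrow> \<forall>u\<in>U. c u = 0"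
  shows "card U \<le> rank_on A V * (N + 1)"
proof (rule ccontr)
  assume neg: "\<not> ?thesis"
  obtain d J M m where d: "\<And>k. k < rank_on A V \<Longrightarrow> d k \<in> V" "indep_on {..<rank_on A V} A d" "J \<subseteq> A" "finite J"
    "card J = rank_on A V" "M \<noteq> 0" "\<And>y a. y \<in> V \<Longrightarrow> a \<in> A \<Longrightarrow> M * y a = (\<Sum>\<kappa>\<in>J. m a \<kappa> * y \<kappa>)"
    using that by (rule rank_on_obtains[OF finA, of V])
  have "card (J \<times> {..N}) < card U" using neg d(5) by (simp add: card_cartesian_product)
  then obtain c where c: "\<exists>u\<in>U. c u \<noteq> 0" "\<forall>e\<in>J \<times> {..N}. (\<Sum>u\<in>U. (case e of (a, i) \<Rightarrow> coeff (y u a) i) * c u) = 0"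
    using homogeneous_system_solvable[of "J \<times> {..N}" U "\<lambda>e u. case e of (a, i) \<Rightarrow> coeff (y u a) i"] assms(1) d(4) by auto
  define x where "x = (\<lambda>a. \<Sum>u\<in>U. [:c u:] * y u a)"
  have xV: "x \<in> V" unfolding x_def by (rule dmod_sum[OF assms(4,1,2)])
  have xJ: "x a = 0" if "a \<in> J" for a
  proof (rule poly_eqI)
    fix i
    have "coeff (x a) i = (\<Sum>u\<in>U. coeff (y u a) i * c u)" by (simp add: x_def coeff_sum mult.commute)
    also have "\<dots> = 0"
    proof (cases "i \<le> N")
      case True then show ?thesis using c(2) that by auto
    next
      case False
      then have "coeff (y u a) i = 0" if "u \<in> U" for u using assms(3)[OF that, of a] by (intro coeff_eq_0) simp
      then show ?thesis by simp
    qed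
    finally show "coeff (x a) i = coeff 0 i" by simp
  qed
  have "x a = 0" if "a \<in> A" for a
  proof -
    have "M * x a = (\<Sum>\<kappa>\<in>J. m a \<kappa> * x \<kappa>)" by (rule d(7)[OF xV that])
    also have "\<dots> = 0" using xJ by simp
    finally show ?thesis using d(6) by simp
  qed
  then have "\<forall>u\<in>U. c u = 0" using ind[of c] by (simp add: x_def)
  then show False using c(1) by auto
qed

text \<open>A dimension count in place of a determinant. Take the multiples of the
  \<open>P j\<close> of multiplier degree at most \<open>N\<close>, of the \<open>b k\<close> of
  multiplier degree below \<open>s - e\<close>, and of \<open>X^s bs\<close> of multiplier degree
  below \<open>K - e'\<close>. They are independent over the rationals: remainders modulo
  \<open>X^s\<close> isolate the \<open>b k\<close>, the expansion \<open>phi\<close> modulo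
  \<open>X^K\<close> isolates \<open>bs\<close>, and the \<open>P j\<close> are independent by
  hypothesis. All have degree at most \<open>N + n\<close>, so \<open>i * (N + 1)\<close> cancels
  from the comparison. The case \<open>K = 0\<close> dispenses with \<open>phi\<close>.\<close>

lemma zero_estimate:
  fixes phi :: "('a \<Rightarrow> rat poly) \<Rightarrow> real fps" and P b :: "nat \<Rightarrow> 'a \<Rightarrow> rat poly"
  assumes V: "dmod V" and i: "i = rank_on A V"
    and P: "\<And>j. j < i \<Longrightarrow> P j \<in> V" "indep_on {..<i} A P" "\<And>j a. j < i \<Longrightarrow> degree (P j a) \<le> n"
      "\<And>j l. j < i \<Longrightarrow> l \<in> L \<Longrightarrow> fps_X ^ s dvd remd (P j) l"
    and b: "\<And>k. k < r \<Longrightarrow> b k \<in> V" "\<And>k a. k < r \<Longrightarrow> degree (b k a) \<le> c"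
    and e: "\<And>\<beta> k. \<forall>l\<in>L. fps_X ^ s dvd (\<Sum>k<r. \<beta> k * remd (b k) l) \<Longrightarrow> k < r \<Longrightarrow> fps_X ^ (s - e) dvd \<beta> k"
    and phi: "\<And>x y. phi (\<lambda>a. x a + y a) = phi x + phi y" "\<And>p x. phi (\<lambda>a. p * x a) = shift_poly p * phi x"
    and PK: "\<And>j. j < i \<Longrightarrow> fps_X ^ K dvd phi (P j)"
    and bs: "bs \<in> V" "\<And>a. degree (bs a) \<le> c" "K = 0 \<or> (phi bs \<noteq> 0 \<and> \<not> fps_X ^ e' dvd phi bs)"
  shows "r * (s - e) + (K - e') \<le> i * n"
proof -
  \<comment> \<open>Large enough to keep the second and third families within degree
    \<open>N\<close>.\<close>
  define N where "N = s + K + c"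
  define U :: "(nat \<times> nat \<times> nat) set" where
    "U = {0} \<times> {..<i} \<times> {..N} \<union> {1} \<times> {..<r} \<times> {..<s - e} \<union> {2} \<times> {0} \<times> {..<K - e'}"
  define y where "y = (\<lambda>(t, j, u) a. if t = (0::nat) then monom 1 u * P j a
      else if t = 1 then monom 1 u * b j a else monom 1 (s + u) * bs a)"
  have cardU: "card U = i * (N + 1) + r * (s - e) + (K - e')"
    unfolding U_def by (subst card_Un_disjoint, auto simp: card_cartesian_product)+
  have "card U \<le> rank_on A V * ((N + n) + 1)"
  proof (rule rational_dimension_le[where y = y])
    show "finite U" by (simp add: U_def)
    show "y u \<in> V" if "u \<in> U" for u
      using that P(1) b(1) bs(1) by (auto simp: U_def y_def intro!: dmodD(4)[OF V])
    have dm: "degree (monom 1 v * p) \<le> v + degree p" for v and p :: "rat poly"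
      using degree_mult_le[of "monom 1 v" p] degree_monom_le[of "1::rat" v] by linarith
    show "degree (y u a) \<le> N + n" if u: "u \<in> U" for u a
    proof -
      obtain t j v where tv: "u = (t, j, v)" by (cases u)
      have "(t = 0 \<and> j < i \<and> v \<le> N) \<or> (t = 1 \<and> j < r \<and> v < s - e) \<or> (t = 2 \<and> v < K - e')"
        using u tv by (auto simp: U_def)
      then show ?thesis
      proof (elim disjE conjE)
        assume h: "t = 0" "j < i" "v \<le> N"
        then show ?thesis using dm[of v "P j a"] P(3)[of j a] by (simp add: tv y_def)
      next
        assume h: "t = 1" "j < r" "v < s - e"
        then show ?thesis using dm[of v "b j a"] b(2)[of j a] by (simp add: tv y_def N_def)
      next
        assume h: "t = 2" "v < K - e'"
        then show ?thesis using dm[of "s + v" "bs a"] bs(2)[of a] by (simp add: tv y_def N_def)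
      qed
    qed
    fix C assume C: "\<forall>a\<in>A. (\<Sum>u\<in>U. smult (C u) (y u a)) = 0"
    define \<alpha> where "\<alpha> = (\<lambda>j. \<Sum>u\<le>N. monom (C (0, j, u)) u)"
    define \<beta> where "\<beta> = (\<lambda>k. \<Sum>u<s - e. monom (C (1, k, u)) u)"
    define \<gamma> where "\<gamma> = (\<Sum>u<K - e'. monom (C (2, 0, u)) u)"
    have c\<alpha>: "coeff (\<alpha> j) u = (if u \<le> N then C (0, j, u) else 0)" for j u by (simp add: \<alpha>_def coeff_sum)
    have c\<beta>: "coeff (\<beta> j) u = (if u < s - e then C (1, j, u) else 0)" for j u by (simp add: \<beta>_def coeff_sum)
    have c\<gamma>: "coeff \<gamma> u = (if u < K - e' then C (2, 0, u) else 0)" for u by (simp add: \<gamma>_def coeff_sum)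
    have sm: "smult k (monom 1 u * p) = monom k u * p" for k u and p :: "rat poly"
      by (simp add: smult_monom mult_smult_left[symmetric] del: mult_smult_left)
    have split: "(\<Sum>u\<in>U. smult (C u) (y u a)) = (\<Sum>j<i. \<alpha> j * P j a) + (\<Sum>k<r. \<beta> k * b k a) + (monom 1 s * \<gamma>) * bs a" for a
    proof -
      define g where "g = (\<lambda>u. smult (C u) (y u a))"
      have "sum g U = sum g ({0} \<times> {..<i} \<times> {..N}) + sum g ({1} \<times> {..<r} \<times> {..<s - e}) + sum g ({2} \<times> {0} \<times> {..<K - e'})"
        unfolding U_def by (subst sum.union_disjoint, auto)+
      also have "sum g ({0} \<times> {..<i} \<times> {..N}) = (\<Sum>(t, j, u)\<in>{0::nat} \<times> {..<i} \<times> {..N}. monom (C (0, j, u)) u * P j a)"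
        by (intro sum.cong) (auto simp: g_def y_def sm)
      also have "sum g ({1} \<times> {..<r} \<times> {..<s - e}) = (\<Sum>(t, j, u)\<in>{1::nat} \<times> {..<r} \<times> {..<s - e}. monom (C (1, j, u)) u * b j a)"
        by (intro sum.cong) (auto simp: g_def y_def sm)
      also have "sum g ({2} \<times> {0} \<times> {..<K - e'}) = (\<Sum>(t, j, u)\<in>{2::nat} \<times> {0::nat} \<times> {..<K - e'}. monom (C (2, 0, u)) (s + u) * bs a)"
        by (intro sum.cong) (auto simp: g_def y_def sm)
      also have "(\<Sum>(t, j, u)\<in>{0::nat} \<times> {..<i} \<times> {..N}. monom (C (0, j, u)) u * P j a) = (\<Sum>j<i. \<alpha> j * P j a)"
        by (simp add: sum.cartesian_product[symmetric] \<alpha>_def sum_distrib_right)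
      also have "(\<Sum>(t, j, u)\<in>{1::nat} \<times> {..<r} \<times> {..<s - e}. monom (C (1, j, u)) u * b j a) = (\<Sum>k<r. \<beta> k * b k a)"
        by (simp add: sum.cartesian_product[symmetric] \<beta>_def sum_distrib_right)
      also have "(\<Sum>(t, j, u)\<in>{2::nat} \<times> {0::nat} \<times> {..<K - e'}. monom (C (2, 0, u)) (s + u) * bs a) = (monom 1 s * \<gamma>) * bs a"
        by (simp add: sum.cartesian_product[symmetric] \<gamma>_def sum_distrib_right sum_distrib_left mult_monom)
      finally show ?thesis by (simp add: g_def)
    qed
    define z where "z = (\<lambda>a. (\<Sum>j<i. \<alpha> j * P j a) + ((\<Sum>k<r. \<beta> k * b k a) + (monom 1 s * \<gamma>) * bs a))"
    have vV: "z \<in> V" unfolding z_def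
      using P(1) b(1) bs(1) by (intro dmodD(3)[OF V] dmod_sum[OF V] dmodD(4)[OF V]) auto
    have z0: "z = (\<lambda>_. 0)"
    proof
      fix a
      show "z a = 0" using C split[of a] vV dmodD(1)[OF V]
        by (cases "a \<in> A") (auto simp: z_def vecs_def add.assoc)
    qed
    have "fps_X ^ s dvd (\<Sum>k<r. fps_of_poly (\<beta> k) * remd (b k) l)" if l: "l \<in> L" for l
    proof -
      have "0 = remd z l" by (simp add: z0 remd_def)
      also have "\<dots> = (\<Sum>j<i. fps_of_poly (\<alpha> j) * remd (P j) l) + ((\<Sum>k<r. fps_of_poly (\<beta> k) * remd (b k) l)
          + fps_of_poly (monom 1 s * \<gamma>) * remd bs l)"
        unfolding z_def by (simp add: remd_add remd_sum remd_mult)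
      finally have "(\<Sum>k<r. fps_of_poly (\<beta> k) * remd (b k) l) =
         - ((\<Sum>j<i. fps_of_poly (\<alpha> j) * remd (P j) l) + fps_X ^ s * (fps_of_poly \<gamma> * remd bs l))"
        by (simp add: fps_of_poly_mult fps_of_poly_monom eq_neg_iff_add_eq_0 algebra_simps)
      also have "fps_X ^ s dvd \<dots>"
        unfolding dvd_minus_iff using P(4) l by (intro dvd_add dvd_sum dvd_mult dvd_triv_left) auto
      finally show ?thesis .
    qed
    then have "fps_X ^ (s - e) dvd fps_of_poly (\<beta> k)" if "k < r" for k
      using e[of "\<lambda>k. fps_of_poly (\<beta> k)"] that by blast
    then have \<beta>0: "\<beta> k = 0" if "k < r" for k
      using that by (intro fps_of_poly_eq_0_if_dvd[of "s - e"]) (auto simp: c\<beta>)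
    have phi0: "phi (\<lambda>_. 0) = 0" using phi(2)[of 0 "\<lambda>_. 0"] by simp
    have phisum: "phi (\<lambda>a. \<Sum>k\<in>S. f k a) = (\<Sum>k\<in>S. phi (f k))" if "finite S" for S :: "nat set" and f
      using that by (induction S rule: finite_induct) (simp_all add: phi0 phi(1))
    have \<gamma>0: "\<gamma> = 0"
    proof (cases "K = 0")
      case True then show ?thesis by (simp add: \<gamma>_def)
    next
      case False
      have "z = (\<lambda>a. (\<Sum>j<i. \<alpha> j * P j a) + (monom 1 s * \<gamma>) * bs a)" by (auto simp: z_def \<beta>0)
      then have "phi z = (\<Sum>j<i. shift_poly (\<alpha> j) * phi (P j)) + shift_poly (monom 1 s * \<gamma>) * phi bs"
        by (simp add: phi(1,2) phisum)
      then have "shift_poly (monom 1 s * \<gamma>) * phi bs = - (\<Sum>j<i. shift_poly (\<alpha> j) * phi (P j))"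
        by (simp add: z0 phi0 eq_neg_iff_add_eq_0 add.commute)
      also have "fps_X ^ K dvd \<dots>" unfolding dvd_minus_iff using PK by (intro dvd_sum dvd_mult) auto
      finally have "fps_X ^ (K - e') dvd shift_poly (monom 1 s * \<gamma>)"
        using bs(3) False fps_X_power_dvd_mult_cancel[of K "phi bs" _ e'] by (simp add: mult.commute)
      \<comment> \<open>The factor \<open>X^s\<close> hides \<open>bs\<close> from the remainders at
        0, yet it is a unit at 1 and leaves the evaluation unaffected.\<close>
      moreover have "is_unit (shift_poly (monom 1 s))"
        by (simp add: fps_is_unit_iff shift_poly_nth_0 poly_monom)
      ultimately have "fps_X ^ (K - e') dvd shift_poly \<gamma>"
        by (simp add: shift_poly_mult dvd_mult_unit_iff')
      then show ?thesis by (rule shift_poly_eq_0_if_dvd) (simp add: c\<gamma>)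
    qed
    have "\<alpha> j = 0" if "j < i" for j
    proof -
      have "\<forall>a\<in>A. (\<Sum>j<i. \<alpha> j * P j a) = 0" using z0 \<beta>0 \<gamma>0 by (simp add: z_def fun_eq_iff)
      then show ?thesis using P(2) that by (auto simp: indep_on_def)
    qed
    then have "C (0, j, u) = 0" if "j < i" "u \<le> N" for j u using c\<alpha>[of j u] that by simp
    moreover have "C (1, k, u) = 0" if "k < r" "u < s - e" for k u using c\<beta>[of k u] \<beta>0 that by simp
    moreover have "C (2, 0, u) = 0" if "u < K - e'" for u using c\<gamma>[of u] \<gamma>0 that by simp
    ultimately show "\<forall>u\<in>U. C u = 0" by (auto simp: U_def)
  qed (rule V)
  then show ?thesis unfolding cardU i[symmetric] by (simp add: algebra_simps)
qed

end

section \<open>Uniform constants and the module of minimal ratio\<close>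

context pade
begin

lemma remd_low_fin_gen: "fin_gen L (remd ` {x\<in>vecs. \<forall>a. degree (x a) \<le> c})"
proof (rule fin_genI)
  show "finite (A \<times> {..c})" using finA by simp
  fix y assume "y \<in> remd ` {x\<in>vecs. \<forall>a. degree (x a) \<le> c}"
  then obtain x where x: "x \<in> vecs" "\<forall>a. degree (x a) \<le> c" "y = remd x" by auto
  define g where "g = (\<lambda>(a, u) l. G l a * fps_X ^ u)"
  have "y l = (\<Sum>i\<in>A \<times> {..c}. fps_const (case i of (a, u) \<Rightarrow> coeff (x a) u) * g i l)" for l
  proof -
    have e: "fps_of_poly p = (\<Sum>u\<le>c. fps_const (coeff p u) * fps_X ^ u)" if "degree p \<le> c" for p :: "rat poly"
    proof (rule fps_ext)
      fix n
      show "fps_of_poly p $ n = (\<Sum>u\<le>c. fps_const (coeff p u) * fps_X ^ u) $ n"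
        using that by (cases "n \<le> c") (auto simp: fps_sum_nth coeff_eq_0 if_distrib[of "\<lambda>z. _ * z"] cong: if_cong)
    qed
    have "y l = (\<Sum>a\<in>A. \<Sum>u\<le>c. G l a * (fps_const (coeff (x a) u) * fps_X ^ u))"
      unfolding x(3) remd_def using x(2) by (intro sum.cong refl) (subst e, auto simp: sum_distrib_left)
    also have "\<dots> = (\<Sum>i\<in>A \<times> {..c}. fps_const (case i of (a, u) \<Rightarrow> coeff (x a) u) * g i l)"
      by (simp add: sum.cartesian_product g_def split_def mult_ac)
    finally show ?thesis .
  qed
  then show "\<exists>c'. \<forall>l\<in>L. y l = (\<Sum>i\<in>A \<times> {..c}. fps_const (c' i) * g i l)" by blast
qed

text \<open>Low-degree vectors have finitely generated remainders, so \<open>e\<close> depends on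
  \<open>c\<close> and not on the family. At most \<open>card L\<close> remainders are independent,
  so a maximum over \<open>r\<close> exists.\<close>

lemma uniform_order_bounded:
  "\<exists>e. \<forall>r b. (\<forall>k<r. b k \<in> vecs \<and> (\<forall>a. degree (b k a) \<le> c)) \<and> indep_on {..<r::nat} L (\<lambda>k. remd (b k)) \<longrightarrow>
     (\<forall>\<beta> s. (\<forall>l\<in>L. fps_X ^ s dvd (\<Sum>k<r. \<beta> k * remd (b k) l)) \<longrightarrow> (\<forall>k<r. fps_X ^ (s - e) dvd \<beta> k))"
proof -
  define Y where "Y = remd ` {x\<in>vecs. \<forall>a. degree (x a) \<le> c}"
  have "\<forall>r::nat. \<exists>e. \<forall>y. (\<forall>k<r. y k \<in> Y) \<and> indep_on {..<r} L y \<longrightarrow>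
     (\<forall>\<beta> s. (\<forall>l\<in>L. fps_X ^ s dvd (\<Sum>k<r. \<beta> k * y k l)) \<longrightarrow> (\<forall>k<r. fps_X ^ (s - e) dvd \<beta> k))"
    unfolding Y_def by (intro allI, rule uniform_order[OF finL remd_low_fin_gen])
  from choice[OF this] obtain e where "\<forall>r::nat. \<forall>y. (\<forall>k<r. y k \<in> Y) \<and> indep_on {..<r} L y \<longrightarrow>
     (\<forall>\<beta> s. (\<forall>l\<in>L. fps_X ^ s dvd (\<Sum>k<r. \<beta> k * y k l)) \<longrightarrow> (\<forall>k<r. fps_X ^ (s - e r) dvd \<beta> k))" ..
  then have e: "\<And>r y \<beta> s k. (\<forall>k<r. y k \<in> Y) \<Longrightarrow> indep_on {..<r} L y \<Longrightarrow>
     (\<forall>l\<in>L. fps_X ^ s dvd (\<Sum>k<(r::nat). \<beta> k * y k l)) \<Longrightarrow> k < r \<Longrightarrow> fps_X ^ (s - e r) dvd \<beta> k" by simp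
  define E where "E = Max (e ` {..card L})"
  show ?thesis
  proof (intro exI[of _ E] allI impI, elim conjE)
    fix r b \<beta> s k
    assume b: "\<forall>k<r. b k \<in> vecs \<and> (\<forall>a. degree (b k a) \<le> c)" "indep_on {..<r::nat} L (\<lambda>k. remd (b k))"
      and d: "\<forall>l\<in>L. fps_X ^ s dvd (\<Sum>k<r. \<beta> k * remd (b k) l)" and k: "k < r"
    have "r \<le> card L" using indep_on_card_le[OF _ finL b(2)] by auto
    then have le: "e r \<le> E" unfolding E_def by (intro Max_ge) auto
    have "fps_X ^ (s - e r) dvd \<beta> k" by (rule e[OF _ b(2) d k]) (use b(1) in \<open>auto simp: Y_def\<close>)
    then show "fps_X ^ (s - E) dvd \<beta> k" using le by (meson dvd_trans le_imp_power_dvd diff_le_mono2)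
  qed
qed

text \<open>Every element of \<open>Z\<close> is, up to a denominator, a combination of elements of
  low degree, and \<open>remd\<close> is linear.\<close>

lemma remrank_low:
  assumes "dmod Z" "rank_on A {x\<in>Z. \<forall>a. degree (x a) \<le> c} = rank_on A Z"
  shows "rank_on L (remd ` {x\<in>Z. \<forall>a. degree (x a) \<le> c}) = remrank Z"
proof (rule antisym)
  define Z' where "Z' = {x\<in>Z. \<forall>a. degree (x a) \<le> c}"
  show "rank_on L (remd ` {x\<in>Z. \<forall>a. degree (x a) \<le> c}) \<le> remrank Z"
    unfolding remrank_def by (intro rank_on_mono[OF finL]) auto
  obtain x \<Lambda> M m where x: "\<And>k. k < rank_on A Z' \<Longrightarrow> x k \<in> Z'" "indep_on {..<rank_on A Z'} A x" "\<Lambda> \<subseteq> A" "finite \<Lambda>"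
    "card \<Lambda> = rank_on A Z'" "M \<noteq> 0" "\<And>y a. y \<in> Z' \<Longrightarrow> a \<in> A \<Longrightarrow> M * y a = (\<Sum>\<kappa>\<in>\<Lambda>. m a \<kappa> * y \<kappa>)"
    using that by (rule rank_on_obtains[OF finA, of Z'])
  define n where "n = rank_on A Z'"
  have nZ: "n = rank_on A Z" using assms(2) by (simp add: n_def Z'_def)
  have xZ: "\<forall>k<n. x k \<in> Z" using x(1) by (auto simp: n_def Z'_def)
  show "remrank Z \<le> rank_on L (remd ` {x\<in>Z. \<forall>a. degree (x a) \<le> c})"
    unfolding remrank_def
  proof (rule rank_on_le_of_multiples[OF finL])
    fix y assume "y \<in> remd ` Z"
    then obtain z where z: "z \<in> Z" "y = remd z" by auto
    from rank_on_dependence[OF finA xZ x(2)[folded n_def] nZ z(1)]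
    obtain p d where p: "p \<noteq> 0" "\<And>a. a \<in> A \<Longrightarrow> p * z a = (\<Sum>k<n. d k * x k a)" by auto
    have "fps_of_poly p * y l = (\<Sum>k<n. fps_of_poly (d k) * remd (x k) l)" for l
    proof -
      have "fps_of_poly p * y l = remd (\<lambda>a. p * z a) l" by (simp add: z(2) remd_mult)
      also have "\<dots> = remd (\<lambda>a. \<Sum>k<n. d k * x k a) l" unfolding remd_def by (intro sum.cong) (auto simp: p(2))
      finally show ?thesis by (simp add: remd_sum remd_mult)
    qed
    then show "\<exists>p (n::nat) c' x. p \<noteq> 0 \<and> (\<forall>k<n. x k \<in> remd ` {x\<in>Z. \<forall>a. degree (x a) \<le> c}) \<and>
        (\<forall>a\<in>L. p * y a = (\<Sum>k<n. c' k * x k a))"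
      using p(1) x(1)
      by (intro exI[of _ "fps_of_poly p"] exI[of _ n] exI[of _ "\<lambda>k. fps_of_poly (d k)"] exI[of _ "\<lambda>k. remd (x k)"])
         (auto simp: n_def Z'_def)
  qed
qed

lemma remd_basis:
  assumes "S \<subseteq> vecs"
  obtains b where "\<And>k. k < rank_on L (remd ` S) \<Longrightarrow> b k \<in> S" "indep_on {..<rank_on L (remd ` S)} L (\<lambda>k. remd (b k))"
proof -
  define r where "r = rank_on L (remd ` S)"
  obtain y \<Lambda> M m where y: "\<And>k. k < rank_on L (remd ` S) \<Longrightarrow> y k \<in> remd ` S" "indep_on {..<rank_on L (remd ` S)} L y" "\<Lambda> \<subseteq> L" "finite \<Lambda>"
    "card \<Lambda> = rank_on L (remd ` S)" "M \<noteq> 0" "\<And>y a. y \<in> remd ` S \<Longrightarrow> a \<in> L \<Longrightarrow> M * y a = (\<Sum>\<kappa>\<in>\<Lambda>. m a \<kappa> * y \<kappa>)"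
    using that by (rule rank_on_obtains[OF finL, of "remd ` S"])
  have "\<forall>k. \<exists>x. k < r \<longrightarrow> x \<in> S \<and> y k = remd x" using y(1) by (auto simp: r_def)
  from choice[OF this] obtain b where b: "\<And>k. k < r \<Longrightarrow> b k \<in> S \<and> y k = remd (b k)" by auto
  have "indep_on {..<r} L (\<lambda>k. remd (b k))"
    using y(2) b unfolding indep_on_def r_def by (metis (mono_tags, lifting) lessThan_iff sum.cong)
  then show thesis using b that by (auto simp: r_def)
qed

text \<open>The zero estimate without evaluation, with one constant for all modules: the low-degree
  elements of the hull \<open>Z\<close> from \<open>bounded_generation\<close> provide the
  \<open>b k\<close>, so the loss of order is uniform. This is why \<open>V\<close> is replaced by
  \<open>Z\<close> in the conclusion.\<close>

lemma uniform_rank_estimate: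
  "\<exists>c. \<forall>V n s P. dmod V \<longrightarrow> (\<forall>j<rank_on A V. P j \<in> V \<and> (\<forall>a. degree (P j a) \<le> n) \<and> (\<forall>l\<in>L. fps_X ^ s dvd remd (P j) l)) \<longrightarrow>
     indep_on {..<rank_on A V} A P \<longrightarrow>
     (\<exists>Z. dmod Z \<and> rank_on A Z = rank_on A V \<and> remrank Z * (s - c) \<le> rank_on A V * n)"
proof -
  obtain c where c: "\<And>V. dmod V \<Longrightarrow> \<exists>Z. dmod Z \<and> V \<subseteq> Z \<and> rank_on A Z = rank_on A V \<and>
     rank_on A {x\<in>Z. \<forall>a. degree (x a) \<le> c} = rank_on A Z"
    using bounded_generation by auto
  obtain e where e: "\<forall>r b. (\<forall>k<r. b k \<in> vecs \<and> (\<forall>a. degree (b k a) \<le> c)) \<and> indep_on {..<r::nat} L (\<lambda>k. remd (b k)) \<longrightarrow>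
     (\<forall>\<beta> s. (\<forall>l\<in>L. fps_X ^ s dvd (\<Sum>k<r. \<beta> k * remd (b k) l)) \<longrightarrow> (\<forall>k<r. fps_X ^ (s - e) dvd \<beta> k))"
    using uniform_order_bounded[of c] ..
  show ?thesis
  proof (intro exI[of _ e] allI impI)
    fix V n s P
    assume V: "dmod V" and P: "\<forall>j<rank_on A V. P j \<in> V \<and> (\<forall>a. degree (P j a) \<le> n) \<and> (\<forall>l\<in>L. fps_X ^ s dvd remd (P j) l)"
      and ind: "indep_on {..<rank_on A V} A P"
    obtain Z where Z: "dmod Z" "V \<subseteq> Z" "rank_on A Z = rank_on A V"
      "rank_on A {x\<in>Z. \<forall>a. degree (x a) \<le> c} = rank_on A Z" using c[OF V] by auto
    define r where "r = remrank Z"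
    obtain b where b: "\<And>k. k < r \<Longrightarrow> b k \<in> {x\<in>Z. \<forall>a. degree (x a) \<le> c}" "indep_on {..<r} L (\<lambda>k. remd (b k))"
      using remd_basis[of "{x\<in>Z. \<forall>a. degree (x a) \<le> c}"] remrank_low[OF Z(1,4)] dmodD(1)[OF Z(1)]
      unfolding r_def by force
    have e': "fps_X ^ (s - e) dvd \<beta> k" if "\<forall>l\<in>L. fps_X ^ s dvd (\<Sum>k<r. \<beta> k * remd (b k) l)" "k < r" for \<beta> k
      using e[rule_format, of r b s \<beta> k] that b dmodD(1)[OF Z(1)] by auto
    have "r * (s - e) + (0 - 0) \<le> rank_on A V * n"
    proof (rule zero_estimate[OF Z(1), where P = P and b = b and c = c and phi = "\<lambda>_. 0" and bs = "\<lambda>_. 0"])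
      show "\<And>\<beta> k. \<forall>l\<in>L. fps_X ^ s dvd (\<Sum>k<r. \<beta> k * remd (b k) l) \<Longrightarrow> k < r \<Longrightarrow> fps_X ^ (s - e) dvd \<beta> k"
        by (rule e')
    qed (use Z(2,3) P ind b dmodD(2)[OF Z(1)] in auto)
    then show "\<exists>Z. dmod Z \<and> rank_on A Z = rank_on A V \<and> remrank Z * (s - e) \<le> rank_on A V * n"
      using Z by (intro exI[of _ Z]) (simp add: r_def)
  qed
qed

text \<open>Conditions per order of vanishing divided by unknowns per degree: forms in
  \<open>V\<close> reach order \<open>s\<close> with degree about
  \<open>ratio V * s\<close>.\<close>

definition ratio :: "('a \<Rightarrow> rat poly) set \<Rightarrow> real" where "ratio V = remrank V / rank_on A V"

text \<open>Minimising the ratio, with a small penalty on the rank, rules out the degenerate case in which the derivatives of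
  an auxiliary form span a module of smaller rank: no analysis of the singularities is needed.\<close>

lemma minimal_module:
  fixes \<eta> :: real
  assumes "A \<noteq> {}" "\<eta> > 0"
  obtains V where "dmod V" "rank_on A V \<noteq> 0" "ratio V + \<eta> * rank_on A V \<le> card L / card A + \<eta> * card A"
    "\<And>V'. dmod V' \<Longrightarrow> rank_on A V' \<noteq> 0 \<Longrightarrow> ratio V + \<eta> * rank_on A V \<le> ratio V' + \<eta> * rank_on A V'"
proof -
  define f where "f = (\<lambda>(i::nat, r::nat). r / i + \<eta> * i)"
  define S where "S = {(rank_on A V, remrank V) |V. dmod V \<and> rank_on A V \<noteq> 0}"
  obtain h where bij: "bij_betw h {..<card A} A"
    using ex_bij_betw_nat_finite[OF finA] by (auto simp: atLeast0LessThan)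
  have "indep_on {..<card A} A (\<lambda>k. unit_vec (h k))"
    unfolding indep_on_def
  proof (intro allI impI ballI)
    fix c k assume c: "\<forall>a\<in>A. (\<Sum>k<card A. c k * unit_vec (h k) a) = 0" and k: "k \<in> {..<card A}"
    have kA: "h k \<in> A" using k bij by (auto simp: bij_betw_def)
    have "0 = (\<Sum>j<card A. c j * unit_vec (h j) (h k))" using c kA by simp
    also have "\<dots> = (\<Sum>j<card A. if j = k then c j else 0)"
      using bij k by (intro sum.cong) (auto simp: unit_vec_def bij_betw_def inj_on_def)
    also have "\<dots> = c k" using k by simp
    finally show "c k = 0" by simp
  qed
  moreover have "\<forall>k<card A. unit_vec (h k) \<in> vecs"
    using bij by (auto intro!: unit_vec_in_vecs simp: bij_betw_def)
  ultimately have "card A \<le> rank_on A vecs" by (intro indep_on_le_rank[OF finA])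
  then have rv: "rank_on A vecs = card A" using rank_on_le_card[OF finA, of vecs] by simp
  have A0: "card A \<noteq> 0" using assms(1) finA by simp
  \<comment> \<open>Infinitely many modules, but only finitely many pairs of ranks; so the minimum
    is attained.\<close>
  have "S \<subseteq> {..card A} \<times> {..card L}"
    using rank_on_le_card[OF finA] rank_on_le_card[OF finL] by (auto simp: S_def remrank_def)
  then have fS: "finite S" by (rule finite_subset) auto
  have inS: "(card A, remrank vecs) \<in> S" unfolding S_def using rv dmod_vecs A0 by (intro CollectI exI[of _ vecs]) auto
  have "\<exists>p\<in>S. \<forall>p'\<in>S. f p \<le> f p'"
    using ex_min_if_finite[of "f ` S"] fS inS by (auto simp: not_less)
  then obtain p where p: "p \<in> S" "\<And>p'. p' \<in> S \<Longrightarrow> f p \<le> f p'" by auto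
  obtain V where V: "p = (rank_on A V, remrank V)" "dmod V" "rank_on A V \<noteq> 0" using p(1) by (auto simp: S_def)
  have "f p \<le> f (card A, remrank vecs)" by (rule p(2)[OF inS])
  also have "\<dots> \<le> card L / card A + \<eta> * card A"
    using rank_on_le_card[OF finL] by (auto simp: f_def remrank_def intro!: divide_right_mono)
  finally have 1: "ratio V + \<eta> * rank_on A V \<le> card L / card A + \<eta> * card A" by (simp add: f_def V ratio_def)
  have 2: "ratio V + \<eta> * rank_on A V \<le> ratio V' + \<eta> * rank_on A V'" if "dmod V'" "rank_on A V' \<noteq> 0" for V'
    using p(2)[of "(rank_on A V', remrank V')"] that by (auto simp: f_def V ratio_def S_def)
  show thesis by (rule that[OF V(2,3) 1 2])
qed

text \<open>If the derivatives of \<open>P\<close> spanned a smaller rank \<open>m\<close>, the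
  uniform estimate would produce a module of rank \<open>m\<close> with ratio at most about
  \<open>n / s\<close>. Minimality and the penalty force that ratio to be at least
  \<open>ratio V + \<eta>\<close>, because the ranks differ by at least 1. A form of degree below
  this threshold excludes the case.\<close>

lemma derivatives_independent:
  fixes \<eta> :: real
  assumes V: "dmod V" and \<eta>: "\<eta> > 0"
    and min: "\<And>V'. dmod V' \<Longrightarrow> rank_on A V' \<noteq> 0 \<Longrightarrow> ratio V + \<eta> * rank_on A V \<le> ratio V' + \<eta> * rank_on A V'"
  shows "\<exists>C::nat. \<forall>P n s. P \<in> V \<longrightarrow> P \<noteq> (\<lambda>_. 0) \<longrightarrow> (\<forall>a. degree (P a) \<le> n) \<longrightarrow> (\<forall>l\<in>L. fps_X ^ s dvd remd P l) \<longrightarrow>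
     real (n + C) < (ratio V + \<eta>) * (real s - C) \<longrightarrow> indep_on {..<rank_on A V} A (\<lambda>j. (D ^^ j) P)"
proof -
  obtain d where d: "\<forall>x n. x \<in> vecs \<longrightarrow> (\<forall>a. degree (x a) \<le> n) \<longrightarrow> (\<forall>a. degree (D x a) \<le> n + d)"
    using degree_D_bound by auto
  obtain c where c: "\<forall>V n s P. dmod V \<longrightarrow> (\<forall>j<rank_on A V. P j \<in> V \<and> (\<forall>a. degree (P j a) \<le> n) \<and> (\<forall>l\<in>L. fps_X ^ s dvd remd (P j) l)) \<longrightarrow>
     indep_on {..<rank_on A V} A P \<longrightarrow>
     (\<exists>Z. dmod Z \<and> rank_on A Z = rank_on A V \<and> remrank Z * (s - c) \<le> rank_on A V * n)"
    using uniform_rank_estimate by auto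
  \<comment> \<open>The loss of order \<open>c\<close>, and the degree gained by fewer than
    \<open>rank_on A V\<close> derivations.\<close>
  define C where "C = c + rank_on A V * d"
  show ?thesis
  proof (intro exI[of _ C] allI impI)
    fix P n s
    assume P: "P \<in> V" "P \<noteq> (\<lambda>_. 0)" "\<forall>a. degree (P a) \<le> n" "\<forall>l\<in>L. fps_X ^ s dvd remd P l"
      and lt: "real (n + C) < (ratio V + \<eta>) * (real s - C)"
    have Pv: "P \<in> vecs" using P(1) dmodD(1)[OF V] by auto
    obtain V' m where V': "dmod V'" "m \<noteq> 0" "rank_on A V' = m" "indep_on {..<m} A (\<lambda>j. (D ^^ j) P)" "\<And>j. (D ^^ j) P \<in> V'"
      using that by (rule cyclic_module[OF Pv P(2)])
    have le: "m \<le> rank_on A V"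
      by (rule indep_on_le_rank[OF finA _ V'(4)]) (use dmod_funpow[OF V P(1)] in auto)
    show "indep_on {..<rank_on A V} A (\<lambda>j. (D ^^ j) P)"
    proof (cases "m = rank_on A V")
      case True then show ?thesis using V'(4) by simp
    next
      case False
      then have mlt: "m < rank_on A V" using le by simp
      define n' where "n' = n + rank_on A V * d"
      have "degree ((D ^^ j) P a) \<le> n'" if "j < m" for j a
      proof -
        have "degree ((D ^^ j) P a) \<le> n + j * d" using degree_funpow_bound[OF d Pv P(3)] by blast
        also have "\<dots> \<le> n'" using that le by (auto simp: n'_def intro!: mult_right_mono)
        finally show ?thesis .
      qed
      then obtain Z where Z: "dmod Z" "rank_on A Z = m" "remrank Z * (s - c) \<le> m * n'"
        using c[rule_format, of V' "\<lambda>j. (D ^^ j) P" n' s] V' ord_funpow[OF Pv P(4)] by auto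
      have "ratio V + \<eta> * rank_on A V \<le> remrank Z / m + \<eta> * m"
        using min[OF Z(1)] Z(2) V'(2) by (simp add: ratio_def)
      moreover have "\<eta> * rank_on A V \<ge> \<eta> * m + \<eta>"
      proof -
        have "\<eta> * (real m + 1) \<le> \<eta> * rank_on A V" using mlt \<eta> by (intro mult_left_mono) auto
        then show ?thesis by (simp add: algebra_simps)
      qed
      ultimately have "ratio V + \<eta> \<le> remrank Z / m" by linarith
      have nn: "0 \<le> ratio V" by (simp add: ratio_def)
      have pos: "real s - C > 0" using nn lt \<eta> by (smt (verit) of_nat_0_le_iff zero_less_mult_iff)
      have "real s - c \<le> real (s - c)" by (cases "c \<le> s") (auto simp: of_nat_diff)
      moreover have "real c \<le> real C" by (simp add: C_def)
      ultimately have "real s - C \<le> real (s - c)" by linarith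
      with \<open>ratio V + \<eta> \<le> remrank Z / m\<close> have "(ratio V + \<eta>) * (real s - C) \<le> remrank Z / m * real (s - c)"
        using nn \<eta> pos by (intro mult_mono) auto
      also have "\<dots> = real (remrank Z * (s - c)) / m" by simp
      also have "\<dots> \<le> real (m * n') / m" using Z(3) by (intro divide_right_mono) (simp_all only: of_nat_le_iff of_nat_0_le_iff)
      also have "\<dots> = n'" using V'(2) by simp
      also have "\<dots> \<le> real (n + C)" by (simp add: n'_def C_def)
      finally show ?thesis using lt by simp
    qed
  qed
qed

text \<open>The zero estimate for \<open>P\<close> and its derivatives bounds the order which all
  their images under \<open>phi\<close> can share. The constant is fixed by \<open>V\<close>: it is
  independent of \<open>phi\<close> and of the witness \<open>bs\<close>, which will vary with the
  pair of integers.\<close>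

lemma small_order_exists:
  assumes V: "dmod V"
  shows "\<exists>C::nat. \<forall>P n s phi K e' bs. P \<in> V \<longrightarrow> (\<forall>a. degree (P a) \<le> n) \<longrightarrow> (\<forall>l\<in>L. fps_X ^ s dvd remd P l) \<longrightarrow>
     indep_on {..<rank_on A V} A (\<lambda>j. (D ^^ j) P) \<longrightarrow>
     (\<forall>x y. phi (\<lambda>a. x a + y a) = phi x + phi y) \<longrightarrow> (\<forall>p x. phi (\<lambda>a. p * x a) = shift_poly p * phi x) \<longrightarrow>
     (\<forall>j<rank_on A V. fps_X ^ K dvd phi ((D ^^ j) P)) \<longrightarrow> bs \<in> V \<longrightarrow> phi bs \<noteq> 0 \<longrightarrow> \<not> fps_X ^ e' dvd phi bs \<longrightarrow>
     remrank V * (s - C) + (K - e') \<le> rank_on A V * (n + C)"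
proof -
  obtain d where d: "\<forall>x n. x \<in> vecs \<longrightarrow> (\<forall>a. degree (x a) \<le> n) \<longrightarrow> (\<forall>a. degree (D x a) \<le> n + d)"
    using degree_D_bound by auto
  define r where "r = remrank V"
  obtain b where b: "\<And>k. k < r \<Longrightarrow> b k \<in> V" "indep_on {..<r} L (\<lambda>k. remd (b k))"
    using that unfolding r_def remrank_def by (rule remd_basis[OF dmodD(1)[OF V]])
  define c where "c = Max (insert 0 ((\<lambda>(k, a). degree (b k a)) ` ({..<r} \<times> A)))"
  have bv: "b k \<in> vecs" if "k < r" for k using b(1)[OF that] dmodD(1)[OF V] by auto
  have c: "degree (b k a) \<le> c" if "k < r" for k a
  proof (cases "a \<in> A")
    case True then show ?thesis unfolding c_def using that finA by (intro Max_ge) auto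
  qed (use bv[OF that] in \<open>auto simp: vecs_def\<close>)
  obtain e where e: "\<forall>r b. (\<forall>k<r. b k \<in> vecs \<and> (\<forall>a. degree (b k a) \<le> c)) \<and> indep_on {..<r::nat} L (\<lambda>k. remd (b k)) \<longrightarrow>
     (\<forall>\<beta> s. (\<forall>l\<in>L. fps_X ^ s dvd (\<Sum>k<r. \<beta> k * remd (b k) l)) \<longrightarrow> (\<forall>k<r. fps_X ^ (s - e) dvd \<beta> k))"
    using uniform_order_bounded[of c] ..
  have e': "fps_X ^ (s - e) dvd \<beta> k" if "\<forall>l\<in>L. fps_X ^ s dvd (\<Sum>k<r. \<beta> k * remd (b k) l)" "k < r" for \<beta> k s
    using e[rule_format, of r b s \<beta> k] that b c bv by auto
  define C where "C = e + rank_on A V * d"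
  show ?thesis
  proof (intro exI[of _ C] allI impI)
    fix P n s phi K e'' bs
    assume P: "P \<in> V" "\<forall>a. degree (P a) \<le> n" "\<forall>l\<in>L. fps_X ^ s dvd remd P l" "indep_on {..<rank_on A V} A (\<lambda>j. (D ^^ j) P)"
      and phi: "\<forall>x y. phi (\<lambda>a. x a + y a) = phi x + phi y" "\<forall>p x. phi (\<lambda>a. p * x a) = shift_poly p * phi x"
      and K: "\<forall>j<rank_on A V. fps_X ^ K dvd phi ((D ^^ j) P)" and bs: "bs \<in> V" "phi bs \<noteq> 0" "\<not> fps_X ^ e'' dvd phi bs"
    have Pv: "P \<in> vecs" using P(1) dmodD(1)[OF V] by auto
    \<comment> \<open>The degree of \<open>bs\<close> enters the zero estimate only through
      \<open>N\<close>, which cancels; therefore it may be arbitrary.\<close>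
    define c' where "c' = Max (insert c ((\<lambda>a. degree (bs a)) ` A))"
    have c'1: "c \<le> c'" unfolding c'_def using finA by (intro Max_ge) auto
    have c'2: "degree (bs a) \<le> c'" for a
    proof (cases "a \<in> A")
      case True then show ?thesis unfolding c'_def using finA by (intro Max_ge) auto
    next
      case False
      then have "bs a = 0" using bs(1) dmodD(1)[OF V] by (auto simp: vecs_def)
      then show ?thesis by simp
    qed
    have "r * (s - e) + (K - e'') \<le> rank_on A V * (n + rank_on A V * d)"
    proof (rule zero_estimate[OF V refl, where P = "\<lambda>j. (D ^^ j) P" and b = b and c = c' and phi = phi and bs = bs])
      show "\<And>\<beta> k. \<forall>l\<in>L. fps_X ^ s dvd (\<Sum>k<r. \<beta> k * remd (b k) l) \<Longrightarrow> k < r \<Longrightarrow> fps_X ^ (s - e) dvd \<beta> k"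
        by (rule e')
      fix j a assume "j < rank_on A V"
      have "degree ((D ^^ j) P a) \<le> n + j * d" using degree_funpow_bound[OF d Pv P(2)] by blast
      also have "\<dots> \<le> n + rank_on A V * d" using \<open>j < _\<close> by (auto intro!: mult_right_mono)
      finally show "degree ((D ^^ j) P a) \<le> n + rank_on A V * d" .
    next
      fix k a assume "k < r" then show "degree (b k a) \<le> c'" using c[of k a] c'1 by simp
    qed (use P phi K bs b(1) c'2 dmod_funpow[OF V P(1)] ord_funpow[OF Pv P(3)] in auto)
    moreover have "r * (s - C) \<le> r * (s - e)" by (intro mult_left_mono) (auto simp: C_def)
    moreover have "rank_on A V * (n + rank_on A V * d) \<le> rank_on A V * (n + C)" by (intro mult_left_mono) (auto simp: C_def)
    ultimately show "remrank V * (s - C) + (K - e'') \<le> rank_on A V * (n + C)" unfolding r_def by linarith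
  qed
qed

text \<open>Vanishing has to be prescribed in \<open>remrank V\<close> coordinates only; the others
  follow at the cost of the order of the denominator \<open>M\<close>. This makes
  \<open>ratio V\<close>, and not \<open>card L / card A\<close>, the quotient that governs the
  auxiliary forms.\<close>

lemma order_on_coordinates:
  assumes "dmod V"
  obtains \<Lambda> e where "\<Lambda> \<subseteq> L" "finite \<Lambda>" "card \<Lambda> = remrank V"
    "\<And>x s. x \<in> V \<Longrightarrow> \<forall>l\<in>\<Lambda>. fps_X ^ (s + e) dvd remd x l \<Longrightarrow> \<forall>l\<in>L. fps_X ^ s dvd remd x l"
proof -
  obtain y \<Lambda> M m where y: "\<And>k. k < rank_on L (remd ` V) \<Longrightarrow> y k \<in> remd ` V" "indep_on {..<rank_on L (remd ` V)} L y" "\<Lambda> \<subseteq> L" "finite \<Lambda>"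
    "card \<Lambda> = rank_on L (remd ` V)" "M \<noteq> 0" "\<And>y a. y \<in> remd ` V \<Longrightarrow> a \<in> L \<Longrightarrow> M * y a = (\<Sum>\<kappa>\<in>\<Lambda>. m a \<kappa> * y \<kappa>)"
    using that by (rule rank_on_obtains[OF finL, of "remd ` V"])
  have "M $ subdegree M \<noteq> 0" using y(6) by simp
  then have M: "\<not> fps_X ^ Suc (subdegree M) dvd M" unfolding fps_X_power_dvd_iff by auto
  have "fps_X ^ s dvd remd x l" if x: "x \<in> V" and h: "\<forall>l\<in>\<Lambda>. fps_X ^ (s + Suc (subdegree M)) dvd remd x l" and l: "l \<in> L" for x s l
  proof -
    have "M * remd x l = (\<Sum>\<kappa>\<in>\<Lambda>. m l \<kappa> * remd x \<kappa>)" using y(7)[of "remd x" l] x l by auto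
    also have "fps_X ^ (s + Suc (subdegree M)) dvd \<dots>" using h by (intro dvd_sum dvd_mult) auto
    finally have "fps_X ^ (s + Suc (subdegree M)) dvd M * remd x l" .
    from fps_X_power_dvd_mult_cancel[OF this y(6) M] show ?thesis by simp
  qed
  then show thesis using that[of \<Lambda> "Suc (subdegree M)"] y(3,4,5) by (auto simp: remrank_def)
qed

end

section \<open>Siegel's lemma\<close>

text \<open>The box principle. The natural number \<open>k\<close> bounds
  \<open>card E / (card I - card E)\<close>; in the application it stays fixed while the system
  grows, so the solutions have exponential size.\<close>

lemma siegel_lemma:
  fixes M :: "'e \<Rightarrow> 'i \<Rightarrow> int" and B k :: nat
  assumes fin: "finite E" "finite I" and lt: "card E < card I" and B: "\<And>e i. e \<in> E \<Longrightarrow> i \<in> I \<Longrightarrow> \<bar>M e i\<bar> \<le> int B" "B \<ge> 1"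
    and k: "card E \<le> k * (card I - card E)"
  obtains x where "\<exists>i\<in>I. x i \<noteq> 0" "\<And>i. i \<in> I \<Longrightarrow> \<bar>x i\<bar> \<le> int ((2 * card I * B + 1) ^ k)"
    "\<And>e. e \<in> E \<Longrightarrow> (\<Sum>i\<in>I. M e i * x i) = 0"
proof (cases "E = {}")
  case True
  have "I \<noteq> {}" using lt by auto
  then show thesis using that[of "\<lambda>_. 1"] True by auto
next
  case False
  define b where "b = 2 * card I * B"
  define h where "h = (b + 1) ^ k"
  \<comment> \<open>Each equation takes its values on the cube in an interval of
    \<open>2 * c = b * h\<close> integers, so that the comparison needed is
    \<open>(b * h) ^ card E < h ^ card I\<close>.\<close>
  define c where "c = int (card I * B * h)"
  define F where "F = (\<lambda>x. \<lambda>e\<in>E. \<Sum>i\<in>I. M e i * x i)"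
  have E1: "card E \<ge> 1" using False fin(1) by (simp add: Suc_leI card_gt_0_iff)
  have I1: "card I \<ge> 1" using lt by simp
  have h1: "h \<ge> 1" by (simp add: h_def)
  have maps: "F ` (I \<rightarrow>\<^sub>E {0..<int h}) \<subseteq> E \<rightarrow>\<^sub>E {- c + 1..c}"
  proof (intro subsetI)
    fix y assume "y \<in> F ` (I \<rightarrow>\<^sub>E {0..<int h})"
    then obtain x where x: "x \<in> I \<rightarrow>\<^sub>E {0..<int h}" "y = F x" by auto
    have "\<bar>\<Sum>i\<in>I. M e i * x i\<bar> \<le> c - int (card I * B)" if e: "e \<in> E" for e
    proof -
      have "\<bar>\<Sum>i\<in>I. M e i * x i\<bar> \<le> (\<Sum>i\<in>I. \<bar>M e i * x i\<bar>)" by (rule sum_abs)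
      also have "\<dots> \<le> (\<Sum>i\<in>I. int B * (int h - 1))"
        unfolding abs_mult using B(1)[OF e] x(1) by (intro sum_mono mult_mono) (auto simp: PiE_iff)
      finally show ?thesis by (simp add: c_def algebra_simps)
    qed
    moreover have "int (card I * B) \<ge> 1" using I1 B(2) by (metis mult_le_mono mult_1 of_nat_1 of_nat_mono)
    ultimately have "- c + 1 \<le> (\<Sum>i\<in>I. M e i * x i) \<and> (\<Sum>i\<in>I. M e i * x i) \<le> c" if "e \<in> E" for e
      using that by fastforce
    then show "y \<in> E \<rightarrow>\<^sub>E {- c + 1..c}" using x(2) by (auto simp: F_def PiE_iff)
  qed
  have "card (E \<rightarrow>\<^sub>E {- c + 1..c}) = (b * h) ^ card E"
  proof -
    have "nat (2 * c) = b * h" unfolding c_def b_def by (simp add: nat_mult_distrib mult_ac)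
    then show ?thesis using fin(1) by (simp add: card_PiE)
  qed
  also have "\<dots> < h ^ card I"
  proof -
    have "b ^ card E < (b + 1) ^ card E" using E1 by (intro power_strict_mono) auto
    also have "\<dots> \<le> (b + 1) ^ (k * (card I - card E))" using k by (intro power_increasing) auto
    also have "\<dots> = h ^ (card I - card E)" by (simp add: h_def power_mult)
    finally have "b ^ card E * h ^ card E < h ^ (card I - card E) * h ^ card E" using h1 by simp
    also have "\<dots> = h ^ card I" using lt by (simp add: power_add[symmetric])
    finally show ?thesis by (simp add: power_mult_distrib)
  qed
  also have "\<dots> = card (I \<rightarrow>\<^sub>E {0..<int h})" using fin(2) by (simp add: card_PiE)
  finally have "\<not> inj_on F (I \<rightarrow>\<^sub>E {0..<int h})"
    using maps fin(1) card_inj_on_le[of F _ "E \<rightarrow>\<^sub>E {- c + 1..c}"] by (metis finite_PiE finite_atLeastAtMost_int linorder_not_less)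
  then obtain x y where xy: "x \<in> I \<rightarrow>\<^sub>E {0..<int h}" "y \<in> I \<rightarrow>\<^sub>E {0..<int h}" "x \<noteq> y" "F x = F y"
    by (auto simp: inj_on_def)
  show thesis
  proof (rule that[of "\<lambda>i. x i - y i"])
    show "\<exists>i\<in>I. x i - y i \<noteq> 0"
    proof (rule ccontr)
      assume "\<not> ?thesis"
      then have "x i = y i" for i using xy(1,2) by (cases "i \<in> I") (auto simp: PiE_iff extensional_def)
      then show False using xy(3) by auto
    qed
    show "\<bar>x i - y i\<bar> \<le> int ((2 * card I * B + 1) ^ k)" if "i \<in> I" for i
      using xy(1,2) that unfolding h_def b_def PiE_iff by fastforce
    show "(\<Sum>i\<in>I. M e i * (x i - y i)) = 0" if "e \<in> E" for e
      using fun_cong[OF xy(4), of e] that by (simp add: F_def algebra_simps sum_subtractf)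
  qed
qed

section \<open>Arithmetic growth conditions\<close>

text \<open>The first class is the growth condition on the coefficients of E-functions. Only the second, much larger one
  contains the rational components of the Taylor coefficients of an E-function at \<open>1\<close>.\<close>

definition etypes :: "'i set \<Rightarrow> ('i \<Rightarrow> rat fps) \<Rightarrow> bool" where
  "etypes I f \<longleftrightarrow> (\<exists>C::nat. \<forall>n. \<exists>d::nat. 1 \<le> d \<and> d \<le> C ^ (n + 1) \<and>
     (\<forall>i\<in>I. \<forall>j\<le>n. \<bar>fact j * f i $ j\<bar> \<le> of_nat C ^ (n + 1) \<and> of_nat d * (fact j * f i $ j) \<in> \<int>))"

abbreviation etype :: "rat fps \<Rightarrow> bool" where "etype f \<equiv> etypes {()} (\<lambda>_. f)"

definition gtypes :: "'i set \<Rightarrow> ('i \<Rightarrow> real fps) \<Rightarrow> bool" where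
  "gtypes I f \<longleftrightarrow> (\<exists>C::nat. \<forall>n. \<exists>d::nat. 1 \<le> d \<and> d \<le> (n + 2) ^ (C * (n + 1)) \<and>
     (\<forall>i\<in>I. \<forall>j\<le>n. \<bar>f i $ j\<bar> \<le> (real n + 2) ^ (C * (n + 1)) \<and> of_nat d * f i $ j \<in> \<int>))"

abbreviation gtype :: "real fps \<Rightarrow> bool" where "gtype f \<equiv> gtypes {()} (\<lambda>_. f)"

lemma etypesE:
  assumes "etypes I f"
  obtains C :: nat and d :: "nat \<Rightarrow> nat" where "C \<ge> 1" "\<And>n. 1 \<le> d n" "\<And>n. d n \<le> C ^ (n + 1)"
    "\<And>i n. i \<in> I \<Longrightarrow> \<bar>fact n * f i $ n\<bar> \<le> of_nat C ^ (n + 1)" "\<And>i n j. i \<in> I \<Longrightarrow> j \<le> n \<Longrightarrow> of_nat (d n) * (fact j * f i $ j) \<in> \<int>"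
proof -
  obtain C :: nat where C: "\<forall>n. \<exists>d::nat. 1 \<le> d \<and> d \<le> C ^ (n + 1) \<and>
     (\<forall>i\<in>I. \<forall>j\<le>n. \<bar>fact j * f i $ j\<bar> \<le> of_nat C ^ (n + 1) \<and> of_nat d * (fact j * f i $ j) \<in> \<int>)"
    using assms by (auto simp: etypes_def)
  from choice[OF C] obtain d where d: "\<forall>n. 1 \<le> d n \<and> d n \<le> C ^ (n + 1) \<and>
     (\<forall>i\<in>I. \<forall>j\<le>n. \<bar>fact j * f i $ j\<bar> \<le> of_nat C ^ (n + 1) \<and> of_nat (d n) * (fact j * f i $ j) \<in> \<int>)" ..
  have "1 \<le> C ^ (0 + 1)" using d[rule_format, of 0] by linarith
  then have "C \<ge> 1" by simp
  with d show thesis by (intro that[of C d]) auto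
qed

lemma etypesI:
  fixes C C' :: nat
  assumes "\<And>n. 1 \<le> d n" "\<And>n. d n \<le> C ^ (n + 1)" "C' \<ge> 1"
    "\<And>i n. i \<in> I \<Longrightarrow> \<bar>fact n * f i $ n\<bar> \<le> of_nat C' ^ (n + 1)" "\<And>i n j. i \<in> I \<Longrightarrow> j \<le> n \<Longrightarrow> of_nat (d n) * (fact j * f i $ j) \<in> \<int>"
  shows "etypes I f"
  unfolding etypes_def
proof (rule exI[of _ "C + C'"], rule allI)
  fix n
  have "\<bar>fact j * f i $ j\<bar> \<le> of_nat (C + C') ^ (n + 1)" if "i \<in> I" "j \<le> n" for i j
  proof -
    have "\<bar>fact j * f i $ j\<bar> \<le> of_nat C' ^ (j + 1)" by (rule assms(4)[OF that(1)])
    also have "\<dots> \<le> of_nat C' ^ (n + 1)" using that assms(3) by (intro power_increasing) auto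
    also have "\<dots> \<le> of_nat (C + C') ^ (n + 1)" by (intro power_mono) auto
    finally show ?thesis .
  qed
  moreover have "d n \<le> (C + C') ^ (n + 1)"
    by (rule order.trans[OF assms(2)]) (intro power_mono, auto)
  ultimately show "\<exists>d::nat. 1 \<le> d \<and> d \<le> (C + C') ^ (n + 1) \<and>
     (\<forall>i\<in>I. \<forall>j\<le>n. \<bar>fact j * f i $ j\<bar> \<le> of_nat (C + C') ^ (n + 1) \<and> of_nat d * (fact j * f i $ j) \<in> \<int>)"
    using assms(1,5) by (intro exI[of _ "d n"]) auto
qed

lemma Ints_mult_dvd: "of_nat a * x \<in> \<int> \<Longrightarrow> of_nat (a * b) * x \<in> (\<int> :: 'a::comm_ring_1 set)"
  by (metis Ints_mult Ints_of_nat mult.commute mult.left_commute of_nat_mult)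

lemma etypes_insert:
  assumes "etypes I f" "etype (f i)"
  shows "etypes (insert i I) f"
proof -
  obtain C1 d1 where 1: "C1 \<ge> 1" "\<And>n. 1 \<le> d1 n" "\<And>n. d1 n \<le> C1 ^ (n + 1)"
    "\<And>i n. i \<in> I \<Longrightarrow> \<bar>fact n * f i $ n\<bar> \<le> of_nat C1 ^ (n + 1)" "\<And>i n j. i \<in> I \<Longrightarrow> j \<le> n \<Longrightarrow> of_nat (d1 n) * (fact j * f i $ j) \<in> \<int>"
    using that by (rule etypesE[OF assms(1)])
  obtain C2 d2 where 2: "C2 \<ge> 1" "\<And>n. 1 \<le> d2 n" "\<And>n. d2 n \<le> C2 ^ (n + 1)"
    "\<And>u n. u \<in> {()} \<Longrightarrow> \<bar>fact n * f i $ n\<bar> \<le> of_nat C2 ^ (n + 1)" "\<And>u n j. u \<in> {()} \<Longrightarrow> j \<le> n \<Longrightarrow> of_nat (d2 n) * (fact j * f i $ j) \<in> \<int>"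
    using that by (rule etypesE[OF assms(2)])
  show ?thesis
  proof (rule etypesI[of "\<lambda>n. d1 n * d2 n" "C1 * C2" "C1 + C2"])
    show "1 \<le> d1 n * d2 n" for n using 1(2)[of n] 2(2)[of n] by (metis mult_le_mono mult_1)
    show "d1 n * d2 n \<le> (C1 * C2) ^ (n + 1)" for n using 1(3)[of n] 2(3)[of n] by (simp only: power_mult_distrib mult_le_mono)
    show "C1 + C2 \<ge> 1" using 1(1) by simp
    have p: "of_nat C1 ^ (n + 1) \<le> (of_nat (C1 + C2) ^ (n + 1) :: rat)" "of_nat C2 ^ (n + 1) \<le> (of_nat (C1 + C2) ^ (n + 1) :: rat)" for n
      by (intro power_mono; simp)+
    show "\<bar>fact n * f j $ n\<bar> \<le> of_nat (C1 + C2) ^ (n + 1)" if "j \<in> insert i I" for j n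
      using that 1(4)[of j n] 2(4)[of "()" n] p[of n] by auto
    show "of_nat (d1 n * d2 n) * (fact j * f k $ j) \<in> \<int>" if "k \<in> insert i I" "j \<le> n" for k n j
    proof (cases "k = i")
      case True
      have "of_nat (d2 n * d1 n) * (fact j * f k $ j) \<in> \<int>" using 2(5)[OF _ that(2)] True by (intro Ints_mult_dvd) auto
      then show ?thesis by (simp only: mult.commute)
    next
      case False
      then show ?thesis using 1(5)[OF _ that(2)] that by (intro Ints_mult_dvd) auto
    qed
  qed
qed

lemma etypes_finite: "finite I \<Longrightarrow> (\<And>i. i \<in> I \<Longrightarrow> etype (f i)) \<Longrightarrow> etypes I f"
proof (induction I rule: finite_induct)
  case empty
  show ?case unfolding etypes_def by (rule exI[of _ 1]) auto
qed (auto intro: etypes_insert)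

lemma etypes_pairE:
  assumes "etype f" "etype g"
  obtains C :: nat and d :: "nat \<Rightarrow> nat" where "C \<ge> 1" "\<And>n. 1 \<le> d n" "\<And>n. d n \<le> C ^ (n + 1)"
    "\<And>n. \<bar>fact n * f $ n\<bar> \<le> of_nat C ^ (n + 1)" "\<And>n. \<bar>fact n * g $ n\<bar> \<le> of_nat C ^ (n + 1)"
    "\<And>n j. j \<le> n \<Longrightarrow> of_nat (d n) * (fact j * f $ j) \<in> \<int>" "\<And>n j. j \<le> n \<Longrightarrow> of_nat (d n) * (fact j * g $ j) \<in> \<int>"
proof -
  have "etypes UNIV (\<lambda>b. if b then f else g)" by (rule etypes_finite) (use assms in \<open>auto split: if_splits\<close>)
  then obtain C d where 1: "C \<ge> 1" "\<And>n. 1 \<le> d n" "\<And>n. d n \<le> C ^ (n + 1)"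
    "\<And>i n. i \<in> UNIV \<Longrightarrow> \<bar>fact n * (if i then f else g) $ n\<bar> \<le> of_nat C ^ (n + 1)"
    "\<And>i n j. i \<in> UNIV \<Longrightarrow> j \<le> n \<Longrightarrow> of_nat (d n) * (fact j * (if i then f else g) $ j) \<in> \<int>"
    using that by (rule etypesE)
  show thesis
    using 1(4)[of True] 1(4)[of False] 1(5)[of True] 1(5)[of False]
    by (intro that[of C d] 1(1,2,3)) auto
qed

lemma etype_add:
  assumes "etype f" "etype g"
  shows "etype (f + g)"
proof -
  obtain C d where 1: "C \<ge> 1" "\<And>n. 1 \<le> d n" "\<And>n. d n \<le> C ^ (n + 1)"
    "\<And>n. \<bar>fact n * f $ n\<bar> \<le> of_nat C ^ (n + 1)" "\<And>n. \<bar>fact n * g $ n\<bar> \<le> of_nat C ^ (n + 1)"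
    "\<And>n j. j \<le> n \<Longrightarrow> of_nat (d n) * (fact j * f $ j) \<in> \<int>" "\<And>n j. j \<le> n \<Longrightarrow> of_nat (d n) * (fact j * g $ j) \<in> \<int>"
    using that by (rule etypes_pairE[OF assms])
  show ?thesis
  proof (rule etypesI[of d C "2 * C"])
    show "\<bar>fact n * (f + g) $ n\<bar> \<le> of_nat (2 * C) ^ (n + 1)" for n
    proof -
      have "\<bar>fact n * (f + g) $ n\<bar> \<le> of_nat C ^ (n + 1) + of_nat C ^ (n + 1)"
        using 1(4)[of n] 1(5)[of n] by (simp add: algebra_simps)
      also have "\<dots> = 2 * of_nat C ^ (n + 1)" by simp
      also have "\<dots> \<le> 2 ^ (n + 1) * of_nat C ^ (n + 1)" by (intro mult_right_mono) auto
      finally show ?thesis by (simp add: power_mult_distrib mult_ac)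
    qed
    show "of_nat (d n) * (fact j * (f + g) $ j) \<in> \<int>" if "j \<le> n" for n j
      using Ints_add[OF 1(6)[OF that] 1(7)[OF that]] by (simp add: algebra_simps)
  qed (use 1(1,2,3) in auto)
qed

text \<open>The sequences \<open>fact n * f $ n\<close> are convolved with binomial coefficients,
  whose sum is \<open>2 ^ n\<close>; growth and denominators remain exponential.\<close>

lemma etype_mult:
  assumes "etype f" "etype g"
  shows "etype (f * g)"
proof -
  obtain C d where 1: "C \<ge> 1" "\<And>n. 1 \<le> d n" "\<And>n. d n \<le> C ^ (n + 1)"
    "\<And>n. \<bar>fact n * f $ n\<bar> \<le> of_nat C ^ (n + 1)" "\<And>n. \<bar>fact n * g $ n\<bar> \<le> of_nat C ^ (n + 1)"
    "\<And>n j. j \<le> n \<Longrightarrow> of_nat (d n) * (fact j * f $ j) \<in> \<int>" "\<And>n j. j \<le> n \<Longrightarrow> of_nat (d n) * (fact j * g $ j) \<in> \<int>"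
    using that by (rule etypes_pairE[OF assms])
  have e: "fact n * (f * g) $ n = (\<Sum>i\<le>n. of_nat (n choose i) * ((fact i * f $ i) * (fact (n - i) * g $ (n - i))))" for n
    unfolding fps_mult_nth atLeast0AtMost sum_distrib_left
    by (intro sum.cong refl) (simp add: binomial_fact)
  show ?thesis
  proof (rule etypesI[of "\<lambda>n. d n * d n" "C * C" "2 * C * C"])
    show "1 \<le> d n * d n" for n using 1(2)[of n] by (metis mult_le_mono mult_1)
    show "d n * d n \<le> (C * C) ^ (n + 1)" for n using 1(3)[of n] by (simp only: power_mult_distrib mult_le_mono)
    show "2 * C * C \<ge> 1" using 1(1) by simp
    show "\<bar>fact n * (f * g) $ n\<bar> \<le> of_nat (2 * C * C) ^ (n + 1)" for n
    proof -
      have "\<bar>fact n * (f * g) $ n\<bar> \<le> (\<Sum>i\<le>n. of_nat (n choose i) * (\<bar>fact i * f $ i\<bar> * \<bar>fact (n - i) * g $ (n - i)\<bar>))"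
        unfolding e by (rule order.trans[OF sum_abs]) (simp add: abs_mult)
      also have "\<dots> \<le> (\<Sum>i\<le>n. of_nat (n choose i) * (of_nat C ^ (n + 1) * of_nat C ^ (n + 1)))"
        using 1(1) by (intro sum_mono mult_left_mono mult_mono order.trans[OF 1(4)] order.trans[OF 1(5)] power_increasing) auto
      also have "\<dots> = of_nat (\<Sum>i\<le>n. n choose i) * (of_nat C ^ (n + 1) * of_nat C ^ (n + 1))"
        by (simp add: sum_distrib_right)
      also have "\<dots> = 2 ^ n * (of_nat C ^ (n + 1) * of_nat C ^ (n + 1))" by (simp add: choose_row_sum)
      also have "\<dots> \<le> 2 ^ (n + 1) * (of_nat C ^ (n + 1) * of_nat C ^ (n + 1))" by (intro mult_right_mono power_increasing) auto
      finally show ?thesis by (simp add: power_mult_distrib mult_ac)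
    qed
    show "of_nat (d n * d n) * (fact j * (f * g) $ j) \<in> \<int>" if "j \<le> n" for n j
    proof -
      have "of_nat (d n * d n) * (fact j * (f * g) $ j) = (\<Sum>i\<le>j. of_nat (j choose i) *
         ((of_nat (d n) * (fact i * f $ i)) * (of_nat (d n) * (fact (j - i) * g $ (j - i)))))"
        unfolding e sum_distrib_left by (intro sum.cong refl) (simp add: mult_ac)
      also have "\<dots> \<in> \<int>" using that by (intro Ints_sum Ints_mult Ints_of_nat 1(6,7)) auto
      finally show ?thesis .
    qed
  qed
qed

text \<open>Differentiation merely shifts the sequence \<open>fact n * f $ n\<close>.\<close>

lemma etype_deriv:
  assumes "etype f"
  shows "etype (fps_deriv f)"
proof -
  obtain C d where 1: "C \<ge> 1" "\<And>n. 1 \<le> d n" "\<And>n. d n \<le> C ^ (n + 1)"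
    "\<And>i n. i \<in> {()} \<Longrightarrow> \<bar>fact n * f $ n\<bar> \<le> of_nat C ^ (n + 1)" "\<And>i n j. i \<in> {()} \<Longrightarrow> j \<le> n \<Longrightarrow> of_nat (d n) * (fact j * f $ j) \<in> \<int>"
    using that by (rule etypesE[OF assms])
  have e: "fact n * fps_deriv f $ n = fact (Suc n) * f $ Suc n" for n by (simp add: algebra_simps)
  have p: "C ^ (Suc n + 1) \<le> (C * C) ^ (n + 1)" for n
  proof -
    have "C ^ (Suc n + 1) \<le> C ^ (2 * (n + 1))" using 1(1) by (intro power_increasing) auto
    then show ?thesis by (simp add: power_mult power2_eq_square)
  qed
  show ?thesis
  proof (rule etypesI[of "\<lambda>n. d (Suc n)" "C * C" "C * C"])
    show "d (Suc n) \<le> (C * C) ^ (n + 1)" for n using 1(3)[of "Suc n"] p[of n] by linarith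
    show "\<bar>fact n * fps_deriv f $ n\<bar> \<le> of_nat (C * C) ^ (n + 1)" for n
    proof -
      have "\<bar>fact n * fps_deriv f $ n\<bar> \<le> of_nat (C ^ (Suc n + 1))" unfolding e using 1(4)[of "()" "Suc n"] by simp
      also have "\<dots> \<le> of_nat ((C * C) ^ (n + 1))" using p[of n] by (simp only: of_nat_le_iff)
      finally show ?thesis by simp
    qed
    show "of_nat (d (Suc n)) * (fact j * fps_deriv f $ j) \<in> \<int>" if "j \<le> n" for n j
      unfolding e using that by (intro 1(5)) auto
  qed (use 1 in auto)
qed

lemma etype_const: "etype (fps_const c)"
proof -
  obtain a b where ab: "quotient_of c = (a, b)" by (cases "quotient_of c") auto
  have b: "b > 0" and c: "c = of_int a / of_int b" using ab quotient_of_denom_pos quotient_of_div by auto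
  have "\<bar>c\<bar> \<le> of_nat (nat \<bar>a\<bar>)"
  proof -
    have "\<bar>c\<bar> = \<bar>of_int a\<bar> / of_int b" using b by (simp add: c)
    also have "\<dots> \<le> \<bar>of_int a\<bar> / 1" using b by (intro divide_left_mono) auto
    finally show ?thesis by simp
  qed
  moreover have "of_nat (nat \<bar>a\<bar>) \<le> (of_nat (nat \<bar>a\<bar> + 1) ^ (n + 1) :: rat)" for n
    using self_le_power[of "of_nat (nat \<bar>a\<bar> + 1) :: rat" "n + 1"] by simp
  ultimately have le: "\<bar>c\<bar> \<le> of_nat (nat \<bar>a\<bar> + 1) ^ (n + 1)" for n by (meson order.trans)
  show ?thesis
  proof (rule etypesI[of "\<lambda>_. nat b" "nat b" "nat \<bar>a\<bar> + 1"])
    show "nat b \<le> nat b ^ (n + 1)" for n using b self_le_power[of "nat b" "n + 1"] by simp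
    show "\<bar>fact n * fps_const c $ n\<bar> \<le> of_nat (nat \<bar>a\<bar> + 1) ^ (n + 1)" for n using le[of n] by (cases "n = 0") auto
    show "of_nat (nat b) * (fact j * fps_const c $ j) \<in> \<int>" for j :: nat using b by (cases "j = 0") (auto simp: c)
  qed (use b in auto)
qed

lemma etype_X: "etype fps_X"
  by (rule etypesI[of "\<lambda>_. 1" 1 1]) (auto simp: fps_X_def)

lemma etype_poly: "etype (fps_of_poly p)"
  by (induction p) (auto simp: fps_of_poly_pCons intro!: etype_add etype_mult etype_X etype_const intro: etype_const[of 0, simplified])

lemma etype_sum: "finite I \<Longrightarrow> (\<And>i. i \<in> I \<Longrightarrow> etype (f i)) \<Longrightarrow> etype (sum f I)"
  by (induction I rule: finite_induct) (auto intro: etype_add etype_const[of 0, simplified])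

section \<open>Closure properties of the class with factorial growth\<close>

lemma gtypesE:
  assumes "gtypes I f"
  obtains C :: nat and d :: "nat \<Rightarrow> nat" where "\<And>n. 1 \<le> d n" "\<And>n. d n \<le> (n + 2) ^ (C * (n + 1))"
    "\<And>i n j. i \<in> I \<Longrightarrow> j \<le> n \<Longrightarrow> \<bar>f i $ j\<bar> \<le> (real n + 2) ^ (C * (n + 1))" "\<And>i n j. i \<in> I \<Longrightarrow> j \<le> n \<Longrightarrow> of_nat (d n) * f i $ j \<in> \<int>"
proof -
  obtain C :: nat where C: "\<forall>n. \<exists>d::nat. 1 \<le> d \<and> d \<le> (n + 2) ^ (C * (n + 1)) \<and>
     (\<forall>i\<in>I. \<forall>j\<le>n. \<bar>f i $ j\<bar> \<le> (real n + 2) ^ (C * (n + 1)) \<and> of_nat d * f i $ j \<in> \<int>)"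
    using assms by (auto simp: gtypes_def)
  from choice[OF C] obtain d where "\<forall>n. 1 \<le> d n \<and> d n \<le> (n + 2) ^ (C * (n + 1)) \<and>
     (\<forall>i\<in>I. \<forall>j\<le>n. \<bar>f i $ j\<bar> \<le> (real n + 2) ^ (C * (n + 1)) \<and> of_nat (d n) * f i $ j \<in> \<int>)" ..
  then show thesis by (intro that[of d C]) auto
qed

lemma gtypesI:
  fixes C C' :: nat
  assumes "\<And>n. 1 \<le> d n" "\<And>n. d n \<le> (n + 2) ^ (C * (n + 1))"
    "\<And>i n j. i \<in> I \<Longrightarrow> j \<le> n \<Longrightarrow> \<bar>f i $ j\<bar> \<le> (real n + 2) ^ (C' * (n + 1))" "\<And>i n j. i \<in> I \<Longrightarrow> j \<le> n \<Longrightarrow> of_nat (d n) * f i $ j \<in> \<int>"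
  shows "gtypes I f"
  unfolding gtypes_def
proof (rule exI[of _ "C + C'"], rule allI)
  fix n
  have "\<bar>f i $ j\<bar> \<le> (real n + 2) ^ ((C + C') * (n + 1))" if "i \<in> I" "j \<le> n" for i j
    by (rule order.trans[OF assms(3)[OF that]]) (intro power_increasing mult_le_mono, auto)
  moreover have "d n \<le> (n + 2) ^ ((C + C') * (n + 1))"
    by (rule order.trans[OF assms(2)]) (intro power_increasing mult_le_mono, auto)
  ultimately show "\<exists>d::nat. 1 \<le> d \<and> d \<le> (n + 2) ^ ((C + C') * (n + 1)) \<and>
     (\<forall>i\<in>I. \<forall>j\<le>n. \<bar>f i $ j\<bar> \<le> (real n + 2) ^ ((C + C') * (n + 1)) \<and> of_nat d * f i $ j \<in> \<int>)"
    using assms(1,4) by (intro exI[of _ "d n"]) auto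
qed

lemma gtypes_insert:
  assumes "gtypes I f" "gtype (f i)"
  shows "gtypes (insert i I) f"
proof -
  obtain C1 d1 where 1: "\<And>n. 1 \<le> d1 n" "\<And>n. d1 n \<le> (n + 2) ^ (C1 * (n + 1))"
    "\<And>i n j. i \<in> I \<Longrightarrow> j \<le> n \<Longrightarrow> \<bar>f i $ j\<bar> \<le> (real n + 2) ^ (C1 * (n + 1))" "\<And>i n j. i \<in> I \<Longrightarrow> j \<le> n \<Longrightarrow> of_nat (d1 n) * f i $ j \<in> \<int>"
    using that by (rule gtypesE[OF assms(1)])
  obtain C2 d2 where 2: "\<And>n. 1 \<le> d2 n" "\<And>n. d2 n \<le> (n + 2) ^ (C2 * (n + 1))"
    "\<And>u n j. u \<in> {()} \<Longrightarrow> j \<le> n \<Longrightarrow> \<bar>f i $ j\<bar> \<le> (real n + 2) ^ (C2 * (n + 1))" "\<And>u n j. u \<in> {()} \<Longrightarrow> j \<le> n \<Longrightarrow> of_nat (d2 n) * f i $ j \<in> \<int>"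
    using that by (rule gtypesE[OF assms(2)])
  show ?thesis
  proof (rule gtypesI[of "\<lambda>n. d1 n * d2 n" "C1 + C2" _ _ "C1 + C2"])
    show "1 \<le> d1 n * d2 n" for n using 1(1)[of n] 2(1)[of n] by (metis mult_le_mono mult_1)
    show "d1 n * d2 n \<le> (n + 2) ^ ((C1 + C2) * (n + 1))" for n
      using mult_le_mono[OF 1(2)[of n] 2(2)[of n]] by (simp only: add_mult_distrib power_add)
    have p: "(real n + 2) ^ (C1 * (n + 1)) \<le> (real n + 2) ^ ((C1 + C2) * (n + 1))"
      "(real n + 2) ^ (C2 * (n + 1)) \<le> (real n + 2) ^ ((C1 + C2) * (n + 1))" for n
      by (intro power_increasing mult_le_mono; simp)+
    show "\<bar>f k $ j\<bar> \<le> (real n + 2) ^ ((C1 + C2) * (n + 1))" if "k \<in> insert i I" "j \<le> n" for k n j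
      using that order.trans[OF 1(3) p(1)] order.trans[OF 2(3) p(2)] by auto
    show "of_nat (d1 n * d2 n) * f k $ j \<in> \<int>" if "k \<in> insert i I" "j \<le> n" for k n j
    proof (cases "k = i")
      case True
      have "of_nat (d2 n * d1 n) * f k $ j \<in> \<int>" using 2(4)[OF _ that(2)] True by (intro Ints_mult_dvd) auto
      then show ?thesis by (simp only: mult.commute)
    next
      case False
      then show ?thesis using 1(4)[OF _ that(2)] that by (intro Ints_mult_dvd) auto
    qed
  qed
qed

lemma gtypes_finite: "finite I \<Longrightarrow> (\<And>i. i \<in> I \<Longrightarrow> gtype (f i)) \<Longrightarrow> gtypes I f"
proof (induction I rule: finite_induct)
  case empty
  show ?case unfolding gtypes_def by (rule exI[of _ 0]) (auto intro!: exI[of _ 1])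
qed (auto intro: gtypes_insert)

lemma gtypes_pairE:
  assumes "gtype f" "gtype g"
  obtains C :: nat and d :: "nat \<Rightarrow> nat" where "\<And>n. 1 \<le> d n" "\<And>n. d n \<le> (n + 2) ^ (C * (n + 1))"
    "\<And>n j. j \<le> n \<Longrightarrow> \<bar>f $ j\<bar> \<le> (real n + 2) ^ (C * (n + 1))" "\<And>n j. j \<le> n \<Longrightarrow> \<bar>g $ j\<bar> \<le> (real n + 2) ^ (C * (n + 1))"
    "\<And>n j. j \<le> n \<Longrightarrow> of_nat (d n) * f $ j \<in> \<int>" "\<And>n j. j \<le> n \<Longrightarrow> of_nat (d n) * g $ j \<in> \<int>"
proof -
  have "gtypes UNIV (\<lambda>b. if b then f else g)" by (rule gtypes_finite) (use assms in \<open>auto split: if_splits\<close>)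
  then obtain C d where 1: "\<And>n. 1 \<le> d n" "\<And>n. d n \<le> (n + 2) ^ (C * (n + 1))"
    "\<And>i n j. i \<in> UNIV \<Longrightarrow> j \<le> n \<Longrightarrow> \<bar>(if i then f else g) $ j\<bar> \<le> (real n + 2) ^ (C * (n + 1))"
    "\<And>i n j. i \<in> UNIV \<Longrightarrow> j \<le> n \<Longrightarrow> of_nat (d n) * (if i then f else g) $ j \<in> \<int>"
    using that by (rule gtypesE)
  show thesis
    using 1(3)[of True] 1(3)[of False] 1(4)[of True] 1(4)[of False]
    by (intro that[of d C] 1(1,2)) auto
qed

lemma gtype_add:
  assumes "gtype f" "gtype g"
  shows "gtype (f + g)"
proof -
  obtain C d where 1: "\<And>n. 1 \<le> d n" "\<And>n. d n \<le> (n + 2) ^ (C * (n + 1))"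
    "\<And>n j. j \<le> n \<Longrightarrow> \<bar>f $ j\<bar> \<le> (real n + 2) ^ (C * (n + 1))" "\<And>n j. j \<le> n \<Longrightarrow> \<bar>g $ j\<bar> \<le> (real n + 2) ^ (C * (n + 1))"
    "\<And>n j. j \<le> n \<Longrightarrow> of_nat (d n) * f $ j \<in> \<int>" "\<And>n j. j \<le> n \<Longrightarrow> of_nat (d n) * g $ j \<in> \<int>"
    using that by (rule gtypes_pairE[OF assms])
  show ?thesis
  proof (rule gtypesI[of d C _ _ "C + 1"])
    show "\<bar>(f + g) $ j\<bar> \<le> (real n + 2) ^ ((C + 1) * (n + 1))" if "j \<le> n" for n j
    proof -
      have "\<bar>(f + g) $ j\<bar> \<le> 2 * (real n + 2) ^ (C * (n + 1))" using 1(3)[OF that] 1(4)[OF that] by simp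
      also have "\<dots> \<le> (real n + 2) ^ (n + 1) * (real n + 2) ^ (C * (n + 1))"
        by (intro mult_right_mono order.trans[OF _ self_le_power[of "real n + 2" "n + 1"]]) auto
      finally show ?thesis by (simp add: power_add[symmetric] algebra_simps)
    qed
    show "of_nat (d n) * (f + g) $ j \<in> \<int>" if "j \<le> n" for n j
      using Ints_add[OF 1(5)[OF that] 1(6)[OF that]] by (simp add: algebra_simps)
  qed (use 1(1,2) in auto)
qed

lemma gtype_mult:
  assumes "gtype f" "gtype g"
  shows "gtype (f * g)"
proof -
  obtain C d where 1: "\<And>n. 1 \<le> d n" "\<And>n. d n \<le> (n + 2) ^ (C * (n + 1))"
    "\<And>n j. j \<le> n \<Longrightarrow> \<bar>f $ j\<bar> \<le> (real n + 2) ^ (C * (n + 1))" "\<And>n j. j \<le> n \<Longrightarrow> \<bar>g $ j\<bar> \<le> (real n + 2) ^ (C * (n + 1))"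
    "\<And>n j. j \<le> n \<Longrightarrow> of_nat (d n) * f $ j \<in> \<int>" "\<And>n j. j \<le> n \<Longrightarrow> of_nat (d n) * g $ j \<in> \<int>"
    using that by (rule gtypes_pairE[OF assms])
  show ?thesis
  proof (rule gtypesI[of "\<lambda>n. d n * d n" "C + C" _ _ "C + C + 1"])
    show "1 \<le> d n * d n" for n using 1(1)[of n] by (metis mult_le_mono mult_1)
    show "d n * d n \<le> (n + 2) ^ ((C + C) * (n + 1))" for n
      using mult_le_mono[OF 1(2)[of n] 1(2)[of n]] by (simp only: add_mult_distrib power_add)
    show "\<bar>(f * g) $ j\<bar> \<le> (real n + 2) ^ ((C + C + 1) * (n + 1))" if "j \<le> n" for n j
    proof -
      have "\<bar>(f * g) $ j\<bar> \<le> (\<Sum>i=0..j. \<bar>f $ i\<bar> * \<bar>g $ (j - i)\<bar>)"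
        unfolding fps_mult_nth by (rule order.trans[OF sum_abs]) (simp add: abs_mult)
      also have "\<dots> \<le> (\<Sum>i=0..j. (real n + 2) ^ (C * (n + 1)) * (real n + 2) ^ (C * (n + 1)))"
        using that by (intro sum_mono mult_mono 1(3,4)) auto
      also have "\<dots> = (real j + 1) * ((real n + 2) ^ (C * (n + 1)) * (real n + 2) ^ (C * (n + 1)))" by simp
      also have "\<dots> \<le> (real n + 2) ^ (n + 1) * ((real n + 2) ^ (C * (n + 1)) * (real n + 2) ^ (C * (n + 1)))"
        using that by (intro mult_right_mono order.trans[OF _ self_le_power[of "real n + 2" "n + 1"]]) auto
      finally show ?thesis by (simp add: power_add[symmetric] algebra_simps)
    qed
    show "of_nat (d n * d n) * (f * g) $ j \<in> \<int>" if "j \<le> n" for n j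
    proof -
      have "of_nat (d n * d n) * (f * g) $ j = (\<Sum>i=0..j. (of_nat (d n) * f $ i) * (of_nat (d n) * g $ (j - i)))"
        unfolding fps_mult_nth sum_distrib_left by (intro sum.cong refl) (simp add: mult_ac)
      also have "\<dots> \<in> \<int>" using that by (intro Ints_sum Ints_mult 1(5,6)) auto
      finally show ?thesis .
    qed
  qed
qed

lemma gtype_const_of_int: "gtype (fps_const (of_int c))"
proof (rule gtypesI[of "\<lambda>_. 1" 0 _ _ "nat \<bar>c\<bar>"])
  fix n j :: nat
  have "\<bar>real_of_int c\<bar> \<le> 2 ^ nat \<bar>c\<bar>"
  proof -
    have "real (nat \<bar>c\<bar>) \<le> 2 ^ nat \<bar>c\<bar>" using of_nat_less_two_power[of "nat \<bar>c\<bar>", where 'a = real] by simp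
    then show ?thesis by simp
  qed
  also have "\<dots> \<le> (real n + 2) ^ nat \<bar>c\<bar>" by (intro power_mono) auto
  also have "\<dots> \<le> (real n + 2) ^ (nat \<bar>c\<bar> * (n + 1))" by (intro power_increasing) auto
  finally show "\<bar>fps_const (real_of_int c) $ j\<bar> \<le> (real n + 2) ^ (nat \<bar>c\<bar> * (n + 1))" by simp
qed auto

lemma gtype_uminus: "gtype f \<Longrightarrow> gtype (- f)"
  using gtype_mult[OF gtype_const_of_int[of "- 1"], of f] by (simp add: fps_const_neg[symmetric] del: fps_const_neg)

lemma gtype_sum: "finite I \<Longrightarrow> (\<And>i. i \<in> I \<Longrightarrow> gtype (f i)) \<Longrightarrow> gtype (sum f I)"
  by (induction I rule: finite_induct) (auto intro: gtype_add gtype_const_of_int[of 0, simplified])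

section \<open>Size of polynomials with factorially scaled integer coefficients\<close>

text \<open>Coefficient \<open>i\<close> is \<open>m! / i!\<close> times an integer of size at most
  \<open>K\<close>. The \<open>i!\<close> matches the denominators in the series of an E-function,
  and the common factor \<open>m!\<close> makes values at 1 integral as soon as \<open>m\<close> is
  at least the degree.\<close>

definition fact_form :: "nat \<Rightarrow> nat \<Rightarrow> rat poly \<Rightarrow> bool" where
  "fact_form m K p \<longleftrightarrow> (\<forall>i. coeff p i * fact i / fact m \<in> \<int> \<and> \<bar>coeff p i * fact i / fact m\<bar> \<le> of_nat K)"

lemma fact_form_mono: "fact_form m K p \<Longrightarrow> K \<le> K' \<Longrightarrow> fact_form m K' p"
  unfolding fact_form_def by (meson of_nat_mono order.trans)

lemma fact_form_add: "fact_form m K p \<Longrightarrow> fact_form m K' r \<Longrightarrow> fact_form m (K + K') (p + r)"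
  unfolding fact_form_def
proof (intro allI conjI)
  fix i
  assume a: "\<forall>i. coeff p i * fact i / fact m \<in> \<int> \<and> \<bar>coeff p i * fact i / fact m\<bar> \<le> of_nat K"
    "\<forall>i. coeff r i * fact i / fact m \<in> \<int> \<and> \<bar>coeff r i * fact i / fact m\<bar> \<le> of_nat K'"
  have e: "coeff (p + r) i * fact i / fact m = coeff p i * fact i / fact m + coeff r i * fact i / fact m"
    by (simp add: algebra_simps add_divide_distrib)
  show "coeff (p + r) i * fact i / fact m \<in> \<int>" unfolding e using a by (intro Ints_add) auto
  show "\<bar>coeff (p + r) i * fact i / fact m\<bar> \<le> of_nat (K + K')"
    unfolding e of_nat_add using a by (intro order.trans[OF abs_triangle_ineq] add_mono) auto
qed

lemma fact_form_0: "fact_form m 0 0" by (simp add: fact_form_def)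

lemma fact_form_sum:
  "finite I \<Longrightarrow> (\<And>i. i \<in> I \<Longrightarrow> fact_form m K (p i)) \<Longrightarrow> fact_form m (card I * K) (sum p I)"
proof (induction I rule: finite_induct)
  case (insert i I)
  then show ?case using fact_form_add[of m K "p i" "card I * K" "sum p I"] by simp
qed (simp add: fact_form_0)

lemma fact_quotient:
  assumes "j \<le> i"
  shows "fact i / fact j \<in> (\<int> :: rat set)" "\<bar>fact i / fact j\<bar> \<le> (of_nat i ^ (i - j) :: rat)"
proof -
  obtain k where k: "(fact i :: nat) = fact j * k" using fact_dvd[OF assms, where 'a = nat] by (auto simp: dvd_def)
  then have "(fact i :: rat) = fact j * of_nat k" by (metis of_nat_fact of_nat_mult)
  then have e: "fact i / (fact j :: rat) = of_nat (fact i div fact j)" using k by simp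
  show "fact i / fact j \<in> (\<int> :: rat set)" unfolding e by simp
  have "fact i div fact (i - (i - j)) \<le> i ^ (i - j)" by (rule fact_div_fact_le_pow) simp
  then have "fact i div fact j \<le> i ^ (i - j)" using assms by simp
  then have "of_nat (fact i div fact j) \<le> (of_nat (i ^ (i - j)) :: rat)" by (simp only: of_nat_le_iff)
  then show "\<bar>fact i / fact j\<bar> \<le> (of_nat i ^ (i - j) :: rat)" unfolding e by simp
qed

text \<open>Raising an exponent from \<open>u - i\<close> to \<open>u\<close> costs
  \<open>u! / (u - i)!\<close>, which is a power of the degree as long as \<open>i\<close> is at
  most \<open>c\<close>.\<close>

lemma fact_form_mult:
  assumes p: "fact_form m K p" "degree p \<le> n" and s: "\<And>i. coeff s i \<in> \<int>" "degree s \<le> c" "\<And>i. \<bar>coeff s i\<bar> \<le> of_nat S"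
  shows "fact_form m ((c + 1) * S * (n + c + 1) ^ c * K) (s * p)"
  unfolding fact_form_def
proof (intro allI conjI)
  fix u
  let ?g = "\<lambda>i. coeff s i * (coeff p (u - i) * fact (u - i) / fact m) * (fact u / fact (u - i))"
  have e: "coeff (s * p) u * fact u / fact m = (\<Sum>i\<le>u. ?g i)"
    unfolding coeff_mult sum_distrib_right sum_divide_distrib by (intro sum.cong refl) simp
  show "coeff (s * p) u * fact u / fact m \<in> \<int>"
    unfolding e using p(1) s(1) by (intro Ints_sum Ints_mult fact_quotient(1)) (auto simp: fact_form_def)
  have b: "\<bar>?g i\<bar> \<le> of_nat (S * K * (n + c + 1) ^ c)" if i: "i \<le> u" for i
  proof (cases "i \<le> c \<and> u - i \<le> n")
    case False
    then have "coeff s i = 0 \<or> coeff p (u - i) = 0" using s(2) p(2) by (auto simp: coeff_eq_0)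
    then have "?g i = 0" by auto
    then show ?thesis by (simp only: abs_zero of_nat_0_le_iff)
  next
    case True
    have "\<bar>?g i\<bar> = \<bar>coeff s i\<bar> * \<bar>coeff p (u - i) * fact (u - i) / fact m\<bar> * \<bar>fact u / fact (u - i)\<bar>"
      by (simp add: abs_mult)
    also have "\<dots> \<le> of_nat S * of_nat K * of_nat u ^ (u - (u - i))"
      using p(1) s(3) by (intro mult_mono fact_quotient(2)) (auto simp: fact_form_def)
    also have "\<dots> = of_nat (S * K * u ^ i)" using i by simp
    also have "u ^ i \<le> (n + c + 1) ^ i" using True by (intro power_mono) auto
    also have "\<dots> \<le> (n + c + 1) ^ c" using True by (intro power_increasing) auto
    finally show ?thesis by (simp add: of_nat_mono del: of_nat_mult of_nat_power)
  qed
  have "\<bar>\<Sum>i\<le>u. ?g i\<bar> = \<bar>\<Sum>i\<in>{..u} \<inter> {..c}. ?g i\<bar>"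
    using s(2) by (intro arg_cong[where f=abs] sum.mono_neutral_right) (auto simp: coeff_eq_0)
  also have "\<dots> \<le> (\<Sum>i\<in>{..u} \<inter> {..c}. \<bar>?g i\<bar>)" by (rule sum_abs)
  also have "\<dots> \<le> of_nat (card ({..u} \<inter> {..c})) * of_nat (S * K * (n + c + 1) ^ c)"
    by (intro sum_bounded_above b) auto
  also have "card ({..u} \<inter> {..c}) \<le> c + 1" using card_mono[of "{..c}" "{..u} \<inter> {..c}"] by simp
  then have "(of_nat (card ({..u} \<inter> {..c})) * of_nat (S * K * (n + c + 1) ^ c) :: rat) \<le> of_nat (c + 1) * of_nat (S * K * (n + c + 1) ^ c)"
    by (intro mult_right_mono) (simp_all only: of_nat_le_iff of_nat_0_le_iff)
  finally show "\<bar>coeff (s * p) u * fact u / fact m\<bar> \<le> of_nat ((c + 1) * S * (n + c + 1) ^ c * K)"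
    unfolding e by (simp only: of_nat_mult mult_ac)
qed

lemma fact_form_euler:
  assumes "fact_form m K p" "degree p \<le> n"
  shows "fact_form m (n * K) (pCons 0 (pderiv p))"
  unfolding fact_form_def
proof (intro allI conjI)
  fix u
  have e: "coeff (pCons 0 (pderiv p)) u * fact u / fact m = of_nat u * (coeff p u * fact u / fact m)"
    by (cases u) (simp_all add: coeff_pderiv)
  show "coeff (pCons 0 (pderiv p)) u * fact u / fact m \<in> \<int>"
    unfolding e using assms by (intro Ints_mult) (auto simp: fact_form_def)
  show "\<bar>coeff (pCons 0 (pderiv p)) u * fact u / fact m\<bar> \<le> of_nat (n * K)"
  proof (cases "u \<le> n")
    case True
    then show ?thesis unfolding e abs_mult of_nat_mult using assms by (intro mult_mono) (auto simp: fact_form_def)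
  next
    case False
    then have "coeff p u = 0" using assms(2) by (simp add: coeff_eq_0)
    then show ?thesis unfolding e by simp
  qed
qed

section \<open>Taylor coefficients at 1 of scaled polynomials\<close>

lemma shift_poly_pCons: "shift_poly (pCons c p) = fps_const (of_rat c) + (1 + fps_X) * shift_poly p"
proof -
  have "map_poly (of_rat :: rat \<Rightarrow> real) (pCons c p) = pCons (of_rat c) (map_poly of_rat p)"
    by (rule poly_eqI) (simp add: coeff_map_poly coeff_pCons split: nat.split)
  then show ?thesis
    by (simp add: shift_poly_def pcompose_pCons fps_of_poly_add fps_of_poly_mult fps_of_poly_pCons algebra_simps fps_of_poly_smult)
qed

lemma shift_poly_nth:
  assumes "degree p \<le> m"
  shows "shift_poly p $ k = (\<Sum>i\<le>m. of_rat (coeff p i) * real (i choose k))"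
proof -
  have b: "((1 + fps_X) ^ i :: real fps) $ k = real (i choose k)" for i k
  proof (induction i arbitrary: k)
    case 0
    then show ?case by (cases k) auto
  next
    case (Suc i)
    then show ?case by (cases k) (simp_all add: distrib_right)
  qed
  have "shift_poly (monom c i) = fps_const (of_rat c) * (1 + fps_X) ^ i" for c i
    by (induction i) (simp_all add: monom_0 monom_Suc shift_poly_pCons mult_ac)
  then have m: "shift_poly (monom c i) $ k = of_rat c * real (i choose k)" for c i k by (simp add: b)
  have "p = (\<Sum>i\<le>m. monom (coeff p i) i)" using assms by (intro poly_eqI) (auto simp: coeff_sum coeff_eq_0)
  then have "shift_poly p = shift_poly (\<Sum>i\<le>m. monom (coeff p i) i)" by (rule arg_cong)
  then have "shift_poly p = (\<Sum>i\<le>m. shift_poly (monom (coeff p i) i))" by (simp only: shift_poly_sum)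
  then show ?thesis by (simp add: fps_sum_nth m)
qed

lemma sum_pow_div_fact_le: "(\<Sum>i\<le>m. x ^ i / fact i) \<le> exp (x::real)" if "x \<ge> 0"
proof -
  have "(\<Sum>i<Suc m. inverse (fact i) *\<^sub>R x ^ i) \<le> exp x"
    unfolding exp_def using that by (intro sum_le_suminf summable_exp_generic) auto
  then show ?thesis by (simp add: lessThan_Suc_atMost divide_inverse mult.commute)
qed

text \<open>For \<open>i\<close> up to \<open>m\<close> the quotient \<open>m! / i!\<close> is an
  integer. For the size, the binomial coefficients are at most \<open>2 ^ i\<close>, and the sum of
  \<open>2 ^ i / i!\<close> is at most \<open>exp 2\<close>, whence the constant 9.\<close>

lemma shift_poly_fact_form:
  assumes "fact_form m K p" "degree p \<le> m"
  shows "shift_poly p $ k \<in> \<int>" "\<bar>shift_poly p $ k\<bar> \<le> 9 * real K * fact m"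
proof -
  have c: "of_rat (coeff p i) = real_of_rat (coeff p i * fact i / fact m) * (fact m / fact i)" for i
    using of_rat_of_nat_eq[of "fact i", where 'a = real] of_rat_of_nat_eq[of "fact m", where 'a = real]
    by (simp add: of_rat_mult of_rat_divide)
  have I: "real_of_rat x \<in> \<int>" if "x \<in> \<int>" for x using that by (auto elim!: Ints_cases)
  have fq: "(fact m / fact i :: real) \<in> \<int>" if "i \<le> m" for i
    using I[OF fact_quotient(1)[OF that]] of_rat_of_nat_eq[of "fact i", where 'a = real] of_rat_of_nat_eq[of "fact m", where 'a = real]
    by (simp add: of_rat_divide)
  show "shift_poly p $ k \<in> \<int>"
    unfolding shift_poly_nth[OF assms(2)] c using assms(1)
    by (intro Ints_sum Ints_mult I fq) (auto simp: fact_form_def)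
  have cb: "\<bar>real_of_rat (coeff p i * fact i / fact m)\<bar> \<le> real K" for i
  proof -
    have "\<bar>coeff p i * fact i / fact m\<bar> \<le> of_nat K" using assms(1) by (auto simp: fact_form_def)
    then have "real_of_rat \<bar>coeff p i * fact i / fact m\<bar> \<le> real_of_rat (of_nat K)" by (simp only: of_rat_less_eq)
    then show ?thesis by (simp add: abs_of_rat[symmetric] del: of_rat_divide of_rat_mult)
  qed
  have "\<bar>shift_poly p $ k\<bar> \<le> (\<Sum>i\<le>m. \<bar>real_of_rat (coeff p i * fact i / fact m)\<bar> * (fact m / fact i) * real (i choose k))"
    unfolding shift_poly_nth[OF assms(2)] c by (rule order.trans[OF sum_abs]) (simp add: abs_mult)
  also have "\<dots> \<le> (\<Sum>i\<le>m. real K * (fact m / fact i) * 2 ^ i)"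
  proof (intro sum_mono mult_mono cb)
    fix i
    have "i choose k \<le> 2 ^ i" using binomial_le_pow2 by simp
    then show "real (i choose k) \<le> 2 ^ i" by (metis of_nat_le_numeral_power_cancel_iff of_nat_numeral of_nat_power)
  qed auto
  also have "\<dots> = real K * fact m * (\<Sum>i\<le>m. 2 ^ i / fact i)" by (simp add: sum_distrib_left mult_ac)
  also have "\<dots> \<le> real K * fact m * exp 2" by (intro mult_left_mono sum_pow_div_fact_le) auto
  also have "exp (2::real) \<le> 9"
  proof -
    have "exp (2::real) = exp 1 * exp 1" by (simp add: exp_add[symmetric])
    also have "\<dots> \<le> 3 * 3" using exp_le by (intro mult_mono) auto
    finally show ?thesis by simp
  qed
  then have "real K * fact m * exp 2 \<le> real K * fact m * 9" by (intro mult_left_mono) auto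
  finally show "\<bar>shift_poly p $ k\<bar> \<le> 9 * real K * fact m" by (simp add: mult_ac)
qed

section \<open>Taylor expansion at \<open>1\<close> of entire power series\<close>

definition entire_bound :: "rat fps \<Rightarrow> real \<Rightarrow> real \<Rightarrow> bool" where
  "entire_bound f B c \<longleftrightarrow> (\<forall>u. \<bar>real_of_rat (f $ u)\<bar> \<le> B * c ^ u / fact u)"

text \<open>Taylor expansion at 1 of the entire function given by \<open>f\<close> at 0. Each
  coefficient is an infinite sum, with a sensible value under \<open>entire_bound\<close>.\<close>

definition shift_fps :: "rat fps \<Rightarrow> real fps" where
  "shift_fps f = Abs_fps (\<lambda>k. \<Sum>u. of_rat (f $ u) * real (u choose k))"

lemma entire_bound_etype: "etype f \<Longrightarrow> \<exists>B c. B \<ge> 0 \<and> c \<ge> 1 \<and> entire_bound f B c"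
proof -
  assume f: "etype f"
  obtain C d where 1: "C \<ge> 1" "\<And>n. 1 \<le> d n" "\<And>n. d n \<le> C ^ (n + 1)"
    "\<And>i n. i \<in> {()} \<Longrightarrow> \<bar>fact n * f $ n\<bar> \<le> of_nat C ^ (n + 1)" "\<And>i n j. i \<in> {()} \<Longrightarrow> j \<le> n \<Longrightarrow> of_nat (d n) * (fact j * f $ j) \<in> \<int>"
    using that by (rule etypesE[OF f])
  have "entire_bound f (real C) (real C)"
    unfolding entire_bound_def
  proof
    fix u
    have fu: "real_of_rat (fact u) = fact u" using of_rat_of_nat_eq[of "fact u", where 'a = real] by simp
    have "\<bar>fact u * f $ u\<bar> \<le> of_nat C ^ (u + 1)" by (rule 1(4)) simp
    then have "real_of_rat \<bar>fact u * f $ u\<bar> \<le> real_of_rat (of_nat C ^ (u + 1))" by (simp only: of_rat_less_eq)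
    then have "fact u * \<bar>real_of_rat (f $ u)\<bar> \<le> real C ^ (u + 1)"
      unfolding abs_of_rat[symmetric] of_rat_mult of_rat_power of_rat_of_nat_eq abs_mult fu by simp
    then show "\<bar>real_of_rat (f $ u)\<bar> \<le> real C * real C ^ u / fact u" by (simp add: field_simps)
  qed
  then show ?thesis using 1(1) by (intro exI[of _ "real C"]) auto
qed

lemma shift_summable:
  assumes "entire_bound f B c"
  shows "summable (\<lambda>u. of_rat (f $ u) * real (u choose k))" "summable (\<lambda>u. \<bar>real_of_rat (f $ u) * real (u choose k)\<bar>)"
proof -
  have le: "norm (\<bar>real_of_rat (f $ u) * real (u choose k)\<bar>) \<le> B * (inverse (fact u) *\<^sub>R (2 * c) ^ u)" for u
  proof -
    have B: "B * c ^ u / fact u \<ge> 0" using assms unfolding entire_bound_def by (meson abs_ge_zero order.trans)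
    have "\<bar>real_of_rat (f $ u)\<bar> * real (u choose k) \<le> (B * c ^ u / fact u) * 2 ^ u"
    proof (intro mult_mono)
      have "u choose k \<le> 2 ^ u" using binomial_le_pow2 by simp
      then show "real (u choose k) \<le> 2 ^ u" by (metis of_nat_le_numeral_power_cancel_iff of_nat_numeral of_nat_power)
    qed (use assms B in \<open>auto simp: entire_bound_def\<close>)
    then show ?thesis by (simp add: abs_mult power_mult_distrib field_simps)
  qed
  have s: "summable (\<lambda>u. B * (inverse (fact u) *\<^sub>R (2 * c) ^ u))" by (intro summable_mult summable_exp_generic)
  show "summable (\<lambda>u. \<bar>real_of_rat (f $ u) * real (u choose k)\<bar>)" by (rule summable_comparison_test[OF _ s]) (use le in auto)
  then show "summable (\<lambda>u. of_rat (f $ u) * real (u choose k))" by (rule summable_rabs_cancel)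
qed

lemma shift_etype_summable:
  assumes "etype f"
  shows "summable (\<lambda>u. of_rat (f $ u) * real (u choose k))"
  using entire_bound_etype[OF assms] by (auto intro: shift_summable(1))

lemma shift_fps_nth_sums: "etype f \<Longrightarrow> (\<lambda>u. of_rat (f $ u) * real (u choose k)) sums (shift_fps f $ k)"
  unfolding shift_fps_def using shift_etype_summable by (simp add: summable_sums)

lemma shift_fps_add:
  assumes "etype f" "etype g"
  shows "shift_fps (f + g) = shift_fps f + shift_fps g"
proof (rule fps_ext)
  fix k
  have "(\<lambda>u. of_rat (f $ u) * real (u choose k) + of_rat (g $ u) * real (u choose k)) sums (shift_fps f $ k + shift_fps g $ k)"
    by (intro sums_add shift_fps_nth_sums assms)
  then have "(\<lambda>u. of_rat ((f + g) $ u) * real (u choose k)) sums (shift_fps f $ k + shift_fps g $ k)"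
    by (simp add: of_rat_add algebra_simps)
  from sums_unique2[OF shift_fps_nth_sums[OF etype_add[OF assms]] this]
  show "shift_fps (f + g) $ k = (shift_fps f + shift_fps g) $ k" by simp
qed

text \<open>Pascal's rule. With additivity it yields multiplication by every polynomial, the only
  products that occur under the expansion.\<close>

lemma shift_fps_X_mult:
  assumes "etype f"
  shows "shift_fps (fps_X * f) = (1 + fps_X) * shift_fps f"
proof (rule fps_ext)
  fix k
  have "(\<lambda>u. of_rat ((fps_X * f) $ Suc u) * real (Suc u choose k)) sums (((1 + fps_X) * shift_fps f) $ k)"
  proof (cases k)
    case 0
    then show ?thesis using shift_fps_nth_sums[OF assms, of 0] by (simp add: distrib_right)
  next
    case (Suc k')
    have "(\<lambda>u. of_rat (f $ u) * real (u choose k') + of_rat (f $ u) * real (u choose k)) sums (shift_fps f $ k' + shift_fps f $ k)"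
      by (intro sums_add shift_fps_nth_sums assms)
    then show ?thesis using Suc by (simp add: distrib_left distrib_right add.commute)
  qed
  then have "(\<lambda>u. of_rat ((fps_X * f) $ u) * real (u choose k)) sums (((1 + fps_X) * shift_fps f) $ k)"
    by (subst (asm) sums_Suc_iff) simp
  from sums_unique2[OF shift_fps_nth_sums[OF etype_mult[OF etype_X assms]] this]
  show "shift_fps (fps_X * f) $ k = ((1 + fps_X) * shift_fps f) $ k" .
qed

lemma shift_fps_const_mult:
  assumes "etype f"
  shows "shift_fps (fps_const c * f) = fps_const (of_rat c) * shift_fps f"
proof (rule fps_ext)
  fix k
  have "(\<lambda>u. of_rat c * (of_rat (f $ u) * real (u choose k))) sums (of_rat c * shift_fps f $ k)"
    by (intro sums_mult shift_fps_nth_sums assms)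
  then have "(\<lambda>u. of_rat ((fps_const c * f) $ u) * real (u choose k)) sums (of_rat c * shift_fps f $ k)"
    by (simp add: of_rat_mult mult.assoc)
  from sums_unique2[OF shift_fps_nth_sums[OF etype_mult[OF etype_const assms]] this]
  show "shift_fps (fps_const c * f) $ k = (fps_const (of_rat c) * shift_fps f) $ k" by simp
qed

lemma shift_fps_0 [simp]: "shift_fps 0 = 0" by (simp add: shift_fps_def fps_eq_iff)

lemma shift_fps_poly_mult:
  assumes "etype f"
  shows "shift_fps (fps_of_poly p * f) = shift_poly p * shift_fps f"
proof (induction p)
  case (pCons c p)
  have e: "fps_of_poly (pCons c p) * f = fps_const c * f + fps_X * (fps_of_poly p * f)"
    by (simp add: fps_of_poly_pCons algebra_simps)
  have "etype (fps_of_poly p * f)" by (intro etype_mult etype_poly assms)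
  then show ?case unfolding e using pCons assms
    by (simp only: shift_fps_add[OF etype_mult[OF etype_const] etype_mult[OF etype_X]] shift_fps_X_mult shift_fps_const_mult
      shift_poly_pCons distrib_right mult.assoc)
qed simp

lemma shift_fps_poly: "shift_fps (fps_of_poly p) = shift_poly p"
proof -
  have "shift_fps (fps_of_poly p * 1) = shift_poly p * shift_fps 1"
    by (rule shift_fps_poly_mult) (use etype_const[of 1] in simp)
  moreover have "shift_fps 1 = 1"
  proof (rule fps_ext)
    fix k
    have "(\<lambda>u. of_rat ((1::rat fps) $ u) * real (u choose k)) sums (\<Sum>u\<in>{0}. of_rat ((1::rat fps) $ u) * real (u choose k))"
      by (rule sums_finite) auto
    then show "shift_fps 1 $ k = 1 $ k" by (cases k) (auto simp: shift_fps_def sums_iff)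
  qed
  ultimately show ?thesis by simp
qed

lemma shift_fps_sum: "finite I \<Longrightarrow> (\<And>i. i \<in> I \<Longrightarrow> etype (f i)) \<Longrightarrow> shift_fps (sum f I) = (\<Sum>i\<in>I. shift_fps (f i))"
  by (induction I rule: finite_induct) (auto simp: shift_fps_add etype_sum)

lemma shift_fps_deriv:
  assumes "etype f"
  shows "shift_fps (fps_deriv f) = fps_deriv (shift_fps f)"
proof (rule fps_ext)
  fix k
  have b: "real (Suc u) * real (u choose k) = real (Suc k) * real (Suc u choose Suc k)" for u
  proof -
    have "Suc u * (u choose k) = Suc k * (Suc u choose Suc k)" by (subst Suc_times_binomial_eq) (rule mult.commute)
    then have "real (Suc u * (u choose k)) = real (Suc k * (Suc u choose Suc k))" by (rule arg_cong)
    then show ?thesis by (simp only: of_nat_mult)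
  qed
  have dn: "fps_deriv g $ u = of_nat (Suc u) * g $ Suc u" for g :: "'a::comm_ring_1 fps" and u by simp
  have "(\<lambda>u. of_rat (f $ u) * real (u choose Suc k)) sums (shift_fps f $ Suc k)" by (rule shift_fps_nth_sums[OF assms])
  then have "(\<lambda>u. of_rat (f $ Suc u) * real (Suc u choose Suc k)) sums (shift_fps f $ Suc k)"
    by (subst sums_Suc_iff) simp
  then have "(\<lambda>u. real (Suc k) * (of_rat (f $ Suc u) * real (Suc u choose Suc k))) sums (real (Suc k) * shift_fps f $ Suc k)"
    by (rule sums_mult)
  also have "(\<lambda>u. real (Suc k) * (of_rat (f $ Suc u) * real (Suc u choose Suc k))) = (\<lambda>u. of_rat (fps_deriv f $ u) * real (u choose k))"
  proof
    fix u
    have "real (Suc k) * (of_rat (f $ Suc u) * real (Suc u choose Suc k)) = of_rat (f $ Suc u) * (real (Suc u) * real (u choose k))"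
      unfolding b by (simp only: mult_ac)
    then show "real (Suc k) * (of_rat (f $ Suc u) * real (Suc u choose Suc k)) = of_rat (fps_deriv f $ u) * real (u choose k)"
      unfolding dn of_rat_mult of_rat_of_nat_eq by (simp only: mult_ac)
  qed
  finally show "shift_fps (fps_deriv f) $ k = fps_deriv (shift_fps f) $ k"
    using shift_fps_nth_sums[OF etype_deriv[OF assms], of k] unfolding dn by (simp only: sums_iff)
qed

text \<open>Only the terms from \<open>s\<close> on contribute; they are at most
  \<open>(2 * c)^u / u!\<close> up to \<open>B\<close>, the 2 coming from
  \<open>u choose k \<le> 2 ^ u\<close>. The decisive gain over the height is the factor
  \<open>1 / s!\<close>.\<close>

lemma shift_fps_small:
  assumes b: "entire_bound f B c" "B \<ge> 0" "c \<ge> 0" and s: "fps_X ^ s dvd f"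
  shows "\<bar>shift_fps f $ k\<bar> \<le> B * (2 * c) ^ s / fact s * exp (2 * c)"
proof -
  let ?t = "\<lambda>u. \<bar>real_of_rat (f $ u) * real (u choose k)\<bar>"
  have le: "?t u \<le> B * (2 * c) ^ u / fact u" for u
  proof -
    have "\<bar>real_of_rat (f $ u)\<bar> * real (u choose k) \<le> (B * c ^ u / fact u) * 2 ^ u"
    proof (intro mult_mono)
      have "u choose k \<le> 2 ^ u" using binomial_le_pow2 by simp
      then show "real (u choose k) \<le> 2 ^ u" by (metis of_nat_le_numeral_power_cancel_iff of_nat_numeral of_nat_power)
    qed (use b in \<open>auto simp: entire_bound_def\<close>)
    then show ?thesis by (simp add: abs_mult power_mult_distrib field_simps)
  qed
  have sm: "summable ?t" by (rule shift_summable(2)[OF b(1)])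
  have z: "?t u = 0" if "u < s" for u using s that unfolding fps_X_power_dvd_iff by simp
  have ex: "(\<lambda>v. B * (2 * c) ^ s / fact s * (inverse (fact v) *\<^sub>R (2 * c) ^ v)) sums (B * (2 * c) ^ s / fact s * exp (2 * c))"
    by (intro sums_mult exp_converges)
  have "\<bar>shift_fps f $ k\<bar> \<le> (\<Sum>u. ?t u)" unfolding shift_fps_def using summable_rabs[OF sm] by simp
  also have "\<dots> = (\<Sum>v. ?t (v + s)) + (\<Sum>u<s. ?t u)" by (rule suminf_split_initial_segment[OF sm])
  also have "(\<Sum>u<s. ?t u) = 0" using z by (intro sum.neutral) auto
  also have "(\<Sum>v. ?t (v + s)) \<le> (\<Sum>v. B * (2 * c) ^ s / fact s * (inverse (fact v) *\<^sub>R (2 * c) ^ v))"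
  proof (rule suminf_le)
    show "summable (\<lambda>v. ?t (v + s))" using sm by (subst summable_iff_shift)
    show "summable (\<lambda>v. B * (2 * c) ^ s / fact s * (inverse (fact v) *\<^sub>R (2 * c) ^ v))" using ex by (simp add: sums_iff)
    fix v
    have "fact s * fact v \<le> (fact (v + s) :: real)"
    proof -
      have "fact s * fact v dvd (fact (s + v) :: nat)" by (rule fact_fact_dvd_fact)
      then have "fact s * fact v \<le> (fact (s + v) :: nat)" by (rule dvd_imp_le) simp
      then have "real (fact s * fact v) \<le> real (fact (s + v))" by (simp only: of_nat_le_iff)
      then show ?thesis by (simp add: add.commute)
    qed
    then have "B * (2 * c) ^ (v + s) / fact (v + s) \<le> B * (2 * c) ^ (v + s) / (fact s * fact v)"
      using b by (intro divide_left_mono mult_nonneg_nonneg) auto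
    also have "\<dots> = B * (2 * c) ^ s / fact s * (inverse (fact v) *\<^sub>R (2 * c) ^ v)"
      by (simp add: power_add field_simps)
    finally show "?t (v + s) \<le> B * (2 * c) ^ s / fact s * (inverse (fact v) *\<^sub>R (2 * c) ^ v)" using le[of "v + s"] by linarith
  qed
  also have "\<dots> = B * (2 * c) ^ s / fact s * exp (2 * c)" using ex by (simp add: sums_iff)
  finally show ?thesis by simp
qed

section \<open>Auxiliary forms of small height\<close>

text \<open>Quantities that \<open>s powr (\<epsilon> * s)\<close> eventually exceeds for every
  positive \<epsilon>, hence negligible beside factorials.\<close>

definition expb :: "(nat \<Rightarrow> real) \<Rightarrow> bool" where
  "expb f \<longleftrightarrow> (\<exists>C\<ge>1. \<forall>s. \<bar>f s\<bar> \<le> C ^ (s + 1))"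

lemma expb_mono: "expb g \<Longrightarrow> (\<And>s. \<bar>f s\<bar> \<le> \<bar>g s\<bar>) \<Longrightarrow> expb f"
  unfolding expb_def by (meson order.trans)

lemma expb_mult:
  assumes "expb f" "expb g"
  shows "expb (\<lambda>s. f s * g s)"
proof -
  obtain C where C: "C \<ge> 1" "\<And>s. \<bar>f s\<bar> \<le> C ^ (s + 1)" using assms(1) by (auto simp: expb_def)
  obtain C' where C': "C' \<ge> 1" "\<And>s. \<bar>g s\<bar> \<le> C' ^ (s + 1)" using assms(2) by (auto simp: expb_def)
  have "\<bar>f s * g s\<bar> \<le> (C * C') ^ (s + 1)" for s
    unfolding abs_mult power_mult_distrib using C C' by (intro mult_mono) auto
  moreover have "C * C' \<ge> 1" using mult_mono[of 1 C 1 C'] C(1) C'(1) by simp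
  ultimately show ?thesis unfolding expb_def by blast
qed

lemma expb_add:
  assumes "expb f" "expb g"
  shows "expb (\<lambda>s. f s + g s)"
proof -
  obtain C where C: "C \<ge> 1" "\<And>s. \<bar>f s\<bar> \<le> C ^ (s + 1)" using assms(1) by (auto simp: expb_def)
  obtain C' where C': "C' \<ge> 1" "\<And>s. \<bar>g s\<bar> \<le> C' ^ (s + 1)" using assms(2) by (auto simp: expb_def)
  have "\<bar>f s + g s\<bar> \<le> (C + C') ^ (s + 1)" for s
  proof -
    have "C ^ s * C \<le> (C + C') ^ s * C" "C' ^ s * C' \<le> (C + C') ^ s * C'"
      using C C' by (intro mult_right_mono power_mono; simp)+
    then have "C ^ (s + 1) + C' ^ (s + 1) \<le> (C + C') ^ (s + 1)" by (simp add: algebra_simps)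
    then show ?thesis using C(2)[of s] C'(2)[of s] by linarith
  qed
  then show ?thesis unfolding expb_def using C(1) C'(1) by (intro exI[of _ "C + C'"]) auto
qed

lemma expb_const: "expb (\<lambda>_. c)"
proof -
  have "\<bar>c\<bar> \<le> (\<bar>c\<bar> + 1) ^ (s + 1)" for s
    using self_le_power[of "\<bar>c\<bar> + 1" "s + 1"] by simp
  then show ?thesis unfolding expb_def by (intro exI[of _ "\<bar>c\<bar> + 1"]) auto
qed

lemma expb_power: "expb f \<Longrightarrow> expb (\<lambda>s. f s ^ k)"
  by (induction k) (auto intro: expb_const expb_mult)

lemma expb_geom: "expb (\<lambda>s. c ^ s)"
proof -
  have "\<bar>c ^ s\<bar> \<le> (\<bar>c\<bar> + 1) ^ (s + 1)" for s
  proof -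
    have "\<bar>c ^ s\<bar> \<le> (\<bar>c\<bar> + 1) ^ s" unfolding power_abs by (intro power_mono) auto
    also have "\<dots> \<le> (\<bar>c\<bar> + 1) ^ (s + 1)" by (intro power_increasing) auto
    finally show ?thesis .
  qed
  then show ?thesis unfolding expb_def by (intro exI[of _ "\<bar>c\<bar> + 1"]) auto
qed

lemma expb_real: "expb real"
proof -
  have "real s \<le> 2 ^ (s + 1)" for s
  proof -
    have "real s \<le> 2 ^ s" using of_nat_less_two_power[of s, where 'a = real] by (simp add: less_imp_le)
    also have "\<dots> \<le> 2 ^ (s + 1)" by (intro power_increasing) auto
    finally show ?thesis .
  qed
  then show ?thesis unfolding expb_def by (intro exI[of _ 2]) auto
qed

lemma expb_linear:
  assumes "x \<ge> 0"
  shows "expb (\<lambda>s. real (nat \<lceil>x * real s\<rceil> + c))"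
proof (rule expb_mono)
  show "expb (\<lambda>s. x * real s + (1 + real c))" by (intro expb_add expb_mult expb_const expb_real)
  show "\<bar>real (nat \<lceil>x * real s\<rceil> + c)\<bar> \<le> \<bar>x * real s + (1 + real c)\<bar>" for s
  proof -
    define N where "N = nat \<lceil>x * real s\<rceil>"
    have "real N \<le> x * real s + 1" using assms unfolding N_def by (simp add: of_nat_nat)
    then show ?thesis using assms unfolding N_def[symmetric] by simp
  qed
qed

lemma common_denominator:
  fixes F :: "rat set"
  assumes "finite F"
  shows "\<exists>t::nat. t \<ge> 1 \<and> (\<forall>x\<in>F. of_nat t * x \<in> \<int>)"
  using assms
proof (induction F rule: finite_induct)
  case (insert x F)
  then obtain t where t: "t \<ge> 1" "\<forall>x\<in>F. of_nat t * x \<in> (\<int> :: rat set)" by auto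
  obtain a b where ab: "quotient_of x = (a, b)" by (cases "quotient_of x") auto
  have b: "b > 0" and x: "x = of_int a / of_int b" using ab quotient_of_denom_pos quotient_of_div by auto
  have "of_nat (t * nat b) * x = of_int (int t * a)" using b by (simp add: x)
  then have "of_nat (t * nat b) * x \<in> \<int>" by (simp only: Ints_of_int)
  moreover have "of_nat (t * nat b) * y \<in> \<int>" if "y \<in> F" for y using t that by (intro Ints_mult_dvd) auto
  ultimately show ?case using t b by (intro exI[of _ "t * nat b"]) auto
qed auto

lemma poly_coeff_bound:
  fixes F :: "rat poly set"
  assumes "finite F"
  obtains S :: nat where "\<And>p i. p \<in> F \<Longrightarrow> \<bar>coeff p i\<bar> \<le> of_nat S"
proof -
  define N where "N = Max (insert 0 ((\<lambda>p. Max ((\<lambda>i. \<bar>coeff p i\<bar>) ` {..degree p})) ` F))"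
  have "\<bar>coeff p i\<bar> \<le> of_nat (nat \<lceil>N\<rceil>)" if p: "p \<in> F" for p i
  proof -
    have N: "Max ((\<lambda>i. \<bar>coeff p i\<bar>) ` {..degree p}) \<le> N" "0 \<le> N"
      unfolding N_def using assms p by (intro Max_ge; auto)+
    have "\<bar>coeff p i\<bar> \<le> N"
    proof (cases "i \<le> degree p")
      case True
      then have "\<bar>coeff p i\<bar> \<le> Max ((\<lambda>i. \<bar>coeff p i\<bar>) ` {..degree p})" by (intro Max_ge) auto
      then show ?thesis using N by linarith
    qed (use N in \<open>simp add: coeff_eq_0\<close>)
    also have "N \<le> of_nat (nat \<lceil>N\<rceil>)" using N(2) by (simp add: of_nat_nat)
    finally show ?thesis .
  qed
  then show thesis by (rule that)
qed

text \<open>The factor z of \<open>q\<close> allows the derivation to be written with the Euler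
  operator; integrality of \<open>T\<close> and of the matrix of \<open>D\<close> means that no
  denominators arise under derivation.\<close>

locale pade_arith = pade A q D z0 L G for A :: "'a set" and q D z0 and L :: "'l set" and G +
  fixes T :: "rat poly"
  assumes etG: "\<And>l a. l \<in> L \<Longrightarrow> a \<in> A \<Longrightarrow> etype (G l a)"
    and q_eq: "q = pCons 0 T" and T_int: "\<And>i. coeff T i \<in> \<int>"
    and D_int: "\<And>a b i. b \<in> A \<Longrightarrow> coeff (D (unit_vec b) a) i \<in> \<int>"
begin

lemma etype_remd: "l \<in> L \<Longrightarrow> etype (remd x l)"
  unfolding remd_def using finA by (intro etype_sum etype_mult etype_poly etG) auto

text \<open>The derivation is made of the Euler operator and of products with fixed integral
  polynomials, each of which enlarges the height by a power of the degree only.\<close>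

lemma fact_form_D:
  "\<exists>\<kappa>. \<forall>n m K x. x \<in> vecs \<longrightarrow> (\<forall>a. degree (x a) \<le> n) \<longrightarrow> (\<forall>a. fact_form m K (x a)) \<longrightarrow>
     (\<forall>a. fact_form m (\<kappa> * (n + \<kappa>) ^ \<kappa> * K) (D x a))"
proof -
  define F where "F = insert T ((\<lambda>(b, a). D (unit_vec b) a) ` (A \<times> A))"
  have fF: "finite F" using finA by (simp add: F_def)
  obtain S :: nat where S: "\<And>p i. p \<in> F \<Longrightarrow> \<bar>coeff p i\<bar> \<le> of_nat S" using that by (rule poly_coeff_bound[OF fF])
  define c where "c = Max (degree ` F)"
  have c: "degree p \<le> c" if "p \<in> F" for p unfolding c_def using fF that by (intro Max_ge) auto
  define k where "k = (c + 1) * S"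
  define \<kappa> where "\<kappa> = k * (1 + card A) + c + 2"
  have "fact_form m (\<kappa> * (n + \<kappa>) ^ \<kappa> * K) (D x a)"
    if x: "x \<in> vecs" "\<forall>a. degree (x a) \<le> n" "\<forall>a. fact_form m K (x a)" for n m K x a
  proof (cases "a \<in> A")
    case False
    then have "D x a = 0" using dmodD(5)[OF dmod_vecs x(1)] by (auto simp: vecs_def)
    then show ?thesis using fact_form_mono[OF fact_form_0] by simp
  next
    case True
    have "degree (pCons 0 (pderiv (x a))) \<le> n + 1"
      using degree_pCons_le[of 0 "pderiv (x a)"] degree_pderiv[of "x a"] x(2)[rule_format, of a] by linarith
    then have 1: "fact_form m ((c + 1) * S * ((n + 1) + c + 1) ^ c * (n * K)) (T * pCons 0 (pderiv (x a)))"
      using x(2,3) T_int c[of T] S[of T] by (intro fact_form_mult fact_form_euler) (auto simp: F_def)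
    have "fact_form m ((c + 1) * S * (n + c + 1) ^ c * K) (D (unit_vec b) a * x b)" if b: "b \<in> A" for b
    proof -
      have "(b, a) \<in> A \<times> A" using b True by simp
      then have "D (unit_vec b) a \<in> F" unfolding F_def by (intro insertI2 image_eqI[of _ _ "(b, a)"]) auto
      then show ?thesis using x(2,3) D_int[OF b] c S by (intro fact_form_mult) auto
    qed
    then have 2: "fact_form m (card A * ((c + 1) * S * (n + c + 1) ^ c * K)) (\<Sum>b\<in>A. D (unit_vec b) a * x b)"
      by (intro fact_form_sum[OF finA])
    have e: "D x a = T * pCons 0 (pderiv (x a)) + (\<Sum>b\<in>A. D (unit_vec b) a * x b)"
      unfolding D_expand[OF x(1) True] q_eq by (simp add: mult.commute)
    show ?thesis unfolding e
    proof (rule fact_form_mono[OF fact_form_add[OF 1 2]])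
      have "(n + c + 1) ^ c \<le> (n + c + 2) ^ (c + 1)"
        using power_mono[of "n + c + 1" "n + c + 2" c] power_increasing[of c "c + 1" "n + c + 2"] by simp
      moreover have "((n + 1) + c + 1) ^ c * n \<le> (n + c + 2) ^ (c + 1)"
        using mult_left_mono[of n "n + c + 2" "(n + c + 2) ^ c"] by (simp add: mult.commute)
      ultimately have "k * K * (((n + 1) + c + 1) ^ c * n) + card A * (k * K * (n + c + 1) ^ c)
         \<le> k * K * (n + c + 2) ^ (c + 1) + card A * (k * K * (n + c + 2) ^ (c + 1))"
        by (intro add_mono mult_left_mono) auto
      also have "\<dots> = k * (1 + card A) * (n + c + 2) ^ (c + 1) * K" by (simp add: algebra_simps)
      also have "\<dots> \<le> \<kappa> * (n + \<kappa>) ^ \<kappa> * K"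
      proof (intro mult_mono)
        have "(n + c + 2) ^ (c + 1) \<le> (n + \<kappa>) ^ (c + 1)" by (intro power_mono) (auto simp: \<kappa>_def)
        also have "\<dots> \<le> (n + \<kappa>) ^ \<kappa>" by (intro power_increasing) (auto simp: \<kappa>_def)
        finally show "(n + c + 2) ^ (c + 1) \<le> (n + \<kappa>) ^ \<kappa>" .
      qed (auto simp: \<kappa>_def)
      finally show "(c + 1) * S * (n + 1 + c + 1) ^ c * (n * K) + card A * ((c + 1) * S * (n + c + 1) ^ c * K) \<le> \<kappa> * (n + \<kappa>) ^ \<kappa> * K"
        by (simp add: k_def mult_ac)
    qed
  qed
  then show ?thesis by blast
qed

text \<open>Siegel's lemma with about \<open>rank_on A V * (ratio V + \<delta>) * s\<close> unknowns
  against \<open>remrank V * s\<close> equations. The surplus of at least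
  \<open>\<delta> * s\<close> unknowns keeps the exponent in the lemma bounded, so the height is
  exponential in \<open>s\<close>. The parameter \<open>m\<close> is free: it is just a common
  factor \<open>m!\<close>.\<close>

lemma auxiliary_form:
  assumes V: "dmod V" "rank_on A V \<noteq> 0" and \<delta>: "\<delta> > 0"
  shows "\<exists>(c::nat) (K::nat \<Rightarrow> nat). expb (\<lambda>s. real (K s)) \<and> (\<forall>s\<ge>1. \<forall>m. \<exists>P\<in>V. P \<noteq> (\<lambda>_. 0) \<and>
     (\<forall>a. degree (P a) \<le> nat \<lceil>(ratio V + \<delta>) * real s\<rceil> + c) \<and> (\<forall>l\<in>L. fps_X ^ s dvd remd P l) \<and> (\<forall>a. fact_form m (K s) (P a)))"
proof -
  define i where "i = rank_on A V"
  define r where "r = remrank V"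
  obtain b0 J M' m' where b0: "\<And>k. k < rank_on A V \<Longrightarrow> b0 k \<in> V" "indep_on {..<rank_on A V} A b0" "J \<subseteq> A" "finite J"
    "card J = rank_on A V" "M' \<noteq> 0" "\<And>y a. y \<in> V \<Longrightarrow> a \<in> A \<Longrightarrow> M' * y a = (\<Sum>\<kappa>\<in>J. m' a \<kappa> * y \<kappa>)"
    using that by (rule rank_on_obtains[OF finA, of V])
  define F0 where "F0 = (\<Union>k\<in>{..<i}. \<Union>a\<in>A. coeff (b0 k a) ` {..degree (b0 k a)})"
  have "finite F0" using finA by (auto simp: F0_def)
  from common_denominator[OF this] obtain t :: nat where t: "t \<ge> 1" "\<forall>x\<in>F0. of_nat t * x \<in> \<int>" by blast
  define b where "b = (\<lambda>k a. [:of_nat t:] * b0 k a)"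
  have bV: "b k \<in> V" if "k < i" for k unfolding b_def using b0(1) that by (intro dmodD(4)[OF V(1)]) (auto simp: i_def)
  have bvec: "b k a = 0" if "k < i" "a \<notin> A" for k a using bV[OF that(1)] dmodD(1)[OF V(1)] that(2) by (auto simp: vecs_def)
  have b_int: "coeff (b k a) j \<in> \<int>" if k: "k < i" for k a j
  proof (cases "a \<in> A \<and> j \<le> degree (b0 k a)")
    case True
    then have "coeff (b0 k a) j \<in> F0" using k by (auto simp: F0_def)
    then show ?thesis using t(2) by (simp add: b_def)
  next
    case False
    have "coeff (b k a) j = 0"
    proof (cases "a \<in> A")
      case True then show ?thesis using False by (simp add: b_def coeff_eq_0)
    next
      assume "a \<notin> A" then show ?thesis using bvec[OF k] by simp
    qed
    then show ?thesis by simp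
  qed
  have b_ind: "indep_on {..<i} A b"
    unfolding indep_on_def
  proof (intro allI impI ballI)
    fix c k assume c: "\<forall>a\<in>A. (\<Sum>k<i. c k * b k a) = 0" and k: "k \<in> {..<i}"
    have "[:of_nat t:] * c k = 0"
    proof (rule indep_onD[OF b0(2)])
      show "k \<in> {..<rank_on A V}" using k by (simp add: i_def)
      fix a assume "a \<in> A"
      then show "(\<Sum>k<rank_on A V. [:of_nat t:] * c k * b0 k a) = 0" using c by (simp add: b_def i_def mult_ac)
    qed
    then show "c k = 0" using t(1) by simp
  qed
  define F where "F = (\<lambda>(k, a). b k a) ` ({..<i} \<times> A)"
  have fF: "finite F" using finA by (simp add: F_def)
  obtain S :: nat where S0: "\<And>p j. p \<in> F \<Longrightarrow> \<bar>coeff p j\<bar> \<le> of_nat S" using that by (rule poly_coeff_bound[OF fF])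
  define c0 where "c0 = Max (insert 0 (degree ` F))"
  have c0: "degree (b k a) \<le> c0" and S: "\<bar>coeff (b k a) j\<bar> \<le> of_nat S" if k: "k < i" for k a j
  proof -
    show "degree (b k a) \<le> c0"
    proof (cases "a \<in> A")
      case True then show ?thesis unfolding c0_def using fF k by (intro Max_ge) (auto simp: F_def)
    qed (use bvec[OF k] in auto)
    show "\<bar>coeff (b k a) j\<bar> \<le> of_nat S"
    proof (cases "a \<in> A")
      case True then show ?thesis using k by (intro S0) (auto simp: F_def)
    qed (use bvec[OF k] in auto)
  qed
  obtain \<Lambda> e0 where \<Lambda>: "\<Lambda> \<subseteq> L" "finite \<Lambda>" "card \<Lambda> = remrank V"
    "\<And>x s. x \<in> V \<Longrightarrow> \<forall>l\<in>\<Lambda>. fps_X ^ (s + e0) dvd remd x l \<Longrightarrow> \<forall>l\<in>L. fps_X ^ s dvd remd x l"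
    using that by (rule order_on_coordinates[OF V(1)])
  have "etypes ({..<i} \<times> L) (\<lambda>(k, l). remd (b k) l)"
  proof (rule etypes_finite)
    fix kl assume "kl \<in> {..<i} \<times> L"
    then show "etype (case kl of (k, l) \<Rightarrow> remd (b k) l)" by (cases kl) (simp add: etype_remd)
  qed (use finL in simp)
  note fam = this
  obtain C d where Cd: "C \<ge> 1" "\<And>n. 1 \<le> d n" "\<And>n. d n \<le> C ^ (n + 1)"
    "\<And>kl n. kl \<in> {..<i} \<times> L \<Longrightarrow> \<bar>fact n * (case kl of (k, l) \<Rightarrow> remd (b k) l) $ n\<bar> \<le> of_nat C ^ (n + 1)"
    "\<And>kl n j. kl \<in> {..<i} \<times> L \<Longrightarrow> j \<le> n \<Longrightarrow> of_nat (d n) * (fact j * (case kl of (k, l) \<Rightarrow> remd (b k) l) $ j) \<in> \<int>"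
    using that by (rule etypesE[OF fam])
  \<comment> \<open>The summand \<open>r * e0\<close> pays for the order \<open>e0\<close> lost in
    passing from \<open>\<Lambda>\<close> to \<open>L\<close>. Below, \<open>k0\<close> bounds the
    number of equations divided by the surplus of unknowns.\<close>
  define n where "n = (\<lambda>s::nat. nat \<lceil>(ratio V + \<delta>) * real s\<rceil> + r * e0)"
  define k0 where "k0 = nat \<lceil>real (r * (1 + e0)) / \<delta>\<rceil>"
  define B where "B = (\<lambda>s. (2 * C * C) ^ (s + e0))"
  define X where "X = (\<lambda>s. (2 * (i * (n s + 1)) * B s + 1) ^ k0)"
  define K where "K = (\<lambda>s. i * ((c0 + 1) * S * (n s + c0 + 1) ^ c0 * X s))"
  have rat0: "ratio V \<ge> 0" by (simp add: ratio_def)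
  have ri: "real r = ratio V * real i" using V(2) by (simp add: ratio_def r_def i_def)
  have expK: "expb (\<lambda>s. real (K s))"
  proof -
    have en: "expb (\<lambda>s. real (n s))" unfolding n_def using rat0 \<delta> by (intro expb_linear) auto
    have eB: "expb (\<lambda>s. real (2 * C * C) ^ s * real (2 * C * C) ^ e0)" by (intro expb_mult expb_geom expb_const)
    show ?thesis unfolding K_def X_def B_def of_nat_mult of_nat_add of_nat_power power_add
      by (intro expb_mult expb_add expb_power expb_const en expb_geom)
  qed
  have "\<exists>P\<in>V. P \<noteq> (\<lambda>_. 0) \<and> (\<forall>a. degree (P a) \<le> nat \<lceil>(ratio V + \<delta>) * real s\<rceil> + (r * e0 + c0)) \<and>
      (\<forall>l\<in>L. fps_X ^ s dvd remd P l) \<and> (\<forall>a. fact_form m (K s) (P a))"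
    if s: "s \<ge> 1" for s m
  proof -
    define E where "E = \<Lambda> \<times> {..<s + e0}"
    define I where "I = {..<i} \<times> {..n s}"
    \<comment> \<open>Condition \<open>u\<close> multiplied by \<open>d u * u! / m!\<close>: the
      weights \<open>m! / j!\<close> of the unknowns become \<open>u choose j\<close>, and the
      entries are integers of exponential size.\<close>
    define mat where "mat = (\<lambda>(l, u) (k, j). if j \<le> u then
        of_nat (u choose j) * (of_nat (d u) * (fact (u - j) * remd (b k) l $ (u - j))) else 0)"
    have cardE: "card E = r * (s + e0)" using \<Lambda>(2,3) by (simp add: E_def card_cartesian_product r_def)
    have cardI: "card I = i * (n s + 1)" by (simp add: I_def card_cartesian_product)
    have gap: "real (card E) + \<delta> * real s \<le> real (card I)"
    proof -
      have i1: "1 \<le> real i" using V(2) by (simp add: i_def)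
      have "(ratio V + \<delta>) * real s + real (r * e0) \<le> real (n s + 1)" unfolding n_def by (simp add: of_nat_nat) linarith
      then have "real i * ((ratio V + \<delta>) * real s + real (r * e0)) \<le> real (card I)"
        unfolding cardI of_nat_mult by (intro mult_left_mono) auto
      moreover have "real i * ((ratio V + \<delta>) * real s + real (r * e0)) = real r * real s + real i * (\<delta> * real s) + real i * real (r * e0)"
        unfolding ri by (simp add: algebra_simps)
      moreover have "1 * (\<delta> * real s) \<le> real i * (\<delta> * real s)" "1 * real (r * e0) \<le> real i * real (r * e0)"
        using i1 \<delta> by (intro mult_right_mono; simp)+
      moreover have "real (card E) = real r * real s + real (r * e0)" by (simp add: cardE algebra_simps)
      ultimately show ?thesis by linarith
    qed
    moreover have "\<delta> * real s > 0" using \<delta> s by simp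
    ultimately have lt: "card E < card I" by linarith
    have k0: "card E \<le> k0 * (card I - card E)"
    proof -
      have "real (card E) \<le> real (r * (1 + e0)) * real s"
        unfolding cardE of_nat_mult[symmetric] of_nat_le_iff using s by (simp add: algebra_simps)
      also have "\<dots> = (real (r * (1 + e0)) / \<delta>) * (\<delta> * real s)" using \<delta> by simp
      also have "\<dots> \<le> real k0 * (real (card I) - real (card E))"
        using gap \<delta> unfolding k0_def by (intro mult_mono real_nat_ceiling_ge of_nat_0_le_iff) auto
      also have "\<dots> = real (k0 * (card I - card E))" using lt by (simp add: of_nat_diff)
      finally show ?thesis by (simp only: of_nat_le_iff)
    qed
    have mat_int: "mat e u \<in> \<int>" if eu: "e \<in> E" "u \<in> I" for e u
    proof -
      obtain l v where e: "e = (l, v)" by (cases e)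
      obtain k j where u: "u = (k, j)" by (cases u)
      have lv: "(k, l) \<in> {..<i} \<times> L" using eu \<Lambda>(1) by (auto simp: e u E_def I_def)
      have "of_nat (d v) * (fact (v - j) * remd (b k) l $ (v - j)) \<in> \<int>" using Cd(5)[OF lv, of "v - j" v] by simp
      then show ?thesis by (simp add: mat_def e u Ints_mult)
    qed
    have mat_bd: "\<bar>mat e u\<bar> \<le> of_nat (B s)" if eu: "e \<in> E" "u \<in> I" for e u
    proof -
      obtain l v where e: "e = (l, v)" by (cases e)
      obtain k j where u: "u = (k, j)" by (cases u)
      have lv: "l \<in> L" "v < s + e0" "k < i" using eu \<Lambda>(1) by (auto simp: e u E_def I_def)
      show ?thesis
      proof (cases "j \<le> v")
        case True
        have "\<bar>mat e u\<bar> = of_nat (v choose j) * (of_nat (d v) * \<bar>fact (v - j) * remd (b k) l $ (v - j)\<bar>)"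
          using True by (simp add: mat_def e u abs_mult)
        also have "\<dots> \<le> of_nat (2 ^ v) * (of_nat (C ^ (v + 1)) * of_nat (C ^ (v + 1)))"
        proof (intro mult_mono)
          show "(of_nat (v choose j) :: rat) \<le> of_nat (2 ^ v)" using binomial_le_pow2 by (simp only: of_nat_le_iff)
          show "(of_nat (d v) :: rat) \<le> of_nat (C ^ (v + 1))" using Cd(3) by (simp only: of_nat_le_iff)
          have "\<bar>fact (v - j) * remd (b k) l $ (v - j)\<bar> \<le> of_nat C ^ (v - j + 1)" using Cd(4)[of "(k, l)" "v - j"] lv by simp
          also have "\<dots> \<le> of_nat C ^ (v + 1)" using Cd(1) by (intro power_increasing) auto
          finally show "\<bar>fact (v - j) * remd (b k) l $ (v - j)\<bar> \<le> of_nat (C ^ (v + 1))" by simp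
        qed auto
        also have "\<dots> = of_nat (2 ^ v * (C ^ (v + 1) * C ^ (v + 1)))" by simp
        also have "2 ^ v * (C ^ (v + 1) * C ^ (v + 1)) \<le> B s"
        proof -
          have "2 ^ v * (C ^ (v + 1) * C ^ (v + 1)) \<le> 2 ^ (v + 1) * (C ^ (v + 1) * C ^ (v + 1))" by (intro mult_right_mono power_increasing) auto
          also have "\<dots> = (2 * C * C) ^ (v + 1)" by (simp add: power_mult_distrib mult_ac)
          also have "\<dots> \<le> B s" unfolding B_def using Cd(1) lv by (intro power_increasing) auto
          finally show ?thesis .
        qed
        finally show ?thesis by (simp only: of_nat_le_iff)
      qed (simp add: mat_def e u)
    qed
    define iM where "iM = (\<lambda>e u. \<lfloor>mat e u\<rfloor>)"
    have iM: "of_int (iM e u) = mat e u" if "e \<in> E" "u \<in> I" for e u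
      using mat_int[OF that] by (auto simp: iM_def elim: Ints_cases)
    have fE: "finite E" "finite I" using \<Lambda>(2) by (auto simp: E_def I_def)
    have B1: "B s \<ge> 1" using Cd(1) by (simp add: B_def)
    have iMb: "\<bar>iM e u\<bar> \<le> int (B s)" if "e \<in> E" "u \<in> I" for e u
    proof -
      have "of_int \<bar>iM e u\<bar> \<le> (of_int (int (B s)) :: rat)" using mat_bd[OF that] iM[OF that] by simp
      then show ?thesis by (simp only: of_int_le_iff)
    qed
    obtain x where x: "\<exists>i\<in>I. x i \<noteq> 0" "\<And>u. u \<in> I \<Longrightarrow> \<bar>x u\<bar> \<le> int ((2 * card I * B s + 1) ^ k0)"
      "\<And>e. e \<in> E \<Longrightarrow> (\<Sum>u\<in>I. iM e u * x u) = 0"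
      by (rule siegel_lemma[OF fE lt _ B1 k0, of iM]) (use iMb that in blast)+
    define \<beta> :: "nat \<Rightarrow> rat poly" where "\<beta> = (\<lambda>k. \<Sum>j\<le>n s. monom (of_int (x (k, j)) * fact m / fact j) j)"
    have c\<beta>: "coeff (\<beta> k) j = (if j \<le> n s then of_int (x (k, j)) * fact m / fact j else 0)" for k j
      by (simp add: \<beta>_def coeff_sum)
    have deg\<beta>: "degree (\<beta> k) \<le> n s" for k by (rule degree_le) (simp add: c\<beta>)
    have ff\<beta>: "fact_form m (X s) (\<beta> k)" if k: "k < i" for k
      unfolding fact_form_def
    proof
      fix j
      show "coeff (\<beta> k) j * fact j / fact m \<in> \<int> \<and> \<bar>coeff (\<beta> k) j * fact j / fact m\<bar> \<le> of_nat (X s)"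
      proof (cases "j \<le> n s")
        case True
        have "\<bar>x (k, j)\<bar> \<le> int (X s)" using x(2)[of "(k, j)"] k True by (simp add: I_def X_def cardI[unfolded I_def])
        then have "(of_int \<bar>x (k, j)\<bar> :: rat) \<le> of_int (int (X s))" by (simp only: of_int_le_iff)
        then show ?thesis using True by (simp add: c\<beta>)
      qed (simp add: c\<beta>)
    qed
    define P where "P = (\<lambda>a. \<Sum>k<i. \<beta> k * b k a)"
    have PV: "P \<in> V" unfolding P_def using bV by (intro dmod_sum[OF V(1)]) auto
    have degP: "degree (P a) \<le> nat \<lceil>(ratio V + \<delta>) * real s\<rceil> + (r * e0 + c0)" for a
      unfolding P_def
    proof (rule degree_sum_le)
      fix k assume "k \<in> {..<i}"
      then show "degree (\<beta> k * b k a) \<le> nat \<lceil>(ratio V + \<delta>) * real s\<rceil> + (r * e0 + c0)"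
        using degree_mult_le[of "\<beta> k" "b k a"] deg\<beta>[of k] c0[of k a] by (simp add: n_def)
    qed simp
    have ffP: "fact_form m (K s) (P a)" for a
    proof -
      have "fact_form m (card {..<i} * ((c0 + 1) * S * (n s + c0 + 1) ^ c0 * X s)) (\<Sum>k<i. b k a * \<beta> k)"
        using ff\<beta> deg\<beta> b_int c0 S by (intro fact_form_sum fact_form_mult) auto
      then show ?thesis by (simp add: P_def K_def mult.commute)
    qed
    \<comment> \<open>Independence of the \<open>b k\<close> over the polynomials transfers the
      nontriviality of the Siegel solution to \<open>P\<close>.\<close>
    have P0: "P \<noteq> (\<lambda>_. 0)"
    proof
      assume "P = (\<lambda>_. 0)"
      then have "(\<Sum>k<i. \<beta> k * b k a) = 0" for a by (simp add: P_def fun_eq_iff)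
      then have "\<beta> k = 0" if "k < i" for k using indep_onD[OF b_ind, of \<beta>] that by auto
      then have "x (k, j) = 0" if "k < i" "j \<le> n s" for k j using c\<beta>[of k j] that by simp
      then show False using x(1) by (auto simp: I_def)
    qed
    have "fps_X ^ (s + e0) dvd remd P l" if l: "l \<in> \<Lambda>" for l
      unfolding fps_X_power_dvd_iff
    proof (intro allI impI)
      fix u assume u: "u < s + e0"
      have e: "(l, u) \<in> E" using l u by (simp add: E_def)
      have "remd P l $ u = (\<Sum>k<i. (fps_of_poly (\<beta> k) * remd (b k) l) $ u)"
        unfolding P_def by (simp add: remd_sum remd_mult fps_sum_nth)
      also have "\<dots> = (\<Sum>k<i. \<Sum>j\<le>u. coeff (\<beta> k) j * remd (b k) l $ (u - j))"
        by (simp add: fps_mult_nth atLeast0AtMost)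
      also have "\<dots> = (\<Sum>k<i. \<Sum>j\<le>n s. if j \<le> u then coeff (\<beta> k) j * remd (b k) l $ (u - j) else 0)"
      proof (rule sum.cong[OF refl])
        fix k
        have "(\<Sum>j\<le>n s. if j \<le> u then coeff (\<beta> k) j * remd (b k) l $ (u - j) else 0) = (\<Sum>j\<in>{..n s} \<inter> {..u}. coeff (\<beta> k) j * remd (b k) l $ (u - j))"
          by (subst sum.inter_restrict) (simp_all only: finite_atMost atMost_iff)
        also have "\<dots> = (\<Sum>j\<le>u. coeff (\<beta> k) j * remd (b k) l $ (u - j))"
          by (intro sum.mono_neutral_left) (auto simp: c\<beta>)
        finally show "(\<Sum>j\<le>u. coeff (\<beta> k) j * remd (b k) l $ (u - j)) = (\<Sum>j\<le>n s. if j \<le> u then coeff (\<beta> k) j * remd (b k) l $ (u - j) else 0)" by simp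
      qed
      also have "\<dots> = (\<Sum>k<i. \<Sum>j\<le>n s. (fact m / (of_nat (d u) * fact u)) * (mat (l, u) (k, j) * of_int (x (k, j))))"
      proof (intro sum.cong refl)
        fix k j assume j: "j \<in> {..n s}"
        have "of_nat (d u) \<noteq> (0::rat)" using Cd(2)[of u] by simp
        then show "(if j \<le> u then coeff (\<beta> k) j * remd (b k) l $ (u - j) else 0) = (fact m / (of_nat (d u) * fact u)) * (mat (l, u) (k, j) * of_int (x (k, j)))"
          using j by (simp add: c\<beta> mat_def binomial_fact field_simps)
      qed
      also have "\<dots> = (fact m / (of_nat (d u) * fact u)) * (\<Sum>v\<in>I. mat (l, u) v * of_int (x v))"
        unfolding sum_distrib_left I_def sum.cartesian_product by (intro sum.cong refl) (simp add: split_def)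
      also have "(\<Sum>v\<in>I. mat (l, u) v * of_int (x v)) = of_int (\<Sum>v\<in>I. iM (l, u) v * x v)"
        unfolding of_int_sum of_int_mult using iM[OF e] by (intro sum.cong) auto
      also have "\<dots> = 0" using x(3)[OF e] by simp
      finally show "remd P l $ u = 0" by simp
    qed
    then have "\<forall>l\<in>L. fps_X ^ s dvd remd P l" using \<Lambda>(4)[OF PV] by blast
    then show ?thesis using PV P0 degP ffP by blast
  qed
  then show ?thesis using expK by (intro exI[of _ "r * e0 + c0"] exI[of _ K]) auto
qed

end

section \<open>Approximations from the auxiliary forms\<close>

lemma eventually_exp_le_powr:
  fixes C \<epsilon> :: real
  assumes "C \<ge> 1" "\<epsilon> > 0"
  shows "\<forall>\<^sub>F s in sequentially. C ^ (s + 1) \<le> real s powr (\<epsilon> * real s)"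
proof -
  have "filterlim (\<lambda>s::nat. \<epsilon> * ln (real s)) at_top sequentially"
    by (rule filterlim_tendsto_pos_mult_at_top[OF tendsto_const assms(2)])
       (rule filterlim_compose[OF ln_at_top filterlim_real_sequentially])
  then have "\<forall>\<^sub>F s::nat in sequentially. 2 * ln C \<le> \<epsilon> * ln (real s)"
    by (simp add: filterlim_at_top)
  then show ?thesis using eventually_gt_at_top[of 0]
  proof eventually_elim
    case (elim s)
    have "C ^ (s + 1) \<le> C ^ (2 * s)" using assms(1) elim by (intro power_increasing) auto
    also have "\<dots> = exp (2 * ln C * real s)"
      using assms(1) by (simp add: exp_of_nat_mult[symmetric] exp_of_nat2_mult powr_realpow[symmetric] powr_def)
    also have "\<dots> \<le> exp (\<epsilon> * ln (real s) * real s)" using elim by (intro iffD2[OF exp_le_cancel_iff] mult_right_mono) auto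
    also have "\<dots> = real s powr (\<epsilon> * real s)" using elim by (simp add: powr_def mult_ac)
    finally show ?case .
  qed
qed

lemma eventually_expb_le_powr:
  assumes "expb f" "\<epsilon> > 0"
  shows "\<forall>\<^sub>F s in sequentially. \<bar>f s\<bar> \<le> real s powr (\<epsilon> * real s)"
proof -
  obtain C where C: "C \<ge> 1" "\<And>s. \<bar>f s\<bar> \<le> C ^ (s + 1)" using assms(1) by (auto simp: expb_def)
  show ?thesis using eventually_exp_le_powr[OF C(1) assms(2)] by eventually_elim (use C(2) order.trans in blast)
qed

lemma eventually_linear_le:
  fixes x y c :: real
  assumes "x < y"
  shows "\<forall>\<^sub>F s in sequentially. x * real s + c \<le> y * real s"
proof -
  have "\<forall>\<^sub>F s in sequentially. c / (y - x) \<le> real s"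
    using filterlim_real_sequentially by (simp add: filterlim_at_top)
  then show ?thesis
  proof eventually_elim
    case (elim s)
    then show ?case using assms by (simp add: field_simps)
  qed
qed

lemma ceiling_le: "x \<ge> 0 \<Longrightarrow> real (nat \<lceil>x\<rceil>) \<le> x + 1"
  by (simp add: of_nat_nat)

text \<open>Factorial growth is harmless at indices that are a small multiple of \<open>s\<close>:
  the exponent \<open>2 * C * x\<close> tends to 0 with \<open>x\<close>.\<close>

lemma eventually_small_factor:
  fixes x :: real and C c :: nat
  assumes "0 < x" "x < 1/2"
  shows "\<forall>\<^sub>F s in sequentially. (real (nat \<lceil>x * real s\<rceil> + c) + 2) ^ (C * ((nat \<lceil>x * real s\<rceil> + c) + 1)) \<le> real s powr (2 * real C * x * real s)"
proof -
  have 1: "\<forall>\<^sub>F s in sequentially. x * real s + (real c + 2) \<le> 2 * x * real s"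
    by (rule eventually_linear_le) (use assms in simp)
  have 2: "\<forall>\<^sub>F s in sequentially. x * real s + (real c + 3) \<le> 1 * real s"
    by (rule eventually_linear_le) (use assms in simp)
  show ?thesis using 1 2 eventually_ge_at_top[of 1]
  proof eventually_elim
    case (elim s)
    define k where "k = nat \<lceil>x * real s\<rceil> + c"
    have k: "real k \<le> x * real s + 1 + real c" using ceiling_le[of "x * real s"] assms by (simp add: k_def)
    have "(real k + 2) ^ (C * (k + 1)) \<le> real s ^ (C * (k + 1))" using k elim by (intro power_mono) auto
    also have "\<dots> = real s powr (real (C * (k + 1)))" using elim by (subst powr_realpow) auto
    also have "\<dots> \<le> real s powr (2 * real C * x * real s)"
    proof (rule powr_mono)
      have "real C * (real k + 1) \<le> real C * (2 * x * real s)" using k elim by (intro mult_left_mono) auto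
      then show "real (C * (k + 1)) \<le> 2 * real C * x * real s" by (simp add: algebra_simps)
    qed (use elim in auto)
    finally show ?case by (simp add: k_def)
  qed
qed

lemma eventually_fact_le:
  fixes t \<epsilon> :: real
  assumes "0 \<le> t" "t < 1" "\<epsilon> > 0"
  shows "\<forall>\<^sub>F s in sequentially. fact (nat \<lceil>t * real s\<rceil>) \<le> real s powr ((t + \<epsilon>) * real s)"
proof -
  have 1: "\<forall>\<^sub>F s in sequentially. t * real s + 1 \<le> (t + \<epsilon>) * real s"
    by (rule eventually_linear_le) (use assms in simp)
  have 2: "\<forall>\<^sub>F s in sequentially. t * real s + 1 \<le> 1 * real s"
    by (rule eventually_linear_le) (use assms in simp)
  show ?thesis using 1 2 eventually_ge_at_top[of 1]
  proof eventually_elim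
    case (elim s)
    define k where "k = nat \<lceil>t * real s\<rceil>"
    have k: "real k \<le> t * real s + 1" using ceiling_le[of "t * real s"] assms by (simp add: k_def)
    have "(fact k :: real) \<le> real (k ^ k)" using fact_le_power[of k, where 'a = real] by simp
    also have "\<dots> \<le> real s ^ k" using k elim by (simp, intro power_mono) auto
    also have "\<dots> = real s powr (real k)" using elim by (simp add: powr_realpow)
    also have "\<dots> \<le> real s powr ((t + \<epsilon>) * real s)" using k elim by (intro powr_mono) auto
    finally show ?case by (simp add: k_def)
  qed
qed

lemma inverse_fact_le: "s \<ge> 1 \<Longrightarrow> 1 / fact s \<le> exp 1 ^ s / real s powr real s"
proof -
  assume s: "s \<ge> 1"
  have "real s ^ s / fact s \<le> (\<Sum>i\<le>s. real s ^ i / fact i)" by (rule member_le_sum) auto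
  also have "\<dots> \<le> exp (real s)" by (rule sum_pow_div_fact_le) simp
  also have "\<dots> = exp 1 ^ s" by (simp add: exp_of_nat_mult[symmetric])
  finally show ?thesis using s by (simp add: powr_realpow field_simps)
qed

lemma shift_poly_eq_0D: "shift_poly p = 0 \<Longrightarrow> p = 0"
  by (rule shift_poly_eq_0_if_dvd[of "Suc (degree p)"]) (auto simp: coeff_eq_0)

section \<open>Pairs of integers from a differential module\<close>

context pade_arith
begin

text \<open>The vector \<open>x\<close> paired with weights along a curve through
  \<open>z = 1\<close>; X is the distance from 1.\<close>

definition ev :: "('a \<Rightarrow> real fps) \<Rightarrow> ('a \<Rightarrow> rat poly) \<Rightarrow> real fps" where
  "ev Y x = (\<Sum>a\<in>A. Y a * shift_poly (x a))"

lemma ev_add: "ev Y (\<lambda>a. x a + y a) = ev Y x + ev Y y"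
  by (simp add: ev_def shift_poly_add algebra_simps sum.distrib)

lemma ev_mult: "ev Y (\<lambda>a. p * x a) = shift_poly p * ev Y x"
  by (simp add: ev_def shift_poly_mult sum_distrib_left mult_ac)

lemma ev_sum: "finite K \<Longrightarrow> ev Y (\<lambda>a. \<Sum>k\<in>K. p k * x k a) = (\<Sum>k\<in>K. shift_poly (p k) * ev Y (x k))"
  by (induction K rule: finite_induct) (simp_all add: ev_add ev_mult, simp add: ev_def)

text \<open>For each member of a basis of \<open>V\<close> the combinations of its two evaluations
  form a space of dimension at most two, where orders are bounded; hence \<open>e\<close> is
  independent of \<open>h0\<close> and \<open>h1\<close>. A combination that is not identically zero
  on \<open>V\<close> is nonzero at some member of the basis.\<close>

lemma uniform_ev_order:
  assumes V: "dmod V"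
  shows "\<exists>e. \<forall>h0 h1 :: real. (\<exists>x\<in>V. fps_const h0 * ev Y0 x + fps_const h1 * ev Y1 x \<noteq> 0) \<longrightarrow>
     (\<exists>x\<in>V. fps_const h0 * ev Y0 x + fps_const h1 * ev Y1 x \<noteq> 0 \<and> \<not> fps_X ^ e dvd fps_const h0 * ev Y0 x + fps_const h1 * ev Y1 x)"
proof -
  define i where "i = rank_on A V"
  obtain b J M' m' where b: "\<And>k. k < rank_on A V \<Longrightarrow> b k \<in> V" "indep_on {..<rank_on A V} A b" "J \<subseteq> A" "finite J"
    "card J = rank_on A V" "M' \<noteq> 0" "\<And>y a. y \<in> V \<Longrightarrow> a \<in> A \<Longrightarrow> M' * y a = (\<Sum>\<kappa>\<in>J. m' a \<kappa> * y \<kappa>)"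
    using that by (rule rank_on_obtains[OF finA, of V])
  have bV: "\<forall>k<i. b k \<in> V" using b(1) by (simp add: i_def)
  have "\<forall>k. \<exists>e. \<forall>c. (\<forall>u<e. (\<Sum>t\<in>UNIV. c t * (if t then ev Y0 (b k) else ev Y1 (b k)) $ u) = 0) \<longrightarrow>
      (\<forall>u. (\<Sum>t\<in>UNIV. c t * (if t then ev Y0 (b k) else ev Y1 (b k)) $ u) = 0)"
    by (intro allI finite_span_order) simp
  from choice[OF this] obtain e where e: "\<And>k c. (\<forall>u<e k. (\<Sum>t\<in>UNIV. c t * (if t then ev Y0 (b k) else ev Y1 (b k)) $ u) = 0) \<Longrightarrow>
      (\<forall>u. (\<Sum>t\<in>UNIV. c t * (if t then ev Y0 (b k) else ev Y1 (b k)) $ u) = 0)" by blast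
  define E where "E = Max (insert 0 (e ` {..<i}))"
  show ?thesis
  proof (intro exI[of _ E] allI impI)
    fix h0 h1 :: real
    define phi where "phi = (\<lambda>x. fps_const h0 * ev Y0 x + fps_const h1 * ev Y1 x)"
    assume "\<exists>x\<in>V. fps_const h0 * ev Y0 x + fps_const h1 * ev Y1 x \<noteq> 0"
    then obtain x where x: "x \<in> V" "phi x \<noteq> 0" by (auto simp: phi_def)
    from rank_on_dependence[OF finA bV b(2)[folded i_def] i_def x(1)]
    obtain p c where p: "p \<noteq> 0" "\<And>a. a \<in> A \<Longrightarrow> p * x a = (\<Sum>k<i. c k * b k a)" by auto
    have evp: "shift_poly p * ev Y x = (\<Sum>k<i. shift_poly (c k) * ev Y (b k))" for Y
    proof -
      have "shift_poly p * ev Y x = ev Y (\<lambda>a. p * x a)" by (simp add: ev_mult)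
      also have "\<dots> = ev Y (\<lambda>a. \<Sum>k<i. c k * b k a)" unfolding ev_def by (intro sum.cong) (auto simp: p(2))
      finally show ?thesis by (simp add: ev_sum)
    qed
    have "shift_poly p * phi x = fps_const h0 * (shift_poly p * ev Y0 x) + fps_const h1 * (shift_poly p * ev Y1 x)"
      by (simp add: phi_def algebra_simps)
    also have "\<dots> = (\<Sum>k<i. shift_poly (c k) * phi (b k))"
      unfolding evp phi_def by (simp add: sum_distrib_left sum.distrib algebra_simps)
    finally have s: "shift_poly p * phi x = (\<Sum>k<i. shift_poly (c k) * phi (b k))" .
    have "\<exists>k<i. phi (b k) \<noteq> 0"
    proof (rule ccontr)
      assume "\<not> ?thesis"
      then have "shift_poly p * phi x = 0" unfolding s by (intro sum.neutral) auto
      then show False using x(2) p(1) shift_poly_eq_0D by auto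
    qed
    then obtain k where k: "k < i" "phi (b k) \<noteq> 0" by auto
    have n: "(\<Sum>t\<in>UNIV. (if t then h0 else h1) * (if t then ev Y0 (b k) else ev Y1 (b k)) $ u) = phi (b k) $ u" for u
      by (simp add: UNIV_bool phi_def)
    have "\<not> fps_X ^ E dvd phi (b k)"
    proof
      assume "fps_X ^ E dvd phi (b k)"
      moreover have "e k \<le> E" unfolding E_def using k by (intro Max_ge) auto
      ultimately have "\<forall>u<e k. phi (b k) $ u = 0" unfolding fps_X_power_dvd_iff by auto
      then have "\<forall>u. phi (b k) $ u = 0" using e[of k "\<lambda>t. if t then h0 else h1"] unfolding n by blast
      then show False using k(2) by (simp add: fps_eq_iff)
    qed
    then show "\<exists>x\<in>V. fps_const h0 * ev Y0 x + fps_const h1 * ev Y1 x \<noteq> 0 \<and> \<not> fps_X ^ E dvd fps_const h0 * ev Y0 x + fps_const h1 * ev Y1 x"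
      using k bV by (auto simp: phi_def)
  qed
qed

text \<open>The binomial theorem: products of \<open>C^j / j!\<close> and
  \<open>1 / (u - j)!\<close> add up to \<open>(C + 1)^u / u!\<close>.\<close>

lemma remd_entire_bound:
  "\<exists>C::nat. \<forall>m K x l. l \<in> L \<longrightarrow> (\<forall>a. fact_form m K (x a)) \<longrightarrow> entire_bound (remd x l) (real (card A * C) * real K * fact m) (real C + 1)"
proof -
  have fam: "etypes (L \<times> A) (\<lambda>(l, a). G l a)" 
    by (rule etypes_finite) (use finL finA etG in auto)
  obtain C d where C: "C \<ge> 1" "\<And>n. 1 \<le> d n" "\<And>n. d n \<le> C ^ (n + 1)"
    "\<And>la n. la \<in> L \<times> A \<Longrightarrow> \<bar>fact n * (case la of (l, a) \<Rightarrow> G l a) $ n\<bar> \<le> of_nat C ^ (n + 1)"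
    "\<And>la n j. la \<in> L \<times> A \<Longrightarrow> j \<le> n \<Longrightarrow> of_nat (d n) * (fact j * (case la of (l, a) \<Rightarrow> G l a) $ j) \<in> \<int>"
    using that by (rule etypesE[OF fam])
  have fr: "real_of_rat (fact n) = fact n" for n using of_rat_of_nat_eq[of "fact n", where 'a = real] by simp
  have "entire_bound (remd x l) (real (card A * C) * real K * fact m) (real C + 1)"
    if l: "l \<in> L" and x: "\<forall>a. fact_form m K (x a)" for m K x l
    unfolding entire_bound_def
  proof
    fix u
    have g: "\<bar>real_of_rat (G l a $ n)\<bar> \<le> real C ^ (n + 1) / fact n" if a: "a \<in> A" for a n
    proof -
      have "\<bar>fact n * G l a $ n\<bar> \<le> of_nat C ^ (n + 1)" using C(4)[of "(l, a)" n] l a by simp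
      then have "real_of_rat \<bar>fact n * G l a $ n\<bar> \<le> real_of_rat (of_nat C ^ (n + 1))" by (simp only: of_rat_less_eq)
      moreover have "real_of_rat \<bar>fact n * G l a $ n\<bar> = fact n * \<bar>real_of_rat (G l a $ n)\<bar>"
      proof -
        have "real_of_rat \<bar>fact n * G l a $ n\<bar> = \<bar>fact n * real_of_rat (G l a $ n)\<bar>"
          by (simp only: abs_of_rat[symmetric] of_rat_mult fr)
        then show ?thesis by (simp only: abs_mult abs_of_nonneg[OF fact_ge_zero])
      qed
      moreover have "real_of_rat (of_nat C ^ (n + 1)) = real C ^ (n + 1)" by (simp only: of_rat_power of_rat_of_nat_eq)
      ultimately have "fact n * \<bar>real_of_rat (G l a $ n)\<bar> \<le> real C ^ (n + 1)" by (simp only:)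
      then show ?thesis by (simp add: field_simps)
    qed
    have k: "\<bar>real_of_rat (coeff (x a) j)\<bar> \<le> real K * fact m / fact j" for a j
    proof -
      have "\<bar>coeff (x a) j * fact j / fact m\<bar> \<le> of_nat K" using x by (auto simp: fact_form_def)
      then have "real_of_rat \<bar>coeff (x a) j * fact j / fact m\<bar> \<le> real_of_rat (of_nat K)" by (simp only: of_rat_less_eq)
      moreover have "real_of_rat \<bar>coeff (x a) j * fact j / fact m\<bar> = \<bar>real_of_rat (coeff (x a) j)\<bar> * fact j / fact m"
      proof -
        have "real_of_rat \<bar>coeff (x a) j * fact j / fact m\<bar> = \<bar>real_of_rat (coeff (x a) j) * fact j / fact m\<bar>"
          by (simp only: abs_of_rat[symmetric] of_rat_mult of_rat_divide fr)
        then show ?thesis by (simp only: abs_mult abs_divide abs_of_nonneg[OF fact_ge_zero])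
      qed
      ultimately have "\<bar>real_of_rat (coeff (x a) j)\<bar> * fact j / fact m \<le> real K" by (simp only: of_rat_of_nat_eq)
      then show ?thesis by (simp add: field_simps)
    qed
    have "real_of_rat (remd x l $ u) = (\<Sum>a\<in>A. \<Sum>j\<le>u. real_of_rat (G l a $ j) * real_of_rat (coeff (x a) (u - j)))"
      by (simp add: remd_def fps_sum_nth fps_mult_nth of_rat_sum of_rat_mult atLeast0AtMost)
    then have "\<bar>real_of_rat (remd x l $ u)\<bar> \<le> (\<Sum>a\<in>A. \<Sum>j\<le>u. \<bar>real_of_rat (G l a $ j)\<bar> * \<bar>real_of_rat (coeff (x a) (u - j))\<bar>)"
      by (simp only: abs_mult[symmetric]) (intro order.trans[OF sum_abs] sum_mono sum_abs)
    also have "\<dots> \<le> (\<Sum>a\<in>A. \<Sum>j\<le>u. (real C ^ (j + 1) / fact j) * (real K * fact m / fact (u - j)))"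
      by (intro sum_mono mult_mono g k) auto
    also have "\<dots> = real (card A) * (\<Sum>j\<le>u. (real C ^ (j + 1) / fact j) * (real K * fact m / fact (u - j)))" by simp
    also have "(\<Sum>j\<le>u. (real C ^ (j + 1) / fact j) * (real K * fact m / fact (u - j)))
       = (\<Sum>j\<le>u. (real C * real K * fact m / fact u) * (of_nat (u choose j) * real C ^ j * 1 ^ (u - j)))"
      by (intro sum.cong refl) (simp add: binomial_fact field_simps)
    also have "\<dots> = (real C * real K * fact m / fact u) * (real C + 1) ^ u"
      unfolding sum_distrib_left[symmetric] binomial_ring ..
    finally show "\<bar>real_of_rat (remd x l $ u)\<bar> \<le> real (card A * C) * real K * fact m * (real C + 1) ^ u / fact u"
      by (simp add: mult_ac)
  qed
  then show ?thesis by blast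
qed

text \<open>The added 1 makes the base at least 1, so that one bound serves all
  \<open>j \<le> i\<close>.\<close>

lemma fact_form_funpow:
  assumes \<kappa>: "\<forall>n m K x. x \<in> vecs \<longrightarrow> (\<forall>a. degree (x a) \<le> n) \<longrightarrow> (\<forall>a. fact_form m K (x a)) \<longrightarrow>
     (\<forall>a. fact_form m (\<kappa> * (n + \<kappa>) ^ \<kappa> * K) (D x a))"
    and x: "x \<in> vecs" "\<forall>a. fact_form m K (x a)" "\<And>j a. j \<le> i \<Longrightarrow> degree ((D ^^ j) x a) \<le> n" and j: "j \<le> i"
  shows "fact_form m ((1 + \<kappa> * (n + \<kappa>) ^ \<kappa>) ^ i * K) ((D ^^ j) x a)"
proof -
  have "\<forall>a. fact_form m ((\<kappa> * (n + \<kappa>) ^ \<kappa>) ^ j * K) ((D ^^ j) x a)" using j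
  proof (induction j)
    case (Suc j)
    have "\<forall>a. fact_form m (\<kappa> * (n + \<kappa>) ^ \<kappa> * ((\<kappa> * (n + \<kappa>) ^ \<kappa>) ^ j * K)) (D ((D ^^ j) x) a)"
      using \<kappa>[rule_format, OF funpow_in_vecs[OF x(1), of j], of n m "(\<kappa> * (n + \<kappa>) ^ \<kappa>) ^ j * K"] Suc x(3) by auto
    then show ?case by (simp add: mult.assoc)
  qed (use x in simp)
  moreover have "(\<kappa> * (n + \<kappa>) ^ \<kappa>) ^ j * K \<le> (1 + \<kappa> * (n + \<kappa>) ^ \<kappa>) ^ i * K"
  proof (intro mult_right_mono)
    have "(\<kappa> * (n + \<kappa>) ^ \<kappa>) ^ j \<le> (1 + \<kappa> * (n + \<kappa>) ^ \<kappa>) ^ j" by (intro power_mono) auto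
    also have "\<dots> \<le> (1 + \<kappa> * (n + \<kappa>) ^ \<kappa>) ^ i" using j by (intro power_increasing) auto
    finally show "(\<kappa> * (n + \<kappa>) ^ \<kappa>) ^ j \<le> (1 + \<kappa> * (n + \<kappa>) ^ \<kappa>) ^ i" .
  qed auto
  ultimately show ?thesis using fact_form_mono by blast
qed

lemma abs_ev_nth_le:
  assumes "\<And>a u. a \<in> A \<Longrightarrow> u \<le> k \<Longrightarrow> \<bar>Y a $ u\<bar> \<le> B" "\<And>a u. a \<in> A \<Longrightarrow> \<bar>shift_poly (x a) $ u\<bar> \<le> B'" "B \<ge> 0"
  shows "\<bar>ev Y x $ k\<bar> \<le> real (card A) * (real k + 1) * B * B'"
proof -
  have "\<bar>ev Y x $ k\<bar> \<le> (\<Sum>a\<in>A. \<Sum>u=0..k. \<bar>Y a $ u\<bar> * \<bar>shift_poly (x a) $ (k - u)\<bar>)"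
    unfolding ev_def fps_sum_nth fps_mult_nth abs_mult[symmetric] by (intro order.trans[OF sum_abs] sum_mono sum_abs)
  also have "\<dots> \<le> (\<Sum>a\<in>A. \<Sum>u=0..k. B * B')" using assms by (intro sum_mono mult_mono) auto
  also have "\<dots> = real (card A) * (real k + 1) * B * B'" by (simp add: algebra_simps)
  finally show ?thesis .
qed

text \<open>Given \<open>(h0, h1)\<close>, the zero estimate finds a derivative \<open>Q\<close> of
  the auxiliary form and an index \<open>k\<close>, at most about \<open>x * s\<close>, at which
  \<open>h0 * ev Y0 Q + h1 * ev Y1 Q\<close> has a nonzero coefficient. The k-th coefficients of
  \<open>ev Y0 Q\<close> and \<open>ev Y1 Q\<close>, cleared of denominators, are \<open>q\<close>
  and \<open>p\<close>. Their main size is \<open>m!\<close> with \<open>m\<close> about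
  \<open>\<theta>1 * s\<close>; the linear form gains \<open>1 / s!\<close> from the order of the
  remainders. The last clause records that identities on all of \<open>V\<close> are inherited by
  \<open>(q, p)\<close>.\<close>

theorem approximants:
  fixes \<xi> \<theta> \<eta> :: real
  assumes V: "dmod V" "rank_on A V \<noteq> 0" and \<eta>: "\<eta> > 0"
    and min: "\<And>V'. dmod V' \<Longrightarrow> rank_on A V' \<noteq> 0 \<Longrightarrow> ratio V + \<eta> * rank_on A V \<le> ratio V' + \<eta> * rank_on A V'"
    and \<theta>: "ratio V < \<theta>" "\<theta> \<le> 1"
    and Y: "\<And>a. a \<in> A \<Longrightarrow> gtype (Y0 a)" "\<And>a. a \<in> A \<Longrightarrow> gtype (Y1 a)" "\<And>l. l \<in> L \<Longrightarrow> gtype (W l)"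
    and rel: "\<And>x. x \<in> V \<Longrightarrow> fps_const \<xi> * ev Y0 x - ev Y1 x = (\<Sum>l\<in>L. W l * shift_fps (remd x l))"
  shows "\<forall>\<^sub>F s in sequentially. \<forall>h0 h1 :: int. (\<exists>x\<in>V. fps_const (of_int h0) * ev Y0 x + fps_const (of_int h1) * ev Y1 x \<noteq> 0) \<longrightarrow>
     (\<exists>q p :: int. h0 * q + h1 * p \<noteq> 0 \<and> \<bar>of_int q\<bar> \<le> real s powr (\<theta> * s) \<and> \<bar>of_int q * \<xi> - of_int p\<bar> \<le> real s powr ((\<theta> - 1) * s) \<and>
       (\<forall>g0 g1 :: int. (\<forall>x\<in>V. fps_const (of_int g0) * ev Y0 x + fps_const (of_int g1) * ev Y1 x = 0) \<longrightarrow> g0 * q + g1 * p = 0))"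
proof -
  define i where "i = rank_on A V"
  define r where "r = remrank V"
  define \<rho> where "\<rho> = ratio V"
  have i1: "i \<ge> 1" using V(2) by (simp add: i_def)
  have \<rho>0: "\<rho> \<ge> 0" by (simp add: \<rho>_def ratio_def)
  have ri: "real r = \<rho> * real i" using V(2) by (simp add: \<rho>_def ratio_def r_def i_def)
  have famY: "gtypes (UNIV \<times> A) (\<lambda>(t, a). if t then Y0 a else Y1 a)"
  proof (rule gtypes_finite)
    show "gtype (case ta of (t, a) \<Rightarrow> if t then Y0 a else Y1 a)" if "ta \<in> UNIV \<times> A" for ta :: "bool \<times> 'a"
      using that Y(1,2) by (cases ta; cases "fst ta") auto
  qed (use finA in simp)
  obtain C dY where CY: "\<And>n. 1 \<le> dY n" "\<And>n. dY n \<le> (n + 2) ^ (C * (n + 1))"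
    "\<And>ta n j. ta \<in> UNIV \<times> A \<Longrightarrow> j \<le> n \<Longrightarrow> \<bar>(case ta of (t, a) \<Rightarrow> if t then Y0 a else Y1 a) $ j\<bar> \<le> (real n + 2) ^ (C * (n + 1))"
    "\<And>ta n j. ta \<in> UNIV \<times> A \<Longrightarrow> j \<le> n \<Longrightarrow> of_nat (dY n) * (case ta of (t, a) \<Rightarrow> if t then Y0 a else Y1 a) $ j \<in> \<int>"
    using that by (rule gtypesE[OF famY])
  have famW: "gtypes L W" by (rule gtypes_finite[OF finL Y(3)])
  obtain CW dW where CW: "\<And>n. 1 \<le> dW n" "\<And>n. dW n \<le> (n + 2) ^ (CW * (n + 1))"
    "\<And>l n j. l \<in> L \<Longrightarrow> j \<le> n \<Longrightarrow> \<bar>W l $ j\<bar> \<le> (real n + 2) ^ (CW * (n + 1))" "\<And>l n j. l \<in> L \<Longrightarrow> j \<le> n \<Longrightarrow> of_nat (dW n) * W l $ j \<in> \<int>"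
    using that by (rule gtypesE[OF famW])
  \<comment> \<open>Half of the room between \<open>ratio V\<close> and \<theta> goes to the degree
    scale \<theta>1, the other half absorbs all factors of lower growth.\<close>
  define \<tau> where "\<tau> = (\<theta> - \<rho>) / 2"
  define \<theta>1 where "\<theta>1 = \<rho> + \<tau>"
  have \<tau>: "\<tau> > 0" "\<theta>1 + \<tau> = \<theta>" using \<theta>(1) by (auto simp: \<tau>_def \<theta>1_def \<rho>_def field_simps)
  \<comment> \<open>The four bounds serve, in this order: independence of the derivatives, degrees
    at most \<open>m s\<close>, \<open>x < 1/2\<close>, and a contribution of at most
    \<open>\<tau> / 2\<close> from the growth of the weights.\<close>
  define \<delta> where "\<delta> = Min {\<eta> / 2, \<tau> / 2, 1 / (4 * real i), \<tau> / (8 * (real C + real CW + 1) * real i)}"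
  have \<delta>: "\<delta> > 0" "\<delta> \<le> \<eta> / 2" "\<delta> \<le> \<tau> / 2" "\<delta> \<le> 1 / (4 * real i)" "\<delta> \<le> \<tau> / (8 * (real C + real CW + 1) * real i)"
  proof -
    have "8 * (real C + real CW + 1) * real i > 0" using i1 by (intro mult_pos_pos) auto
    then show "\<delta> > 0" unfolding \<delta>_def using \<eta> \<tau>(1) i1 by (subst Min_gr_iff) (simp_all only: finite.intros finite_insert insert_not_empty not_False_eq_True ball_simps, auto)
  qed (unfold \<delta>_def, (rule Min_le; simp)+)
  \<comment> \<open>\<open>i * n1 s\<close> exceeds \<open>r * s\<close> by about
    \<open>i * \<delta> * s\<close>, and this excess bounds the order in the zero estimate.\<close>
  define x where "x = real i * \<delta>"
  have x: "x > 0" "x < 1/2" "4 * (real C + real CW) * x \<le> \<tau> / 2"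
  proof -
    show "x > 0" using \<delta> i1 by (simp add: x_def)
    have "x \<le> 1/4" using \<delta>(4) i1 by (simp add: x_def field_simps)
    then show "x < 1/2" by simp
    have "x \<le> \<tau> / (8 * (real C + real CW + 1))"
    proof -
      have "x \<le> real i * (\<tau> / (8 * (real C + real CW + 1) * real i))" unfolding x_def using \<delta>(5) by (intro mult_left_mono) auto
      then show ?thesis using i1 by simp
    qed
    then have "(8 * (real C + real CW + 1)) * x \<le> \<tau>" by (simp add: field_simps)
    moreover have "8 * (real C + real CW) * x \<le> (8 * (real C + real CW + 1)) * x" using \<open>x > 0\<close> by (intro mult_right_mono) auto
    ultimately have "8 * (real C + real CW) * x \<le> \<tau>" by (rule order.trans[rotated])
    then show "4 * (real C + real CW) * x \<le> \<tau> / 2" by (simp add: algebra_simps)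
  qed
  obtain c1 :: nat where "\<exists>K :: nat \<Rightarrow> nat. expb (\<lambda>s. real (K s)) \<and> (\<forall>s\<ge>1. \<forall>m. \<exists>P\<in>V. P \<noteq> (\<lambda>_. 0) \<and>
     (\<forall>a. degree (P a) \<le> nat \<lceil>(ratio V + \<delta>) * real s\<rceil> + c1) \<and> (\<forall>l\<in>L. fps_X ^ s dvd remd P l) \<and> (\<forall>a. fact_form m (K s) (P a)))"
    using auxiliary_form[OF V \<delta>(1)] ..
  then obtain K1 :: "nat \<Rightarrow> nat" where aux0: "expb (\<lambda>s. real (K1 s)) \<and> (\<forall>s\<ge>1. \<forall>m. \<exists>P\<in>V. P \<noteq> (\<lambda>_. 0) \<and>
     (\<forall>a. degree (P a) \<le> nat \<lceil>(ratio V + \<delta>) * real s\<rceil> + c1) \<and> (\<forall>l\<in>L. fps_X ^ s dvd remd P l) \<and> (\<forall>a. fact_form m (K1 s) (P a)))" ..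
  note aux = conjunct1[OF aux0] conjunct2[OF aux0]
  define n1 where "n1 = (\<lambda>s::nat. nat \<lceil>(\<rho> + \<delta>) * real s\<rceil> + c1)"
  have n1b: "real (n1 s) \<le> (\<rho> + \<delta>) * real s + (1 + real c1)" for s
    using ceiling_le[of "(\<rho> + \<delta>) * real s"] \<rho>0 \<delta>(1) by (simp add: n1_def)
  obtain d where d: "\<forall>x n. x \<in> vecs \<longrightarrow> (\<forall>a. degree (x a) \<le> n) \<longrightarrow> (\<forall>a. degree (D x a) \<le> n + d)"
    using degree_D_bound ..
  obtain Ci :: nat where Ci: "\<forall>P n s. P \<in> V \<longrightarrow> P \<noteq> (\<lambda>_. 0) \<longrightarrow> (\<forall>a. degree (P a) \<le> n) \<longrightarrow> (\<forall>l\<in>L. fps_X ^ s dvd remd P l) \<longrightarrow>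
     real (n + Ci) < (ratio V + \<eta>) * (real s - Ci) \<longrightarrow> indep_on {..<rank_on A V} A (\<lambda>j. (D ^^ j) P)"
    using derivatives_independent[OF V(1) \<eta> min] ..
  obtain Cs :: nat where Cs: "\<forall>P n s phi K e' bs. P \<in> V \<longrightarrow> (\<forall>a. degree (P a) \<le> n) \<longrightarrow> (\<forall>l\<in>L. fps_X ^ s dvd remd P l) \<longrightarrow>
     indep_on {..<rank_on A V} A (\<lambda>j. (D ^^ j) P) \<longrightarrow>
     (\<forall>x y. phi (\<lambda>a. x a + y a) = phi x + phi y) \<longrightarrow> (\<forall>p x. phi (\<lambda>a. p * x a) = shift_poly p * phi x) \<longrightarrow>
     (\<forall>j<rank_on A V. fps_X ^ K dvd phi ((D ^^ j) P)) \<longrightarrow> bs \<in> V \<longrightarrow> phi bs \<noteq> 0 \<longrightarrow> \<not> fps_X ^ e' dvd phi bs \<longrightarrow>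
     remrank V * (s - Cs) + (K - e') \<le> rank_on A V * (n + Cs)"
    using small_order_exists[OF V(1)] ..
  obtain e where e: "\<forall>h0 h1 :: real. (\<exists>x\<in>V. fps_const h0 * ev Y0 x + fps_const h1 * ev Y1 x \<noteq> 0) \<longrightarrow>
     (\<exists>x\<in>V. fps_const h0 * ev Y0 x + fps_const h1 * ev Y1 x \<noteq> 0 \<and> \<not> fps_X ^ e dvd fps_const h0 * ev Y0 x + fps_const h1 * ev Y1 x)"
    using uniform_ev_order[OF V(1)] ..
  obtain \<kappa> where \<kappa>: "\<forall>n m K x. x \<in> vecs \<longrightarrow> (\<forall>a. degree (x a) \<le> n) \<longrightarrow> (\<forall>a. fact_form m K (x a)) \<longrightarrow>
     (\<forall>a. fact_form m (\<kappa> * (n + \<kappa>) ^ \<kappa> * K) (D x a))"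
    using fact_form_D ..
  obtain CG :: nat where CG: "\<forall>m K x l. l \<in> L \<longrightarrow> (\<forall>a. fact_form m K (x a)) \<longrightarrow>
      entire_bound (remd x l) (real (card A * CG) * real K * fact m) (real CG + 1)"
    using remd_entire_bound ..
  \<comment> \<open>Eventually at least the degree of all derivatives used, so that their Taylor
    coefficients at 1 are integers.\<close>
  define m where "m = (\<lambda>s::nat. nat \<lceil>\<theta>1 * real s\<rceil>)"
  define n2 where "n2 = (\<lambda>s. n1 s + i * d)"
  define K2 where "K2 = (\<lambda>s. (1 + \<kappa> * (n2 s + \<kappa>) ^ \<kappa>) ^ i * K1 s)"
  \<comment> \<open>The constants of the zero estimate, with 1 added to make the violated inequality
    strict.\<close>
  define c3 where "c3 = i * (1 + c1 + Cs) + r * Cs + e + 1"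
  define K where "K = (\<lambda>s::nat. nat \<lceil>x * real s\<rceil> + c3)"
  define F where "F = (\<lambda>s. (real (K s) + 2) ^ (C * (K s + 1)))"
  define FW where "FW = (\<lambda>s. (real (K s) + 2) ^ (CW * (K s + 1)))"
  define H where "H = (\<lambda>s. real (card A) * (real (K s) + 1) * 9 * real (K2 s))"
  define HW where "HW = (\<lambda>s. real (card L) * (real (K s) + 1) * (real (card A * CG) * real (K2 s) * (2 * (real CG + 1)) ^ s * exp (2 * (real CG + 1)) * exp 1 ^ s))"
  have eK: "expb (\<lambda>s. real (K s))" unfolding K_def using x by (intro expb_linear) auto
  have en2: "expb (\<lambda>s. real (n2 s))" unfolding n2_def n1_def add.assoc using \<rho>0 \<delta>(1) by (intro expb_linear) auto
  have eK2: "expb (\<lambda>s. real (K2 s))" unfolding K2_def of_nat_mult of_nat_add of_nat_power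
    by (intro expb_mult expb_add expb_power expb_const en2 aux(1))
  have eH: "expb H" unfolding H_def by (intro expb_mult expb_add expb_const eK eK2)
  have eHW: "expb HW" unfolding HW_def by (intro expb_mult expb_add expb_const expb_geom eK eK2)
  have \<theta>1: "0 \<le> \<theta>1" "\<theta>1 < 1" using \<rho>0 \<tau> \<theta>(2) by (auto simp: \<theta>1_def)
  have ev1: "\<forall>\<^sub>F s in sequentially. (\<rho> + \<delta>) * real s + (1 + real c1 + real (i * d)) \<le> \<theta>1 * real s"
    using \<delta>(3) \<tau>(1) by (intro eventually_linear_le) (simp add: \<theta>1_def)
  have ev2: "\<forall>\<^sub>F s in sequentially. (\<rho> + \<delta>) * real s + (2 + real c1 + real Ci + (\<rho> + \<eta>) * real Ci) \<le> (\<rho> + \<eta>) * real s"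
    using \<delta>(2) \<eta> by (intro eventually_linear_le) simp
  have ev3: "\<forall>\<^sub>F s in sequentially. F s \<le> real s powr (2 * real C * x * real s)"
    unfolding F_def K_def by (rule eventually_small_factor[OF x(1,2)])
  have ev4: "\<forall>\<^sub>F s in sequentially. FW s \<le> real s powr (2 * real CW * x * real s)"
    unfolding FW_def K_def by (rule eventually_small_factor[OF x(1,2)])
  have ev5: "\<forall>\<^sub>F s in sequentially. fact (m s) \<le> real s powr ((\<theta>1 + \<tau> / 8) * real s)"
    unfolding m_def using \<tau> by (intro eventually_fact_le \<theta>1) auto
  have ev6: "\<forall>\<^sub>F s in sequentially. \<bar>H s\<bar> \<le> real s powr (\<tau> / 8 * real s)"
    using \<tau> by (intro eventually_expb_le_powr eH) auto
  have ev7: "\<forall>\<^sub>F s in sequentially. \<bar>HW s\<bar> \<le> real s powr (\<tau> / 8 * real s)"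
    using \<tau> by (intro eventually_expb_le_powr eHW) auto
  show ?thesis
    using eventually_ge_at_top[of 1] ev1 ev2 ev3 ev4 ev5 ev6 ev7
  proof eventually_elim
    case (elim s)
    note s1 = elim(1)
    obtain P where P: "P \<in> V" "P \<noteq> (\<lambda>_. 0)" "\<forall>a. degree (P a) \<le> n1 s" "\<forall>l\<in>L. fps_X ^ s dvd remd P l"
      "\<forall>a. fact_form (m s) (K1 s) (P a)"
      using aux(2)[rule_format, OF s1, of "m s"] by (auto simp: n1_def \<rho>_def)
    have Pv: "P \<in> vecs" using P(1) dmodD(1)[OF V(1)] by auto
    have "real (n1 s + Ci) < (\<rho> + \<eta>) * (real s - Ci)"
      using n1b[of s] elim(3) unfolding right_diff_distrib of_nat_add by linarith
    then have ind: "indep_on {..<rank_on A V} A (\<lambda>j. (D ^^ j) P)" using Ci P(1-4) by (auto simp: \<rho>_def)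
    have degj: "degree ((D ^^ j) P a) \<le> n2 s" if "j \<le> i" for j a
    proof -
      have "degree ((D ^^ j) P a) \<le> n1 s + j * d" using degree_funpow_bound[OF d Pv P(3)] by blast
      also have "\<dots> \<le> n2 s" using that by (auto simp: n2_def intro!: mult_right_mono)
      finally show ?thesis .
    qed
    have "real (n2 s) \<le> real (m s)"
    proof -
      have "real (n2 s) \<le> \<theta>1 * real s" using n1b[of s] elim(2) by (simp add: n2_def)
      also have "\<dots> \<le> real (m s)" unfolding m_def by (rule real_nat_ceiling_ge)
      finally show ?thesis .
    qed
    then have degm: "degree ((D ^^ j) P a) \<le> m s" if "j \<le> i" for j a using degj[OF that, of a] by simp
    have ffj: "fact_form (m s) (K2 s) ((D ^^ j) P a)" if "j \<le> i" for j a
      unfolding K2_def by (rule fact_form_funpow[OF \<kappa> Pv P(5) degj that])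
    show ?case
    proof (intro allI impI)
      fix h0 h1 :: int
      define phi where "phi = (\<lambda>x. fps_const (of_int h0) * ev Y0 x + fps_const (of_int h1) * ev Y1 x)"
      assume "\<exists>x\<in>V. fps_const (of_int h0) * ev Y0 x + fps_const (of_int h1) * ev Y1 x \<noteq> 0"
      then have "\<exists>x\<in>V. phi x \<noteq> 0 \<and> \<not> fps_X ^ e dvd phi x"
        using e[THEN spec[of _ "of_int h0"], THEN spec[of _ "of_int h1"]] unfolding phi_def by (rule rev_mp)
      then obtain bs where bs: "bs \<in> V" "phi bs \<noteq> 0" "\<not> fps_X ^ e dvd phi bs" by (elim bexE conjE)
      \<comment> \<open>In the zero estimate \<open>r * s\<close> cancels, and \<open>K s\<close>
        exceeds the remaining \<open>x * s\<close> together with the constants.\<close>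
      have "\<not> (\<forall>j<i. fps_X ^ K s dvd phi ((D ^^ j) P))"
      proof
        assume "\<forall>j<i. fps_X ^ K s dvd phi ((D ^^ j) P)"
        moreover have "\<forall>x y. phi (\<lambda>a. x a + y a) = phi x + phi y" by (simp add: phi_def ev_add algebra_simps)
        moreover have "\<forall>p x. phi (\<lambda>a. p * x a) = shift_poly p * phi x" by (simp add: phi_def ev_mult algebra_simps)
        ultimately have "r * (s - Cs) + (K s - e) \<le> i * (n1 s + Cs)"
          using Cs[rule_format, OF P(1) P(3)[rule_format] P(4)[rule_format] ind, of phi "K s" bs e] bs by (simp add: i_def r_def)
        then have n1: "real (r * (s - Cs)) + real (K s - e) \<le> real (i * (n1 s + Cs))"
          unfolding of_nat_add[symmetric] of_nat_le_iff .
        have n2: "real (i * (n1 s + Cs)) \<le> real r * real s + x * real s + real (i * (1 + c1 + Cs))"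
        proof -
          have "real i * real (n1 s + Cs) \<le> real i * ((\<rho> + \<delta>) * real s + (1 + real c1) + real Cs)"
            using n1b[of s] by (intro mult_left_mono) auto
          then show ?thesis unfolding ri x_def by (simp add: algebra_simps)
        qed
        have n3: "real r * real s \<le> real (r * (s - Cs)) + real (r * Cs)"
        proof -
          have "s \<le> (s - Cs) + Cs" by simp
          then have "r * s \<le> r * ((s - Cs) + Cs)" by (rule mult_le_mono2)
          then show ?thesis unfolding of_nat_mult[symmetric] of_nat_add[symmetric] of_nat_le_iff distrib_left .
        qed
        have n4: "x * real s + real (i * (1 + c1 + Cs)) + real (r * Cs) + 1 \<le> real (K s - e)"
        proof -
          have "K s - e = nat \<lceil>x * real s\<rceil> + (i * (1 + c1 + Cs) + r * Cs + 1)" by (simp add: K_def c3_def)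
          then have "real (K s - e) = real (nat \<lceil>x * real s\<rceil>) + (real (i * (1 + c1 + Cs)) + real (r * Cs) + 1)"
            by (simp only: of_nat_add of_nat_1)
          then show ?thesis using real_nat_ceiling_ge[of "x * real s"] by argo
        qed
        show False using n1 n2 n3 n4 by argo
      qed
      then obtain j k where jk: "j < i" "k < K s" "phi ((D ^^ j) P) $ k \<noteq> 0"
        unfolding fps_X_power_dvd_iff by auto
      define Q where "Q = (D ^^ j) P"
      have QV: "Q \<in> V" unfolding Q_def by (rule dmod_funpow[OF V(1) P(1)])
      have ffQ: "fact_form (m s) (K2 s) (Q a)" "degree (Q a) \<le> m s" for a
        using ffj[of j a] degm[of j a] jk(1) by (auto simp: Q_def)
      define dd where "dd = real (dY (K s))"
      have int: "dd * ev (if t then Y0 else Y1) Q $ k \<in> \<int>" for t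
      proof -
        have "dd * ev (if t then Y0 else Y1) Q $ k = (\<Sum>a\<in>A. \<Sum>u=0..k. (dd * (if t then Y0 a else Y1 a) $ u) * shift_poly (Q a) $ (k - u))"
          by (simp add: ev_def fps_sum_nth fps_mult_nth sum_distrib_left mult.assoc if_distrib)
        also have "\<dots> \<in> \<int>"
        proof (rule Ints_sum, rule Ints_sum, rule Ints_mult)
          fix a u assume "a \<in> A" "u \<in> {0..k}"
          then show "dd * (if t then Y0 a else Y1 a) $ u \<in> \<int>" using CY(4)[of "(t, a)" u "K s"] jk(2) by (simp add: dd_def)
        qed (rule shift_poly_fact_form(1)[OF ffQ])
        finally show ?thesis .
      qed
      obtain q where q: "of_int q = dd * ev Y0 Q $ k" using int[of True] by (auto elim: Ints_cases)
      obtain p where p: "of_int p = dd * ev Y1 Q $ k" using int[of False] by (auto elim: Ints_cases)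
      have dd1: "dd \<ge> 1" "dd \<le> F s"
      proof -
        show "dd \<ge> 1" using CY(1)[of "K s"] by (simp add: dd_def)
        have "dd \<le> real ((K s + 2) ^ (C * (K s + 1)))" unfolding dd_def using CY(2)[of "K s"] by (simp only: of_nat_le_iff)
        then show "dd \<le> F s" by (simp add: F_def add.commute)
      qed
      have F0: "F s \<ge> 0" "FW s \<ge> 0" by (simp_all add: F_def FW_def)
      have H1: "H s \<le> real s powr (\<tau> / 8 * real s)" by (rule order.trans[OF abs_ge_self elim(7)])
      have HW1: "HW s \<le> real s powr (\<tau> / 8 * real s)" by (rule order.trans[OF abs_ge_self elim(8)])
      have H0: "H s \<ge> 0" and HW0: "HW s \<ge> 0" by (simp_all add: H_def HW_def)
      have nz: "h0 * q + h1 * p \<noteq> 0"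
      proof
        assume "h0 * q + h1 * p = 0"
        then have "real_of_int (h0 * q + h1 * p) = 0" by simp
        then have "dd * phi Q $ k = 0" by (simp add: q p phi_def algebra_simps)
        then show False using jk(3) dd1(1) by (simp add: Q_def)
      qed
      have others: "g0 * q + g1 * p = 0" if g: "\<forall>x\<in>V. fps_const (of_int g0) * ev Y0 x + fps_const (of_int g1) * ev Y1 x = 0" for g0 g1 :: int
      proof -
        have "fps_const (of_int g0) * ev Y0 Q + fps_const (of_int g1) * ev Y1 Q = 0" using g QV by blast
        then have "(fps_const (of_int g0) * ev Y0 Q + fps_const (of_int g1) * ev Y1 Q) $ k = 0" by simp
        then have "dd * (of_int g0 * ev Y0 Q $ k + of_int g1 * ev Y1 Q $ k) = 0" by simp
        then have "real_of_int (g0 * q + g1 * p) = 0" by (simp add: q p algebra_simps)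
        then show ?thesis by (simp only: of_int_eq_0_iff)
      qed
      have s0: "real s \<ge> 1" using s1 by simp
      have "\<bar>ev Y0 Q $ k\<bar> \<le> real (card A) * (real k + 1) * F s * (9 * real (K2 s) * fact (m s))"
      proof (rule abs_ev_nth_le)
        fix a u assume "a \<in> A" "u \<le> k"
        then show "\<bar>Y0 a $ u\<bar> \<le> F s" using CY(3)[of "(True, a)" u "K s"] jk(2) by (simp add: F_def)
      qed (use F0 shift_poly_fact_form(2)[OF ffQ] in auto)
      also have "\<dots> \<le> real (card A) * (real (K s) + 1) * F s * (9 * real (K2 s) * fact (m s))"
        using jk(2) F0 by (intro mult_right_mono mult_left_mono) auto
      also have "\<dots> = F s * (H s * fact (m s))" by (simp add: H_def mult_ac)
      finally have evb: "\<bar>ev Y0 Q $ k\<bar> \<le> F s * (H s * fact (m s))" .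
      have "\<bar>real_of_int q\<bar> \<le> F s * (F s * (H s * fact (m s)))"
        unfolding q abs_mult using evb dd1 F0 by (intro mult_mono) auto
      \<comment> \<open>One factor \<open>F s\<close> is the denominator of the weights, the other
        their size; \<open>H s\<close> is negligible, and \<open>m!\<close> provides the main
        exponent \<theta>1.\<close>
      also have "\<dots> \<le> real s powr (2 * real C * x * real s) * (real s powr (2 * real C * x * real s) *
          (real s powr (\<tau> / 8 * real s) * real s powr ((\<theta>1 + \<tau> / 8) * real s)))"
        using H0 by (intro mult_mono mult_nonneg_nonneg powr_ge_zero fact_ge_zero F0 elim(4) elim(6) H1)
      also have "\<dots> = real s powr ((4 * real C * x + \<tau> / 4 + \<theta>1) * real s)"
        unfolding powr_add[symmetric] by (rule arg_cong[of _ _ "\<lambda>e. real s powr e"]) (simp add: algebra_simps)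
      also have "\<dots> \<le> real s powr (\<theta> * real s)"
      proof (intro powr_mono mult_right_mono)
        have "4 * real C * x \<le> 4 * (real C + real CW) * x" using x(1) by (intro mult_right_mono) auto
        then show "4 * real C * x + \<tau> / 4 + \<theta>1 \<le> \<theta>" using x(3) \<tau> by linarith
      qed (use s0 in auto)
      finally have qb: "\<bar>real_of_int q\<bar> \<le> real s powr (\<theta> * real s)" .
      define Sm where "Sm = real (card A * CG) * real (K2 s) * fact (m s) * (2 * (real CG + 1)) ^ s / fact s * exp (2 * (real CG + 1))"
      have Sm0: "Sm \<ge> 0" by (simp add: Sm_def)
      have sm: "\<bar>shift_fps (remd Q l) $ u\<bar> \<le> Sm" if l: "l \<in> L" for l u
      proof -
        have "entire_bound (remd Q l) (real (card A * CG) * real (K2 s) * fact (m s)) (real CG + 1)" using CG[rule_format, OF l ffQ(1)] .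
        moreover have "fps_X ^ s dvd remd Q l" using ord_funpow[OF Pv P(4)] l unfolding Q_def by blast
        ultimately show ?thesis unfolding Sm_def by (intro shift_fps_small) auto
      qed
      have "real_of_int q * \<xi> - of_int p = dd * (fps_const \<xi> * ev Y0 Q - ev Y1 Q) $ k" by (simp add: q p algebra_simps)
      also have "\<dots> = dd * (\<Sum>l\<in>L. \<Sum>u=0..k. W l $ u * shift_fps (remd Q l) $ (k - u))"
        unfolding rel[OF QV] by (simp add: fps_sum_nth fps_mult_nth)
      finally have *: "real_of_int q * \<xi> - of_int p = dd * (\<Sum>l\<in>L. \<Sum>u=0..k. W l $ u * shift_fps (remd Q l) $ (k - u))" .
      have "\<bar>real_of_int q * \<xi> - of_int p\<bar> \<le> dd * (\<Sum>l\<in>L. \<Sum>u=0..k. \<bar>W l $ u\<bar> * \<bar>shift_fps (remd Q l) $ (k - u)\<bar>)"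
      proof -
        have "\<bar>\<Sum>l\<in>L. \<Sum>u=0..k. W l $ u * shift_fps (remd Q l) $ (k - u)\<bar> \<le> (\<Sum>l\<in>L. \<bar>\<Sum>u=0..k. W l $ u * shift_fps (remd Q l) $ (k - u)\<bar>)"
          by (rule sum_abs)
        also have "\<dots> \<le> (\<Sum>l\<in>L. \<Sum>u=0..k. \<bar>W l $ u\<bar> * \<bar>shift_fps (remd Q l) $ (k - u)\<bar>)"
          unfolding abs_mult[symmetric] by (rule sum_mono) (rule sum_abs)
        finally show ?thesis using dd1(1) * by (simp add: abs_mult mult_left_mono)
      qed
      also have "\<dots> \<le> F s * (\<Sum>l\<in>L. \<Sum>u=0..k. FW s * Sm)"
      proof (intro mult_mono sum_mono)
        fix l u assume "l \<in> L" "u \<in> {0..k}"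
        then show "\<bar>W l $ u\<bar> \<le> FW s" using CW(3)[of l u "K s"] jk(2) by (simp add: FW_def)
        show "\<bar>shift_fps (remd Q l) $ (k - u)\<bar> \<le> Sm" using sm[OF \<open>l \<in> L\<close>] .
      qed (use dd1 F0 Sm0 in \<open>auto intro!: sum_nonneg\<close>)
      also have "\<dots> = F s * (real (card L) * (real k + 1) * (FW s * Sm))" by simp
      also have "\<dots> \<le> F s * (real (card L) * (real (K s) + 1) * (FW s * Sm))"
        using jk(2) F0 Sm0 by (intro mult_left_mono mult_right_mono) auto
      \<comment> \<open>The factor \<open>1 / s!\<close> enters as
        \<open>exp 1 ^ s / s powr s\<close>; it lowers the exponent by 1, and
        \<open>exp 1 ^ s\<close> is absorbed in \<open>HW\<close>.\<close>
      also have "\<dots> \<le> F s * (FW s * (HW s * (fact (m s) / real s powr real s)))"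
      proof -
        have "Sm = real (card A * CG) * real (K2 s) * fact (m s) * (2 * (real CG + 1)) ^ s * exp (2 * (real CG + 1)) * (1 / fact s)"
          by (simp add: Sm_def)
        also have "\<dots> \<le> real (card A * CG) * real (K2 s) * fact (m s) * (2 * (real CG + 1)) ^ s * exp (2 * (real CG + 1)) * (exp 1 ^ s / real s powr real s)"
          by (intro mult_left_mono inverse_fact_le s1) auto
        finally have "real (card L) * (real (K s) + 1) * Sm \<le> real (card L) * (real (K s) + 1) *
          (real (card A * CG) * real (K2 s) * fact (m s) * (2 * (real CG + 1)) ^ s * exp (2 * (real CG + 1)) * (exp 1 ^ s / real s powr real s))"
          by (intro mult_left_mono) auto
        also have "\<dots> = HW s * (fact (m s) / real s powr real s)" by (simp add: HW_def mult_ac)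
        finally have "FW s * (real (card L) * (real (K s) + 1) * Sm) \<le> FW s * (HW s * (fact (m s) / real s powr real s))"
          using F0 by (intro mult_left_mono)
        then show ?thesis using F0 by (intro mult_left_mono) (simp_all add: mult_ac)
      qed
      also have "\<dots> \<le> real s powr (2 * real C * x * real s) * (real s powr (2 * real CW * x * real s) *
          (real s powr (\<tau> / 8 * real s) * (real s powr ((\<theta>1 + \<tau> / 8) * real s) / real s powr real s)))"
        using HW0 by (intro mult_mono divide_right_mono mult_nonneg_nonneg divide_nonneg_nonneg powr_ge_zero fact_ge_zero F0 elim(4-6) HW1)
      also have "\<dots> = real s powr ((2 * (real C + real CW) * x + \<tau> / 4 + \<theta>1 - 1) * real s)"
        unfolding powr_diff[symmetric] powr_add[symmetric] by (rule arg_cong[of _ _ "\<lambda>e. real s powr e"]) (simp add: algebra_simps)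
      also have "\<dots> \<le> real s powr ((\<theta> - 1) * real s)"
      proof (intro powr_mono mult_right_mono)
        have "2 * (real C + real CW) * x \<le> 4 * (real C + real CW) * x" using x(1) by (intro mult_right_mono) auto
        then show "2 * (real C + real CW) * x + \<tau> / 4 + \<theta>1 - 1 \<le> \<theta> - 1" using x(3) \<tau> by linarith
      qed (use s0 in auto)
      finally have rb: "\<bar>real_of_int q * \<xi> - of_int p\<bar> \<le> real s powr ((\<theta> - 1) * real s)" .
      show "\<exists>q p :: int. h0 * q + h1 * p \<noteq> 0 \<and> \<bar>of_int q\<bar> \<le> real s powr (\<theta> * s) \<and> \<bar>of_int q * \<xi> - of_int p\<bar> \<le> real s powr ((\<theta> - 1) * s) \<and>
       (\<forall>g0 g1 :: int. (\<forall>x\<in>V. fps_const (of_int g0) * ev Y0 x + fps_const (of_int g1) * ev Y1 x = 0) \<longrightarrow> g0 * q + g1 * p = 0)"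
        using nz qb rb others by (intro exI[of _ q] exI[of _ p] conjI allI impI)
    qed
  qed
qed

end

section \<open>Approximations adapted to an arbitrary pair of integers\<close>

lemma eventually_powr_less:
  fixes \<theta> c :: real
  assumes "\<theta> < 1" "c > 0"
  shows "\<forall>\<^sub>F s::nat in sequentially. real s powr ((\<theta> - 1) * s) < c"
proof -
  define B where "B = max 2 (1 / c)"
  have B: "B \<ge> 2" "1 / c \<le> B" by (auto simp: B_def)
  have "\<forall>\<^sub>F s in sequentially. B ^ (s + 1) \<le> real s powr ((1 - \<theta>) * real s)"
    by (rule eventually_exp_le_powr) (use assms B in auto)
  then show ?thesis using eventually_ge_at_top[of 1]
  proof eventually_elim
    case (elim s)
    have "B < B ^ (s + 1)" using power_strict_increasing[of 1 "s + 1" B] elim B by simp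
    then have "1 / c < real s powr ((1 - \<theta>) * real s)" using elim B by linarith
    then have "1 / (real s powr ((1 - \<theta>) * real s)) < c" using assms elim by (simp add: field_simps)
    also have "1 / (real s powr ((1 - \<theta>) * real s)) = real s powr (- ((1 - \<theta>) * real s))" by (simp add: powr_minus_divide)
    finally show ?case by (simp add: algebra_simps)
  qed
qed

context pade_arith
begin

definition evaluation_data :: "real \<Rightarrow> ('a \<Rightarrow> rat poly) set \<Rightarrow> ('a \<Rightarrow> real fps) \<Rightarrow> ('a \<Rightarrow> real fps) \<Rightarrow> ('l \<Rightarrow> real fps) \<Rightarrow> bool" where
  "evaluation_data \<xi> V Y0 Y1 W \<longleftrightarrow> (\<forall>a\<in>A. gtype (Y0 a)) \<and> (\<forall>a\<in>A. gtype (Y1 a)) \<and> (\<forall>l\<in>L. gtype (W l)) \<and>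
      (\<forall>x\<in>V. fps_const \<xi> * ev Y0 x - ev Y1 x = (\<Sum>l\<in>L. W l * shift_fps (remd x l))) \<and> (\<exists>x\<in>V. ev Y0 x \<noteq> 0 \<or> ev Y1 x \<noteq> 0)"

text \<open>Were some nonzero \<open>(g0, g1)\<close> to annihilate the evaluations on all of
  \<open>V\<close>, the approximations \<open>(q, p)\<close> would lie on one rational line, and
  \<open>q * \<xi> - p\<close> would be \<open>q\<close> times a fixed nonzero number, as \<xi> is
  irrational. But it tends to 0. So every nonzero pair of integers is admissible.\<close>

theorem independent_approximants:
  fixes \<xi> \<theta> :: real
  assumes irr: "\<xi> \<notin> \<rat>" and A: "A \<noteq> {}" and \<theta>: "card L / card A < \<theta>" "\<theta> < 1"
    and data: "\<And>V. dmod V \<Longrightarrow> rank_on A V \<noteq> 0 \<Longrightarrow> \<exists>Y0 Y1 W. evaluation_data \<xi> V Y0 Y1 W"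
  shows "\<forall>\<^sub>F s in sequentially. \<forall>h0 h1 :: int. (h0, h1) \<noteq> (0, 0) \<longrightarrow>
     (\<exists>q p :: int. h0 * q + h1 * p \<noteq> 0 \<and> \<bar>of_int q\<bar> \<le> real s powr (\<theta> * s) \<and> \<bar>of_int q * \<xi> - of_int p\<bar> \<le> real s powr ((\<theta> - 1) * s))"
proof -
  \<comment> \<open>With this choice the penalised ratio of the minimal module is at most the
    midpoint of \<open>card L / card A\<close> and \<theta>.\<close>
  define \<eta> where "\<eta> = (\<theta> - card L / card A) / (2 * real (card A))"
  have cA: "card A > 0" using A finA by (simp add: card_gt_0_iff)
  have \<eta>: "\<eta> > 0" "card L / card A + \<eta> * card A < \<theta>" using \<theta> cA by (auto simp: \<eta>_def field_simps)
  obtain V where V: "dmod V" "rank_on A V \<noteq> 0" "ratio V + \<eta> * rank_on A V \<le> card L / card A + \<eta> * card A"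
    "\<And>V'. dmod V' \<Longrightarrow> rank_on A V' \<noteq> 0 \<Longrightarrow> ratio V + \<eta> * rank_on A V \<le> ratio V' + \<eta> * rank_on A V'"
    using that by (rule minimal_module[OF A \<eta>(1)])
  have "\<eta> * rank_on A V \<ge> 0" using \<eta>(1) by simp
  then have rat: "ratio V < \<theta>" using V(3) \<eta>(2) by linarith
  obtain Y0 Y1 W where Y0: "evaluation_data \<xi> V Y0 Y1 W" using data[OF V(1,2)] by (elim exE)
  note Yd = Y0[unfolded evaluation_data_def]
  note Y = conjunct1[OF Yd, THEN bspec] conjunct1[OF conjunct2[OF Yd], THEN bspec] conjunct1[OF conjunct2[OF conjunct2[OF Yd]], THEN bspec]
    conjunct1[OF conjunct2[OF conjunct2[OF conjunct2[OF Yd]]], THEN bspec]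
  have Y5: "\<exists>x\<in>V. ev Y0 x \<noteq> 0 \<or> ev Y1 x \<noteq> 0" by (rule conjunct2[OF conjunct2[OF conjunct2[OF conjunct2[OF Yd]]]])
  have appr: "\<forall>\<^sub>F s in sequentially. \<forall>h0 h1 :: int. (\<exists>x\<in>V. fps_const (of_int h0) * ev Y0 x + fps_const (of_int h1) * ev Y1 x \<noteq> 0) \<longrightarrow>
     (\<exists>q p :: int. h0 * q + h1 * p \<noteq> 0 \<and> \<bar>of_int q\<bar> \<le> real s powr (\<theta> * s) \<and> \<bar>of_int q * \<xi> - of_int p\<bar> \<le> real s powr ((\<theta> - 1) * s) \<and>
       (\<forall>g0 g1 :: int. (\<forall>x\<in>V. fps_const (of_int g0) * ev Y0 x + fps_const (of_int g1) * ev Y1 x = 0) \<longrightarrow> g0 * q + g1 * p = 0))"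
    by (rule approximants[OF V(1,2) \<eta>(1) V(4) rat less_imp_le[OF \<theta>(2)] Y])
  have nondeg: "\<exists>x\<in>V. fps_const (of_int g0) * ev Y0 x + fps_const (of_int g1) * ev Y1 x \<noteq> 0" if g: "(g0, g1) \<noteq> (0, 0)" for g0 g1 :: int
  proof (rule ccontr)
    assume "\<not> ?thesis"
    then have g0: "\<forall>x\<in>V. fps_const (of_int g0) * ev Y0 x + fps_const (of_int g1) * ev Y1 x = 0" by simp
    obtain x where x: "x \<in> V" "ev Y0 x \<noteq> 0 \<or> ev Y1 x \<noteq> 0" using Y5 by (elim bexE)
    \<comment> \<open>One of the two evaluations is nonzero; that alone yields the approximations
      which contradict a relation \<open>(g0, g1)\<close>.\<close>
    define h0 h1 :: int where "h0 = (if ev Y0 x \<noteq> 0 then 1 else 0)" and "h1 = (if ev Y0 x \<noteq> 0 then 0 else 1)"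
    have h: "fps_const (of_int h0) * ev Y0 x + fps_const (of_int h1) * ev Y1 x \<noteq> 0"
      using x(2) by (simp add: h0_def h1_def)
    define c where "c = (if g1 = 0 then 1 else \<bar>\<xi> + of_int g0 / of_int g1\<bar>)"
    have "\<xi> + of_int g0 / of_int g1 \<noteq> 0"
    proof
      assume "\<xi> + of_int g0 / of_int g1 = 0"
      then have "\<xi> = - (of_int g0 / of_int g1)" by simp
      then show False using irr by simp
    qed
    then have c: "c > 0" by (simp add: c_def)
    have "\<forall>\<^sub>F s::nat in sequentially. False"
      using appr eventually_powr_less[OF \<theta>(2) c] eventually_powr_less[OF \<theta>(2) zero_less_one]
    proof eventually_elim
      case (elim s)
      have "\<exists>x\<in>V. fps_const (of_int h0) * ev Y0 x + fps_const (of_int h1) * ev Y1 x \<noteq> 0" using h x(1) by (rule bexI)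
      from elim(1)[THEN spec[of _ h0], THEN spec[of _ h1], THEN mp, OF this]
      obtain q p :: int where *: "h0 * q + h1 * p \<noteq> 0 \<and> \<bar>of_int q\<bar> \<le> real s powr (\<theta> * s) \<and> \<bar>of_int q * \<xi> - of_int p\<bar> \<le> real s powr ((\<theta> - 1) * s) \<and>
       (\<forall>g0 g1 :: int. (\<forall>x\<in>V. fps_const (of_int g0) * ev Y0 x + fps_const (of_int g1) * ev Y1 x = 0) \<longrightarrow> g0 * q + g1 * p = 0)" by (elim exE)
      note qp = conjunct1[OF *] conjunct1[OF conjunct2[OF conjunct2[OF *]]]
      have qp3: "g0 * q + g1 * p = 0" by (rule conjunct2[OF conjunct2[OF conjunct2[OF *]], THEN spec, THEN spec, THEN mp, OF g0])
      have less: "\<bar>of_int q * \<xi> - of_int p\<bar> < c" "\<bar>of_int q * \<xi> - of_int p\<bar> < 1" using qp(2) elim(2,3) by linarith+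
      have q0: "q \<noteq> 0"
      proof
        assume "q = 0"
        with less(2) have "\<bar>real_of_int p\<bar> < 1" by simp
        then have "p = 0" by linarith
        with \<open>q = 0\<close> qp(1) show False by simp
      qed
      have g1: "g1 \<noteq> 0" using qp3 q0 g by auto
      have "real_of_int g0 * of_int q + of_int g1 * of_int p = 0" using qp3 by (metis of_int_0 of_int_add of_int_mult)
      then have "real_of_int p = - (of_int g0 / of_int g1) * of_int q" using g1 by (simp add: field_simps)
      then have "of_int q * \<xi> - of_int p = of_int q * (\<xi> + of_int g0 / of_int g1)" by (simp add: algebra_simps)
      then have "\<bar>of_int q\<bar> * c = \<bar>of_int q * \<xi> - of_int p\<bar>" using g1 by (simp add: c_def abs_mult)
      moreover have "1 * c \<le> \<bar>of_int q\<bar> * c" using q0 c by (intro mult_right_mono) linarith+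
      ultimately show False using less(1) by linarith
    qed
    then show False by simp
  qed
  show ?thesis using appr
  proof eventually_elim
    case (elim s)
    show ?case
    proof (intro allI impI)
      fix h0 h1 :: int assume "(h0, h1) \<noteq> (0, 0)"
      then have "\<exists>x\<in>V. fps_const (of_int h0) * ev Y0 x + fps_const (of_int h1) * ev Y1 x \<noteq> 0" by (rule nondeg)
      from elim[THEN spec[of _ h0], THEN spec[of _ h1], THEN mp, OF this]
      obtain q p :: int where *: "h0 * q + h1 * p \<noteq> 0 \<and> \<bar>of_int q\<bar> \<le> real s powr (\<theta> * s) \<and> \<bar>of_int q * \<xi> - of_int p\<bar> \<le> real s powr ((\<theta> - 1) * s) \<and>
       (\<forall>g0 g1 :: int. (\<forall>x\<in>V. fps_const (of_int g0) * ev Y0 x + fps_const (of_int g1) * ev Y1 x = 0) \<longrightarrow> g0 * q + g1 * p = 0)" by (elim exE)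
      show "\<exists>q p :: int. h0 * q + h1 * p \<noteq> 0 \<and> \<bar>of_int q\<bar> \<le> real s powr (\<theta> * s) \<and> \<bar>of_int q * \<xi> - of_int p\<bar> \<le> real s powr ((\<theta> - 1) * s)"
        by (intro exI[of _ q] exI[of _ p] conjI conjunct1[OF *] conjunct1[OF conjunct2[OF *]] conjunct1[OF conjunct2[OF conjunct2[OF *]]])
    qed
  qed
qed

end

section \<open>From approximants to the irrationality exponent\<close>

text \<open>Consecutive values of \<open>s powr s\<close> are close on a logarithmic scale, so
  choosing the least suitable \<open>s\<close> loses nothing in the exponent.\<close>

lemma eventually_Suc_power_Suc_le:
  fixes \<delta> :: real
  assumes "\<delta> > 0"
  shows "\<forall>\<^sub>F n in sequentially. real (Suc n) powr (real (Suc n)) \<le> real n powr ((1 + \<delta>) * real n)"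
  using eventually_exp_le_powr[of 4 \<delta>, OF _ assms, simplified] eventually_ge_at_top[of 1]
proof eventually_elim
  case (elim n)
  have "real (Suc n) powr (real (Suc n)) = real (Suc n) ^ n * real (Suc n)" by (subst powr_realpow) auto
  also have "\<dots> \<le> (2 * real n) ^ n * 2 ^ Suc n"
  proof (intro mult_mono power_mono)
    have "Suc n \<le> 2 ^ Suc n" by (rule less_imp_le) (rule less_exp)
    then have "real (Suc n) \<le> real (2 ^ Suc n)" by (simp only: of_nat_le_iff)
    then show "real (Suc n) \<le> 2 ^ Suc n" by simp
  qed (use elim in auto)
  also have "\<dots> = real n ^ n * (2 * (2 ^ n * 2 ^ n))" by (simp add: power_mult_distrib)
  also have "(2::real) ^ n * 2 ^ n = 4 ^ n" by (simp flip: power_mult_distrib)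
  also have "real n ^ n * (2 * 4 ^ n) \<le> real n ^ n * (4 ^ (n + 1))" by (intro mult_left_mono) auto
  also have "\<dots> \<le> real n ^ n * real n powr (\<delta> * real n)" using elim by (intro mult_left_mono) auto
  also have "\<dots> = real n powr ((1 + \<delta>) * real n)" using elim by (simp add: powr_realpow[symmetric] powr_add[symmetric] algebra_simps)
  finally show ?case .
qed

text \<open>Compare \<open>p0 / q0\<close> with the approximation belonging to the pair
  \<open>(p0, - q0)\<close>: the integer \<open>p0 * q - q0 * p\<close> is nonzero by that choice.
  For the least \<open>s\<close> that makes the bound for \<open>q0 * (q * \<xi> - p)\<close> at
  most 1/2, the term \<open>q * (q0 * \<xi> - p0)\<close> has absolute value at least 1/2.
  Minimality bounds \<open>s powr (\<theta> * s)\<close> by a power of \<open>2 * q0\<close> with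
  exponent close to \<open>\<theta> / (1 - \<theta>)\<close>.\<close>

lemma irrationality_exponent:
  fixes \<xi> \<epsilon> :: real
  assumes appr: "\<And>\<theta>::real. 1/2 < \<theta> \<Longrightarrow> \<theta> < 1 \<Longrightarrow> \<forall>\<^sub>F s in sequentially. \<forall>h0 h1 :: int. (h0, h1) \<noteq> (0, 0) \<longrightarrow>
     (\<exists>q p :: int. h0 * q + h1 * p \<noteq> 0 \<and> \<bar>of_int q\<bar> \<le> real s powr (\<theta> * s) \<and> \<bar>of_int q * \<xi> - of_int p\<bar> \<le> real s powr ((\<theta> - 1) * s))"
    and \<epsilon>: "\<epsilon> > 0"
  shows "\<exists>c>0. \<forall>(p::int) (q::nat). q \<ge> 1 \<longrightarrow> \<bar>\<xi> - of_int p / real q\<bar> \<ge> c / real q powr (2 + \<epsilon>)"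
proof -
  \<comment> \<open>Small enough for
    \<open>\<theta> * (1 + t) / (1 - \<theta>) \<le> 1 + \<epsilon>\<close> with
    \<open>\<theta> = 1/2 + t\<close>.\<close>
  define t where "t = min (1/8) (\<epsilon> / 16)"
  have t: "t > 0" "t \<le> 1/8" "t \<le> \<epsilon> / 16" using \<epsilon> by (auto simp: t_def)
  define \<theta> where "\<theta> = 1/2 + t"
  have \<theta>: "1/2 < \<theta>" "\<theta> < 1" using t by (auto simp: \<theta>_def)
  have "t * t \<le> (1/2) * t" using t by (intro mult_right_mono) auto
  moreover have "t * \<epsilon> \<le> (1/8) * \<epsilon>" using t \<epsilon> by (intro mult_right_mono) auto
  moreover have "\<theta> * (1 + t) = 1/2 + 3/2 * t + t * t" "(1 + \<epsilon>) * (1 - \<theta>) = 1/2 + \<epsilon> / 2 - t - t * \<epsilon>"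
    by (simp_all add: \<theta>_def field_simps)
  ultimately have "\<theta> * (1 + t) \<le> (1 + \<epsilon>) * (1 - \<theta>)" using t by linarith
  then have expo: "\<theta> * (1 + t) / (1 - \<theta>) \<le> 1 + \<epsilon>" using \<theta> by (simp add: field_simps)
  define Q where "Q = (\<lambda>s. \<forall>h0 h1 :: int. (h0, h1) \<noteq> (0, 0) \<longrightarrow>
     (\<exists>q p :: int. h0 * q + h1 * p \<noteq> 0 \<and> \<bar>of_int q\<bar> \<le> real s powr (\<theta> * s) \<and> \<bar>of_int q * \<xi> - of_int p\<bar> \<le> real s powr ((\<theta> - 1) * s)))"
  have "\<forall>\<^sub>F s in sequentially. Q s \<and> real (Suc s) powr (real (Suc s)) \<le> real s powr ((1 + t) * real s) \<and> 2 \<le> s"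
    using eventually_conj[OF appr[OF \<theta>] eventually_conj[OF eventually_Suc_power_Suc_le[OF t(1)] eventually_ge_at_top[of 2]]]
    unfolding Q_def .
  then obtain s0 where *: "\<forall>s\<ge>s0. Q s \<and> real (Suc s) powr (real (Suc s)) \<le> real s powr ((1 + t) * real s) \<and> 2 \<le> s"
    unfolding eventually_sequentially ..
  have s0: "\<And>s. s \<ge> s0 \<Longrightarrow> Q s" "\<And>n. n \<ge> s0 \<Longrightarrow> real (Suc n) powr (real (Suc n)) \<le> real n powr ((1 + t) * real n)" "s0 \<ge> 2"
    using * by auto
  \<comment> \<open>The first entry covers the case that the least \<open>s\<close> is
    \<open>s0\<close>, where minimality says nothing; the second pays for the 2 in
    \<open>2 * q0\<close>.\<close>
  define c where "c = min (real s0 powr (- \<theta> * s0) / 2) (2 powr (- (1 + \<epsilon>)) / 2)"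
  have c: "c > 0" "c \<le> real s0 powr (- \<theta> * s0) / 2" "c \<le> 2 powr (- (1 + \<epsilon>)) / 2" using s0(3) by (auto simp: c_def)
  have "c / real q0 powr (2 + \<epsilon>) \<le> \<bar>\<xi> - of_int p0 / real q0\<bar>" if q0: "q0 \<ge> 1" for p0 :: int and q0 :: nat
  proof -
    define P where "P = (\<lambda>s::nat. s \<ge> s0 \<and> real s powr ((\<theta> - 1) * s) * real q0 \<le> 1/2)"
    have "\<forall>\<^sub>F s in sequentially. (2 * real q0) ^ (s + 1) \<le> real s powr ((1 - \<theta>) * real s)"
      by (rule eventually_exp_le_powr) (use q0 \<theta> in auto)
    from eventually_conj[OF this eventually_ge_at_top[of s0]]
    obtain s1 where s1: "(2 * real q0) ^ (s1 + 1) \<le> real s1 powr ((1 - \<theta>) * real s1)" "s1 \<ge> s0"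
      by (auto simp: eventually_sequentially)
    have crit: "P s" if s: "s \<ge> s0" "2 * real q0 \<le> real s powr ((1 - \<theta>) * real s)" for s
    proof -
      define e where "e = real s powr ((1 - \<theta>) * real s)"
      have "real s powr ((\<theta> - 1) * s) = real s powr (- ((1 - \<theta>) * real s))" by (simp add: algebra_simps)
      then have 1: "real s powr ((\<theta> - 1) * s) = 1 / e" by (simp add: powr_minus_divide e_def)
      have "2 * real q0 \<le> e" "e > 0" using s s0(3) by (auto simp: e_def)
      then have "1 / e * real q0 \<le> 1 / 2" by (simp add: field_simps)
      then show ?thesis using s(1) unfolding P_def 1 by simp
    qed
    have "2 * real q0 \<le> (2 * real q0) ^ (s1 + 1)" using q0 by (intro self_le_power) auto
    then have "P s1" using s1 by (intro crit) auto
    define s where "s = (LEAST s. P s)"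
    have Ps: "P s" unfolding s_def by (rule LeastI[of P s1]) fact
    then have s: "s \<ge> s0" "real s powr ((\<theta> - 1) * s) * real q0 \<le> 1/2" by (auto simp: P_def)
    have "(p0, - int q0) \<noteq> (0, 0)" using q0 by simp
    with s0(1)[OF s(1), unfolded Q_def, THEN spec[of _ p0], THEN spec[of _ "- int q0"]] obtain q p :: int where qp: "p0 * q + (- int q0) * p \<noteq> 0"
      "\<bar>of_int q\<bar> \<le> real s powr (\<theta> * s)" "\<bar>of_int q * \<xi> - of_int p\<bar> \<le> real s powr ((\<theta> - 1) * s)" by auto
    define R where "R = \<bar>real q0 * \<xi> - of_int p0\<bar>"
    have "1 \<le> \<bar>real_of_int (p0 * q + (- int q0) * p)\<bar>" using qp(1) by linarith
    also have "real_of_int (p0 * q + (- int q0) * p) = real q0 * (of_int q * \<xi> - of_int p) - of_int q * (real q0 * \<xi> - of_int p0)"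
      by (simp add: algebra_simps)
    also have "\<bar>\<dots>\<bar> \<le> real q0 * \<bar>of_int q * \<xi> - of_int p\<bar> + \<bar>of_int q\<bar> * R"
      unfolding R_def by (rule order.trans[OF abs_triangle_ineq4]) (simp add: abs_mult)
    also have "\<dots> \<le> real q0 * real s powr ((\<theta> - 1) * s) + real s powr (\<theta> * s) * R"
      using qp by (intro add_mono mult_left_mono mult_right_mono) (auto simp: R_def)
    also have "\<dots> \<le> 1/2 + real s powr (\<theta> * s) * R" using s(2) by (simp add: mult.commute)
    finally have R: "1/2 \<le> real s powr (\<theta> * s) * R" by simp
    have sp: "real s powr (\<theta> * s) > 0" using s(1) s0(3) by simp
    have R': "1 / (2 * real s powr (\<theta> * s)) \<le> R" using R sp by (simp add: field_simps)
    have *: "c / real q0 powr (1 + \<epsilon>) / real q0 = c / real q0 powr (2 + \<epsilon>)"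
    proof -
      have "real q0 powr (2 + \<epsilon>) = real q0 powr ((1 + \<epsilon>) + 1)" by (simp add: algebra_simps)
      also have "\<dots> = real q0 powr (1 + \<epsilon>) * real q0" unfolding powr_add using q0 by simp
      finally show ?thesis by simp
    qed
    have "c / real q0 powr (1 + \<epsilon>) \<le> R"
    proof (cases "s = s0")
      case True
      have "c / real q0 powr (1 + \<epsilon>) \<le> c / 1" using q0 c(1) \<epsilon> by (intro divide_left_mono) (auto simp: ge_one_powr_ge_zero)
      also have "\<dots> \<le> 1 / (2 * real s powr (\<theta> * s))" using c(2) True by (simp add: powr_minus_divide)
      finally show ?thesis using R' by simp
    next
      case False
      define n where "n = s - 1"
      have n: "s = Suc n" "n \<ge> s0" using False s(1) s0(3) by (auto simp: n_def)
      have "\<not> P n" using not_less_Least[of n P] n by (simp add: s_def[symmetric])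
      then have "real n powr ((1 - \<theta>) * real n) < 2 * real q0" using crit[of n] n by force
      then have "(real n powr ((1 - \<theta>) * real n)) powr (\<theta> * (1 + t) / (1 - \<theta>)) \<le> (2 * real q0) powr (\<theta> * (1 + t) / (1 - \<theta>))"
        using \<theta> t by (intro powr_mono2) auto
      also have "(real n powr ((1 - \<theta>) * real n)) powr (\<theta> * (1 + t) / (1 - \<theta>)) = real n powr ((1 + t) * real n * \<theta>)"
        using \<theta> by (simp add: powr_powr mult_ac)
      also have "\<dots> = (real n powr ((1 + t) * real n)) powr \<theta>" by (simp add: powr_powr)
      finally have 1: "(real n powr ((1 + t) * real n)) powr \<theta> \<le> (2 * real q0) powr (\<theta> * (1 + t) / (1 - \<theta>))" .
      have "real s powr (\<theta> * s) = (real s powr s) powr \<theta>" by (simp add: powr_powr mult.commute)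
      also have "\<dots> \<le> (real n powr ((1 + t) * real n)) powr \<theta>" unfolding n(1) using s0(2)[OF n(2)] \<theta> by (intro powr_mono2) auto
      also have "\<dots> \<le> (2 * real q0) powr (\<theta> * (1 + t) / (1 - \<theta>))" by (rule 1)
      also have "\<dots> \<le> (2 * real q0) powr (1 + \<epsilon>)" using expo q0 by (intro powr_mono) auto
      also have "\<dots> = 2 powr (1 + \<epsilon>) * real q0 powr (1 + \<epsilon>)" by (simp add: powr_mult)
      finally have 2: "real s powr (\<theta> * s) \<le> 2 powr (1 + \<epsilon>) * real q0 powr (1 + \<epsilon>)" .
      have q0p: "real q0 powr (1 + \<epsilon>) > 0" using q0 by simp
      have "c / real q0 powr (1 + \<epsilon>) \<le> 2 powr (- (1 + \<epsilon>)) / 2 / real q0 powr (1 + \<epsilon>)" using c(3) q0p by (intro divide_right_mono) auto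
      also have "\<dots> = 1 / (2 * (2 powr (1 + \<epsilon>) * real q0 powr (1 + \<epsilon>)))" by (simp only: powr_minus_divide divide_divide_eq_left mult_ac)
      also have "\<dots> \<le> 1 / (2 * real s powr (\<theta> * s))" using 2 sp q0p by (intro divide_left_mono mult_left_mono mult_pos_pos) auto
      finally show ?thesis using R' by simp
    qed
    then have "c / real q0 powr (1 + \<epsilon>) / real q0 \<le> R / real q0" by (intro divide_right_mono) auto
    also have "R / real q0 = \<bar>\<xi> - of_int p0 / real q0\<bar>"
    proof -
      have "\<xi> - of_int p0 / real q0 = (real q0 * \<xi> - of_int p0) / real q0" using q0 by (simp add: field_simps)
      then show ?thesis by (simp add: R_def abs_divide)
    qed
    finally show ?thesis unfolding * .
  qed
  then show ?thesis using c(1) by (intro exI[of _ c] conjI allI impI)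
qed

section \<open>Multi-indices and Weyl operators\<close>

text \<open>Exponent vectors of the monomials of degree \<open>n\<close> in \<open>m\<close>
  variables; a form is represented by its coefficient function.\<close>

definition indices :: "nat \<Rightarrow> nat \<Rightarrow> (nat \<Rightarrow> nat) set" where
  "indices m n = {\<kappa>. (\<forall>i\<ge>m. \<kappa> i = 0) \<and> sum \<kappa> {..<m} = n}"

lemma finite_indices: "finite (indices m n)"
proof (rule finite_subset)
  show "indices m n \<subseteq> {\<kappa>. \<forall>i. (i \<in> {..<m} \<longrightarrow> \<kappa> i \<in> {..n}) \<and> (i \<notin> {..<m} \<longrightarrow> \<kappa> i = 0)}"
    by (auto simp: indices_def intro!: member_le_sum)
qed (rule finite_set_of_finite_funs, auto)

lemma sum_fun_upd_less: "k < (m::nat) \<Longrightarrow> sum (\<kappa>(k := c)) {..<m} + \<kappa> k = sum \<kappa> {..<m} + (c::nat)"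
  by (subst (1 2) sum.remove[of _ k]) (auto intro!: sum.cong)

lemma indices_raise: "k < m \<Longrightarrow> \<kappa> \<in> indices m n \<Longrightarrow> \<kappa>(k := \<kappa> k + 1) \<in> indices m (Suc n)"
  using sum_fun_upd_less[of k m \<kappa> "\<kappa> k + 1"] by (auto simp: indices_def)

lemma indices_lower: "k < m \<Longrightarrow> \<kappa> \<in> indices m (Suc n) \<Longrightarrow> \<kappa> k \<noteq> 0 \<Longrightarrow> \<kappa>(k := \<kappa> k - 1) \<in> indices m n"
  using sum_fun_upd_less[of k m \<kappa> "\<kappa> k - 1"] by (auto simp: indices_def)

lemma indices_lower_iff:
  assumes "k < m" "\<kappa> k \<noteq> 0"
  shows "\<kappa>(k := \<kappa> k - 1) \<in> indices m n \<longleftrightarrow> \<kappa> \<in> indices m (Suc n)"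
proof
  assume "\<kappa>(k := \<kappa> k - 1) \<in> indices m n"
  from indices_raise[OF assms(1) this] show "\<kappa> \<in> indices m (Suc n)" using assms(2) by simp
qed (use assms indices_lower in blast)

text \<open>Multiplication by variable \<open>k\<close> maps the monomials of degree
  \<open>n\<close> bijectively to those of degree \<open>n + 1\<close> that contain it.\<close>

lemma sum_indices_Suc:
  assumes "k < m"
  shows "(\<Sum>\<kappa>\<in>indices m (Suc n). if \<kappa> k = 0 then 0 else g \<kappa>) = (\<Sum>\<kappa>\<in>indices m n. g (\<kappa>(k := \<kappa> k + 1)))"
proof -
  have "(\<Sum>\<kappa>\<in>indices m (Suc n). if \<kappa> k = 0 then 0 else g \<kappa>) = (\<Sum>\<kappa>\<in>{\<kappa> \<in> indices m (Suc n). \<kappa> k \<noteq> 0}. g \<kappa>)"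
    by (rule sum.mono_neutral_cong_right) (auto simp: finite_indices)
  also have "\<dots> = (\<Sum>\<kappa>\<in>indices m n. g (\<kappa>(k := \<kappa> k + 1)))"
  proof (rule sum.reindex_bij_witness[of _ "\<lambda>\<kappa>. \<kappa>(k := \<kappa> k + 1)" "\<lambda>\<kappa>. \<kappa>(k := \<kappa> k - 1)"])
    fix \<kappa> assume \<kappa>: "\<kappa> \<in> {\<kappa> \<in> indices m (Suc n). \<kappa> k \<noteq> 0}"
    then show "\<kappa>(k := \<kappa> k - 1) \<in> indices m n" using indices_lower[OF assms] by auto
  next
    fix \<kappa> assume "\<kappa> \<in> indices m n"
    then show "\<kappa>(k := \<kappa> k + 1) \<in> {\<kappa> \<in> indices m (Suc n). \<kappa> k \<noteq> 0}" using indices_raise[OF assms] by auto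
  qed auto
  finally show ?thesis .
qed

text \<open>Double counting of the monomials of degree \<open>n + 1\<close>, each weighted by the
  sum of its exponents. This is all that is needed for the quotient of consecutive
  cardinalities.\<close>

lemma card_indices_Suc: "card (indices m (Suc n)) * Suc n = card (indices m n) * (n + m)"
proof -
  have "card (indices m (Suc n)) * Suc n = (\<Sum>\<kappa>\<in>indices m (Suc n). \<Sum>k<m. \<kappa> k)"
    by (simp add: indices_def)
  also have "\<dots> = (\<Sum>k<m. \<Sum>\<kappa>\<in>indices m (Suc n). \<kappa> k)" by (rule sum.swap)
  also have "\<dots> = (\<Sum>k<m. \<Sum>\<kappa>\<in>indices m n. \<kappa> k + 1)"
  proof (rule sum.cong[OF refl])
    fix k assume k: "k \<in> {..<m}"
    have "(\<Sum>\<kappa>\<in>indices m (Suc n). \<kappa> k) = (\<Sum>\<kappa>\<in>indices m (Suc n). if \<kappa> k = 0 then 0 else \<kappa> k)" by (intro sum.cong) auto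
    also have "\<dots> = (\<Sum>\<kappa>\<in>indices m n. \<kappa> k + 1)" using k by (subst sum_indices_Suc) auto
    finally show "(\<Sum>\<kappa>\<in>indices m (Suc n). \<kappa> k) = (\<Sum>\<kappa>\<in>indices m n. \<kappa> k + 1)" .
  qed
  also have "\<dots> = (\<Sum>\<kappa>\<in>indices m n. \<Sum>k<m. \<kappa> k + 1)" by (rule sum.swap)
  also have "\<dots> = (\<Sum>\<kappa>\<in>indices m n. n + m)" by (intro sum.cong refl) (simp only: sum.distrib, simp add: indices_def)
  finally show ?thesis by simp
qed

lemma indices_ne: "m > 0 \<Longrightarrow> indices m n \<noteq> {}"
proof -
  assume "m > 0"
  then have "(\<lambda>i. if i = 0 then n else 0) \<in> indices m n" by (auto simp: indices_def sum.delta)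
  then show ?thesis by blast
qed

definition mul_var :: "nat \<Rightarrow> ((nat \<Rightarrow> nat) \<Rightarrow> 'r::comm_ring_1) \<Rightarrow> (nat \<Rightarrow> nat) \<Rightarrow> 'r" where
  "mul_var k y \<kappa> = (if \<kappa> k = 0 then 0 else y (\<kappa>(k := \<kappa> k - 1)))"

definition dif_var :: "nat \<Rightarrow> ((nat \<Rightarrow> nat) \<Rightarrow> 'r::comm_ring_1) \<Rightarrow> (nat \<Rightarrow> nat) \<Rightarrow> 'r" where
  "dif_var k y \<kappa> = of_nat (\<kappa> k + 1) * y (\<kappa>(k := \<kappa> k + 1))"

lemma mul_var_commute: "mul_var j (mul_var k y) = mul_var k (mul_var j y)"
  by (rule ext) (cases "j = k"; simp add: mul_var_def fun_upd_twist)

text \<open>The Weyl commutation relation between a variable and a partial derivative, on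
  coefficient functions.\<close>

lemma dif_mul_var: "dif_var i (mul_var j y) \<kappa> = mul_var j (dif_var i y) \<kappa> + (if i = j then y \<kappa> else 0)"
  by (cases "i = j"; cases "\<kappa> i") (auto simp: mul_var_def dif_var_def fun_upd_twist fun_upd_idem algebra_simps)

lemma mul_var_lin: "mul_var k (\<lambda>\<kappa>. y \<kappa> + c * z \<kappa>) \<kappa> = mul_var k y \<kappa> + c * mul_var k z \<kappa>"
  by (simp add: mul_var_def)

lemma mul_var_sum: "mul_var k (\<lambda>\<kappa>. \<Sum>j\<in>J. c j * z j \<kappa>) \<kappa> = (\<Sum>j\<in>J. c j * mul_var k (z j) \<kappa>)"
  by (simp add: mul_var_def)

lemma dif_var_sum: "dif_var k (\<lambda>\<kappa>. \<Sum>j\<in>J. c j * z j \<kappa>) \<kappa> = (\<Sum>j\<in>J. c j * dif_var k (z j) \<kappa>)"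
  by (simp add: dif_var_def sum_distrib_left mult_ac)

section \<open>The differential module of a system\<close>

locale ode_system =
  fixes m :: nat and T :: "rat poly" and c :: "nat \<Rightarrow> nat \<Rightarrow> rat poly" and f :: "nat \<Rightarrow> rat fps"
  assumes m_pos: "m > 0" and T_nz: "T \<noteq> 0" and T_int': "\<And>i. coeff T i \<in> \<int>" and c_int: "\<And>j i n. coeff (c j i) n \<in> \<int>"
    and f_etype: "\<And>i. i < m \<Longrightarrow> etype (f i)"
    and system: "\<And>j. j < m \<Longrightarrow> fps_of_poly (pCons 0 T) * fps_deriv (f j) = (\<Sum>i<m. fps_of_poly (c j i) * f i)"
begin

text \<open>The derivation \<open>z T d/dz\<close> minus a linear vector field in the variables
  \<open>w\<close>, chosen so that the form \<open>\<gamma>\<close> with coefficients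
  \<open>f\<close> is annihilated.\<close>

definition opD :: "((nat \<Rightarrow> nat) \<Rightarrow> rat poly) \<Rightarrow> (nat \<Rightarrow> nat) \<Rightarrow> rat poly" where
  "opD x \<kappa> = pCons 0 T * pderiv (x \<kappa>) - (\<Sum>j<m. \<Sum>i<m. c j i * mul_var j (dif_var i x) \<kappa>)"

definition opF :: "((nat \<Rightarrow> nat) \<Rightarrow> rat fps) \<Rightarrow> (nat \<Rightarrow> nat) \<Rightarrow> rat fps" where
  "opF y \<kappa> = fps_of_poly (pCons 0 T) * fps_deriv (y \<kappa>) - (\<Sum>j<m. \<Sum>i<m. fps_of_poly (c j i) * mul_var j (dif_var i y) \<kappa>)"

definition gam :: "((nat \<Rightarrow> nat) \<Rightarrow> rat fps) \<Rightarrow> (nat \<Rightarrow> nat) \<Rightarrow> rat fps" where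
  "gam y \<kappa> = (\<Sum>k<m. f k * mul_var k y \<kappa>)"

lemma fps_of_poly_opD: "fps_of_poly (opD x \<kappa>) = opF (\<lambda>\<kappa>. fps_of_poly (x \<kappa>)) \<kappa>"
proof -
  have "fps_of_poly (mul_var j (dif_var i x) \<kappa>) = mul_var j (dif_var i (\<lambda>\<kappa>. fps_of_poly (x \<kappa>))) \<kappa>" for i j
    by (simp add: mul_var_def dif_var_def fps_of_poly_mult fps_of_poly_add of_nat_poly fps_of_poly_const fps_of_nat flip: fps_of_nat)
  then show ?thesis by (simp add: opD_def opF_def fps_of_poly_diff fps_of_poly_mult fps_of_poly_sum fps_of_poly_pderiv del: mult_pCons_left)
qed

text \<open>Multiplication by \<open>\<Sum>f\<^sub>k w\<^sub>k\<close> is horizontal: this is why the remainders of a derived form are as small as the original ones.\<close>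

lemma opF_gam: "opF (gam y) \<kappa> = gam (opF y) \<kappa>"
proof -
  let ?q = "fps_of_poly (pCons 0 T)" and ?c = "\<lambda>j i. fps_of_poly (c j i)"
  have d: "fps_deriv (mul_var k y \<kappa>) = mul_var k (\<lambda>\<kappa>. fps_deriv (y \<kappa>)) \<kappa>" for k \<kappa> by (simp add: mul_var_def)
  \<comment> \<open>Moving \<open>dif_var i\<close> past \<gamma> leaves the term
    \<open>f i * y\<close>. Weighted with \<open>c j i\<close> it cancels against the derivatives of
    the \<open>f j\<close> given by the system.\<close>
  have m: "mul_var j (dif_var i (gam y)) \<kappa> = (\<Sum>k<m. f k * mul_var k (mul_var j (dif_var i y)) \<kappa>) + f i * mul_var j y \<kappa>" if i: "i < m" for i j
  proof -
    have "dif_var i (gam y) = (\<lambda>\<kappa>. (\<Sum>k<m. f k * mul_var k (dif_var i y) \<kappa>) + f i * y \<kappa>)"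
    proof
      fix \<kappa>
      have "dif_var i (gam y) \<kappa> = (\<Sum>k<m. f k * dif_var i (mul_var k y) \<kappa>)" unfolding gam_def by (rule dif_var_sum)
      also have "\<dots> = (\<Sum>k<m. f k * mul_var k (dif_var i y) \<kappa> + (if k = i then f i * y \<kappa> else 0))"
        by (intro sum.cong refl) (simp add: dif_mul_var algebra_simps)
      also have "\<dots> = (\<Sum>k<m. f k * mul_var k (dif_var i y) \<kappa>) + f i * y \<kappa>" using i by (simp add: sum.distrib)
      finally show "dif_var i (gam y) \<kappa> = (\<Sum>k<m. f k * mul_var k (dif_var i y) \<kappa>) + f i * y \<kappa>" .
    qed
    then show ?thesis by (simp only: mul_var_lin mul_var_sum mul_var_commute[of j])
  qed
  have "?q * fps_deriv (gam y \<kappa>) = (\<Sum>k<m. (?q * fps_deriv (f k)) * mul_var k y \<kappa>) + (\<Sum>k<m. f k * (?q * mul_var k (\<lambda>\<kappa>. fps_deriv (y \<kappa>)) \<kappa>))"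
    by (simp add: gam_def fps_deriv_sum d sum_distrib_left sum.distrib algebra_simps)
  also have "(\<Sum>k<m. (?q * fps_deriv (f k)) * mul_var k y \<kappa>) = (\<Sum>k<m. \<Sum>i<m. ?c k i * (f i * mul_var k y \<kappa>))"
    by (intro sum.cong refl) (simp add: system sum_distrib_right mult.assoc)
  finally have 1: "?q * fps_deriv (gam y \<kappa>) = (\<Sum>k<m. \<Sum>i<m. ?c k i * (f i * mul_var k y \<kappa>)) + (\<Sum>k<m. f k * (?q * mul_var k (\<lambda>\<kappa>. fps_deriv (y \<kappa>)) \<kappa>))" .
  have "(\<Sum>j<m. \<Sum>i<m. ?c j i * mul_var j (dif_var i (gam y)) \<kappa>)
      = (\<Sum>j<m. \<Sum>i<m. \<Sum>k<m. f k * (?c j i * mul_var k (mul_var j (dif_var i y)) \<kappa>)) + (\<Sum>j<m. \<Sum>i<m. ?c j i * (f i * mul_var j y \<kappa>))"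
    unfolding sum.distrib[symmetric] by (intro sum.cong refl) (simp add: m distrib_left sum_distrib_left mult_ac)
  also have "(\<Sum>j<m. \<Sum>i<m. \<Sum>k<m. f k * (?c j i * mul_var k (mul_var j (dif_var i y)) \<kappa>))
     = (\<Sum>k<m. f k * (\<Sum>j<m. \<Sum>i<m. ?c j i * mul_var k (mul_var j (dif_var i y)) \<kappa>))"
  proof -
    have "(\<Sum>j<m. \<Sum>i<m. \<Sum>k<m. f k * (?c j i * mul_var k (mul_var j (dif_var i y)) \<kappa>))
      = (\<Sum>j<m. \<Sum>k<m. \<Sum>i<m. f k * (?c j i * mul_var k (mul_var j (dif_var i y)) \<kappa>))" by (rule sum.cong[OF refl]) (rule sum.swap)
    also have "\<dots> = (\<Sum>k<m. \<Sum>j<m. \<Sum>i<m. f k * (?c j i * mul_var k (mul_var j (dif_var i y)) \<kappa>))" by (rule sum.swap)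
    finally show ?thesis by (simp add: sum_distrib_left)
  qed
  finally have 2: "(\<Sum>j<m. \<Sum>i<m. ?c j i * mul_var j (dif_var i (gam y)) \<kappa>) =
    (\<Sum>k<m. f k * (\<Sum>j<m. \<Sum>i<m. ?c j i * mul_var k (mul_var j (dif_var i y)) \<kappa>)) + (\<Sum>j<m. \<Sum>i<m. ?c j i * (f i * mul_var j y \<kappa>))" .
  have 3: "mul_var k (opF y) \<kappa> = ?q * mul_var k (\<lambda>\<kappa>. fps_deriv (y \<kappa>)) \<kappa> - (\<Sum>j<m. \<Sum>i<m. ?c j i * mul_var k (mul_var j (dif_var i y)) \<kappa>)" for k
    by (cases "\<kappa> k = 0") (simp_all add: mul_var_def[of k] opF_def)
  show ?thesis unfolding opF_def[of "gam y"] 1 2 unfolding gam_def[of "opF y"] 3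
    by (simp add: right_diff_distrib sum_subtractf)
qed

text \<open>Lowering one exponent and raising one preserves the degree; in degree 0 both sides are
  false.\<close>

lemma mul_dif_var_in_indices:
  assumes "i < m" "j < m" "\<kappa> j \<noteq> 0"
  shows "(\<kappa>(j := \<kappa> j - 1))(i := (\<kappa>(j := \<kappa> j - 1)) i + 1) \<in> indices m n \<longleftrightarrow> \<kappa> \<in> indices m n"
proof (cases n)
  case 0
  have "\<kappa> \<notin> indices m 0" using assms by (auto simp: indices_def)
  moreover have "(\<kappa>(j := \<kappa> j - 1))(i := (\<kappa>(j := \<kappa> j - 1)) i + 1) \<notin> indices m 0"
    using assms(1) by (auto simp: indices_def intro!: bexI[of _ i])
  ultimately show ?thesis using 0 by simp
next
  case (Suc n')
  define l where "l = \<kappa>(j := \<kappa> j - 1)"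
  have "l(i := l i + 1) \<in> indices m (Suc n') \<longleftrightarrow> l \<in> indices m n'"
    using indices_lower_iff[of i m "l(i := l i + 1)" n'] assms(1) by simp
  then show ?thesis using indices_lower_iff[of j m \<kappa> n', OF assms(2,3)] Suc unfolding l_def by blast
qed

text \<open>The Euler operator maps \<open>z^s u\<close> to a multiple of \<open>z^s\<close>, which
  is the reason for the factor z in \<open>pCons 0 T\<close>; the rest contains no derivative in z
  and preserves the degree in \<open>w\<close>.\<close>

lemma opF_order:
  assumes y: "\<forall>\<kappa>\<in>indices m n. fps_X ^ s dvd y \<kappa>" and \<kappa>: "\<kappa> \<in> indices m n"
  shows "fps_X ^ s dvd opF y \<kappa>"
proof -
  obtain u where u: "y \<kappa> = fps_X ^ s * u" using y \<kappa> by (auto elim: dvdE)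
  have X: "fps_X * fps_deriv (fps_X ^ s) = (of_nat s * fps_X ^ s :: rat fps)" by (induction s) (simp_all add: algebra_simps)
  have "fps_of_poly (pCons 0 T) * fps_deriv (y \<kappa>) = fps_of_poly T * ((fps_X * fps_deriv (fps_X ^ s)) * u + fps_X ^ s * (fps_X * fps_deriv u))"
    by (simp add: u fps_of_poly_pCons algebra_simps)
  also have "\<dots> = fps_X ^ s * (fps_of_poly T * (of_nat s * u + fps_X * fps_deriv u))"
    unfolding X by (simp add: algebra_simps)
  finally have "fps_X ^ s dvd fps_of_poly (pCons 0 T) * fps_deriv (y \<kappa>)" by simp
  moreover have "fps_X ^ s dvd mul_var j (dif_var i y) \<kappa>" if "i < m" "j < m" for i j
    using y \<kappa> mul_dif_var_in_indices[OF that, of \<kappa> n] by (auto simp: mul_var_def dif_var_def intro!: dvd_mult)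
  ultimately show ?thesis unfolding opF_def by (intro dvd_diff dvd_sum dvd_mult[of _ _ "fps_of_poly (c _ _)"]) auto
qed

definition idx :: "nat \<Rightarrow> (nat \<Rightarrow> nat) set" where "idx F = indices m F \<union> indices m (Suc F)"

text \<open>Matrix of the map from the pair of forms to the coefficients of
  \<open>\<gamma> x0 - x1\<close>; both forms are stored in one function on \<open>idx F\<close>,
  their degrees being different.\<close>

definition rcoef :: "(nat \<Rightarrow> nat) \<Rightarrow> (nat \<Rightarrow> nat) \<Rightarrow> rat fps" where
  "rcoef l a = (\<Sum>k<m. if l k \<noteq> 0 \<and> l(k := l k - 1) = a then f k else 0) - (if a = l then 1 else 0)"

lemma finite_idx: "finite (idx F)" by (simp add: idx_def finite_indices)

lemma rcoef_sum:
  assumes l: "l \<in> indices m (Suc F)"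
  shows "(\<Sum>a\<in>idx F. rcoef l a * y a) = gam y l - y l"
proof -
  have "(\<Sum>a\<in>idx F. (if a = l then 1 else 0) * y a) = (\<Sum>a\<in>idx F. if a = l then y a else 0)" by (intro sum.cong) auto
  also have "\<dots> = y l"
  proof -
    have "l \<in> idx F" using l by (simp add: idx_def)
    then show ?thesis by (simp add: finite_idx)
  qed
  finally have 1: "(\<Sum>a\<in>idx F. (if a = l then 1 else 0) * y a) = y l" .
  have "(\<Sum>a\<in>idx F. (\<Sum>k<m. if l k \<noteq> 0 \<and> l(k := l k - 1) = a then f k else 0) * y a)
     = (\<Sum>k<m. \<Sum>a\<in>idx F. (if l k \<noteq> 0 \<and> l(k := l k - 1) = a then f k else 0) * y a)"
    by (simp only: sum_distrib_right) (rule sum.swap)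
  also have "\<dots> = (\<Sum>k<m. f k * mul_var k y l)"
  proof (rule sum.cong[OF refl])
    fix k assume k: "k \<in> {..<m}"
    show "(\<Sum>a\<in>idx F. (if l k \<noteq> 0 \<and> l(k := l k - 1) = a then f k else 0) * y a) = f k * mul_var k y l"
    proof (cases "l k = 0")
      case False
      then have in': "l(k := l k - 1) \<in> idx F" using indices_lower[of k m l F] k l by (auto simp: idx_def)
      have "(\<Sum>a\<in>idx F. (if l k \<noteq> 0 \<and> l(k := l k - 1) = a then f k else 0) * y a) = (\<Sum>a\<in>idx F. if l(k := l k - 1) = a then f k * y a else 0)"
        using False by (intro sum.cong) auto
      also have "\<dots> = f k * y (l(k := l k - 1))" using in' by (simp add: finite_idx)
      finally show ?thesis using False by (simp add: mul_var_def)
    qed (simp add: mul_var_def)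
  qed
  finally show ?thesis unfolding rcoef_def left_diff_distrib sum_subtractf 1 by (simp add: gam_def)
qed

lemma etype_uminus_one: "etype (- 1)"
  using etype_poly[of "- 1"] by (simp add: fps_of_poly_uminus)

lemma etype_rcoef: "etype (rcoef l a)"
proof -
  have 0: "etype 0" using etype_poly[of 0] by simp
  have "etype (\<Sum>k<m. if l k \<noteq> 0 \<and> l(k := l k - 1) = a then f k else 0)"
    by (rule etype_sum) (use f_etype 0 in auto)
  moreover have "etype (if a = l then - 1 else 0)" using 0 etype_uminus_one by simp
  moreover have "rcoef l a = (\<Sum>k<m. if l k \<noteq> 0 \<and> l(k := l k - 1) = a then f k else 0) + (if a = l then - 1 else 0)"
    by (simp add: rcoef_def)
  ultimately show ?thesis by (simp only: etype_add)
qed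

lemma opF_diff: "opF (\<lambda>\<kappa>. y \<kappa> - z \<kappa>) \<kappa> = opF y \<kappa> - opF z \<kappa>"
proof -
  have "mul_var j (dif_var i (\<lambda>\<kappa>. y \<kappa> - z \<kappa>)) \<kappa> = mul_var j (dif_var i y) \<kappa> - mul_var j (dif_var i z) \<kappa>" for i j
    by (simp add: mul_var_def dif_var_def algebra_simps)
  then show ?thesis by (simp add: opF_def right_diff_distrib sum_subtractf)
qed

text \<open>The base point \<open>z0\<close> of the flow may be any nonroot of \<open>z T\<close>;
  it has nothing to do with the point of evaluation.\<close>

lemma pade_arith_system: "\<exists>z0. pade_arith (idx F) (pCons 0 T) opD z0 (indices m (Suc F)) rcoef T"
proof -
  have qn: "pCons 0 T \<noteq> 0" using T_nz by simp
  then obtain z0 where z0: "poly (pCons 0 T) z0 \<noteq> 0" using poly_all_0_iff_0 by blast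
  have supp: "\<forall>a. a \<notin> idx F \<longrightarrow> opD x a = 0" if x: "\<forall>a. a \<notin> idx F \<longrightarrow> x a = 0" for x
  proof (intro allI impI)
    fix \<kappa> assume \<kappa>: "\<kappa> \<notin> idx F"
    have "mul_var j (dif_var i x) \<kappa> = 0" if "i < m" "j < m" for i j
      using x \<kappa> mul_dif_var_in_indices[OF that, of \<kappa>] by (auto simp: mul_var_def dif_var_def idx_def)
    then show "opD x \<kappa> = 0" using x \<kappa> by (simp add: opD_def)
  qed
  interpret diff_module_at "idx F" "pCons 0 T" opD z0
  proof
    show "opD (\<lambda>a. x a + y a) = (\<lambda>a. opD x a + opD y a)" for x y
    proof
      fix \<kappa>
      have "mul_var j (dif_var i (\<lambda>a. x a + y a)) \<kappa> = mul_var j (dif_var i x) \<kappa> + mul_var j (dif_var i y) \<kappa>" for i j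
        by (simp add: mul_var_def dif_var_def algebra_simps)
      then show "opD (\<lambda>a. x a + y a) \<kappa> = opD x \<kappa> + opD y \<kappa>"
        unfolding opD_def by (simp only: pderiv_add distrib_left sum.distrib algebra_simps)
    qed
    show "opD (\<lambda>a. p * x a) = (\<lambda>a. pCons 0 T * pderiv p * x a + p * opD x a)" for p x
    proof
      fix \<kappa>
      have "mul_var j (dif_var i (\<lambda>a. p * x a)) \<kappa> = p * mul_var j (dif_var i x) \<kappa>" for i j
        by (simp add: mul_var_def dif_var_def mult_ac)
      then have "(\<Sum>j<m. \<Sum>i<m. c j i * mul_var j (dif_var i (\<lambda>a. p * x a)) \<kappa>) = p * (\<Sum>j<m. \<Sum>i<m. c j i * mul_var j (dif_var i x) \<kappa>)"
        by (simp add: sum_distrib_left mult_ac)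
      then show "opD (\<lambda>a. p * x a) \<kappa> = pCons 0 T * pderiv p * x \<kappa> + p * opD x \<kappa>"
        unfolding opD_def by (simp only: pderiv_mult algebra_simps)
    qed
  qed (use finite_idx qn supp z0 in auto)
  have "pade_arith (idx F) (pCons 0 T) opD z0 (indices m (Suc F)) rcoef T"
  proof
    fix s x assume x: "\<forall>l\<in>indices m (Suc F). fps_X ^ s dvd (\<Sum>a\<in>idx F. rcoef l a * fps_of_poly (x a))"
    show "\<forall>l\<in>indices m (Suc F). fps_X ^ s dvd (\<Sum>a\<in>idx F. rcoef l a * fps_of_poly (opD x a))"
    proof
      fix l assume l: "l \<in> indices m (Suc F)"
      define y where "y = (\<lambda>\<kappa>. fps_of_poly (x \<kappa>))"
      have "(\<Sum>a\<in>idx F. rcoef l a * fps_of_poly (opD x a)) = gam (opF y) l - opF y l"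
        using rcoef_sum[OF l, of "opF y"] by (simp add: fps_of_poly_opD y_def)
      also have "\<dots> = opF (\<lambda>\<kappa>. gam y \<kappa> - y \<kappa>) l" by (simp add: opF_gam[symmetric] opF_diff)
      finally show "fps_X ^ s dvd (\<Sum>a\<in>idx F. rcoef l a * fps_of_poly (opD x a))"
        using opF_order[OF _ l, of s "\<lambda>\<kappa>. gam y \<kappa> - y \<kappa>"] x by (simp add: rcoef_sum y_def)
    qed
  next
    fix a b i assume "b \<in> idx F"
    have u: "coeff (unit_vec b \<kappa>) n \<in> \<int>" for \<kappa> n by (simp add: unit_vec_def)
    have "coeff (mul_var j (dif_var k (unit_vec b)) a) n \<in> \<int>" for j k n
      using u by (auto simp: mul_var_def dif_var_def coeff_mult of_nat_poly coeff_pCons split: nat.split intro!: Ints_sum Ints_mult)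
    moreover have "pderiv (unit_vec b a) = 0" by (simp add: unit_vec_def)
    ultimately show "coeff (opD (unit_vec b) a) i \<in> \<int>"
      unfolding opD_def by (auto simp: coeff_sum coeff_mult intro!: Ints_minus Ints_sum Ints_mult c_int)
  qed (auto intro: finite_indices etype_rcoef T_int')
  then show ?thesis ..
qed

text \<open>The quotient \<open>card L / card A\<close> of the abstract estimates; it falls below
  any \<theta> greater than 1/2 once \<open>F\<close> is large against \<open>m\<close>.\<close>

lemma card_ratio:
  "real (card (indices m (Suc F))) / real (card (idx F)) = (F + m) / (2 * F + m + 1)"
proof -
  have "idx F = indices m F \<union> indices m (Suc F)" "indices m F \<inter> indices m (Suc F) = {}" by (auto simp: idx_def indices_def)
  then have c: "card (idx F) = card (indices m F) + card (indices m (Suc F))" by (simp add: card_Un_disjoint finite_indices)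
  have "real (card (indices m (Suc F)) * Suc F) = real (card (indices m F) * (F + m))" by (simp only: card_indices_Suc)
  then have e: "real (card (indices m F)) = real (card (indices m (Suc F))) * (F + 1) / (F + m)" using m_pos by (simp add: field_simps)
  have n: "real (card (indices m (Suc F))) > 0" using indices_ne[OF m_pos] finite_indices by (simp add: card_gt_0_iff)
  have "real (card (idx F)) = real (card (indices m (Suc F))) * ((2 * F + m + 1) / (F + m))"
    unfolding c of_nat_add e using m_pos by (simp add: field_simps)
  then show ?thesis using n by simp
qed

end

section \<open>Evaluation along a curve\<close>

text \<open>Among the terms with nonzero coefficient the largest degree occurs only once, so its
  leading coefficient survives.\<close>

lemma monic_combination_eq_0:
  fixes p :: "'k \<Rightarrow> 'r::idom poly"
  assumes I: "finite I" and inj: "inj_on (\<lambda>k. degree (p k)) I" and monic: "\<And>k. k \<in> I \<Longrightarrow> lead_coeff (p k) = 1"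
    and 0: "(\<Sum>k\<in>I. smult (c k) (p k)) = 0"
  shows "\<forall>k\<in>I. c k = 0"
proof (rule ccontr)
  define J where "J = {k\<in>I. c k \<noteq> 0}"
  assume "\<not> ?thesis"
  then have J: "finite J" "J \<noteq> {}" using I by (auto simp: J_def)
  define N where "N = Max ((\<lambda>k. degree (p k)) ` J)"
  have "N \<in> (\<lambda>k. degree (p k)) ` J" unfolding N_def using J by (intro Max_in) auto
  then obtain k where k: "k \<in> J" "N = degree (p k)" by auto
  have z: "c k' * coeff (p k') N = 0" if "k' \<in> I - {k}" for k'
  proof (cases "k' \<in> J")
    case True
    then have "degree (p k') \<le> N" unfolding N_def using J by (intro Max_ge) auto
    moreover have "degree (p k') \<noteq> N" using inj k that True by (auto simp: inj_on_def J_def)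
    ultimately show ?thesis by (simp add: coeff_eq_0)
  qed (use that in \<open>auto simp: J_def\<close>)
  have kI: "k \<in> I" using k by (simp add: J_def)
  have "0 = coeff (\<Sum>k\<in>I. smult (c k) (p k)) N" by (simp add: 0)
  also have "\<dots> = (\<Sum>k\<in>I. c k * coeff (p k) N)" by (simp add: coeff_sum)
  also have "\<dots> = c k * coeff (p k) N" using I kI z by (subst sum.remove[of _ k]) (auto simp del: mult_eq_0_iff intro!: sum.neutral)
  finally show False using k monic[OF kI] by (simp add: J_def)
qed

lemma digits_eq:
  fixes B :: nat
  shows "(\<forall>i<m. \<kappa> i < B \<and> \<mu> i < B) \<Longrightarrow> (\<Sum>i<m. \<kappa> i * B ^ i) = (\<Sum>i<m. \<mu> i * B ^ i) \<Longrightarrow> i < m \<Longrightarrow> \<kappa> i = \<mu> i"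
proof (induction m arbitrary: \<kappa> \<mu> i)
  case (Suc m)
  have e: "(\<Sum>i<Suc m. \<kappa> i * B ^ i) = \<kappa> 0 + B * (\<Sum>i<m. \<kappa> (Suc i) * B ^ i)" for \<kappa>
    unfolding sum.lessThan_Suc_shift by (simp add: sum_distrib_left mult_ac)
  have eq: "\<kappa> 0 + B * (\<Sum>i<m. \<kappa> (Suc i) * B ^ i) = \<mu> 0 + B * (\<Sum>i<m. \<mu> (Suc i) * B ^ i)" using Suc.prems(2) unfolding e .
  have less: "\<kappa> 0 < B" "\<mu> 0 < B" using Suc.prems(1) by auto
  have "\<kappa> 0 = (\<kappa> 0 + B * (\<Sum>i<m. \<kappa> (Suc i) * B ^ i)) mod B" using less by simp
  also have "\<dots> = \<mu> 0" unfolding eq using less by simp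
  finally have 0: "\<kappa> 0 = \<mu> 0" .
  then have s: "(\<Sum>i<m. \<kappa> (Suc i) * B ^ i) = (\<Sum>i<m. \<mu> (Suc i) * B ^ i)" using eq less by auto
  show ?case
  proof (cases i)
    case (Suc j)
    have "\<forall>i<m. \<kappa> (Suc i) < B \<and> \<mu> (Suc i) < B" using Suc.prems(1) by auto
    from Suc.IH[OF this s, of j] show ?thesis using Suc Suc.prems(3) by simp
  qed (use 0 in simp)
qed simp

text \<open>On the curve given by the \<open>w i\<close>, the form \<gamma> takes the value
  \<open>\<alpha> \<xi> + \<beta>\<close>. Nothing guarantees that a nonzero form remains nonzero on
  it, and hence it is perturbed below.\<close>

locale evaluation_curve = ode_system m T c f for m T c f +
  fixes w :: "nat \<Rightarrow> real fps" and \<alpha> \<beta> :: "real fps" and \<xi> :: real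
  assumes w_gtype: "\<And>i. i < m \<Longrightarrow> gtype (w i)" and \<alpha>_gtype: "gtype \<alpha>" and \<beta>_gtype: "gtype \<beta>" and \<alpha>_nz: "\<alpha> \<noteq> 0"
    and curve: "(\<Sum>i<m. w i * shift_fps (f i)) = \<alpha> * fps_const \<xi> + \<beta>"
begin

context
  fixes F :: nat
begin

text \<open>The perturbation by distinct powers of a new variable \<open>s\<close>, with a gap between the exponents, keeps the monomials independent.\<close>

definition om :: "nat \<Rightarrow> real fps poly" where "om i = [:w i:] + monom 1 ((F + 2) ^ i)"

definition pw :: "(nat \<Rightarrow> nat) \<Rightarrow> real fps poly" where "pw \<kappa> = (\<Prod>i<m. om i ^ \<kappa> i)"

definition psi :: "nat \<Rightarrow> ((nat \<Rightarrow> nat) \<Rightarrow> rat poly) \<Rightarrow> real fps poly" where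
  "psi n x = (\<Sum>\<kappa>\<in>indices m n. smult (shift_poly (x \<kappa>)) (pw \<kappa>))"

lemma om_degree: "degree (om i) = (F + 2) ^ i" and om_monic: "lead_coeff (om i) = 1"
proof -
  have d: "degree (monom 1 ((F + 2) ^ i) :: real fps poly) = (F + 2) ^ i" by (simp add: degree_monom_eq)
  have "degree [:w i:] < degree (monom 1 ((F + 2) ^ i) :: real fps poly)" unfolding d by simp
  then show 1: "degree (om i) = (F + 2) ^ i" unfolding om_def using d by (simp add: degree_add_eq_right)
  show "lead_coeff (om i) = 1" unfolding 1 by (simp add: om_def coeff_pCons split: nat.split)
qed

lemma om_nz: "om i \<noteq> 0" using om_monic[of i] by auto

lemma pw_monic: "lead_coeff (pw \<kappa>) = 1"
  by (simp add: pw_def lead_coeff_prod lead_coeff_power om_monic)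

lemma pw_degree: "degree (pw \<kappa>) = (\<Sum>i<m. \<kappa> i * (F + 2) ^ i)"
  unfolding pw_def by (subst degree_prod_eq_sum_degree) (auto simp: om_nz degree_power_eq om_degree)

text \<open>Exponents are at most \<open>n < F + 2\<close>, so they are the base
  \<open>F + 2\<close> digits of the degree in the new variable.\<close>

lemma pw_inj:
  assumes "n < F + 2"
  shows "inj_on (\<lambda>\<kappa>. degree (pw \<kappa>)) (indices m n)"
proof (rule inj_onI, rule ext)
  fix \<kappa> \<mu> i assume \<kappa>: "\<kappa> \<in> indices m n" "\<mu> \<in> indices m n" and e: "degree (pw \<kappa>) = degree (pw \<mu>)"
  have le: "\<kappa> i \<le> n" if "\<kappa> \<in> indices m n" "i < m" for \<kappa> i
    using that member_le_sum[of i "{..<m}" \<kappa>] by (auto simp: indices_def)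
  show "\<kappa> i = \<mu> i"
  proof (cases "i < m")
    case True
    have "\<forall>i<m. \<kappa> i < F + 2 \<and> \<mu> i < F + 2" using le \<kappa> assms by force
    from digits_eq[OF this _ True] show ?thesis using e by (simp add: pw_degree)
  qed (use \<kappa> in \<open>auto simp: indices_def\<close>)
qed

lemma pw_raise: "k < m \<Longrightarrow> pw (\<kappa>(k := \<kappa> k + 1)) = om k * pw \<kappa>"
  unfolding pw_def by (subst (1 2) prod.remove[of _ k]) (auto intro!: prod.cong simp: mult.assoc)

lemma psi_eq_0D:
  assumes "psi n x = 0" "n < F + 2" "\<kappa> \<in> indices m n"
  shows "x \<kappa> = 0"
proof -
  have "\<forall>\<kappa>\<in>indices m n. shift_poly (x \<kappa>) = 0"
    by (rule monic_combination_eq_0[OF finite_indices pw_inj[OF assms(2)] pw_monic]) (use assms(1) in \<open>simp add: psi_def\<close>)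
  then have "shift_poly (x \<kappa>) = 0" using assms(3) by simp
  then show ?thesis by (rule shift_poly_eq_0D)
qed

lemma shift_remainder:
  "shift_fps (gam (\<lambda>\<kappa>. fps_of_poly (x \<kappa>)) l - fps_of_poly (x l))
     = (\<Sum>k<m. shift_fps (f k) * mul_var k (\<lambda>\<kappa>. shift_poly (x \<kappa>)) l) - shift_poly (x l)"
proof -
  define u where "u = (\<lambda>k. if l k = 0 then 0 else x (l(k := l k - 1)))"
  have e: "etype (fps_of_poly (u k) * f k)" if "k < m" for k using etype_mult[OF etype_poly f_etype[OF that]] .
  have ss: "shift_fps (\<Sum>k<m. fps_of_poly (u k) * f k) = (\<Sum>k<m. shift_fps (fps_of_poly (u k) * f k))"
    by (rule shift_fps_sum) (use e in auto)
  have es: "etype (\<Sum>k<m. fps_of_poly (u k) * f k)" by (rule etype_sum) (use e in auto)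
  have "gam (\<lambda>\<kappa>. fps_of_poly (x \<kappa>)) l - fps_of_poly (x l) = (\<Sum>k<m. fps_of_poly (u k) * f k) + fps_of_poly (- x l)"
    unfolding gam_def fps_of_poly_uminus by (simp add: mul_var_def u_def mult.commute) (intro sum.cong refl, auto simp: mult.commute)
  also have "shift_fps \<dots> = (\<Sum>k<m. shift_fps (fps_of_poly (u k) * f k)) + shift_poly (- x l)"
    using es e by (subst shift_fps_add) (auto simp: etype_poly ss shift_fps_poly)
  also have "\<dots> = (\<Sum>k<m. shift_fps (f k) * mul_var k (\<lambda>\<kappa>. shift_poly (x \<kappa>)) l) + shift_poly (- x l)"
    by (intro arg_cong2[of _ _ _ _ "(+)"] sum.cong refl) (simp add: shift_fps_poly_mult f_etype u_def mul_var_def)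
  also have "shift_poly (- x l) = - shift_poly (x l)" using shift_poly_add[of "- x l" "x l"] by (simp add: eq_neg_iff_add_eq_0)
  finally show ?thesis by simp
qed

text \<open>The identity defining the remainders of \<open>\<gamma> x0 - x1\<close>, expanded at 1
  and evaluated at the perturbed point.\<close>

lemma psi_relation:
  "(\<Sum>l\<in>indices m (Suc F). smult (shift_fps (gam (\<lambda>\<kappa>. fps_of_poly (x \<kappa>)) l - fps_of_poly (x l))) (pw l))
    = (\<Sum>k<m. smult (shift_fps (f k)) (om k)) * psi F x - psi (Suc F) x"
proof -
  let ?X = "\<lambda>\<kappa>. shift_poly (x \<kappa>)"
  have "(\<Sum>l\<in>indices m (Suc F). \<Sum>k<m. smult (shift_fps (f k) * mul_var k ?X l) (pw l))
     = (\<Sum>k<m. \<Sum>l\<in>indices m (Suc F). smult (shift_fps (f k) * mul_var k ?X l) (pw l))" by (rule sum.swap)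
  also have "\<dots> = (\<Sum>k<m. smult (shift_fps (f k)) (om k) * psi F x)"
  proof (rule sum.cong[OF refl])
    fix k assume k: "k \<in> {..<m}"
    have "(\<Sum>l\<in>indices m (Suc F). smult (shift_fps (f k) * mul_var k ?X l) (pw l))
       = (\<Sum>l\<in>indices m (Suc F). if l k = 0 then 0 else smult (shift_fps (f k) * ?X (l(k := l k - 1))) (pw l))"
      by (intro sum.cong) (auto simp: mul_var_def)
    also have "\<dots> = (\<Sum>\<kappa>\<in>indices m F. smult (shift_fps (f k) * ?X \<kappa>) (pw (\<kappa>(k := \<kappa> k + 1))))"
      using k by (subst sum_indices_Suc) auto
    also have "\<dots> = (\<Sum>\<kappa>\<in>indices m F. smult (shift_fps (f k)) (om k) * smult (?X \<kappa>) (pw \<kappa>))"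
      using k by (intro sum.cong refl) (simp only: pw_raise lessThan_iff, simp add: mult_ac)
    finally show "(\<Sum>l\<in>indices m (Suc F). smult (shift_fps (f k) * mul_var k ?X l) (pw l)) = smult (shift_fps (f k)) (om k) * psi F x"
      by (simp add: psi_def sum_distrib_left)
  qed
  finally show ?thesis
    unfolding shift_remainder by (simp add: psi_def[of "Suc F"] smult_diff_left smult_sum sum_subtractf sum_distrib_right)
qed

lemma gtype_coeff_pw: "gtype (coeff (pw \<kappa>) n)"
proof -
  define P where "P = (\<lambda>p::real fps poly. \<forall>n. gtype (coeff p n))"
  have g: "gtype (fps_const (of_int i))" for i by (rule gtype_const_of_int)
  have g0: "gtype 0" "gtype 1" using g[of 0] g[of 1] by simp_all
  have Pm: "P (p * r)" if "P p" "P r" for p r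
    unfolding P_def coeff_mult using that by (auto simp: P_def intro!: gtype_sum gtype_mult)
  have P1: "P 1" by (auto simp: P_def coeff_1 g0)
  have Pw: "P (p ^ k)" if "P p" for p k by (induction k) (auto simp: P1 Pm that)
  have Po: "P (om i)" if "i < m" for i
    unfolding P_def om_def using w_gtype[OF that] g0 by (auto simp: coeff_pCons intro!: gtype_add split: nat.split)
  have "P (\<Prod>i\<in>K. om i ^ \<kappa> i)" if "finite K" "K \<subseteq> {..<m}" for K
    using that by (induction K rule: finite_induct) (auto simp: P1 intro!: Pm Pw Po)
  then show ?thesis by (auto simp: pw_def P_def)
qed

text \<open>Take the lowest power \<nu> of the new variable at which a form from \<open>V\<close>
  survives. In coefficient \<nu> of the product with \<gamma>, only the unperturbed value
  \<open>\<alpha> \<xi> + \<beta>\<close> contributes, because the lower coefficients of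
  \<open>psi F x\<close> vanish for all \<open>x\<close> in \<open>V\<close>.\<close>

lemma evaluation_exists:
  assumes V: "\<exists>x\<in>V. \<exists>a\<in>idx F. x a \<noteq> 0"
  shows "\<exists>Y0 Y1 W. (\<forall>a\<in>idx F. gtype (Y0 a)) \<and> (\<forall>a\<in>idx F. gtype (Y1 a)) \<and> (\<forall>l\<in>indices m (Suc F). gtype (W l)) \<and>
    (\<forall>x\<in>V. fps_const \<xi> * (\<Sum>a\<in>idx F. Y0 a * shift_poly (x a)) - (\<Sum>a\<in>idx F. Y1 a * shift_poly (x a))
        = (\<Sum>l\<in>indices m (Suc F). W l * shift_fps (\<Sum>a\<in>idx F. rcoef l a * fps_of_poly (x a)))) \<and>
    (\<exists>x\<in>V. (\<Sum>a\<in>idx F. Y0 a * shift_poly (x a)) \<noteq> 0 \<or> (\<Sum>a\<in>idx F. Y1 a * shift_poly (x a)) \<noteq> 0)"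
proof -
  define Q where "Q = (\<lambda>n. \<exists>x\<in>V. coeff (psi F x) n \<noteq> 0 \<or> coeff (psi (Suc F) x) n \<noteq> 0)"
  define \<nu> where "\<nu> = (LEAST n. Q n)"
  have "\<exists>n. Q n"
  proof (rule ccontr)
    assume "\<nexists>n. Q n"
    then have "psi F x = 0" "psi (Suc F) x = 0" if "x \<in> V" for x using that by (auto simp: Q_def poly_eq_iff)
    then have "x a = 0" if "x \<in> V" "a \<in> idx F" for x a
      using that psi_eq_0D[of F x a] psi_eq_0D[of "Suc F" x a] by (auto simp: idx_def)
    then show False using V by auto
  qed
  then have Q: "Q \<nu>" unfolding \<nu>_def by (rule LeastI_ex)
  have low: "coeff (psi F x) n = 0" if "x \<in> V" "n < \<nu>" for x n
    using not_less_Least[of n Q] that by (auto simp: \<nu>_def Q_def)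
  define W where "W = (\<lambda>l. coeff (pw l) \<nu>)"
  \<comment> \<open>Sorted by powers of \<xi>, the expression
    \<open>(\<alpha> \<xi> + \<beta>) x0 - x1\<close> is \<xi> times \<open>\<alpha> x0\<close>,
    minus \<open>x1 - \<beta> x0\<close>. As \<alpha> is nonzero, the pair vanishes only if both
    forms do.\<close>
  define Y0 where "Y0 = (\<lambda>a. if a \<in> indices m F then \<alpha> * W a else 0)"
  define Y1 where "Y1 = (\<lambda>a. if a \<in> indices m F then - (\<beta> * W a) else W a)"
  have g0: "gtype 0" using gtype_const_of_int[of 0] by simp
  have gW: "gtype (W l)" for l unfolding W_def by (rule gtype_coeff_pw)
  have gY: "gtype (Y0 a)" "gtype (Y1 a)" for a
    unfolding Y0_def Y1_def using g0 gW \<alpha>_gtype \<beta>_gtype by (auto intro!: gtype_mult gtype_uminus)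
  have cpsi: "coeff (psi n x) \<nu> = (\<Sum>\<kappa>\<in>indices m n. W \<kappa> * shift_poly (x \<kappa>))" for n x
    by (simp add: psi_def coeff_sum W_def mult.commute)
  have disj: "indices m F \<inter> indices m (Suc F) = {}" by (auto simp: indices_def)
  have split: "(\<Sum>a\<in>idx F. g a) = (\<Sum>a\<in>indices m F. g a) + (\<Sum>a\<in>indices m (Suc F). g a)" for g :: "_ \<Rightarrow> real fps"
    unfolding idx_def by (rule sum.union_disjoint[OF finite_indices finite_indices disj])
  have E0: "(\<Sum>a\<in>idx F. Y0 a * shift_poly (x a)) = \<alpha> * coeff (psi F x) \<nu>" for x
  proof -
    have "(\<Sum>a\<in>indices m F. Y0 a * shift_poly (x a)) = (\<Sum>a\<in>indices m F. \<alpha> * (W a * shift_poly (x a)))"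
      by (intro sum.cong) (auto simp: Y0_def mult.assoc)
    moreover have "(\<Sum>a\<in>indices m (Suc F). Y0 a * shift_poly (x a)) = 0"
      by (intro sum.neutral) (use disj in \<open>auto simp: Y0_def\<close>)
    ultimately show ?thesis unfolding split cpsi by (simp add: sum_distrib_left)
  qed
  have E1: "(\<Sum>a\<in>idx F. Y1 a * shift_poly (x a)) = coeff (psi (Suc F) x) \<nu> - \<beta> * coeff (psi F x) \<nu>" for x
  proof -
    have "(\<Sum>a\<in>indices m F. Y1 a * shift_poly (x a)) = (\<Sum>a\<in>indices m F. - \<beta> * (W a * shift_poly (x a)))"
      by (intro sum.cong) (auto simp: Y1_def mult.assoc)
    moreover have "(\<Sum>a\<in>indices m (Suc F). Y1 a * shift_poly (x a)) = (\<Sum>a\<in>indices m (Suc F). W a * shift_poly (x a))"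
      by (intro sum.cong) (use disj in \<open>auto simp: Y1_def\<close>)
    ultimately show ?thesis unfolding split cpsi by (simp add: sum_distrib_left sum_negf)
  qed
  have rel: "fps_const \<xi> * (\<alpha> * coeff (psi F x) \<nu>) - (coeff (psi (Suc F) x) \<nu> - \<beta> * coeff (psi F x) \<nu>)
    = (\<Sum>l\<in>indices m (Suc F). W l * shift_fps (\<Sum>a\<in>idx F. rcoef l a * fps_of_poly (x a)))" if x: "x \<in> V" for x
  proof -
    define S where "S = (\<Sum>k<m. smult (shift_fps (f k)) (om k))"
    have "coeff (om k) 0 = w k" for k by (simp add: om_def)
    then have S0: "coeff S 0 = \<alpha> * fps_const \<xi> + \<beta>" using curve by (simp add: S_def coeff_sum mult.commute)
    have "coeff (S * psi F x) \<nu> = (\<Sum>i\<le>\<nu>. coeff S i * coeff (psi F x) (\<nu> - i))" by (simp add: coeff_mult)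
    also have "\<dots> = (\<Sum>i\<in>{0}. coeff S i * coeff (psi F x) (\<nu> - i))"
      by (rule sum.mono_neutral_right) (auto intro!: low[OF x])
    finally have SP: "coeff (S * psi F x) \<nu> = (\<alpha> * fps_const \<xi> + \<beta>) * coeff (psi F x) \<nu>" by (simp add: S0)
    have "(\<Sum>l\<in>indices m (Suc F). W l * shift_fps (\<Sum>a\<in>idx F. rcoef l a * fps_of_poly (x a)))
       = coeff (\<Sum>l\<in>indices m (Suc F). smult (shift_fps (gam (\<lambda>\<kappa>. fps_of_poly (x \<kappa>)) l - fps_of_poly (x l))) (pw l)) \<nu>"
      unfolding coeff_sum coeff_smult W_def by (rule sum.cong[OF refl], subst rcoef_sum, assumption, rule mult.commute)
    also have "\<dots> = coeff (S * psi F x) \<nu> - coeff (psi (Suc F) x) \<nu>" unfolding psi_relation S_def by simp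
    finally show ?thesis unfolding SP by (simp add: algebra_simps)
  qed
  obtain x where x: "x \<in> V" "coeff (psi F x) \<nu> \<noteq> 0 \<or> coeff (psi (Suc F) x) \<nu> \<noteq> 0" using Q by (auto simp: Q_def)
  have nz: "\<exists>x\<in>V. (\<Sum>a\<in>idx F. Y0 a * shift_poly (x a)) \<noteq> 0 \<or> (\<Sum>a\<in>idx F. Y1 a * shift_poly (x a)) \<noteq> 0"
    by (rule bexI[OF _ x(1)]) (use x(2) \<alpha>_nz in \<open>auto simp: E0 E1\<close>)
  show ?thesis
    by (rule exI[of _ Y0], rule exI[of _ Y1], rule exI[of _ W]) (intro conjI ballI gY gW nz, unfold E0 E1, rule rel)
qed

end

theorem curve_approximants:
  fixes \<theta> :: real
  assumes irr: "\<xi> \<notin> \<rat>" and \<theta>: "1/2 < \<theta>" "\<theta> < 1"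
  shows "\<forall>\<^sub>F s in sequentially. \<forall>h0 h1 :: int. (h0, h1) \<noteq> (0, 0) \<longrightarrow>
     (\<exists>q p :: int. h0 * q + h1 * p \<noteq> 0 \<and> \<bar>of_int q\<bar> \<le> real s powr (\<theta> * s) \<and> \<bar>of_int q * \<xi> - of_int p\<bar> \<le> real s powr ((\<theta> - 1) * s))"
proof -
  \<comment> \<open>Sufficient for \<open>(F + m) / (2 * F + m + 1) < \<theta>\<close>.\<close>
  obtain F :: nat where F: "real m / (2 * \<theta> - 1) < real F" using reals_Archimedean2 by blast
  have "real m < real F * (2 * \<theta> - 1)" using F \<theta> by (simp add: field_simps)
  moreover have "real (m + 1) * \<theta> \<ge> 0" using \<theta> by simp
  ultimately have "real (F + m) < \<theta> * real (2 * F + m + 1)" by (simp add: algebra_simps)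
  then have F': "real (card (indices m (Suc F))) / real (card (idx F)) < \<theta>" unfolding card_ratio by (simp add: field_simps)
  obtain z0 where "pade_arith (idx F) (pCons 0 T) opD z0 (indices m (Suc F)) rcoef T" using pade_arith_system ..
  then interpret P: pade_arith "idx F" "pCons 0 T" opD z0 "indices m (Suc F)" rcoef T .
  have ne: "idx F \<noteq> {}" using indices_ne[OF m_pos] by (auto simp: idx_def)
  show ?thesis
  proof (rule P.independent_approximants[OF irr ne F' \<theta>(2)])
    fix V assume V: "P.dmod V" "rank_on (idx F) V \<noteq> 0"
    have "\<exists>x\<in>V. \<exists>a\<in>idx F. x a \<noteq> 0"
    proof (rule ccontr)
      assume "\<not> ?thesis"
      then have "V \<subseteq> {\<lambda>_. 0}" using P.dmodD(1)[OF V(1)] by (fastforce simp: P.vecs_def)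
      moreover obtain b J M m' where "\<And>k. k < rank_on (idx F) V \<Longrightarrow> b k \<in> V" "indep_on {..<rank_on (idx F) V} (idx F) b" "J \<subseteq> idx F" "finite J"
        "card J = rank_on (idx F) V" "M \<noteq> 0" "\<And>y a. y \<in> V \<Longrightarrow> a \<in> idx F \<Longrightarrow> M * y a = (\<Sum>\<kappa>\<in>J. m' a \<kappa> * y \<kappa>)"
        using that by (rule rank_on_obtains[OF finite_idx[of F], of V])
      ultimately have b: "b 0 = (\<lambda>_. 0)" "indep_on {..<rank_on (idx F) V} (idx F) b" using V(2) by auto
      have "(\<Sum>k<rank_on (idx F) V. (if k = 0 then 1 else 0) * b k a) = 0" for a
        by (rule sum.neutral) (simp add: b(1))
      from indep_onD[OF b(2) this, of 0] show False using V(2) by simp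
    qed
    from evaluation_exists[OF this] show "\<exists>Y0 Y1 W. P.evaluation_data \<xi> V Y0 Y1 W"
      unfolding P.evaluation_data_def P.ev_def P.remd_def .
  qed
qed

end

section \<open>Growth of the solutions of linear differential equations\<close>

lemma rat_denominator: "x \<in> \<rat> \<Longrightarrow> \<exists>d::nat. d \<ge> 1 \<and> of_nat d * (x::real) \<in> \<int>"
proof -
  assume "x \<in> \<rat>"
  then obtain p :: int and q :: nat where "q \<noteq> 0" "x = of_int p / of_nat q" unfolding Rats_eq_int_div_nat by blast
  then show ?thesis by (intro exI[of _ q]) auto
qed

text \<open>Each step multiplies the denominator by one integer \<open>e n\<close>, of size a power
  of \<open>n\<close>, and the bound by a similar factor; the exponent \<open>C * (n + 1)\<close>
  makes room for exactly this. The initial values are arbitrary rationals.\<close>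

lemma gtype_recurrence:
  fixes g :: "real fps" and e :: "nat \<Rightarrow> real" and c :: "nat \<Rightarrow> nat \<Rightarrow> real" and B D N :: nat
  assumes rec: "\<And>n. n \<ge> N \<Longrightarrow> e n * g $ n = (\<Sum>l=1..D. c n l * g $ (n - l))" and N: "N \<ge> 1"
    and e: "\<And>n. n \<ge> N \<Longrightarrow> e n \<in> \<int>" "\<And>n. n \<ge> N \<Longrightarrow> e n \<noteq> 0" "\<And>n. n \<ge> N \<Longrightarrow> \<bar>e n\<bar> \<le> (real n + 2) ^ B"
    and c: "\<And>n l. n \<ge> N \<Longrightarrow> c n l \<in> \<int>" "\<And>n l. n \<ge> N \<Longrightarrow> l \<le> D \<Longrightarrow> \<bar>c n l\<bar> \<le> (real n + 2) ^ B"
    and rat: "\<And>n. g $ n \<in> \<rat>"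
  shows "gtype g"
proof -
  have "\<forall>j. \<exists>d::nat. d \<ge> 1 \<and> of_nat d * g $ j \<in> \<int>" using rat_denominator[OF rat] by blast
  from choice[OF this] obtain d0 where d0: "\<forall>j. d0 j \<ge> 1 \<and> of_nat (d0 j) * g $ j \<in> \<int>" ..
  define d1 where "d1 = (\<Prod>j<N. d0 j)"
  define M where "M = nat \<lceil>\<Sum>j<N. \<bar>g $ j\<bar>\<rceil>"
  have d1: "d1 \<ge> 1" unfolding d1_def using d0 by (intro prod_ge_1) auto
  have d1Z: "of_nat d1 * g $ j \<in> \<int>" if "j < N" for j
  proof -
    have "d1 = d0 j * (\<Prod>j\<in>{..<N}-{j}. d0 j)" unfolding d1_def using that by (intro prod.remove) auto
    then have "of_nat d1 * g $ j = of_nat (\<Prod>j\<in>{..<N}-{j}. d0 j) * (of_nat (d0 j) * g $ j)" by (simp add: mult_ac)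
    also have "\<dots> \<in> \<int>" by (rule Ints_mult[OF Ints_of_nat]) (use d0 in simp)
    finally show ?thesis .
  qed
  have M: "\<bar>g $ j\<bar> \<le> real M" if "j < N" for j
  proof -
    have "\<bar>g $ j\<bar> \<le> (\<Sum>j<N. \<bar>g $ j\<bar>)" using that by (intro member_le_sum) auto
    also have "\<dots> \<le> real M" unfolding M_def by (rule real_nat_ceiling_ge)
    finally show ?thesis .
  qed
  \<comment> \<open>\<open>B + D\<close> pays for one step of the recurrence, \<open>d1 + M\<close>
    for the initial denominators and values.\<close>
  define C where "C = B + D + (d1 + M)"
  have C2: "2 ^ (d1 + M) \<le> (n + 2) ^ (C * (n + 1))" for n :: nat
  proof -
    have "(2::nat) ^ (d1 + M) \<le> (n + 2) ^ (d1 + M)" by (intro power_mono) auto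
    also have "\<dots> \<le> (n + 2) ^ (C * (n + 1))" by (intro power_increasing) (auto simp: C_def)
    finally show ?thesis .
  qed
  have dM: "d1 \<le> 2 ^ (d1 + M)" "M \<le> 2 ^ (d1 + M)"
    using less_exp[of "d1 + M"] by linarith+
  have base: "\<exists>d::nat. 1 \<le> d \<and> d \<le> (n + 2) ^ (C * (n + 1)) \<and> (\<forall>j\<le>n. \<bar>g $ j\<bar> \<le> (real n + 2) ^ (C * (n + 1)) \<and> of_nat d * g $ j \<in> \<int>)"
    if n: "n < N" for n
  proof (rule exI[of _ d1], intro conjI allI impI)
    show "d1 \<le> (n + 2) ^ (C * (n + 1))" by (rule order.trans[OF dM(1) C2])
    fix j assume j: "j \<le> n"
    have "\<bar>g $ j\<bar> \<le> real ((n + 2) ^ (C * (n + 1)))"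
    proof -
      have "\<bar>g $ j\<bar> \<le> real M" using M[of j] j n by simp
      also have "\<dots> \<le> real ((n + 2) ^ (C * (n + 1)))" using order.trans[OF dM(2) C2[of n]] by (simp only: of_nat_le_iff)
      finally show ?thesis .
    qed
    then show "\<bar>g $ j\<bar> \<le> (real n + 2) ^ (C * (n + 1))" by (simp add: add.commute)
    show "of_nat d1 * g $ j \<in> \<int>" using d1Z j n by simp
  qed (rule d1)
  have "\<exists>d::nat. 1 \<le> d \<and> d \<le> (n + 2) ^ (C * (n + 1)) \<and> (\<forall>j\<le>n. \<bar>g $ j\<bar> \<le> (real n + 2) ^ (C * (n + 1)) \<and> of_nat d * g $ j \<in> \<int>)" for n
  proof (induction n)
    case 0
    then show ?case using base[of 0] N by simp
  next
    case (Suc n)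
    show ?case
    proof (cases "Suc n < N")
      case False
      then have sn: "Suc n \<ge> N" by simp
      obtain d :: nat where d: "1 \<le> d" "d \<le> (n + 2) ^ (C * (n + 1))" "\<forall>j\<le>n. \<bar>g $ j\<bar> \<le> (real n + 2) ^ (C * (n + 1)) \<and> of_nat d * g $ j \<in> \<int>"
        using Suc by blast
      obtain k :: int where k: "e (Suc n) = of_int k" using e(1)[OF sn] by (auto elim: Ints_cases)
      have k0: "k \<noteq> 0" using e(2)[OF sn] k by auto
      have kB: "real (nat \<bar>k\<bar>) \<le> (real (Suc n) + 2) ^ B" using e(3)[OF sn] by (simp add: k)
      have kB': "nat \<bar>k\<bar> \<le> (Suc n + 2) ^ B"
      proof -
        have "real (nat \<bar>k\<bar>) \<le> real ((Suc n + 2) ^ B)" using kB by (simp add: add_ac)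
        then show ?thesis by (simp only: of_nat_le_iff)
      qed
      have mono: "(n + 2) ^ (C * (n + 1)) \<le> (Suc n + 2) ^ (C * (n + 1))" by (intro power_mono) auto
      have rmono: "(real n + 2) ^ (C * (n + 1)) \<le> (real (Suc n) + 2) ^ (C * (n + 1))" by (intro power_mono) auto
      have Ck: "C * (n + 1) + (B + D) \<le> C * (Suc n + 1)" by (simp add: C_def)
      show ?thesis
      proof (rule exI[of _ "d * nat \<bar>k\<bar>"], intro conjI allI impI)
        show "1 \<le> d * nat \<bar>k\<bar>" using d(1) k0 by simp
        have "d * nat \<bar>k\<bar> \<le> (Suc n + 2) ^ (C * (n + 1)) * (Suc n + 2) ^ B"
          using d(2) mono kB' by (intro mult_le_mono) auto
        also have "\<dots> \<le> (Suc n + 2) ^ (C * (Suc n + 1))"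
          unfolding power_add[symmetric] using Ck by (intro power_increasing) auto
        finally show "d * nat \<bar>k\<bar> \<le> (Suc n + 2) ^ (C * (Suc n + 1))" .
        fix j assume j: "j \<le> Suc n"
        show "\<bar>g $ j\<bar> \<le> (real (Suc n) + 2) ^ (C * (Suc n + 1))"
        proof (cases "j = Suc n")
          case True
          have "1 \<le> \<bar>e (Suc n)\<bar>" using k k0 by simp
          then have "\<bar>g $ Suc n\<bar> \<le> \<bar>e (Suc n)\<bar> * \<bar>g $ Suc n\<bar>" using mult_right_mono[of 1 "\<bar>e (Suc n)\<bar>" "\<bar>g $ Suc n\<bar>"] by simp
          also have "\<dots> = \<bar>\<Sum>l=1..D. c (Suc n) l * g $ (Suc n - l)\<bar>" by (simp only: abs_mult[symmetric] rec[OF sn])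
          also have "\<dots> \<le> (\<Sum>l=1..D. \<bar>c (Suc n) l * g $ (Suc n - l)\<bar>)" by (rule sum_abs)
          also have "\<dots> \<le> (\<Sum>l=1..D. (real (Suc n) + 2) ^ B * (real n + 2) ^ (C * (n + 1)))"
            unfolding abs_mult using c(2)[OF sn] d(3) by (intro sum_mono mult_mono) auto
          also have "\<dots> = real D * ((real (Suc n) + 2) ^ B * (real n + 2) ^ (C * (n + 1)))" by simp
          also have "\<dots> \<le> (real (Suc n) + 2) ^ D * ((real (Suc n) + 2) ^ B * (real (Suc n) + 2) ^ (C * (n + 1)))"
          proof (intro mult_mono rmono order.refl)
            have "real D \<le> real (2 ^ D)" using less_exp[of D] by (simp only: of_nat_le_iff)
            also have "\<dots> = 2 ^ D" by simp
            also have "\<dots> \<le> (real (Suc n) + 2) ^ D" by (intro power_mono) auto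
            finally show "real D \<le> (real (Suc n) + 2) ^ D" .
          qed auto
          also have "\<dots> \<le> (real (Suc n) + 2) ^ (C * (Suc n + 1))"
            unfolding power_add[symmetric] using Ck by (intro power_increasing) auto
          finally show ?thesis using True by simp
        next
          case False
          then have "\<bar>g $ j\<bar> \<le> (real n + 2) ^ (C * (n + 1))" using d(3) j by simp
          also note rmono
          also have "(real (Suc n) + 2) ^ (C * (n + 1)) \<le> (real (Suc n) + 2) ^ (C * (Suc n + 1))" by (intro power_increasing) auto
          finally show ?thesis .
        qed
        show "of_nat (d * nat \<bar>k\<bar>) * g $ j \<in> \<int>"
        proof (cases "j = Suc n")
          case True
          have "of_int k * g $ Suc n = (\<Sum>l=1..D. c (Suc n) l * g $ (Suc n - l))" using rec[OF sn] k by simp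
          then have "of_nat d * (of_int k * g $ Suc n) = (\<Sum>l=1..D. c (Suc n) l * (of_nat d * g $ (Suc n - l)))"
            by (simp add: sum_distrib_left mult_ac)
          also have "\<dots> \<in> \<int>" by (rule Ints_sum, rule Ints_mult[OF c(1)[OF sn]]) (use d(3) in auto)
          finally have "of_int (sgn k) * (of_nat d * (of_int k * g $ Suc n)) \<in> \<int>" by (rule Ints_mult[OF Ints_of_int])
          moreover have "of_int (sgn k) * of_int k = real (nat \<bar>k\<bar>)"
            by (cases "k > 0") (auto simp: sgn_if)
          ultimately show ?thesis using True by (simp add: mult_ac) (metis mult.assoc mult.commute)
        next
          case False
          have "of_nat (nat \<bar>k\<bar>) * (of_nat d * g $ j) \<in> \<int>" by (rule Ints_mult[OF Ints_of_nat]) (use d(3) j False in simp)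
          with False show ?thesis by (simp only: of_nat_mult mult_ac)
        qed
      qed
    qed (rule base)
  qed
  then show ?thesis by (auto simp: gtypes_def)
qed

lemma poly_bound_at_nats: "\<exists>B::nat. \<forall>n. \<bar>poly A (real n)\<bar> \<le> (real n + 2) ^ B"
proof (induction A)
  case (pCons a A)
  then obtain B where B: "\<And>n. \<bar>poly A (real n)\<bar> \<le> (real n + 2) ^ B" by auto
  define b where "b = nat \<lceil>\<bar>a\<bar>\<rceil>"
  have "\<bar>poly (pCons a A) (real n)\<bar> \<le> (real n + 2) ^ (b + B + 2)" for n
  proof -
    have 1: "1 \<le> (real n + 2) ^ k" for k by (intro one_le_power) auto
    have "\<bar>a\<bar> \<le> real b" unfolding b_def by (rule real_nat_ceiling_ge)
    also have "real b \<le> real (2 ^ b)" using less_exp[of b] by (simp only: of_nat_le_iff)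
    also have "\<dots> = 2 ^ b" by simp
    also have "\<dots> \<le> (real n + 2) ^ b" by (intro power_mono) auto
    finally have a: "\<bar>a\<bar> \<le> (real n + 2) ^ b" .
    have "\<bar>poly (pCons a A) (real n)\<bar> \<le> \<bar>a\<bar> + \<bar>real n * poly A (real n)\<bar>" by simp
    also have "\<dots> \<le> (real n + 2) ^ b + (real n + 2) * (real n + 2) ^ B"
      unfolding abs_mult using a B[of n] by (intro add_mono mult_mono) auto
    also have "\<dots> \<le> (real n + 2) ^ (b + B + 1) + (real n + 2) ^ (b + B + 1)"
      unfolding power_Suc[symmetric] by (intro add_mono power_increasing) auto
    also have "\<dots> = 2 * (real n + 2) ^ (b + B + 1)" by simp
    also have "\<dots> \<le> (real n + 2) * (real n + 2) ^ (b + B + 1)" by (intro mult_right_mono) auto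
    finally show ?thesis by simp
  qed
  then show ?case by blast
qed (auto intro: exI[of _ 0])

lemma X_power_deriv_nth:
  "(fps_X ^ k * (fps_deriv ^^ k) g) $ n = (\<Prod>u<k. of_nat n - of_nat u) * (g :: real fps) $ n"
proof (induction k arbitrary: n)
  case (Suc k)
  have X: "fps_X * fps_deriv (fps_X ^ k) = (of_nat k * fps_X ^ k :: real fps)" by (induction k) (simp_all add: algebra_simps)
  define H where "H = fps_X ^ k * (fps_deriv ^^ k) g"
  have "fps_X * fps_deriv H = (fps_X * fps_deriv (fps_X ^ k)) * (fps_deriv ^^ k) g + fps_X ^ Suc k * (fps_deriv ^^ Suc k) g"
    by (simp add: H_def algebra_simps)
  then have "fps_X ^ Suc k * (fps_deriv ^^ Suc k) g = fps_X * fps_deriv H - of_nat k * H" unfolding X by (simp add: H_def mult.assoc)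
  moreover have "(fps_X * fps_deriv H) $ n = of_nat n * H $ n" by (cases n) auto
  moreover have "(of_nat k * H) $ n = of_nat k * H $ n" by (simp add: fps_of_nat[symmetric])
  ultimately have "(fps_X ^ Suc k * (fps_deriv ^^ Suc k) g) $ n = (of_nat n - of_nat k) * H $ n" by (simp add: left_diff_distrib)
  then show ?case using Suc by (simp add: H_def mult_ac)
qed simp

text \<open>The eigenvalue of \<open>X^k d^k/dX^k\<close> on the power of exponent \<open>n\<close>,
  as a polynomial in \<open>n\<close>.\<close>

definition falling :: "nat \<Rightarrow> real poly" where "falling k = (\<Prod>u<k. [:- of_nat u, 1:])"

lemma falling_degree: "degree (falling k) = k" and falling_monic: "lead_coeff (falling k) = 1"
proof -
  show "degree (falling k) = k" unfolding falling_def by (simp add: degree_prod_eq_sum_degree)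
  show "lead_coeff (falling k) = 1" unfolding falling_def lead_coeff_prod by simp
qed

lemma poly_falling: "poly (falling k) x = (\<Prod>u<k. x - of_nat u)"
  by (simp add: falling_def poly_prod)

text \<open>Multiplied by \<open>X^m\<close>, the equation is a combination of the operators
  \<open>X^k d^k/dX^k\<close>, which act diagonally on powers. So the coefficients obey a recurrence
  with coefficients polynomial in the index, whatever the type of singularity at 0.\<close>

theorem gtype_differential_equation:
  fixes g :: "real fps" and R :: "nat \<Rightarrow> real poly"
  assumes int: "\<And>k i. coeff (R k) i \<in> \<int>" and nz: "R m \<noteq> 0"
    and ode: "(\<Sum>k\<le>m. fps_of_poly (R k) * (fps_deriv ^^ k) g) = 0" and rat: "\<And>n. g $ n \<in> \<rat>"
  shows "gtype g"
proof -
  define S where "S = (\<lambda>k. monom 1 (m - k) * R k)"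
  have S_int: "coeff (S k) i \<in> \<int>" for k i
    using int by (auto simp: S_def coeff_monom_mult)
  have "(\<Sum>k\<le>m. fps_of_poly (S k) * (fps_X ^ k * (fps_deriv ^^ k) g)) = fps_X ^ m * (\<Sum>k\<le>m. fps_of_poly (R k) * (fps_deriv ^^ k) g)"
    unfolding sum_distrib_left
  proof (rule sum.cong[OF refl])
    fix k assume "k \<in> {..m}"
    then have "fps_X ^ (m - k) * fps_X ^ k = (fps_X ^ m :: real fps)" by (simp flip: power_add)
    then show "fps_of_poly (S k) * (fps_X ^ k * (fps_deriv ^^ k) g) = fps_X ^ m * (fps_of_poly (R k) * (fps_deriv ^^ k) g)"
      by (simp add: S_def fps_of_poly_mult fps_of_poly_monom' mult_ac)
  qed
  then have ode': "(\<Sum>k\<le>m. fps_of_poly (S k) * (fps_X ^ k * (fps_deriv ^^ k) g)) = 0" using ode by simp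
  define J where "J = Max ((\<lambda>k. degree (S k)) ` {..m})"
  have J: "degree (S k) \<le> J" if "k \<le> m" for k unfolding J_def using that by (intro Max_ge) auto
  define Q where "Q = (\<lambda>j. \<Sum>k\<le>m. smult (coeff (S k) j) (falling k))"
  have rec0: "(\<Sum>j\<le>J. poly (Q j) (real (n - j)) * g $ (n - j)) = 0" if n: "n \<ge> J" for n
  proof -
    have "0 = (\<Sum>k\<le>m. \<Sum>j=0..n. coeff (S k) j * (poly (falling k) (real (n - j)) * g $ (n - j)))"
      using arg_cong[OF ode', of "\<lambda>f. f $ n"] by (simp add: fps_sum_nth fps_mult_nth[of "fps_of_poly _"] X_power_deriv_nth poly_falling)
    also have "\<dots> = (\<Sum>k\<le>m. \<Sum>j\<le>J. coeff (S k) j * (poly (falling k) (real (n - j)) * g $ (n - j)))"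
    proof (rule sum.cong[OF refl], rule sum.mono_neutral_right)
      fix k assume "k \<in> {..m}"
      then show "\<forall>j\<in>{0..n} - {..J}. coeff (S k) j * (poly (falling k) (real (n - j)) * g $ (n - j)) = 0"
        using J[of k] by (auto simp: coeff_eq_0)
    qed (use n in auto)
    also have "\<dots> = (\<Sum>j\<le>J. \<Sum>k\<le>m. coeff (S k) j * (poly (falling k) (real (n - j)) * g $ (n - j)))" by (rule sum.swap)
    also have "\<dots> = (\<Sum>j\<le>J. poly (Q j) (real (n - j)) * g $ (n - j))"
      by (simp add: Q_def poly_sum sum_distrib_right mult.assoc)
    finally show ?thesis ..
  qed
  \<comment> \<open>The lowest power of X that occurs: \<open>Q h\<close> multiplies the newest
    coefficient of \<open>g\<close>, and it is nonzero because falling factorials have distinct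
    degrees.\<close>
  define h where "h = (LEAST j. \<exists>k\<le>m. coeff (S k) j \<noteq> 0)"
  have "S m \<noteq> 0" using nz by (simp add: S_def)
  then have "\<exists>k\<le>m. coeff (S k) (degree (S m)) \<noteq> 0" by (intro exI[of _ m]) auto
  then have h: "\<exists>k\<le>m. coeff (S k) h \<noteq> 0" unfolding h_def by (rule LeastI)
  have below: "Q j = 0" if "j < h" for j
    using not_less_Least[OF that[unfolded h_def]] by (auto simp: Q_def)
  have hJ: "h \<le> J" using h J le_degree le_trans by blast
  have Qh: "Q h \<noteq> 0"
  proof
    assume "Q h = 0"
    then have "\<forall>k\<in>{..m}. coeff (S k) h = 0"
      unfolding Q_def by (intro monic_combination_eq_0) (auto simp: falling_degree falling_monic[unfolded falling_degree] inj_on_def)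
    then show False using h by auto
  qed
  have Qint: "poly (Q j) (real n) \<in> \<int>" for j n
    unfolding Q_def poly_sum poly_smult poly_falling by (intro Ints_sum Ints_mult S_int Ints_prod Ints_diff) auto
  have "\<forall>j. \<exists>B::nat. \<forall>n. \<bar>poly (Q j) (real n)\<bar> \<le> (real n + 2) ^ B" using poly_bound_at_nats by blast
  from choice[OF this] obtain b where b: "\<forall>j n. \<bar>poly (Q j) (real n)\<bar> \<le> (real n + 2) ^ b j" ..
  define B where "B = Max (b ` {..J})"
  have B: "\<bar>poly (Q j) (real n)\<bar> \<le> (real n' + 2) ^ B" if "j \<le> J" "n \<le> n'" for j n n'
  proof -
    have "\<bar>poly (Q j) (real n)\<bar> \<le> (real n + 2) ^ b j" using b by simp
    also have "\<dots> \<le> (real n' + 2) ^ b j" using that by (intro power_mono) auto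
    also have "\<dots> \<le> (real n' + 2) ^ B" using that unfolding B_def by (intro power_increasing Max_ge) auto
    finally show ?thesis .
  qed
  obtain N1 :: nat where N1: "\<And>n. n \<ge> N1 \<Longrightarrow> poly (Q h) (real n) \<noteq> 0"
  proof -
    have "finite {x. poly (Q h) x = 0}" by (rule poly_roots_finite[OF Qh])
    then have "finite (real -` {x. poly (Q h) x = 0})" by (rule finite_vimageI) (simp add: inj_on_def)
    then obtain K where "\<forall>n\<in>real -` {x. poly (Q h) x = 0}. n \<le> K" by (auto simp: finite_nat_set_iff_bounded_le)
    then show ?thesis by (intro that[of "Suc K"]) force
  qed
  show ?thesis
  proof (rule gtype_recurrence[where e = "\<lambda>n. poly (Q h) (real n)" and c = "\<lambda>n l. - poly (Q (h + l)) (real (n - l))"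
        and N = "N1 + J + 1" and D = "J - h" and B = B])
    fix n assume n: "n \<ge> N1 + J + 1"
    have "0 = (\<Sum>j\<le>J. poly (Q j) (real (n + h - j)) * g $ (n + h - j))" using rec0[of "n + h"] n by simp
    also have "\<dots> = (\<Sum>j=h..J. poly (Q j) (real (n + h - j)) * g $ (n + h - j))"
      by (rule sum.mono_neutral_right) (auto simp: below)
    also have "\<dots> = (\<Sum>l=0..J - h. poly (Q (h + l)) (real (n - l)) * g $ (n - l))"
      by (rule sum.reindex_bij_witness[of _ "\<lambda>l. h + l" "\<lambda>j. j - h"]) (use hJ in auto)
    also have "\<dots> = poly (Q h) (real n) * g $ n + (\<Sum>l=1..J - h. poly (Q (h + l)) (real (n - l)) * g $ (n - l))"
      by (subst sum.atLeast_Suc_atMost) auto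
    finally show "poly (Q h) (real n) * g $ n = (\<Sum>l=1..J - h. - poly (Q (h + l)) (real (n - l)) * g $ (n - l))"
      by (simp add: sum_negf)
    show "poly (Q h) (real n) \<noteq> 0" using N1 n by simp
    show "\<bar>poly (Q h) (real n)\<bar> \<le> (real n + 2) ^ B" using B hJ by simp
    show "\<bar>- poly (Q (h + l)) (real (n - l))\<bar> \<le> (real n + 2) ^ B" if "l \<le> J - h" for l
      unfolding abs_minus_cancel by (rule B) (use that hJ in auto)
  qed (use Qint rat in auto)
qed

lemma gtype_deriv:
  assumes "gtype f"
  shows "gtype (fps_deriv f)"
proof -
  obtain C :: nat and d :: "nat \<Rightarrow> nat" where C: "\<And>n. 1 \<le> d n" "\<And>n. d n \<le> (n + 2) ^ (C * (n + 1))"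
    "\<And>i n j. i \<in> {()} \<Longrightarrow> j \<le> n \<Longrightarrow> \<bar>f $ j\<bar> \<le> (real n + 2) ^ (C * (n + 1))" "\<And>i n j. i \<in> {()} \<Longrightarrow> j \<le> n \<Longrightarrow> of_nat (d n) * f $ j \<in> \<int>"
    using that by (rule gtypesE[OF assms])
  \<comment> \<open>\<open>n + 3 \<le> (n + 2)^2\<close> trades the shift of the index for a factor
    in the exponent.\<close>
  have e: "(Suc n + 2) ^ (C * (Suc n + 1)) \<le> (n + 2) ^ (4 * C * (n + 1))" for n :: nat
  proof -
    have "(Suc n + 2) ^ (C * (Suc n + 1)) \<le> ((n + 2) ^ 2) ^ (C * (Suc n + 1))"
      by (intro power_mono) (auto simp: power2_eq_square)
    also have "\<dots> = (n + 2) ^ (2 * (C * (Suc n + 1)))" by (simp only: power_mult)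
    also have "\<dots> \<le> (n + 2) ^ (4 * C * (n + 1))" by (intro power_increasing) auto
    finally show ?thesis .
  qed
  show ?thesis
  proof (rule gtypesI[of "\<lambda>n. d (Suc n)" "4 * C" _ _ "4 * C + 1"])
    show "1 \<le> d (Suc n)" for n :: nat by (rule C(1))
    show "d (Suc n) \<le> (n + 2) ^ (4 * C * (n + 1))" for n :: nat by (rule order.trans[OF C(2) e])
    fix i :: unit and n j :: nat assume j: "i \<in> {()}" "j \<le> n"
    have "real ((Suc n + 2) ^ (C * (Suc n + 1))) \<le> real ((n + 2) ^ (4 * C * (n + 1)))" using e by (simp only: of_nat_le_iff)
    then have "\<bar>f $ (j + 1)\<bar> \<le> (real n + 2) ^ (4 * C * (n + 1))" using C(3)[of i "j + 1" "Suc n"] j by (simp add: add_ac)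
    then have "real (j + 1) * \<bar>f $ (j + 1)\<bar> \<le> (real n + 2) * (real n + 2) ^ (4 * C * (n + 1))" using j by (intro mult_mono) auto
    also have "\<dots> = (real n + 2) ^ Suc (4 * C * (n + 1))" by simp
    also have "\<dots> \<le> (real n + 2) ^ ((4 * C + 1) * (n + 1))" by (intro power_increasing) auto
    finally show "\<bar>fps_deriv f $ j\<bar> \<le> (real n + 2) ^ ((4 * C + 1) * (n + 1))" by (simp add: abs_mult)
    have "of_nat (j + 1) * (of_nat (d (Suc n)) * f $ (j + 1)) \<in> \<int>" by (rule Ints_mult[OF Ints_of_nat]) (use C(4)[of i "j + 1" "Suc n"] j in simp)
    then show "of_nat (d (Suc n)) * fps_deriv f $ j \<in> \<int>" by (simp add: mult_ac)
  qed
qed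

section \<open>Rational coordinates\<close>

lemma vector_space_over_rat: "vector_space (\<lambda>(q::rat) (x::'a::field_char_0). of_rat q * x)"
  by unfold_locales (simp_all add: of_rat_add of_rat_mult algebra_simps)

text \<open>A coordinate with respect to a Hamel basis over the rationals that contains
  \<open>y\<close>.\<close>

lemma rational_functional:
  fixes y :: "'a::field_char_0"
  assumes "y \<noteq> 0"
  shows "\<exists>lam :: 'a \<Rightarrow> rat. (\<forall>u v. lam (u + v) = lam u + lam v) \<and> (\<forall>q u. lam (of_rat q * u) = q * lam u) \<and> lam y = 1"
proof -
  interpret V: vector_space "\<lambda>(q::rat) (x::'a). of_rat q * x" by (rule vector_space_over_rat)
  have ind: "V.independent {y}" using assms by (simp add: V.independent_insert)
  define B where "B = V.extend_basis {y}"
  have B: "V.independent B" "V.span B = UNIV" "y \<in> B"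
    using V.independent_extend_basis[OF ind] V.span_extend_basis[OF ind] V.extend_basis_superset[OF ind] by (auto simp: B_def)
  show ?thesis
    using B by (intro exI[of _ "\<lambda>x. V.representation B x y"] conjI allI)
      (simp_all add: V.representation_add V.representation_scale V.representation_basis)
qed

text \<open>Coordinates in a Hamel basis that extends 1 and \<xi>, which are independent over the
  rationals by irrationality.\<close>

lemma rational_coordinates:
  fixes \<xi> :: real
  assumes "\<xi> \<notin> \<rat>"
  obtains B :: "real set" and lam :: "real \<Rightarrow> real \<Rightarrow> rat" where "\<xi> \<in> B" "\<And>b u v. lam b (u + v) = lam b u + lam b v"
    "\<And>b q u. lam b (of_rat q * u) = q * lam b u" "\<And>b. b \<in> B \<Longrightarrow> lam b \<xi> = (if b = \<xi> then 1 else 0)"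
    "\<And>u. \<forall>b\<in>B - {1, \<xi>}. lam b u = 0 \<Longrightarrow> u = of_rat (lam 1 u) + of_rat (lam \<xi> u) * \<xi>"
proof -
  interpret V: vector_space "\<lambda>(q::rat) (x::real). of_rat q * x" by (rule vector_space_over_rat)
  have "\<xi> \<notin> V.span {1}"
    using assms by (auto simp: V.span_singleton)
  then have ind: "V.independent {\<xi>, 1}" by (simp add: V.independent_insert)
  define B where "B = V.extend_basis {\<xi>, 1}"
  have B: "V.independent B" "V.span B = UNIV" "\<xi> \<in> B" "1 \<in> B"
    using V.independent_extend_basis[OF ind] V.span_extend_basis[OF ind] V.extend_basis_superset[OF ind] by (auto simp: B_def)
  show ?thesis
  proof (rule that[of B "\<lambda>b x. V.representation B x b"])
    fix u assume u: "\<forall>b\<in>B - {1, \<xi>}. V.representation B u b = 0"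
    have "{b. V.representation B u b \<noteq> 0} \<subseteq> {1, \<xi>}"
      using u V.representation_ne_zero[of B u] by blast
    then have "(\<Sum>b | V.representation B u b \<noteq> 0. of_rat (V.representation B u b) * b)
       = (\<Sum>b\<in>{1, \<xi>}. of_rat (V.representation B u b) * b)" by (intro sum.mono_neutral_left) auto
    moreover have "(\<Sum>b | V.representation B u b \<noteq> 0. of_rat (V.representation B u b) * b) = u"
      using B by (intro V.sum_nonzero_representation_eq) auto
    moreover have "\<xi> \<noteq> 1" using assms by auto
    ultimately show "u = of_rat (V.representation B u 1) + of_rat (V.representation B u \<xi>) * \<xi>" by simp
  qed (use B in \<open>auto simp: V.representation_add V.representation_scale V.representation_basis\<close>)
qed

text \<open>Commutes with derivation and with multiplication by rational series, and therefore maps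
  solutions of a rational equation to solutions with rational coefficients.\<close>

definition coordinate :: "(real \<Rightarrow> rat) \<Rightarrow> real fps \<Rightarrow> real fps" where
  "coordinate lam g = Abs_fps (\<lambda>n. of_rat (lam (g $ n)))"

locale rational_linear =
  fixes lam :: "'a::field_char_0 \<Rightarrow> rat"
  assumes add: "lam (u + v) = lam u + lam v" and scale: "lam (of_rat q * u) = q * lam u"
begin

lemma zero: "lam 0 = 0" using scale[of 0 0] by simp

lemma sum: "lam (sum g K) = (\<Sum>k\<in>K. lam (g k))"
  by (induction K rule: infinite_finite_induct) (simp_all add: zero add)

end

lemma coordinate_add: "rational_linear lam \<Longrightarrow> coordinate lam (g + h) = coordinate lam g + coordinate lam h"
  by (simp add: coordinate_def fps_eq_iff rational_linear.add of_rat_add)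

lemma coordinate_0: "rational_linear lam \<Longrightarrow> coordinate lam 0 = 0"
  by (simp add: coordinate_def fps_eq_iff rational_linear.zero)

lemma coordinate_sum: "rational_linear lam \<Longrightarrow> coordinate lam (sum g K) = (\<Sum>k\<in>K. coordinate lam (g k))"
  by (induction K rule: infinite_finite_induct) (simp_all add: coordinate_0 coordinate_add)

lemma coordinate_mult:
  assumes "rational_linear lam" "\<And>n. r $ n \<in> \<rat>"
  shows "coordinate lam (r * g) = r * coordinate lam g"
proof -
  have "\<forall>n. \<exists>q. r $ n = of_rat q" using assms(2) by (auto elim: Rats_cases)
  from choice[OF this] obtain q where q: "\<forall>n. r $ n = of_rat (q n)" ..
  then show ?thesis
    by (simp add: coordinate_def fps_eq_iff fps_mult_nth rational_linear.sum[OF assms(1)] rational_linear.scale[OF assms(1)] of_rat_sum of_rat_mult)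
qed

lemma coordinate_deriv:
  assumes "rational_linear lam"
  shows "coordinate lam ((fps_deriv ^^ k) g) = (fps_deriv ^^ k) (coordinate lam g)"
proof (induction k arbitrary: g)
  case (Suc k)
  have "lam (real n * x) = of_nat n * lam x" for n x using rational_linear.scale[OF assms, of "of_nat n" x] by simp
  then have "coordinate lam (fps_deriv g) = fps_deriv (coordinate lam g)" for g
    by (simp add: coordinate_def fps_eq_iff of_rat_mult)
       (metis (no_types, opaque_lifting) of_nat_Suc of_rat_mult of_rat_of_nat_eq)
  then show ?case using Suc by simp
qed simp

lemma coordinate_rational: "coordinate lam g $ n \<in> \<rat>"
  by (simp add: coordinate_def)

section \<open>Horizontal solutions\<close>

text \<open>Subtract the multiple of \<open>M\<close> that cancels coefficient \<open>n\<close>,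
  where \<open>n\<close> is the order of \<open>M\<close>. If a difference \<open>d\<close> of order
  \<open>k\<close> were left, the lowest coefficients of \<open>X M d' = X M' d\<close> would give
  \<open>k = n\<close>, where \<open>d\<close> has coefficient 0.\<close>

lemma proportional_if_wronskian_0:
  fixes M c :: "real fps"
  assumes M: "M \<noteq> 0" and W: "M * fps_deriv c = fps_deriv M * c"
  shows "\<exists>q. c = fps_const q * M"
proof -
  define n where "n = subdegree M"
  define d where "d = c - fps_const (c $ n / M $ n) * M"
  have Mn: "M $ n \<noteq> 0" using M by (simp add: n_def)
  have dn: "d $ n = 0" using Mn by (simp add: d_def)
  have Wd: "M * fps_deriv d = fps_deriv M * d" using W by (simp add: d_def algebra_simps)
  have "d = 0"
  proof (rule ccontr)
    assume d: "d \<noteq> 0"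
    define k where "k = subdegree d"
    have dk: "d $ k \<noteq> 0" using d by (simp add: k_def)
    have low: "M $ i = 0" if "i < n" for i using that unfolding n_def by (rule nth_less_subdegree_zero)
    have lowd: "d $ i = 0" if "i < k" for i using that unfolding k_def by (rule nth_less_subdegree_zero)
    have X: "(fps_X * fps_deriv h) $ i = of_nat i * h $ i" for h :: "real fps" and i by (cases i) auto
    have prod: "(g * h) $ (n + k) = g $ n * h $ k" if "\<And>i. i < n \<Longrightarrow> g $ i = 0" "\<And>i. i < k \<Longrightarrow> h $ i = 0" for g h :: "real fps"
    proof -
      have "(g * h) $ (n + k) = (\<Sum>i=0..n+k. g $ i * h $ (n + k - i))" by (simp add: fps_mult_nth)
      also have "\<dots> = (\<Sum>i\<in>{n}. g $ i * h $ (n + k - i))"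
      proof (rule sum.mono_neutral_right)
        show "\<forall>i\<in>{0..n+k} - {n}. g $ i * h $ (n + k - i) = 0"
        proof
          fix i assume "i \<in> {0..n+k} - {n}"
          then consider "i < n" | "n + k - i < k" by fastforce
          then show "g $ i * h $ (n + k - i) = 0" by cases (auto simp: that)
        qed
      qed auto
      finally show ?thesis by simp
    qed
    have "M * (fps_X * fps_deriv d) = fps_X * (M * fps_deriv d)" by (simp only: mult_ac)
    also have "\<dots> = (fps_X * fps_deriv M) * d" unfolding Wd by (simp only: mult_ac)
    finally have "(M * (fps_X * fps_deriv d)) $ (n + k) = ((fps_X * fps_deriv M) * d) $ (n + k)" by (simp only:)
    moreover have "(M * (fps_X * fps_deriv d)) $ (n + k) = M $ n * (fps_X * fps_deriv d) $ k"
      by (rule prod) (simp_all only: X low lowd mult_zero_right)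
    moreover have "((fps_X * fps_deriv M) * d) $ (n + k) = (fps_X * fps_deriv M) $ n * d $ k"
      by (rule prod) (simp_all only: X low lowd mult_zero_right)
    ultimately have "M $ n * (of_nat k * d $ k) = of_nat n * M $ n * d $ k" by (simp only: X)
    then have "real k = real n" using Mn dk by simp
    then show False using dn dk by simp
  qed
  then show ?thesis unfolding d_def by (intro exI[of _ "c $ n / M $ n"]) simp
qed

text \<open>A relation over the field of power series between horizontal vectors forces one over the constants: differentiate it.\<close>

lemma horizontal_relation:
  fixes R :: "nat \<Rightarrow> real fps" and y :: "nat \<Rightarrow> real fps" and z :: "real fps"
  assumes m: "m > 0" and Rm: "R m \<noteq> 0"
    and ode: "\<And>k. k < n \<Longrightarrow> (\<Sum>j\<le>m. R j * (fps_deriv ^^ j) (y k)) = 0" "(\<Sum>j\<le>m. R j * (fps_deriv ^^ j) z) = 0"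
    and ind: "indep_on {..<n} {..<m} (\<lambda>k j. (fps_deriv ^^ j) (y k))"
    and M: "M \<noteq> 0" and rel: "\<And>j. j < m \<Longrightarrow> M * (fps_deriv ^^ j) z = (\<Sum>k<n. c k * (fps_deriv ^^ j) (y k))"
  shows "\<exists>q. z = (\<Sum>k<n. fps_const (q k) * y k)"
proof -
  \<comment> \<open>The equation expresses derivative \<open>m\<close> by lower ones, so the
    relation extends to \<open>j = m\<close>, as is needed for differentiating it.\<close>
  have top: "R m * (fps_deriv ^^ m) g = - (\<Sum>j<m. R j * (fps_deriv ^^ j) g)" if "(\<Sum>j\<le>m. R j * (fps_deriv ^^ j) g) = 0" for g
    using that by (simp add: lessThan_Suc_atMost[symmetric] eq_neg_iff_add_eq_0 add.commute)
  have "R m * (M * (fps_deriv ^^ m) z) = M * (R m * (fps_deriv ^^ m) z)" by (simp add: mult_ac)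
  also have "\<dots> = - (\<Sum>j<m. R j * (M * (fps_deriv ^^ j) z))" unfolding top[OF ode(2)] by (simp add: sum_distrib_left mult_ac)
  also have "\<dots> = - (\<Sum>j<m. R j * (\<Sum>k<n. c k * (fps_deriv ^^ j) (y k)))" by (simp add: rel)
  also have "\<dots> = - (\<Sum>k<n. c k * (\<Sum>j<m. R j * (fps_deriv ^^ j) (y k)))"
    unfolding sum_distrib_left by (subst sum.swap) (simp add: mult_ac)
  also have "\<dots> = (\<Sum>k<n. c k * (R m * (fps_deriv ^^ m) (y k)))" by (simp add: top[OF ode(1)] sum_negf)
  also have "\<dots> = R m * (\<Sum>k<n. c k * (fps_deriv ^^ m) (y k))" by (simp add: sum_distrib_left mult_ac)
  finally have relm: "M * (fps_deriv ^^ m) z = (\<Sum>k<n. c k * (fps_deriv ^^ m) (y k))" using Rm by simp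
  have rel': "M * (fps_deriv ^^ j) z = (\<Sum>k<n. c k * (fps_deriv ^^ j) (y k))" if "j \<le> m" for j
    using that rel relm by (cases "j = m") auto
  have "\<exists>q. c k = fps_const q * M" if k: "k < n" for k
  proof (rule proportional_if_wronskian_0[OF M])
    \<comment> \<open>Eliminating \<open>z\<close> between the relation and its derivative leaves a
      relation between the \<open>y k\<close> alone; independence makes the Wronskian of
      \<open>c k\<close> and \<open>M\<close> vanish.\<close>
    have "(\<Sum>k<n. (M * fps_deriv (c k) - fps_deriv M * c k) * (fps_deriv ^^ j) (y k)) = 0" if "j \<in> {..<m}" for j
    proof -
      have j: "j < m" using that by simp
      have "fps_deriv (M * (fps_deriv ^^ j) z) = fps_deriv (\<Sum>k<n. c k * (fps_deriv ^^ j) (y k))" by (simp only: rel[OF j])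
      then have "M * (fps_deriv ^^ Suc j) z + fps_deriv M * (fps_deriv ^^ j) z
         = (\<Sum>k<n. c k * (fps_deriv ^^ Suc j) (y k)) + (\<Sum>k<n. fps_deriv (c k) * (fps_deriv ^^ j) (y k))"
        by (simp add: fps_deriv_sum sum.distrib)
      then have d: "fps_deriv M * (fps_deriv ^^ j) z = (\<Sum>k<n. fps_deriv (c k) * (fps_deriv ^^ j) (y k))"
        using rel'[of "Suc j"] j by simp
      have "M * (\<Sum>k<n. fps_deriv (c k) * (fps_deriv ^^ j) (y k)) = fps_deriv M * (\<Sum>k<n. c k * (fps_deriv ^^ j) (y k))"
        unfolding d[symmetric] rel[OF j, symmetric] by (simp add: mult_ac)
      then show ?thesis by (simp add: sum_distrib_left left_diff_distrib sum_subtractf mult.assoc)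
    qed
    from indep_onD[OF ind this] k show "M * fps_deriv (c k) = fps_deriv M * c k" by simp
  qed
  then have "\<forall>k. \<exists>q. k < n \<longrightarrow> c k = fps_const q * M" by blast
  from choice[OF this] obtain q where q: "\<forall>k. k < n \<longrightarrow> c k = fps_const (q k) * M" ..
  have "M * z = (\<Sum>k<n. c k * y k)" using rel[OF m] by simp
  also have "\<dots> = M * (\<Sum>k<n. fps_const (q k) * y k)" using q by (simp add: sum_distrib_left mult_ac)
  finally show ?thesis using M by auto
qed

text \<open>The weights must annihilate the coordinate vectors of all basis elements other than 1
  and \<xi>, but not that of \<xi>. This is possible unless the latter depends on the others. In
  that case \<open>horizontal_relation\<close> gives a relation with constant coefficients, which
  fails at the constant terms: the coordinates of \<open>\<phi> $ 0 = \<xi>\<close> are 1 at \<xi>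
  and 0 elsewhere.\<close>

lemma evaluation_weights:
  fixes R :: "nat \<Rightarrow> real poly" and \<phi> :: "real fps" and \<xi> :: real
  assumes irr: "\<xi> \<notin> \<rat>" and \<phi>0: "\<phi> $ 0 = \<xi>" and m: "m > 0" and int: "\<And>k i. coeff (R k) i \<in> \<int>" and nz: "R m \<noteq> 0"
    and ode: "(\<Sum>k\<le>m. fps_of_poly (R k) * (fps_deriv ^^ k) \<phi>) = 0"
  shows "\<exists>w \<alpha> \<beta>. (\<forall>i<m. gtype (w i)) \<and> gtype \<alpha> \<and> gtype \<beta> \<and> \<alpha> \<noteq> 0 \<and>
    (\<Sum>i<m. w i * (fps_deriv ^^ i) \<phi>) = \<alpha> * fps_const \<xi> + \<beta>"
proof -
  obtain B :: "real set" and lam :: "real \<Rightarrow> real \<Rightarrow> rat" where coords: "\<xi> \<in> B" "\<And>b u v. lam b (u + v) = lam b u + lam b v"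
    "\<And>b q u. lam b (of_rat q * u) = q * lam b u" "\<And>b. b \<in> B \<Longrightarrow> lam b \<xi> = (if b = \<xi> then 1 else 0)"
    "\<And>u. \<forall>b\<in>B - {1, \<xi>}. lam b u = 0 \<Longrightarrow> u = of_rat (lam 1 u) + of_rat (lam \<xi> u) * \<xi>"
    using that by (rule rational_coordinates[OF irr])
  note B = coords(1) and add = coords(2) and scale = coords(3) and \<xi> = coords(4) and dec = coords(5)
  have lin: "rational_linear (lam b)" for b by unfold_locales (rule add, rule scale)
  define y where "y = (\<lambda>b. coordinate (lam b) \<phi>)"
  define v where "v = (\<lambda>b i. (fps_deriv ^^ i) (y b))"
  have odey: "(\<Sum>k\<le>m. fps_of_poly (R k) * (fps_deriv ^^ k) (y b)) = 0" for b
  proof -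
    have R: "fps_of_poly (R k) $ n \<in> \<rat>" for k n using int[of k n] Ints_subset_Rats by auto
    have "(\<Sum>k\<le>m. fps_of_poly (R k) * (fps_deriv ^^ k) (y b)) = coordinate (lam b) (\<Sum>k\<le>m. fps_of_poly (R k) * (fps_deriv ^^ k) \<phi>)"
      using R by (simp add: coordinate_sum[OF lin] coordinate_mult[OF lin] coordinate_deriv[OF lin] y_def)
    then show ?thesis by (simp add: ode coordinate_0[OF lin])
  qed
  have yrat: "v b i $ n \<in> \<rat>" for b i n
    unfolding v_def y_def coordinate_deriv[OF lin, symmetric] by (rule coordinate_rational)
  have gv: "gtype (v b i)" for b i
  proof (induction i)
    case 0
    have "gtype (y b)" by (rule gtype_differential_equation[OF int nz odey]) (simp add: y_def coordinate_rational)
    then show ?case by (simp add: v_def)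
  next
    case (Suc i)
    from gtype_deriv[OF this] show ?case by (simp add: v_def)
  qed
  \<comment> \<open>Rationality is carried along with growth, since taking coordinates is linear
    over rational series only.\<close>
  define P where "P = (\<lambda>g :: real fps. gtype g \<and> (\<forall>n. g $ n \<in> \<rat>))"
  have P: "P 0" "P 1" "\<And>u v. P u \<Longrightarrow> P v \<Longrightarrow> P (u + v)" "\<And>u v. P u \<Longrightarrow> P v \<Longrightarrow> P (u * v)" "\<And>u. P u \<Longrightarrow> P (- u)"
    using gtype_const_of_int[of 0] gtype_const_of_int[of 1]
    by (auto simp: P_def fps_mult_nth gtype_uminus intro!: gtype_add gtype_mult Rats_sum)
  have Pv: "P (v b i)" for b i using gv yrat by (simp add: P_def)
  define S where "S = v ` (B - {1, \<xi>})"
  define r where "r = rank_on {..<m} S"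
  obtain x J M m' where x: "\<And>k. k < rank_on {..<m} S \<Longrightarrow> x k \<in> S" "indep_on {..<rank_on {..<m} S} {..<m} x" "J \<subseteq> {..<m}" "finite J"
    "card J = rank_on {..<m} S" "M \<noteq> 0" "\<And>y a. y \<in> S \<Longrightarrow> a \<in> {..<m} \<Longrightarrow> M * y a = (\<Sum>\<kappa>\<in>J. m' a \<kappa> * y \<kappa>)"
    using that by (rule rank_on_obtains[OF finite_lessThan, of m S])
  have xS: "\<forall>k<r. x k \<in> S" and ind: "indep_on {..<r} {..<m} x" using x(1,2) by (auto simp: r_def)
  have "\<forall>k. \<exists>b. k < r \<longrightarrow> b \<in> B - {1, \<xi>} \<and> x k = v b" using xS unfolding S_def by blast
  from choice[OF this] obtain b where b: "\<forall>k. k < r \<longrightarrow> b k \<in> B - {1, \<xi>} \<and> x k = v (b k)" ..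
  define X where "X = (\<lambda>k. if k < r then x k else v \<xi>)"
  have indX: "indep_on {..<Suc r} {..<m} X"
    unfolding indep_on_def
  proof (intro allI impI)
    fix c assume c: "\<forall>a\<in>{..<m}. (\<Sum>k\<in>{..<Suc r}. c k * X k a) = 0"
    have e: "(\<Sum>k<r. c k * x k a) + c r * v \<xi> a = 0" if "a < m" for a
      using c[rule_format, of a] that by (simp add: X_def)
    have cr: "c r = 0"
    proof (rule ccontr)
      assume cr: "c r \<noteq> 0"
      have "\<exists>q. y \<xi> = (\<Sum>k<r. fps_const (q k) * y (b k))"
      proof (rule horizontal_relation[where c = "\<lambda>k. - c k" and M = "c r" and R = "\<lambda>k. fps_of_poly (R k)" and m = m])
        show "indep_on {..<r} {..<m} (\<lambda>k j. (fps_deriv ^^ j) (y (b k)))"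
          unfolding indep_on_def
        proof (intro allI impI ballI)
          fix c' k assume c': "\<forall>a\<in>{..<m}. (\<Sum>k<r. c' k * (fps_deriv ^^ a) (y (b k))) = 0" and k: "k \<in> {..<r}"
          show "c' k = 0"
          proof (rule indep_onD[OF ind _ k])
            fix a assume "a \<in> {..<m}"
            then show "(\<Sum>k<r. c' k * x k a) = 0" using c' b by (simp add: v_def)
          qed
        qed
        show "c r * (fps_deriv ^^ j) (y \<xi>) = (\<Sum>k<r. - c k * (fps_deriv ^^ j) (y (b k)))" if "j < m" for j
        proof -
          have "(\<Sum>k<r. c k * x k j) = (\<Sum>k<r. c k * (fps_deriv ^^ j) (y (b k)))" using b by (intro sum.cong) (auto simp: v_def)
          then show ?thesis using e[OF that] by (simp add: v_def sum_negf add_eq_0_iff)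
        qed
      qed (use m nz cr odey in auto)
      then obtain q where "y \<xi> = (\<Sum>k<r. fps_const (q k) * y (b k))" ..
      then have "y \<xi> $ 0 = (\<Sum>k<r. q k * y (b k) $ 0)" by (simp add: fps_sum_nth)
      also have "\<dots> = 0" using b \<xi> by (intro sum.neutral) (auto simp: y_def coordinate_def \<phi>0)
      finally show False using \<xi>[OF B] by (simp add: y_def coordinate_def \<phi>0)
    qed
    show "\<forall>k\<in>{..<Suc r}. c k = 0"
    proof
      fix k assume k: "k \<in> {..<Suc r}"
      show "c k = 0"
      proof (cases "k = r")
        case False
        have "(\<Sum>k<r. c k * x k a) = 0" if "a \<in> {..<m}" for a using e[of a] that cr by simp
        from indep_onD[OF ind this, of k] show ?thesis using k False by simp
      qed (use cr in simp)
    qed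
  qed
  have PX: "P (X k a)" if "k < Suc r" "a \<in> {..<m}" for k a
    using Pv b by (auto simp: X_def)
  obtain w where w: "\<And>a. a \<in> {..<m} \<Longrightarrow> P (w a)" "(\<Sum>a\<in>{..<m}. w a * X r a) \<noteq> 0"
    "\<And>k. k < Suc r \<Longrightarrow> k \<noteq> r \<Longrightarrow> (\<Sum>a\<in>{..<m}. w a * X k a) = 0"
  proof (rule dual_vector_exists[of "{..<m}" "Suc r" X P r])
    fix w assume "\<And>a. a \<in> {..<m} \<Longrightarrow> P (w a)" "(\<Sum>a\<in>{..<m}. w a * X r a) \<noteq> 0"
      "\<And>k. k < Suc r \<Longrightarrow> k \<noteq> r \<Longrightarrow> (\<Sum>a\<in>{..<m}. w a * X k a) = 0"
    then show thesis by (rule that)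
  qed (assumption | rule indX PX P(1) P(2) P(3) P(4) P(5) lessI finite_lessThan)+
  have wv: "(\<Sum>i<m. w i * v b' i) = 0" if b': "b' \<in> B - {1, \<xi>}" for b'
  proof -
    have "v b' \<in> S" using b' by (simp add: S_def)
    from rank_on_dependence[OF finite_lessThan xS ind r_def this]
    obtain p c where p: "p \<noteq> 0" "\<And>a. a \<in> {..<m} \<Longrightarrow> p * v b' a = (\<Sum>k<r. c k * x k a)" by auto
    have "p * (\<Sum>i<m. w i * v b' i) = (\<Sum>i<m. w i * (p * v b' i))" by (simp add: sum_distrib_left mult_ac)
    also have "\<dots> = (\<Sum>i<m. w i * (\<Sum>k<r. c k * x k i))" by (simp add: p(2))
    also have "\<dots> = (\<Sum>k<r. c k * (\<Sum>i<m. w i * x k i))"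
      unfolding sum_distrib_left by (subst sum.swap) (simp add: mult_ac)
    also have "\<dots> = 0" using w(3) by (intro sum.neutral) (auto simp: X_def)
    finally show ?thesis using p(1) by simp
  qed
  have coord: "of_rat (lam b' ((\<Sum>i<m. w i * (fps_deriv ^^ i) \<phi>) $ n)) = (\<Sum>i<m. w i * v b' i) $ n" for b' n
  proof -
    have "coordinate (lam b') (\<Sum>i<m. w i * (fps_deriv ^^ i) \<phi>) = (\<Sum>i<m. w i * v b' i)"
      unfolding coordinate_sum[OF lin]
    proof (rule sum.cong[OF refl])
      fix i assume "i \<in> {..<m}"
      then have "\<forall>n. w i $ n \<in> \<rat>" using w(1) by (simp add: P_def)
      then show "coordinate (lam b') (w i * (fps_deriv ^^ i) \<phi>) = w i * v b' i"
        by (simp add: coordinate_mult[OF lin] coordinate_deriv[OF lin] v_def y_def)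
    qed
    then show ?thesis by (simp add: coordinate_def fps_eq_iff)
  qed
  have main: "(\<Sum>i<m. w i * (fps_deriv ^^ i) \<phi>) = (\<Sum>i<m. w i * v \<xi> i) * fps_const \<xi> + (\<Sum>i<m. w i * v 1 i)"
  proof (rule fps_ext)
    fix n
    have "lam b' ((\<Sum>i<m. w i * (fps_deriv ^^ i) \<phi>) $ n) = 0" if "b' \<in> B - {1, \<xi>}" for b'
      using coord[of b' n] wv[OF that] by simp
    then have "(\<Sum>i<m. w i * (fps_deriv ^^ i) \<phi>) $ n = of_rat (lam 1 ((\<Sum>i<m. w i * (fps_deriv ^^ i) \<phi>) $ n))
        + of_rat (lam \<xi> ((\<Sum>i<m. w i * (fps_deriv ^^ i) \<phi>) $ n)) * \<xi>" by (intro dec) blast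
    then show "(\<Sum>i<m. w i * (fps_deriv ^^ i) \<phi>) $ n = ((\<Sum>i<m. w i * v \<xi> i) * fps_const \<xi> + (\<Sum>i<m. w i * v 1 i)) $ n"
      unfolding coord by simp
  qed
  have gw: "gtype (w i)" if "i < m" for i using w(1)[of i] that by (simp add: P_def)
  have gs: "gtype (\<Sum>i<m. w i * v b' i)" for b' by (intro gtype_sum gtype_mult gv gw) auto
  have "(\<Sum>i<m. w i * v \<xi> i) \<noteq> 0" using w(2) by (simp add: X_def)
  then show ?thesis using main gs gw
    by (intro exI[of _ w] exI[of _ "\<Sum>i<m. w i * v \<xi> i"] exI[of _ "\<Sum>i<m. w i * v 1 i"]) auto
qed

lemma shift_poly_int:
  assumes "\<And>i. coeff p i \<in> \<int>"
  shows "shift_poly p $ k \<in> \<int>"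
  unfolding shift_poly_nth[OF order.refl]
proof (rule Ints_sum)
  fix i
  obtain z where "coeff p i = of_int z" using assms[of i] by (auto elim: Ints_cases)
  then show "of_rat (coeff p i) * real (i choose k) \<in> \<int>" by simp
qed

theorem rational_ode_approximants:
  fixes f :: "rat fps" and P :: "nat \<Rightarrow> rat poly" and \<theta> :: real
  defines "\<xi> \<equiv> shift_fps f $ 0"
  assumes f: "etype f" and int: "\<And>k i. coeff (P k) i \<in> \<int>" and nz: "P m \<noteq> 0" and m: "m > 0"
    and ode: "(\<Sum>k\<le>m. fps_of_poly (P k) * (fps_deriv ^^ k) f) = 0" and irr: "\<xi> \<notin> \<rat>" and \<theta>: "1/2 < \<theta>" "\<theta> < 1"
  shows "\<forall>\<^sub>F s in sequentially. \<forall>h0 h1 :: int. (h0, h1) \<noteq> (0, 0) \<longrightarrow>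
     (\<exists>q p :: int. h0 * q + h1 * p \<noteq> 0 \<and> \<bar>of_int q\<bar> \<le> real s powr (\<theta> * s) \<and> \<bar>of_int q * \<xi> - of_int p\<bar> \<le> real s powr ((\<theta> - 1) * s))"
proof -
  define \<phi> where "\<phi> = shift_fps f"
  have et: "etype ((fps_deriv ^^ k) f)" for k by (induction k) (auto intro: f etype_deriv)
  have sd: "shift_fps ((fps_deriv ^^ k) f) = (fps_deriv ^^ k) \<phi>" for k
    by (induction k) (simp_all add: \<phi>_def shift_fps_deriv et)
  define R where "R = (\<lambda>k. pcompose (map_poly of_rat (P k)) [:1, 1:] :: real poly)"
  have R: "fps_of_poly (R k) = shift_poly (P k)" for k by (simp add: R_def shift_poly_def)
  have Rint: "coeff (R k) i \<in> \<int>" for k i using shift_poly_int[OF int, of k i] by (simp flip: R)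
  have Rnz: "R m \<noteq> 0" using nz shift_poly_eq_0D[of "P m"] by (auto simp flip: R)
  have e: "etype (fps_of_poly (P k) * (fps_deriv ^^ k) f)" for k by (rule etype_mult[OF etype_poly et])
  have "(\<Sum>k\<le>m. fps_of_poly (R k) * (fps_deriv ^^ k) \<phi>) = shift_fps (\<Sum>k\<le>m. fps_of_poly (P k) * (fps_deriv ^^ k) f)"
    by (subst shift_fps_sum) (auto simp: e R shift_fps_poly_mult et sd)
  then have odeR: "(\<Sum>k\<le>m. fps_of_poly (R k) * (fps_deriv ^^ k) \<phi>) = 0" by (simp add: ode)
  have \<phi>0: "\<phi> $ 0 = \<xi>" by (simp add: \<phi>_def \<xi>_def)
  from evaluation_weights[OF irr \<phi>0 m Rint Rnz odeR]
  obtain w \<alpha> \<beta> where w: "\<forall>i<m. gtype (w i)" "gtype \<alpha>" "gtype \<beta>" "\<alpha> \<noteq> 0" "(\<Sum>i<m. w i * (fps_deriv ^^ i) \<phi>) = \<alpha> * fps_const \<xi> + \<beta>"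
    by (elim exE conjE)
  \<comment> \<open>Companion matrix of the equation, cleared of the leading coefficient
    \<open>P m\<close> and multiplied by z.\<close>
  define c where "c = (\<lambda>j i. if Suc j < m then (if i = Suc j then pCons 0 (P m) else 0) else - pCons 0 (P i))"
  interpret evaluation_curve m "P m" c "\<lambda>i. (fps_deriv ^^ i) f" w \<alpha> \<beta> \<xi>
  proof
    show "fps_of_poly (pCons 0 (P m)) * fps_deriv ((fps_deriv ^^ j) f) = (\<Sum>i<m. fps_of_poly (c j i) * (fps_deriv ^^ i) f)" if "j < m" for j
    proof (cases "Suc j < m")
      case True
      have "(\<Sum>i<m. fps_of_poly (c j i) * (fps_deriv ^^ i) f) = (\<Sum>i<m. if i = Suc j then fps_of_poly (pCons 0 (P m)) * (fps_deriv ^^ i) f else 0)"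
        using True by (intro sum.cong) (auto simp: c_def)
      then show ?thesis using True by simp
    next
      case False
      then have j: "m = Suc j" using that by simp
      have "fps_of_poly (P m) * (fps_deriv ^^ m) f = - (\<Sum>i<m. fps_of_poly (P i) * (fps_deriv ^^ i) f)"
        using ode by (simp add: lessThan_Suc_atMost[symmetric] eq_neg_iff_add_eq_0 add.commute)
      then have "fps_X * (fps_of_poly (P m) * (fps_deriv ^^ m) f) = (\<Sum>i<m. - (fps_X * fps_of_poly (P i)) * (fps_deriv ^^ i) f)"
        by (simp add: sum_distrib_left sum_negf mult.assoc)
      moreover have "(\<Sum>i<m. fps_of_poly (c j i) * (fps_deriv ^^ i) f) = (\<Sum>i<m. - (fps_X * fps_of_poly (P i)) * (fps_deriv ^^ i) f)"
        using False by (intro sum.cong refl) (simp add: c_def fps_of_poly_pCons fps_of_poly_uminus)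
      moreover have "fps_deriv ((fps_deriv ^^ j) f) = (fps_deriv ^^ m) f" by (simp add: j)
      moreover have "fps_of_poly (pCons 0 (P m)) = fps_X * fps_of_poly (P m)" by (simp add: fps_of_poly_pCons)
      ultimately show ?thesis by (simp only: mult.assoc)
    qed
    show "coeff (c j i) n \<in> \<int>" for j i n using int by (auto simp: c_def coeff_pCons split: nat.split)
    show "(\<Sum>i<m. w i * shift_fps ((fps_deriv ^^ i) f)) = \<alpha> * fps_const \<xi> + \<beta>" unfolding sd by (rule w(5))
  qed (use m nz int et w in auto)
  show ?thesis by (rule curve_approximants[OF irr \<theta>])
qed

section \<open>Reduction to integer differential equations\<close>

text \<open>The series \<open>g(r z)\<close>; it moves the argument \<open>r\<close> to the point
  1.\<close>

definition fps_rescale :: "'a::comm_ring_1 \<Rightarrow> 'a fps \<Rightarrow> 'a fps" where "fps_rescale r g = Abs_fps (\<lambda>n. r ^ n * g $ n)"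

lemma fps_rescale_mult: "fps_rescale r (g * h) = fps_rescale r g * fps_rescale r h"
proof (rule fps_ext)
  fix n
  have "r ^ n * (g $ i * h $ (n - i)) = r ^ i * g $ i * (r ^ (n - i) * h $ (n - i))" if "i \<in> {0..n}" for i
  proof -
    have "r ^ n = r ^ i * r ^ (n - i)" using that by (simp flip: power_add)
    then show ?thesis by (simp add: mult_ac)
  qed
  then show "fps_rescale r (g * h) $ n = (fps_rescale r g * fps_rescale r h) $ n"
    by (simp add: fps_rescale_def fps_mult_nth sum_distrib_left)
qed

lemma fps_rescale_sum: "fps_rescale r (sum g K) = (\<Sum>k\<in>K. fps_rescale r (g k))"
  by (simp add: fps_rescale_def fps_eq_iff fps_sum_nth sum_distrib_left)

lemma fps_rescale_poly: "fps_rescale r (fps_of_poly p) = fps_of_poly (pcompose p [:0, r:])"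
  by (simp add: fps_rescale_def fps_eq_iff coeff_pcompose_linear)

lemma fps_deriv_rescale: "(fps_deriv ^^ k) (fps_rescale r g) = fps_const (r ^ k) * fps_rescale r ((fps_deriv ^^ k) g)"
proof (induction k)
  case (Suc k)
  have "fps_deriv (fps_rescale r h) = fps_const r * fps_rescale r (fps_deriv h)" for h :: "'a fps"
    by (simp add: fps_rescale_def fps_eq_iff mult_ac)
  then show ?case using Suc by (simp add: fps_deriv_mult_const_left fps_const_mult[symmetric] mult_ac del: fps_const_mult)
qed simp

text \<open>A rational functional equal to 1 at one nonzero coefficient is applied to all
  coefficients of the equation; since \<open>g\<close> is rational, the equation persists.\<close>

lemma rational_equation:
  fixes g :: "rat fps" and P :: "nat \<Rightarrow> complex poly"
  assumes ode: "(\<Sum>k\<le>m. fps_of_poly (P k) * (fps_deriv ^^ k) (Abs_fps (\<lambda>n. of_rat (g $ n)))) = 0" and nz: "\<exists>k\<le>m. P k \<noteq> 0"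
  shows "\<exists>Q :: nat \<Rightarrow> rat poly. (\<exists>k\<le>m. Q k \<noteq> 0) \<and> (\<Sum>k\<le>m. fps_of_poly (Q k) * (fps_deriv ^^ k) g) = 0"
proof -
  obtain k0 i0 where k0: "k0 \<le> m" "coeff (P k0) i0 \<noteq> 0" using nz by (auto simp: poly_eq_iff)
  obtain lam :: "complex \<Rightarrow> rat" where lam: "(\<forall>u v. lam (u + v) = lam u + lam v) \<and> (\<forall>q u. lam (of_rat q * u) = q * lam u) \<and> lam (coeff (P k0) i0) = 1"
    using rational_functional[OF k0(2)] ..
  interpret rational_linear lam by unfold_locales (use lam in auto)
  have deriv: "((fps_deriv ^^ k) (Abs_fps (\<lambda>n. of_rat (g $ n))) :: complex fps) $ i = of_rat ((fps_deriv ^^ k) g $ i)" for k i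
  proof (induction k arbitrary: i)
    case (Suc k)
    have "of_rat (of_nat n * x) = (of_nat n * of_rat x :: complex)" for n x by (simp only: of_rat_mult of_rat_of_nat_eq)
    then show ?case using Suc by (simp only: funpow.simps o_apply fps_deriv_nth)
  qed simp
  define Q where "Q = (\<lambda>k. map_poly lam (P k))"
  have Qc: "coeff (Q k) i = lam (coeff (P k) i)" for k i by (simp add: Q_def coeff_map_poly zero)
  have "(\<Sum>k\<le>m. fps_of_poly (Q k) * (fps_deriv ^^ k) g) = 0"
  proof (rule fps_ext)
    fix n
    have "0 = lam ((\<Sum>k\<le>m. fps_of_poly (P k) * (fps_deriv ^^ k) (Abs_fps (\<lambda>n. of_rat (g $ n)))) $ n)" by (simp add: ode zero)
    also have "\<dots> = (\<Sum>k\<le>m. \<Sum>i=0..n. lam (of_rat ((fps_deriv ^^ k) g $ (n - i)) * coeff (P k) i))"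
      by (simp add: fps_sum_nth fps_mult_nth deriv sum mult.commute)
    also have "\<dots> = (\<Sum>k\<le>m. fps_of_poly (Q k) * (fps_deriv ^^ k) g) $ n"
      unfolding scale by (simp add: fps_sum_nth fps_mult_nth Qc mult.commute)
    finally show "(\<Sum>k\<le>m. fps_of_poly (Q k) * (fps_deriv ^^ k) g) $ n = 0 $ n" by simp
  qed
  moreover have "coeff (Q k0) i0 \<noteq> 0" using lam by (simp add: Qc)
  then have "\<exists>k\<le>m. Q k \<noteq> 0" using k0(1) by (intro exI[of _ k0]) auto
  ultimately show ?thesis by blast
qed

lemma irrationality_exponent_of_series:
  fixes a :: "nat \<Rightarrow> rat" and r :: rat and C :: real and P :: "nat \<Rightarrow> complex poly" and d :: "nat \<Rightarrow> int"
  defines "\<xi> \<equiv> (\<Sum>n. real_of_rat (a n) / fact n * real_of_rat r ^ n)"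
  assumes ode: "(\<Sum>k\<le>m. fps_of_poly (P k) * (fps_deriv ^^ k) (Abs_fps (\<lambda>n. of_rat (a n) / fact n))) = 0" and nz: "\<exists>k\<le>m. P k \<noteq> 0"
    and C: "C > 0" "\<And>n. \<bar>real_of_rat (a n)\<bar> \<le> C ^ (n + 1)"
    and d: "\<And>n. 1 \<le> d n" "\<And>n. real_of_int (d n) \<le> C ^ (n + 1)" "\<And>n j. j \<le> n \<Longrightarrow> of_int (d n) * a j \<in> \<int>"
    and irr: "\<xi> \<notin> \<rat>" and \<epsilon>: "\<epsilon> > 0"
  shows "\<exists>c>0. \<forall>(p::int) (q::nat). q \<ge> 1 \<longrightarrow> \<bar>\<xi> - of_int p / real q\<bar> \<ge> c / real q powr (2 + \<epsilon>)"
proof -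
  define g where "g = Abs_fps (\<lambda>n. a n / fact n)"
  define f where "f = fps_rescale r g"
  have fact_rat: "of_rat (fact n) = (fact n :: 'b::field_char_0)" for n
    using of_rat_of_nat_eq[of "fact n", where 'a = 'b] by simp
  have fn: "f $ n = a n / fact n * r ^ n" for n by (simp add: f_def g_def fps_rescale_def)
  have et: "etype f"
  proof -
    define C1 where "C1 = nat \<lceil>C\<rceil> + 1"
    define R where "R = nat \<lceil>\<bar>r\<bar>\<rceil> + 1"
    have C1: "C \<le> real C1" by (simp add: C1_def) linarith
    have R: "\<bar>r\<bar> \<le> of_nat R" by (simp add: R_def) linarith
    obtain p q where pq: "quotient_of r = (p, q)" by (cases "quotient_of r") auto
    have q: "q > 0" and r: "r = of_int p / of_int q" using pq quotient_of_denom_pos quotient_of_div by auto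
    show ?thesis
    proof (rule etypesI[of "\<lambda>n. nat (d n) * nat q ^ n" "C1 * nat q" "C1 * R"])
      show "1 \<le> nat (d n) * nat q ^ n" for n using d(1)[of n] q by simp
      show "nat (d n) * nat q ^ n \<le> (C1 * nat q) ^ (n + 1)" for n
      proof -
        have "real (nat (d n)) \<le> C ^ (n + 1)" using d(1)[of n] d(2)[of n] by simp
        also have "\<dots> \<le> real C1 ^ (n + 1)" using C(1) C1 by (intro power_mono) auto
        finally have "real (nat (d n)) \<le> real (C1 ^ (n + 1))" by simp
        then have "nat (d n) \<le> C1 ^ (n + 1)" by (simp only: of_nat_le_iff)
        moreover have "nat q ^ n \<le> nat q ^ (n + 1)" using q by (intro power_increasing) auto
        ultimately show ?thesis unfolding power_mult_distrib by (rule mult_le_mono)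
      qed
      show "1 \<le> C1 * R" by (simp add: C1_def R_def)
      fix i :: unit and n :: nat
      have "real_of_rat \<bar>a n\<bar> \<le> C ^ (n + 1)" using C(2)[of n] by simp
      also have "\<dots> \<le> real C1 ^ (n + 1)" using C(1) C1 by (intro power_mono) auto
      also have "\<dots> = real_of_rat (of_nat C1 ^ (n + 1))" by (simp only: of_rat_power of_rat_of_nat_eq)
      finally have an: "\<bar>a n\<bar> \<le> of_nat C1 ^ (n + 1)" by (simp only: of_rat_less_eq)
      have "\<bar>r\<bar> ^ n \<le> of_nat R ^ n" using R by (intro power_mono) auto
      also have "\<dots> \<le> of_nat R ^ (n + 1)" by (intro power_increasing) (auto simp: R_def)
      finally have rn: "\<bar>r\<bar> ^ n \<le> of_nat R ^ (n + 1)" .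
      have "\<bar>fact n * f $ n\<bar> = \<bar>a n\<bar> * \<bar>r\<bar> ^ n" by (simp add: fn abs_mult power_abs)
      also have "\<dots> \<le> of_nat C1 ^ (n + 1) * of_nat R ^ (n + 1)" using an rn by (intro mult_mono) auto
      finally show "\<bar>fact n * f $ n\<bar> \<le> of_nat (C1 * R) ^ (n + 1)" by (simp add: power_mult_distrib mult_ac)
      fix j assume j: "j \<le> n"
      have "of_nat (nat (d n) * nat q ^ n) * (fact j * f $ j) = (of_int (d n) * a j) * (of_int q ^ n * r ^ j)"
        using q d(1)[of n] by (simp add: fn)
      also have "of_int q ^ n * r ^ j = of_int (q ^ (n - j) * p ^ j)"
      proof -
        have "q ^ n = q ^ (n - j) * q ^ j" using j by (simp flip: power_add)
        then have "of_int q ^ n = (of_int q ^ (n - j) * of_int q ^ j :: rat)" by (metis of_int_mult of_int_power)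
        then show ?thesis using q by (simp add: r power_divide)
      qed
      finally show "of_nat (nat (d n) * nat q ^ n) * (fact j * f $ j) \<in> \<int>" using d(3)[OF j] by simp
    qed
  qed
  have \<xi>: "\<xi> = shift_fps f $ 0"
  proof -
    have "(\<lambda>u. of_rat (f $ u) * real (u choose 0)) sums (shift_fps f $ 0)" by (rule shift_fps_nth_sums[OF et])
    moreover have "of_rat (f $ u) * real (u choose 0) = real_of_rat (a u) / fact u * real_of_rat r ^ u" for u
      by (simp add: fn of_rat_mult of_rat_divide of_rat_power fact_rat)
    ultimately show ?thesis unfolding \<xi>_def by (simp add: sums_iff)
  qed
  have r0: "r \<noteq> 0"
  proof
    assume "r = 0"
    then have "\<xi> = (\<Sum>n\<in>{0}. real_of_rat (a n) / fact n * real_of_rat r ^ n)"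
      unfolding \<xi>_def by (intro suminf_finite) auto
    then show False using irr by simp
  qed
  have "Abs_fps (\<lambda>n. of_rat (a n) / fact n) = (Abs_fps (\<lambda>n. of_rat (g $ n)) :: complex fps)"
    by (simp add: g_def of_rat_divide fact_rat)
  from rational_equation[of P g m, folded this, OF ode nz]
  obtain Q :: "nat \<Rightarrow> rat poly" where Q0: "(\<exists>k\<le>m. Q k \<noteq> 0) \<and> (\<Sum>k\<le>m. fps_of_poly (Q k) * (fps_deriv ^^ k) g) = 0" ..
  note Q = conjunct1[OF Q0] conjunct2[OF Q0]
  \<comment> \<open>The true order of the equation: its leading coefficient has to be
    nonzero.\<close>
  define M where "M = Max {k. k \<le> m \<and> Q k \<noteq> 0}"
  have "M \<in> {k. k \<le> m \<and> Q k \<noteq> 0}" unfolding M_def using Q(1) by (intro Max_in) auto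
  then have M: "M \<le> m" "Q M \<noteq> 0" by auto
  have above: "Q k = 0" if "k \<le> m" "k > M" for k
    using that Max_ge[of "{k. k \<le> m \<and> Q k \<noteq> 0}" k] by (fastforce simp: M_def)
  obtain t :: nat where t: "t \<ge> 1" "\<And>k i. k \<le> M \<Longrightarrow> of_nat t * (r ^ (M - k) * (r ^ i * coeff (Q k) i)) \<in> \<int>"
  proof -
    define S where "S = (\<Union>k\<in>{..M}. (\<lambda>i. r ^ (M - k) * (r ^ i * coeff (Q k) i)) ` {..degree (Q k)})"
    have "finite S" by (simp add: S_def)
    from common_denominator[OF this] obtain t where t: "t \<ge> 1" "\<forall>x\<in>S. of_nat t * x \<in> \<int>" by auto
    have "of_nat t * (r ^ (M - k) * (r ^ i * coeff (Q k) i)) \<in> \<int>" if "k \<le> M" for k i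
    proof (cases "i \<le> degree (Q k)")
      case True
      then have "r ^ (M - k) * (r ^ i * coeff (Q k) i) \<in> S" using that by (auto simp: S_def)
      then show ?thesis using t(2) by blast
    qed (simp add: coeff_eq_0)
    then show ?thesis using t(1) by (intro that)
  qed
  \<comment> \<open>The k-th derivative of \<open>g(r z)\<close> brings a factor
    \<open>r ^ k\<close>; the weight \<open>r ^ (M - k)\<close> makes the powers of \<open>r\<close>
    uniform, and \<open>t\<close> clears the denominators.\<close>
  define Q' where "Q' = (\<lambda>k. if k \<le> M then smult (of_nat t * r ^ (M - k)) (pcompose (Q k) [:0, r:]) else 0)"
  have Q'int: "coeff (Q' k) i \<in> \<int>" for k i
    using t(2)[of k i] by (simp add: Q'_def coeff_pcompose_linear mult_ac)
  have Q'M: "Q' M \<noteq> 0"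
  proof -
    obtain i where "coeff (Q M) i \<noteq> 0" using M(2) by (auto simp: poly_eq_iff)
    then have "coeff (Q' M) i \<noteq> 0" using t(1) r0 by (simp add: Q'_def coeff_pcompose_linear)
    then show ?thesis by auto
  qed
  have Q'ode: "(\<Sum>k\<le>M. fps_of_poly (Q' k) * (fps_deriv ^^ k) f) = 0"
  proof -
    have "(\<Sum>k\<le>m. fps_of_poly (Q k) * (fps_deriv ^^ k) g) = (\<Sum>k\<le>M. fps_of_poly (Q k) * (fps_deriv ^^ k) g)"
      by (rule sum.mono_neutral_right) (use M(1) above in auto)
    then have 0: "(\<Sum>k\<le>M. fps_rescale r (fps_of_poly (Q k)) * fps_rescale r ((fps_deriv ^^ k) g)) = 0"
      using Q(2) by (simp flip: fps_rescale_mult fps_rescale_sum) (simp add: fps_rescale_def fps_eq_iff)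
    have "fps_of_poly (Q' k) * (fps_deriv ^^ k) f
       = fps_const (of_nat t * r ^ M) * (fps_rescale r (fps_of_poly (Q k)) * fps_rescale r ((fps_deriv ^^ k) g))" if "k \<le> M" for k
    proof -
      have "of_nat t * r ^ M = (of_nat t * r ^ (M - k)) * r ^ k" using that by (simp add: mult.assoc flip: power_add)
      then have "fps_const (of_nat t * r ^ M) = fps_const (of_nat t * r ^ (M - k)) * fps_const (r ^ k)" by simp
      moreover have "fps_of_poly (Q' k) = fps_const (of_nat t * r ^ (M - k)) * fps_rescale r (fps_of_poly (Q k))"
        using that by (simp add: Q'_def fps_of_poly_smult fps_rescale_poly)
      ultimately show ?thesis unfolding f_def fps_deriv_rescale by (simp only: mult_ac)
    qed
    then have "(\<Sum>k\<le>M. fps_of_poly (Q' k) * (fps_deriv ^^ k) f)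
       = fps_const (of_nat t * r ^ M) * (\<Sum>k\<le>M. fps_rescale r (fps_of_poly (Q k)) * fps_rescale r ((fps_deriv ^^ k) g))"
      by (simp add: sum_distrib_left)
    then show ?thesis by (simp only: 0 mult_zero_right)
  qed
  \<comment> \<open>An equation of order 0 would force \<open>f = 0\<close>, contradicting
    irrationality of the value.\<close>
  have Mpos: "M > 0"
  proof (rule ccontr)
    assume "\<not> M > 0"
    then have "fps_of_poly (Q' 0) * f = 0" "Q' 0 \<noteq> 0" using Q'ode Q'M by auto
    then have "f = 0" by simp
    then have "\<xi> = 0" by (simp add: \<xi>)
    then show False using irr by simp
  qed
  have irr': "shift_fps f $ 0 \<notin> \<rat>" using irr \<xi> by simp
  show ?thesis unfolding \<xi>
    by (rule irrationality_exponent[OF rational_ode_approximants[OF et Q'int Q'M Mpos Q'ode irr'] \<epsilon>])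
qed

theorem theorem1:
  fixes a :: "nat \<Rightarrow> rat" and r :: rat
  assumes "E_function (\<lambda>n. of_rat (a n))"
  shows "(\<Sum>n. real_of_rat (a n) / fact n * real_of_rat r ^ n) \<in> \<rat> \<or>
         (\<forall>\<epsilon>::real. \<epsilon> > 0 \<longrightarrow>
            (\<exists>c::real. c > 0 \<and>
               (\<forall>(p::int) (q::nat). q \<ge> 1 \<longrightarrow>
                  \<bar>(\<Sum>n. real_of_rat (a n) / fact n * real_of_rat r ^ n) - real_of_int p / real q\<bar>
                    \<ge> c / real q powr (2 + \<epsilon>))))"
proof -
  let ?\<xi> = "\<Sum>n. real_of_rat (a n) / fact n * real_of_rat r ^ n"
  note E = assms[unfolded E_function_def]
  from E obtain m and P :: "nat \<Rightarrow> complex poly" where ode: "\<exists>k\<le>m. P k \<noteq> 0"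
    "(\<Sum>k\<le>m. fps_of_poly (P k) * (fps_deriv ^^ k) (Abs_fps (\<lambda>n. of_rat (a n) / fact n))) = 0" by auto
  from conjunct2[OF conjunct2[OF E]] obtain C :: real where C: "C > 0"
    "\<And>\<sigma> n. complex_field_aut \<sigma> \<Longrightarrow> norm (\<sigma> (of_rat (a n))) \<le> C ^ (n + 1)"
    "\<exists>d :: nat \<Rightarrow> int. \<forall>n. 1 \<le> d n \<and> real_of_int (d n) \<le> C ^ (n + 1) \<and> (\<forall>m\<le>n. algebraic_integer (of_int (d n) * of_rat (a m)))"
    by auto
  from C(3) obtain d :: "nat \<Rightarrow> int" where d: "\<forall>n. 1 \<le> d n \<and> real_of_int (d n) \<le> C ^ (n + 1) \<and>
    (\<forall>m\<le>n. algebraic_integer (of_int (d n) * of_rat (a m)))" ..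
  \<comment> \<open>At the identity, condition (ii) becomes a bound on \<open>a n\<close>
    itself.\<close>
  have "complex_field_aut (\<lambda>x. x)" by (simp add: complex_field_aut_def bij_id[unfolded id_def])
  then have bound: "\<bar>real_of_rat (a n)\<bar> \<le> C ^ (n + 1)" for n
  proof -
    obtain p q where "quotient_of (a n) = (p, q)" by (cases "quotient_of (a n)") auto
    then have "a n = of_int p / of_int q" by (rule quotient_of_div)
    then have "(of_rat (a n) :: complex) = of_real (of_rat (a n))" by (simp add: of_rat_divide)
    then show ?thesis using C(2)[OF \<open>complex_field_aut (\<lambda>x. x)\<close>, of n] by simp
  qed
  \<comment> \<open>A rational algebraic integer is an integer, so the \<open>d n\<close> are
    denominators in the usual sense.\<close>
  have int: "of_int (d n) * a j \<in> \<int>" if "j \<le> n" for n j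
  proof -
    have "algebraic_int (of_int (d n) * of_rat (a j) :: complex)"
      using d that by (auto simp: algebraic_integer_def algebraic_int_altdef_ipoly)
    moreover have "of_int (d n) * of_rat (a j) \<in> (\<rat> :: complex set)" by (intro Rats_mult) auto
    ultimately have "of_int (d n) * of_rat (a j) \<in> (\<int> :: complex set)" by (rule rational_algebraic_int_is_int)
    then obtain z where "of_int (d n) * of_rat (a j) = (of_int z :: complex)" by (elim Ints_cases)
    then have "of_rat (of_int (d n) * a j) = (of_rat (of_int z) :: complex)" by (simp add: of_rat_mult)
    then have "of_int (d n) * a j = of_int z" by (simp only: of_rat_eq_iff)
    then show ?thesis by simp
  qed
  show ?thesis
  proof (cases "?\<xi> \<in> \<rat>")
    case False
    have "\<exists>c>0. \<forall>(p::int) (q::nat). q \<ge> 1 \<longrightarrow> \<bar>?\<xi> - of_int p / real q\<bar> \<ge> c / real q powr (2 + \<epsilon>)" if "\<epsilon> > 0" for \<epsilon> :: real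
      by (rule irrationality_exponent_of_series[OF ode(2,1) C(1) bound _ _ int False that]) (use d in auto)
    then show ?thesis by auto
  qed simp
qed

end
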